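(* Let $p$ be a prime number and let $f(x,y,z)\in\mathbf{Z}_p[x,y,z]$ be a nonzero polynomial in three variables with $f(0,0,0)=0$. Suppose that $f$ is non-degenerated over $\mathbf{F}_p$ with respect to all the compact faces of its Newton polyhedron $\Gamma_f$. Let $\chi:\mathbf{Z}_p^\times\to\mathbf{C}^\times$ be a non-trivial character of $\mathbf{Z}_p^\times$ that is trivial on $1+p\mathbf{Z}_p$. Suppose that $s_0$ is a candidate pole of $Z^0_{f,\chi}$ that is only contributed by $B_1$-facets of $\Gamma_f$ (i.e. every facet of $\Gamma_f$ contributing to $s_0$ is a $B_1$-facet). Further assume that for any pair of contributing $B_1$-facets, either they are $B_1$-facets for a same variable, or they have at most one point in common. Then $s_0$ is not a pole of $Z^0_{f,\chi}$.
   Context: Newton polyhedron: for a nonzero polynomial $f=\sum_{\omega\in\mathbf{Z}_{\geqslant0}^n}a_\omega x^\omega$ over a ring with $f(0)=0$, put $\mathrm{supp}(f)=\{\omega\mid a_\omega\neq0\}$; the Newton polyhedron $\Gamma_f$ is the convex hull of $\bigcup_{\omega\in\mathrm{supp}(f)}(\omega+\mathbf{R}_{\geqslant0}^n)$. Faces of $\Gamma_f$ are $\Gamma_f$ itself and its intersections with supporting hyperplanes; facets are faces of codimension one. For a face $\tau$, $f_\tau(x)=\sum_{\omega\in\tau}a_\omega x^\omega$. Here $n=3$. Non-degeneracy over $\mathbf{F}_p$ with respect to all the compact faces of $\Gamma_f$: for every compact face $\tau$, the reduction $\overline{f_\tau}$ of $f_\tau$ modulo $p$ and all its partial derivatives have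 no common zero in $(\mathbf{F}_p^\times)^n$. Twisted local zeta function: for $a\in\mathbf{Q}_p$, $|a|=p^{-\mathrm{ord}_p a}$ and $\mathrm{ac}\,a=|a|a$. A character $\chi:\mathbf{Z}_p^\times\to\mathbf{C}^\times$ is a multiplicative group homomorphism with finite image; formally put $\chi(0)=0$. With $|dx|$ the Haar measure on $\mathbf{Q}_p^n$ giving $\mathbf{Z}_p^n$ measure one, $Z^0_{f,\chi}(s)=\int_{(p\mathbf{Z}_p)^n}\chi(\mathrm{ac}\,f(x))|f(x)|^s|dx|$ for $\Re(s)>0$; $Z^0_{f,\chi}$ also denotes its meromorphic continuation to $\mathbf{C}$. For $k\in\mathbf{R}_{\geqslant0}^n$ put $m(k)=\inf_{x\in\Gamma_f}k\cdot x$ and $\sigma(k)=k_1+\cdots+k_n$. Let $\gamma_1,\ldots,\gamma_r$ be all facets of $\Gamma_f$ and $v_j\in\mathbf{Z}_{\geqslant0}^n\setminus\{0\}$ the unique primitive vector (integer components with greatest common divisor one) perpendicular to $\gamma_j$. The candidate poles of $Z^0_{f,\chi}$ are the numbers $-\frac{\sigma(v_j)}{m(v_j)}+\frac{2k\pi i}{m(v_j)\log p}$ with $j$ such that $m(v_j)\neq0$ and $k\in\mathbf{Z}$. The facet $\gamma_j$ contributes to the candidate pole $s_0$ if $p^{\sigma(v_j)+m(v_j)s_0}=1$. $B_1$-facets (coordinates $x_1,x_2,x_3$): a facet $\tau$ of $\Gamma_f$ is a $B_1$-simplex for the variable $x_i$ if $\tau$ is a simplex with two vertices in the coordinate plane $\{x_i=0\}$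 and one vertex in the plane $\{x_i=1\}$. A facet $\tau$ is non-compact for a variable $x_j$ if adding $1$ to the $x_j$-coordinate of any point of $\tau$ gives again a point of $\tau$. A facet $\tau$ is a non-compact $B_1$-facet for the variable $x_i$ if $\tau$ is non-compact for precisely one variable $x_j$, $x_j\neq x_i$, and the image $\pi_j(\tau)$ of $\tau$ under the projection $\pi_j:\mathbf{R}^3\to\mathbf{R}^2$ forgetting the coordinate $x_j$ is a segment with one vertex in $\{x_i=0\}$ and one vertex in $\{x_i=1\}$. A facet is a $B_1$-facet for $x_i$ if it is a $B_1$-simplex for $x_i$ or a non-compact $B_1$-facet for $x_i$; it is a $B_1$-facet if it is one for some variable. *)

theory Defs
  imports
    "HOL-Complex_Analysis.Complex_Analysis"
    "HOL-Library.Poly_Mapping"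
    "Berlekamp_Zassenhaus.Finite_Field"
begin

section \<open>The ring of p-adic integers\<close>

text \<open>
  As for the type of residues \<^typ>\<open>'p mod_ring\<close>, the prime number \<open>p\<close> is the cardinality of a type
  \<open>'p\<close> of class \<^class>\<open>prime_card\<close>. The ring of p-adic integers is the inverse limit of the rings
  of integers modulo \<open>p ^ n\<close>, each residue class being represented by its least nonnegative element.
\<close>

typedef (overloaded) ('p::prime_card) padic_int =
  "{x :: nat \<Rightarrow> int. \<forall>n. x (Suc n) mod int CARD('p) ^ n = x n}"
  morphisms padic_res Abs_padic_int
  by (rule exI[of _ "\<lambda>_. 0"]) simp

setup_lifting type_definition_padic_int

lemma padic_mod_Suc: "(a mod int q ^ Suc n) mod int q ^ n = a mod int q ^ n"
  by (rule mod_mod_cancel) simp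

instantiation padic_int :: (prime_card) comm_ring_1
begin

lift_definition zero_padic_int :: "'a padic_int" is "\<lambda>_. 0" by simp

lift_definition one_padic_int :: "'a padic_int" is "\<lambda>n. 1 mod int CARD('a) ^ n"
  by (rule padic_mod_Suc)

lift_definition plus_padic_int :: "'a padic_int \<Rightarrow> 'a padic_int \<Rightarrow> 'a padic_int"
  is "\<lambda>x y n. (x n + y n) mod int CARD('a) ^ n"
  by (metis padic_mod_Suc mod_add_eq)

lift_definition uminus_padic_int :: "'a padic_int \<Rightarrow> 'a padic_int"
  is "\<lambda>x n. (- x n) mod int CARD('a) ^ n"
  by (metis padic_mod_Suc mod_minus_eq)

lift_definition minus_padic_int :: "'a padic_int \<Rightarrow> 'a padic_int \<Rightarrow> 'a padic_int"
  is "\<lambda>x y n. (x n - y n) mod int CARD('a) ^ n"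
  by (metis padic_mod_Suc mod_diff_eq)

lift_definition times_padic_int :: "'a padic_int \<Rightarrow> 'a padic_int \<Rightarrow> 'a padic_int"
  is "\<lambda>x y n. (x n * y n) mod int CARD('a) ^ n"
  by (metis padic_mod_Suc mod_mult_eq)

instance
proof
  have red: "x n mod int CARD('a) ^ n = x n"
    if "\<forall>n. x (Suc n) mod int CARD('a) ^ n = x n" for x n
    using that by (metis mod_mod_trivial)
  fix a b c :: "'a padic_int"
  show "a * b * c = a * (b * c)"
    by transfer (auto simp: mod_simps mult_ac)
  show "a * b = b * a"
    by transfer (auto simp: mult_ac)
  show "1 * a = a"
    by transfer (auto simp: mod_simps red)
  show "(a + b) * c = a * c + b * c"
    by transfer (auto simp: mod_simps algebra_simps)
  show "a + b + c = a + (b + c)"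
    by transfer (auto simp: mod_simps add_ac)
  show "a + b = b + a"
    by transfer (auto simp: add_ac)
  show "0 + a = a"
    by transfer (auto simp: red)
  show "- a + a = 0"
    by transfer (auto simp: mod_simps)
  show "a - b = a + - b"
    by transfer (auto simp: mod_simps)
  show "0 \<noteq> (1 :: 'a padic_int)"
  proof (transfer, rule notI)
    assume "(\<lambda>_::nat. 0::int) = (\<lambda>n. 1 mod int CARD('a) ^ n)"
    then have "0 = 1 mod int CARD('a) ^ 1" by metis
    then show False using nontriv[where ?'a='a] by simp
  qed
qed

end

lemma padic_res_of_int: "padic_res (of_int k :: 'p::prime_card padic_int) n = k mod int CARD('p) ^ n"
proof (induction k rule: int_induct[of _ 0])
  case base
  then show ?case by (simp add: zero_padic_int.rep_eq)
next
  case (step1 i)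
  then show ?case by (simp add: plus_padic_int.rep_eq one_padic_int.rep_eq mod_simps)
next
  case (step2 i)
  then show ?case by (simp add: minus_padic_int.rep_eq one_padic_int.rep_eq mod_simps)
qed

lemma padic_res_power:
  "padic_res (x ^ k :: 'p::prime_card padic_int) n = padic_res x n ^ k mod int CARD('p) ^ n"
proof (induction k)
  case 0
  then show ?case by (simp add: one_padic_int.rep_eq)
next
  case (Suc k)
  then show ?case by (simp add: times_padic_int.rep_eq mod_simps)
qed

lemma padic_res_0_of_dvd:
  assumes "(of_nat CARD('p) :: 'p::prime_card padic_int) ^ n dvd x"
  shows "padic_res x n = 0"
proof -
  from assms obtain y where x: "x = (of_nat CARD('p)) ^ n * y" by (auto simp: dvd_def)
  have "(of_nat CARD('p) :: 'p padic_int) ^ n = of_int (int CARD('p) ^ n)" by simp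
  then have "padic_res ((of_nat CARD('p) :: 'p padic_int) ^ n) n = 0"
    by (simp only: padic_res_of_int) simp
  then show ?thesis unfolding x by (simp add: times_padic_int.rep_eq)
qed

text \<open>The value of \<open>padic_ord\<close> at \<open>0\<close> is irrelevant.\<close>

definition padic_ord :: "'p::prime_card padic_int \<Rightarrow> nat" where
  "padic_ord x = (GREATEST n. of_nat CARD('p) ^ n dvd x)"

definition padic_abs :: "'p::prime_card padic_int \<Rightarrow> real" where
  "padic_abs x = (if x = 0 then 0 else real CARD('p) powi (- int (padic_ord x)))"

text \<open>
  The angular component \<open>|x| x\<close>; for \<open>x \<noteq> 0\<close> this is the unit \<open>p ^ (- ord x) x\<close>.
\<close>

definition padic_ac :: "'p::prime_card padic_int \<Rightarrow> 'p padic_int" where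
  "padic_ac x = (if x = 0 then 0 else (THE u. x = of_nat CARD('p) ^ padic_ord x * u))"

lemma padic_dvd_ord:
  fixes x :: "'p::prime_card padic_int"
  assumes "x \<noteq> 0"
  shows "of_nat CARD('p) ^ n dvd x \<longleftrightarrow> n \<le> padic_ord x"
proof -
  obtain m where m: "padic_res x m \<noteq> 0"
    using assms by (metis padic_res_inject zero_padic_int.rep_eq ext)
  have bound: "k \<le> m" if "of_nat CARD('p) ^ k dvd x" for k
  proof (rule ccontr)
    assume "\<not> k \<le> m"
    then have "of_nat CARD('p) ^ m dvd x" using that
      by (meson dvd_trans le_imp_power_dvd nat_le_linear)
    then show False using m padic_res_0_of_dvd by blast
  qed
  have "of_nat CARD('p) ^ padic_ord x dvd x"
    unfolding padic_ord_def
    by (rule GreatestI_nat[of "\<lambda>n. of_nat CARD('p) ^ n dvd x" 0 m]) (use bound in auto)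
  moreover have "n \<le> padic_ord x" if "of_nat CARD('p) ^ n dvd x"
    unfolding padic_ord_def
    by (rule Greatest_le_nat[of "\<lambda>n. of_nat CARD('p) ^ n dvd x" n m]) (use bound that in auto)
  ultimately show ?thesis by (meson dvd_trans le_imp_power_dvd)
qed

lemma padic_abs_minus: "padic_abs (- x) = padic_abs x"
  by (simp add: padic_abs_def padic_ord_def)

lemma padic_abs_ultra: "padic_abs (x + y) \<le> max (padic_abs x) (padic_abs y)"
  for x y :: "'p::prime_card padic_int"
proof -
  have p1: "real CARD('p) > 1" using nontriv[where ?'a='p] by simp
  consider "x = 0" | "y = 0" | "x + y = 0" | "x \<noteq> 0" "y \<noteq> 0" "x + y \<noteq> 0" by blast
  then show ?thesis
  proof cases
    case 4
    have "of_nat CARD('p) ^ min (padic_ord x) (padic_ord y) dvd x + y"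
      using 4 by (intro dvd_add) (simp_all add: padic_dvd_ord)
    then have "min (padic_ord x) (padic_ord y) \<le> padic_ord (x + y)"
      using padic_dvd_ord[OF 4(3)] by blast
    then consider "padic_ord x \<le> padic_ord (x + y)" | "padic_ord y \<le> padic_ord (x + y)" by linarith
    then show ?thesis
      by cases (use 4 p1 in \<open>auto simp: padic_abs_def le_max_iff_disj power_int_increasing\<close>)
  qed (auto simp: padic_abs_def le_max_iff_disj)
qed

instantiation padic_int :: (prime_card) metric_space
begin

definition dist_padic_int :: "'a padic_int \<Rightarrow> 'a padic_int \<Rightarrow> real" where
  "dist_padic_int x y = padic_abs (x - y)"

definition uniformity_padic_int :: "('a padic_int \<times> 'a padic_int) filter" where
  "uniformity_padic_int = (INF e\<in>{0<..}. principal {(x, y). dist x y < e})"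

definition open_padic_int :: "'a padic_int set \<Rightarrow> bool" where
  "open_padic_int U \<longleftrightarrow> (\<forall>x\<in>U. \<forall>\<^sub>F (x', y) in uniformity. x' = x \<longrightarrow> y \<in> U)"

instance
proof
  fix x y z :: "'a padic_int"
  have p0: "real CARD('a) > 0" by simp
  show "dist x y = 0 \<longleftrightarrow> x = y"
    by (simp add: dist_padic_int_def padic_abs_def)
  have nonneg: "padic_abs u \<ge> 0" for u :: "'a padic_int"
    by (simp add: padic_abs_def)
  have "dist x y \<le> max (padic_abs (x - z)) (padic_abs (- (y - z)))"
    using padic_abs_ultra[of "x - z" "- (y - z)"] by (simp add: dist_padic_int_def)
  then show "dist x y \<le> dist x z + dist y z"
    using nonneg[of "x - z"] nonneg[of "y - z"]
    by (simp add: dist_padic_int_def padic_abs_minus del: minus_diff_eq)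
qed (simp_all add: uniformity_padic_int_def open_padic_int_def)

end

text \<open>
  Normalised Haar measure on the compact group of vectors of p-adic integers, i.e. the restriction
  to it of the Haar measure on vectors of p-adic numbers giving it measure one: the unique
  translation invariant probability measure on the Borel sets.
\<close>

definition padic_haar :: "('p::prime_card padic_int ^ 'n::finite) measure" where
  "padic_haar = (THE M. sets M = sets borel \<and> emeasure M UNIV = 1 \<and>
     (\<forall>a. \<forall>A\<in>sets M. emeasure M ((\<lambda>x. a + x) ` A) = emeasure M A))"

text \<open>Reduction modulo \<open>p\<close>.\<close>

definition padic_mod_p :: "'p::prime_card padic_int \<Rightarrow> 'p mod_ring" where
  "padic_mod_p x = of_int (padic_res x 1)"

text \<open>
  Characters of the group of units, as functions on the whole ring with value \<open>0\<close> at \<open>0\<close>. Their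
  values at the other non-units do not matter.
\<close>

definition padic_character :: "('p::prime_card padic_int \<Rightarrow> complex) \<Rightarrow> bool" where
  "padic_character chi \<longleftrightarrow>
     (\<forall>u. u dvd 1 \<longrightarrow> chi u \<noteq> 0) \<and>
     (\<forall>u v. u dvd 1 \<longrightarrow> v dvd 1 \<longrightarrow> chi (u * v) = chi u * chi v) \<and>
     finite (chi ` {u. u dvd 1}) \<and> chi 0 = 0"

section \<open>Polynomials in several variables\<close>

text \<open>A polynomial is the finitely supported family of its coefficients, indexed by exponent vectors.\<close>

type_synonym ('n, 'a) mpoly = "(nat ^ 'n) \<Rightarrow>\<^sub>0 'a"

definition mpoly_eval :: "('n::finite, 'a::comm_ring_1) mpoly \<Rightarrow> 'a ^ 'n \<Rightarrow> 'a" where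
  "mpoly_eval f x =
     (\<Sum>\<omega>\<in>Poly_Mapping.keys f. Poly_Mapping.lookup f \<omega> * (\<Prod>i\<in>UNIV. (x $ i) ^ (\<omega> $ i)))"

text \<open>The truncated subtraction only matters for terms whose coefficient vanishes.\<close>

definition mpoly_deriv :: "'n::finite \<Rightarrow> ('n, 'a::comm_ring_1) mpoly \<Rightarrow> ('n, 'a) mpoly" where
  "mpoly_deriv i f = (\<Sum>\<omega>\<in>Poly_Mapping.keys f.
     Poly_Mapping.single (\<omega> - axis i 1) (of_nat (\<omega> $ i) * Poly_Mapping.lookup f \<omega>))"

definition real_vec :: "nat ^ 'n \<Rightarrow> real ^ 'n" where
  "real_vec \<omega> = (\<chi> i. real (\<omega> $ i))"

definition mpoly_restrict :: "(real ^ 'n) set \<Rightarrow> ('n::finite, 'a::zero) mpoly \<Rightarrow> ('n, 'a) mpoly" where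
  "mpoly_restrict \<tau> f =
     Poly_Mapping.Abs_poly_mapping (\<lambda>\<omega>. if real_vec \<omega> \<in> \<tau> then Poly_Mapping.lookup f \<omega> else 0)"

section \<open>Newton polyhedra\<close>

definition newton_polyhedron :: "('n::finite, 'a::zero) mpoly \<Rightarrow> (real ^ 'n) set" where
  "newton_polyhedron f =
     convex hull (\<Union>\<omega>\<in>Poly_Mapping.keys f. {real_vec \<omega> + r | r. \<forall>i. 0 \<le> r $ i})"

text \<open>
  The polyhedron itself is an exposed face of itself, and the other nonempty exposed faces are the
  intersections with supporting hyperplanes.
\<close>

definition newton_face :: "('n::finite, 'a::zero) mpoly \<Rightarrow> (real ^ 'n) set \<Rightarrow> bool" where
  "newton_face f \<tau> \<longleftrightarrow> \<tau> \<noteq> {} \<and> \<tau> exposed_face_of newton_polyhedron f"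

definition newton_facet :: "('n::finite, 'a::zero) mpoly \<Rightarrow> (real ^ 'n) set \<Rightarrow> bool" where
  "newton_facet f \<tau> \<longleftrightarrow> newton_face f \<tau> \<and> aff_dim \<tau> = aff_dim (newton_polyhedron f) - 1"

definition nondegenerate_mod_p :: "('n::finite, 'p::prime_card padic_int) mpoly \<Rightarrow> bool" where
  "nondegenerate_mod_p f \<longleftrightarrow>
     (\<forall>\<tau>. newton_face f \<tau> \<and> compact \<tau> \<longrightarrow>
        (let g = Poly_Mapping.map padic_mod_p (mpoly_restrict \<tau> f) in
         \<not> (\<exists>x :: 'p mod_ring ^ 'n. (\<forall>i. x $ i \<noteq> 0) \<and>
               mpoly_eval g x = 0 \<and> (\<forall>i. mpoly_eval (mpoly_deriv i g) x = 0))))"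

definition newton_m :: "('n::finite, 'a::zero) mpoly \<Rightarrow> nat ^ 'n \<Rightarrow> real" where
  "newton_m f k = (INF x\<in>newton_polyhedron f. real_vec k \<bullet> x)"

definition newton_sigma :: "nat ^ 'n::finite \<Rightarrow> real" where
  "newton_sigma k = (\<Sum>i\<in>UNIV. real (k $ i))"

text \<open>
  The primitive vector perpendicular to a facet; the entries being nonnegative fixes its sign.
\<close>

definition facet_normal :: "(real ^ 'n::finite) set \<Rightarrow> nat ^ 'n" where
  "facet_normal \<tau> =
     (THE v. v \<noteq> 0 \<and> Gcd (range (\<lambda>i. v $ i)) = 1 \<and> (\<forall>x\<in>\<tau>. \<forall>y\<in>\<tau>. real_vec v \<bullet> (x - y) = 0))"

section \<open>The twisted local zeta function\<close>

definition zeta0_integral ::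
  "('n::finite, 'p::prime_card padic_int) mpoly \<Rightarrow> ('p padic_int \<Rightarrow> complex) \<Rightarrow> complex \<Rightarrow> complex" where
  "zeta0_integral f chi s =
     (LINT x : {x. \<forall>i. of_nat CARD('p) dvd x $ i} | padic_haar.
        chi (padic_ac (mpoly_eval f x)) * of_real (padic_abs (mpoly_eval f x)) powr s)"

text \<open>
  The meromorphic continuation to the complex plane. Asking for a nicely meromorphic function (one
  with removable singularities removed and value \<open>0\<close> at its poles) makes it unique as a function.
\<close>

definition zeta0 ::
  "('n::finite, 'p::prime_card padic_int) mpoly \<Rightarrow> ('p padic_int \<Rightarrow> complex) \<Rightarrow> complex \<Rightarrow> complex" where
  "zeta0 f chi = (THE Z. Z nicely_meromorphic_on UNIV \<and> (\<forall>s. Re s > 0 \<longrightarrow> Z s = zeta0_integral f chi s))"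

definition candidate_pole :: "('n::finite, 'p::prime_card padic_int) mpoly \<Rightarrow> complex \<Rightarrow> bool" where
  "candidate_pole f s\<^sub>0 \<longleftrightarrow>
     (\<exists>\<tau> (k::int). newton_facet f \<tau> \<and> newton_m f (facet_normal \<tau>) \<noteq> 0 \<and>
        s\<^sub>0 = - of_real (newton_sigma (facet_normal \<tau>) / newton_m f (facet_normal \<tau>))
             + 2 * of_int k * of_real pi * \<i> /
               of_real (newton_m f (facet_normal \<tau>) * ln (real CARD('p))))"

definition contributes :: "('n::finite, 'p::prime_card padic_int) mpoly \<Rightarrow> (real ^ 'n) set \<Rightarrow> complex \<Rightarrow> bool" where
  "contributes f \<tau> s\<^sub>0 \<longleftrightarrow> newton_facet f \<tau> \<and>
     of_nat CARD('p) powr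
       (of_real (newton_sigma (facet_normal \<tau>)) + of_real (newton_m f (facet_normal \<tau>)) * s\<^sub>0) = 1"

section \<open>B1-facets\<close>

definition B1_simplex :: "3 \<Rightarrow> (real ^ 3) set \<Rightarrow> bool" where
  "B1_simplex i \<tau> \<longleftrightarrow> 2 simplex \<tau> \<and>
     card {v. v extreme_point_of \<tau> \<and> v $ i = 0} = 2 \<and>
     card {v. v extreme_point_of \<tau> \<and> v $ i = 1} = 1"

definition noncompact_for :: "3 \<Rightarrow> (real ^ 3) set \<Rightarrow> bool" where
  "noncompact_for j \<tau> \<longleftrightarrow> (\<forall>x\<in>\<tau>. x + axis j 1 \<in> \<tau>)"

text \<open>
  The projection forgetting the coordinate \<open>j\<close>, its target being identified with the coordinate
  plane where that coordinate vanishes.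
\<close>

definition forget_coord :: "3 \<Rightarrow> real ^ 3 \<Rightarrow> real ^ 3" where
  "forget_coord j x = (\<chi> l. if l = j then 0 else x $ l)"

definition noncompact_B1 :: "3 \<Rightarrow> (real ^ 3) set \<Rightarrow> bool" where
  "noncompact_B1 i \<tau> \<longleftrightarrow>
     (\<exists>j. {l. noncompact_for l \<tau>} = {j} \<and> j \<noteq> i \<and>
        (\<exists>a b. forget_coord j ` \<tau> = closed_segment a b \<and> a $ i = 0 \<and> b $ i = 1))"

definition B1_facet :: "(3, 'a::zero) mpoly \<Rightarrow> 3 \<Rightarrow> (real ^ 3) set \<Rightarrow> bool" where
  "B1_facet f i \<tau> \<longleftrightarrow> newton_facet f \<tau> \<and> (B1_simplex i \<tau> \<or> noncompact_B1 i \<tau>)"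

end

theory Submission
  imports Defs "HOL-Probability.Probability"
begin

text \<open>
  Split the domain of integration into the shells of points whose coordinates have orders \<open>k \<ge> 1\<close>.
  By non-degeneracy and because \<open>chi\<close> is non-trivial modulo \<open>p\<close>, the integral over a shell is
  \<open>p\<close> to the power \<open>- (sigma k + m k * s)\<close> times a character sum \<open>c\<close> that depends only on the face of the
  Newton polyhedron on which \<open>k\<close> is minimal. If that face consists of a point at height \<open>1\<close> over a
  coordinate plane and a part \<open>E\<close> inside that plane, summing over one coordinate gives
  \<open>(p - 1) * c = - c E\<close>. Raising \<open>k\<close> in that coordinate leaves \<open>m k\<close> fixed and moves the face to \<open>E\<close>,
  so the terms along such a fibre add up to \<open>0\<close>. Removing the fibres that start at the contributing
  B1-facets leaves finitely many sets of lattice points of cones that no longer contain a contributing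
  normal vector. The generating function of such a set is rational with denominators that do not
  vanish at the candidate pole. The assumption on pairs of facets makes the fibres disjoint and keeps
  the remaining sets polyhedral.
\<close>

subsection \<open>Arithmetic of p-adic integers\<close>

text \<open>The constant behind the cancellation is 1/(p - 1), the sum of p^(-t) over t >= 1: it
  compares the points above the foot of a fibre with the foot itself. The obstacle is that several
  contributing normals may lie in one dual cone, so that its generating function can have a pole of
  higher order. Cancelling lattice points exactly, before anything is continued, treats all orders
  at once and replaces residue computations by combinatorics. The price is to show that what is left
  at a vertex \<open>A\<close> is cut out by finitely many linear inequalities: each contributing
  normal \<open>v\<close> at \<open>A\<close> gets one form, negative at \<open>v\<close> and
  nonnegative at the other rays of the cone, and the surviving points lie on its nonnegative side.
  Vertices with a coordinate equal to 1 have vanishing character sum; hence every vertex that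
  matters lies in the coordinate plane of each contributing facet through it. The same argument with
  nothing removed shows that the integral is holomorphic for Re s > 0, which identifies the
  meromorphic continuation.\<close>

lemma card_gt_1: "int CARD('p::prime_card) > 1"
  using nontriv[where ?'a='p] by simp

lemma padic_res_mod_le:
  fixes x :: "'p::prime_card padic_int"
  assumes "m \<le> n"
  shows "padic_res x n mod int CARD('p) ^ m = padic_res x m"
  using assms
proof (induction n rule: dec_induct)
  case base
  have "padic_res x (Suc m) mod int CARD('p) ^ m = padic_res x m"
    using padic_res[of x] by blast
  then show ?case by (metis mod_mod_trivial)
next
  case (step n)
  have "padic_res x (Suc n) mod int CARD('p) ^ n = padic_res x n"
    using padic_res[of x] by blast
  then have "padic_res x n mod int CARD('p) ^ m
      = padic_res x (Suc n) mod int CARD('p) ^ n mod int CARD('p) ^ m" by simp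
  also have "\<dots> = padic_res x (Suc n) mod int CARD('p) ^ m"
    using step by (intro mod_mod_cancel le_imp_power_dvd) auto
  finally show ?case using step by simp
qed

lemma padic_res_bounds:
  fixes x :: "'p::prime_card padic_int"
  shows "0 \<le> padic_res x n" "padic_res x n < int CARD('p) ^ n"
proof -
  have "padic_res x n = padic_res x n mod int CARD('p) ^ n" using padic_res_mod_le[of n n x] by simp
  then show "0 \<le> padic_res x n" "padic_res x n < int CARD('p) ^ n"
    using pos_mod_bound[of "int CARD('p) ^ n" "padic_res x n"]
      pos_mod_sign[of "int CARD('p) ^ n" "padic_res x n"] by auto
qed

lemma padic_res_0_level [simp]: "padic_res x 0 = 0"
  using padic_res_bounds[of x 0] by simp

lemma padic_eqI: "(\<And>n. padic_res x n = padic_res y n) \<Longrightarrow> x = y"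
  by (metis padic_res_inject ext)

lemma padic_res_add: "padic_res (x + y :: 'p::prime_card padic_int) n
    = (padic_res x n + padic_res y n) mod int CARD('p) ^ n"
  by (simp add: plus_padic_int.rep_eq)

lemma padic_res_diff: "padic_res (x - y :: 'p::prime_card padic_int) n
    = (padic_res x n - padic_res y n) mod int CARD('p) ^ n"
  by (simp add: minus_padic_int.rep_eq)

lemma padic_res_mult: "padic_res (x * y :: 'p::prime_card padic_int) n
    = (padic_res x n * padic_res y n) mod int CARD('p) ^ n"
  by (simp add: times_padic_int.rep_eq)

lemma padic_res_zero [simp]: "padic_res 0 n = 0"
  by (simp add: zero_padic_int.rep_eq)

lemma padic_eq_Abs:
  fixes g :: "nat \<Rightarrow> int"
  assumes "\<And>n. g (Suc n) mod int CARD('p::prime_card) ^ n = g n"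
  obtains y :: "'p::prime_card padic_int" where "padic_res y = g"
  using Abs_padic_int_inverse[where ?'p='p, of g] assms by auto

text \<open>The quotient of \<open>x\<close> by \<open>p ^ n\<close> is obtained by shifting the sequence of residues.\<close>

lemma padic_dvd_iff_res:
  fixes x :: "'p::prime_card padic_int"
  shows "of_nat CARD('p) ^ n dvd x \<longleftrightarrow> padic_res x n = 0"
proof
  assume "padic_res x n = 0"
  then have d: "int CARD('p) ^ n dvd padic_res x (m + n)" for m
    using padic_res_mod_le[of n "m + n" x] by (simp add: mod_eq_0_iff_dvd)
  define g where "g m = padic_res x (m + n) div int CARD('p) ^ n" for m
  have p0: "int CARD('p) ^ n > 0" by simp
  have gm: "padic_res x (m + n) = int CARD('p) ^ n * g m" for m
    using d[of m] by (simp add: g_def)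
  have "g (Suc m) mod int CARD('p) ^ m = g m" for m
  proof -
    have "padic_res x (Suc m + n) mod int CARD('p) ^ (m + n) = padic_res x (m + n)"
      using padic_res_mod_le[of "m + n" "Suc m + n" x] by simp
    then have "int CARD('p) ^ n * g (Suc m) mod (int CARD('p) ^ n * int CARD('p) ^ m)
        = int CARD('p) ^ n * g m"
      unfolding gm by (simp add: power_add mult.commute)
    then show ?thesis using p0 unfolding mult_mod_right[symmetric] by simp
  qed
  then obtain y :: "'p padic_int" where y: "padic_res y = g" by (rule padic_eq_Abs)
  have "padic_res x m = padic_res (of_nat CARD('p) ^ n * y) m" for m
  proof -
    have e: "(of_nat CARD('p) :: 'p padic_int) ^ n = of_int (int CARD('p) ^ n)" by simp
    have "padic_res (of_nat CARD('p) ^ n * y) m = int CARD('p) ^ n * g m mod int CARD('p) ^ m"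
      unfolding e padic_res_mult padic_res_of_int y by (simp add: mod_simps)
    also have "\<dots> = padic_res x (m + n) mod int CARD('p) ^ m" using gm by simp
    also have "\<dots> = padic_res x m" by (rule padic_res_mod_le) simp
    finally show ?thesis by simp
  qed
  then have "x = of_nat CARD('p) ^ n * y" by (rule padic_eqI)
  then show "of_nat CARD('p) ^ n dvd x" by simp
qed (rule padic_res_0_of_dvd)

lemma padic_res_eq_iff_dvd:
  fixes x y :: "'p::prime_card padic_int"
  shows "padic_res x n = padic_res y n \<longleftrightarrow> of_nat CARD('p) ^ n dvd x - y"
proof -
  have "padic_res x n = padic_res y n \<longleftrightarrow> padic_res x n mod int CARD('p) ^ n = padic_res y n mod int CARD('p) ^ n"
    by (simp add: padic_res_mod_le)
  also have "\<dots> \<longleftrightarrow> padic_res (x - y) n = 0"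
    by (simp add: padic_res_diff mod_eq_dvd_iff mod_eq_0_iff_dvd)
  finally show ?thesis by (simp add: padic_dvd_iff_res)
qed

lemma padic_p_dvd_iff: "of_nat CARD('p) dvd (x :: 'p::prime_card padic_int) \<longleftrightarrow> padic_res x 1 = 0"
  using padic_dvd_iff_res[of 1 x] by simp

text \<open>The inverse is assembled from inverses modulo \<open>p ^ n\<close>. They exist because a
  residue prime to \<open>p\<close> is prime to every power of \<open>p\<close>, and uniqueness of
  inverses makes them compatible from one level to the next.\<close>

lemma padic_unit_iff: "x dvd 1 \<longleftrightarrow> \<not> of_nat CARD('p) dvd x" for x :: "'p::prime_card padic_int"
proof
  assume "x dvd 1"
  then obtain y where "1 = x * y" by (auto simp: dvd_def)
  then have "1 mod int CARD('p) = padic_res x 1 * padic_res y 1 mod int CARD('p)"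
    by (metis padic_res_mult one_padic_int.rep_eq power_one_right)
  then have "padic_res x 1 \<noteq> 0" using card_gt_1[where ?'p='p] by auto
  then show "\<not> of_nat CARD('p) dvd x" by (simp add: padic_p_dvd_iff)
next
  assume "\<not> of_nat CARD('p) dvd x"
  then have r1: "padic_res x 1 \<noteq> 0" by (simp add: padic_p_dvd_iff)
  have cop: "coprime (padic_res x n) (int CARD('p) ^ n)" for n
  proof (cases "n = 0")
    case False
    then have "padic_res x n mod int CARD('p) = padic_res x 1"
      using padic_res_mod_le[of 1 n x] by simp
    then have "\<not> int CARD('p) dvd padic_res x n" using r1 by (simp add: dvd_eq_mod_eq_0)
    then have "coprime (int CARD('p)) (padic_res x n)"
      using prime_card_int[where ?'a='p] by (metis prime_imp_coprime_int)
    then show ?thesis by (simp add: coprime_commute)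
  qed simp
  have inv: "\<exists>y. 0 \<le> y \<and> y < int CARD('p) ^ n \<and> padic_res x n * y mod int CARD('p) ^ n = 1 mod int CARD('p) ^ n" for n
  proof -
    obtain y where "[padic_res x n * y = 1] (mod int CARD('p) ^ n)"
      using cop[of n] by (metis cong_solve_coprime_int)
    then show ?thesis
      by (intro exI[of _ "y mod int CARD('p) ^ n"]) (auto simp: cong_def mod_simps)
  qed
  then obtain g where g: "0 \<le> g n" "g n < int CARD('p) ^ n"
      "padic_res x n * g n mod int CARD('p) ^ n = 1 mod int CARD('p) ^ n" for n by metis
  have uniq: "u mod int CARD('p) ^ n = g n"
    if "padic_res x n * u mod int CARD('p) ^ n = 1 mod int CARD('p) ^ n" for n u
  proof -
    have "[padic_res x n * u = padic_res x n * g n] (mod int CARD('p) ^ n)"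
      using that g(3)[of n] by (simp add: cong_def)
    then have "[u = g n] (mod int CARD('p) ^ n)" using cop[of n] by (simp add: cong_mult_lcancel)
    then show ?thesis using g(1,2)[of n] by (simp add: cong_def)
  qed
  have "g (Suc n) mod int CARD('p) ^ n = g n" for n
  proof (rule uniq)
    have d: "int CARD('p) ^ n dvd int CARD('p) ^ Suc n" by simp
    have "padic_res x (Suc n) * g (Suc n) mod int CARD('p) ^ Suc n mod int CARD('p) ^ n
        = 1 mod int CARD('p) ^ n"
      unfolding g(3) by (rule mod_mod_cancel[OF d])
    then have "padic_res x (Suc n) * g (Suc n) mod int CARD('p) ^ n = 1 mod int CARD('p) ^ n"
      by (simp only: mod_mod_cancel[OF d])
    then have "(padic_res x (Suc n) mod int CARD('p) ^ n) * g (Suc n) mod int CARD('p) ^ n = 1 mod int CARD('p) ^ n"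
      by (simp add: mod_simps)
    then show "padic_res x n * g (Suc n) mod int CARD('p) ^ n = 1 mod int CARD('p) ^ n"
      using padic_res_mod_le[of n "Suc n" x] by simp
  qed
  then obtain y :: "'p padic_int" where y: "padic_res y = g" by (rule padic_eq_Abs)
  have "x * y = 1"
    by (rule padic_eqI) (simp add: padic_res_mult y g(3) one_padic_int.rep_eq)
  then show "x dvd 1" by (metis dvd_triv_left)
qed

lemma padic_res_p_mult:
  fixes z :: "'p::prime_card padic_int"
  shows "padic_res (of_nat CARD('p) ^ n * z) (m + n) = int CARD('p) ^ n * padic_res z m" 
proof -
  have e: "(of_nat CARD('p) :: 'p padic_int) ^ n = of_int (int CARD('p) ^ n)" by simp
  have "padic_res (of_nat CARD('p) ^ n * z) (m + n)
      = (int CARD('p) ^ n * padic_res z (m + n)) mod (int CARD('p) ^ n * int CARD('p) ^ m)"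
    unfolding e padic_res_mult padic_res_of_int
    by (simp only: mod_mult_left_eq power_add[of _ m n] mult.commute[of "int CARD('p) ^ m" "int CARD('p) ^ n"])
  also have "\<dots> = int CARD('p) ^ n * (padic_res z (m + n) mod int CARD('p) ^ m)"
    by (simp only: mult_mod_right)
  finally show ?thesis by (simp add: padic_res_mod_le)
qed

text \<open>Multiplication by \<open>p ^ n\<close> scales the residues and shifts them by
  \<open>n\<close> levels, so equal multiples have equal residues at every level.\<close>

lemma padic_p_mult_cancel:
  fixes x y :: "'p::prime_card padic_int"
  shows "of_nat CARD('p) ^ n * x = of_nat CARD('p) ^ n * y \<longleftrightarrow> x = y"
proof
  assume eq: "of_nat CARD('p) ^ n * x = of_nat CARD('p) ^ n * y"
  show "x = y"
  proof (rule padic_eqI)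
    fix m
    have "int CARD('p) ^ n * padic_res x m = int CARD('p) ^ n * padic_res y m"
      using eq padic_res_p_mult by metis
    then show "padic_res x m = padic_res y m" by simp
  qed
qed simp

lemma padic_unit_factor:
  fixes x :: "'p::prime_card padic_int"
  assumes "x \<noteq> 0"
  obtains u where "x = of_nat CARD('p) ^ padic_ord x * u" "u dvd 1"
proof -
  have "of_nat CARD('p) ^ padic_ord x dvd x" using assms by (simp add: padic_dvd_ord)
  then obtain u where u: "x = of_nat CARD('p) ^ padic_ord x * u" by (auto simp: dvd_def)
  have "\<not> of_nat CARD('p) dvd u"
  proof
    assume "of_nat CARD('p) dvd u"
    then have "of_nat CARD('p) ^ Suc (padic_ord x) dvd x"
      by (subst u) (simp add: mult.commute mult_dvd_mono)
    then show False using assms padic_dvd_ord[of x "Suc (padic_ord x)"] by simp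
  qed
  then show ?thesis using u that padic_unit_iff by blast
qed

text \<open>The splitting into a power of \<open>p\<close> and a unit is unique, which evaluates the
  \<open>GREATEST\<close> in \<open>padic_ord\<close> and the \<open>THE\<close> in
  \<open>padic_ac\<close>.\<close>

lemma padic_p_times_unit:
  fixes u :: "'p::prime_card padic_int"
  assumes "u dvd 1"
  shows "of_nat CARD('p) ^ n * u \<noteq> 0" "padic_ord (of_nat CARD('p) ^ n * u) = n"
    "padic_ac (of_nat CARD('p) ^ n * u) = u"
    "padic_abs (of_nat CARD('p) ^ n * u) = real CARD('p) powi (- int n)"
proof -
  let ?x = "of_nat CARD('p) ^ n * u"
  have "u \<noteq> 0" using assms padic_unit_iff[of u] by auto
  then show nz: "?x \<noteq> 0" using padic_p_mult_cancel[of n u 0] by simp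
  have "n \<le> padic_ord ?x" using padic_dvd_ord[OF nz, of n] by simp
  moreover have "\<not> Suc n \<le> padic_ord ?x"
  proof
    assume "Suc n \<le> padic_ord ?x"
    then have "of_nat CARD('p) ^ Suc n dvd ?x" using padic_dvd_ord[OF nz] by blast
    then obtain v where "?x = of_nat CARD('p) ^ n * (of_nat CARD('p) * v)"
      by (auto simp: dvd_def mult_ac)
    then have "u = of_nat CARD('p) * v" by (simp only: padic_p_mult_cancel)
    then show False using assms padic_unit_iff[of u] by simp
  qed
  ultimately show o: "padic_ord ?x = n" by simp
  show "padic_ac ?x = u"
    unfolding padic_ac_def o using nz by (auto simp: padic_p_mult_cancel)
  show "padic_abs ?x = real CARD('p) powi (- int n)" using nz o by (simp add: padic_abs_def)
qed

subsection \<open>Reduction modulo p\<close>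

lemma padic_mod_p_eq_iff: 
  "padic_mod_p x = padic_mod_p y \<longleftrightarrow> of_nat CARD('p) dvd (x - y :: 'p::prime_card padic_int)"
proof -
  have t: "to_int_mod_ring (padic_mod_p z) = padic_res z 1" for z :: "'p padic_int"
    unfolding padic_mod_p_def of_int_of_int_mod_ring
    using padic_res_bounds[of z 1] by (intro to_int_mod_ring_of_int_mod_ring) auto
  have "padic_mod_p x = padic_mod_p y \<longleftrightarrow> padic_res x 1 = padic_res y 1"
    by (metis t padic_mod_p_def)
  then show ?thesis using padic_res_eq_iff_dvd[of x 1 y] by simp
qed

lemma of_int_mod_card [simp]: "(of_int (a mod int CARD('p::prime_card)) :: 'p mod_ring) = of_int a"
  unfolding of_int_of_int_mod_ring by transfer simp

lemma padic_mod_p_add [simp]: "padic_mod_p (x + y) = padic_mod_p x + padic_mod_p y"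
  unfolding padic_mod_p_def padic_res_add by simp

lemma padic_mod_p_diff [simp]: "padic_mod_p (x - y) = padic_mod_p x - padic_mod_p y"
  unfolding padic_mod_p_def padic_res_diff by simp

lemma padic_mod_p_mult [simp]: "padic_mod_p (x * y) = padic_mod_p x * padic_mod_p y"
  unfolding padic_mod_p_def padic_res_mult by simp

lemma padic_mod_p_0 [simp]: "padic_mod_p 0 = 0"
  unfolding padic_mod_p_def by simp

lemma padic_mod_p_of_int [simp]: "padic_mod_p (of_int k) = of_int k"
  unfolding padic_mod_p_def padic_res_of_int by simp

lemma padic_mod_p_1 [simp]: "padic_mod_p 1 = 1"
  using padic_mod_p_of_int[of 1] by simp

lemma padic_mod_p_of_nat [simp]: "padic_mod_p (of_nat k) = of_nat k"
  using padic_mod_p_of_int[of "int k"] by simp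

lemma padic_mod_p_power [simp]: "padic_mod_p (x ^ n) = padic_mod_p x ^ n"
  by (induction n) simp_all

lemma padic_mod_p_sum [simp]: "padic_mod_p (sum h A) = (\<Sum>a\<in>A. padic_mod_p (h a))"
  by (induction A rule: infinite_finite_induct) simp_all

lemma padic_mod_p_prod [simp]: "padic_mod_p (prod h A) = (\<Prod>a\<in>A. padic_mod_p (h a))"
  by (induction A rule: infinite_finite_induct) simp_all

lemma padic_mod_p_eq_0_iff: "padic_mod_p x = 0 \<longleftrightarrow> of_nat CARD('p) dvd (x :: 'p::prime_card padic_int)"
  using padic_mod_p_eq_iff[of x 0] by simp

lemma padic_unit_iff_mod_p: "x dvd 1 \<longleftrightarrow> padic_mod_p x \<noteq> 0"
  by (simp add: padic_unit_iff padic_mod_p_eq_0_iff)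

lemma of_int_to_int_mod_ring [simp]: "of_int (to_int_mod_ring a) = (a :: 'p::prime_card mod_ring)"
  unfolding of_int_of_int_mod_ring by simp

subsection \<open>Residue boxes and the Haar measure\<close>

text \<open>Each coordinate has its own level: precision \<open>N\<close> for \<open>u\<close>
  becomes precision \<open>N + k i\<close> for a coordinate \<open>p ^ k i * u i\<close>. Values of
  \<open>b\<close> outside the range of residues give the empty set.\<close>

definition res_box :: "('n::finite \<Rightarrow> nat) \<Rightarrow> ('n \<Rightarrow> int) \<Rightarrow> ('p::prime_card padic_int ^ 'n) set" where
  "res_box n b = {x. \<forall>j. padic_res (x $ j) (n j) = b j}"

lemma padic_dist_small:
  fixes x y :: "'p::prime_card padic_int"
  assumes "padic_res x n = padic_res y n"
  shows "dist x y \<le> real CARD('p) powi (- int n)"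
proof (cases "x = y")
  case False
  then have "x - y \<noteq> 0" by simp
  then have "n \<le> padic_ord (x - y)"
    using assms padic_dvd_ord[of "x - y" n] by (simp add: padic_res_eq_iff_dvd)
  then show ?thesis using \<open>x - y \<noteq> 0\<close> card_gt_1[where ?'p='p]
    by (auto simp: dist_padic_int_def padic_abs_def intro!: power_int_increasing)
qed (auto intro!: zero_le_power_int)

lemma padic_res_eq_of_dist:
  fixes x y :: "'p::prime_card padic_int"
  assumes "dist x y < real CARD('p) powi (- int n)"
  shows "padic_res x n = padic_res y n"
proof (cases "x = y")
  case False
  then have nz: "x - y \<noteq> 0" by simp
  have "n \<le> padic_ord (x - y)"
  proof (rule ccontr)
    assume "\<not> n \<le> padic_ord (x - y)"
    then have "real CARD('p) powi (- int n) \<le> real CARD('p) powi (- int (padic_ord (x - y)))"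
      using card_gt_1[where ?'p='p] by (intro power_int_increasing) auto
    then show False using assms nz by (simp add: dist_padic_int_def padic_abs_def)
  qed
  then show ?thesis using nz padic_dvd_ord[of "x - y" n] by (simp add: padic_res_eq_iff_dvd)
qed simp

lemma open_padic_res: "open {y :: 'p::prime_card padic_int. padic_res y n = b}"
  unfolding open_dist
proof (intro ballI)
  fix x :: "'p padic_int" assume "x \<in> {y. padic_res y n = b}"
  then show "\<exists>e>0. \<forall>y. dist y x < e \<longrightarrow> y \<in> {y. padic_res y n = b}"
    by (intro exI[of _ "real CARD('p) powi (- int n)"]) (auto dest: padic_res_eq_of_dist)
qed

lemma open_res_box: "open (res_box n b)"
  unfolding open_vec_def res_box_def
  by (intro ballI exI[of _ "\<lambda>j. {y. padic_res y (n j) = b j}"]) (auto intro: open_padic_res)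

lemma open_contains_res_box:
  fixes U :: "('p::prime_card padic_int ^ 'n::finite) set"
  assumes "open U" "x \<in> U"
  obtains N where "res_box (\<lambda>_. N) (\<lambda>j. padic_res (x $ j) N) \<subseteq> U"
proof -
  obtain A where A: "\<And>i. open (A i) \<and> x $ i \<in> A i" "\<And>y. (\<And>i. y $ i \<in> A i) \<Longrightarrow> y \<in> U"
    using assms unfolding open_vec_def by metis
  have "\<exists>n. \<forall>y. padic_res y n = padic_res (x $ i) n \<longrightarrow> y \<in> A i" for i
  proof -
    obtain e where e: "e > 0" "\<And>y. dist y (x $ i) < e \<Longrightarrow> y \<in> A i"
      using A(1)[of i] unfolding open_dist by metis
    obtain n where "(1 / real CARD('p)) ^ n < e"
      using real_arch_pow_inv[of e "1 / real CARD('p)"] e(1) card_gt_1[where ?'p='p] by auto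
    then have "real CARD('p) powi (- int n) < e"
      by (simp add: power_int_minus power_one_over inverse_eq_divide)
    then show ?thesis
      by (intro exI[of _ n] allI impI e(2)) (erule le_less_trans[OF padic_dist_small])
  qed
  then obtain n where n: "\<And>i y. padic_res y (n i) = padic_res (x $ i) (n i) \<Longrightarrow> y \<in> A i" by metis
  define N where "N = Max (range n)"
  have "n i \<le> N" for i unfolding N_def by simp
  then have "res_box (\<lambda>_. N) (\<lambda>j. padic_res (x $ j) N) \<subseteq> U"
    unfolding res_box_def by (auto intro!: A(2) n) (metis padic_res_mod_le)
  then show ?thesis by (rule that)
qed

text \<open>With one common level two boxes are nested or disjoint, so closure under intersection
  reduces to a single comparison of levels.\<close>

definition uniform_boxes :: "('p::prime_card padic_int ^ 'n::finite) set set" where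
  "uniform_boxes = {res_box (\<lambda>_. N) b |N b. True}"

lemma countable_uniform_boxes:
  "countable (uniform_boxes :: ('p::prime_card padic_int ^ 'n::finite) set set)"
proof -
  have "countable (PiE (UNIV :: 'n set) (\<lambda>_. UNIV :: int set))"
    by (intro countable_PiE) auto
  then have c: "countable (UNIV :: ('n \<Rightarrow> int) set)" by simp
  have "(uniform_boxes :: ('p padic_int ^ 'n) set set)
      = (\<Union>N. range (res_box (\<lambda>_. N)))"
    unfolding uniform_boxes_def by auto
  moreover have "countable (\<Union>N. range (res_box (\<lambda>_. N)) :: ('p padic_int ^ 'n) set set)"
    by (intro countable_UN countable_image c) simp
  ultimately show ?thesis by simp
qed

lemma borel_eq_uniform_boxes:
  "(borel :: ('p::prime_card padic_int ^ 'n::finite) measure) = sigma UNIV uniform_boxes"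
proof (rule borel_eq_countable_basis[OF countable_uniform_boxes])
  show "topological_basis (uniform_boxes :: ('p padic_int ^ 'n) set set)"
  proof (rule topological_basisI)
    show "open B" if "B \<in> uniform_boxes" for B :: "('p padic_int ^ 'n) set"
      using that unfolding uniform_boxes_def by (auto intro: open_res_box)
    fix U :: "('p padic_int ^ 'n) set" and x assume "open U" "x \<in> U"
    then obtain N where "res_box (\<lambda>_. N) (\<lambda>j. padic_res (x $ j) N) \<subseteq> U"
      by (rule open_contains_res_box)
    then show "\<exists>B\<in>uniform_boxes. x \<in> B \<and> B \<subseteq> U"
      by (intro bexI[of _ "res_box (\<lambda>_. N) (\<lambda>j. padic_res (x $ j) N)"] conjI)
        (simp add: res_box_def, assumption, unfold uniform_boxes_def, blast)
  qed
qed

lemma sets_borel_uniform_boxes: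
  "sets (borel :: ('p::prime_card padic_int ^ 'n::finite) measure) = sigma_sets UNIV uniform_boxes"
  by (subst borel_eq_uniform_boxes) simp

lemma res_box_Int:
  fixes b c :: "'n::finite \<Rightarrow> int"
  assumes "M \<le> N"
  shows "(res_box (\<lambda>_. M) b \<inter> res_box (\<lambda>_. N) c :: ('p::prime_card padic_int ^ 'n) set) \<in> uniform_boxes"
proof (cases "\<forall>j. c j mod int CARD('p) ^ M = b j")
  case True
  have "(res_box (\<lambda>_. M) b \<inter> res_box (\<lambda>_. N) c :: ('p padic_int ^ 'n) set) = res_box (\<lambda>_. N) c"
  proof (intro equalityI subsetI)
    fix x :: "'p padic_int ^ 'n" assume x: "x \<in> res_box (\<lambda>_. N) c"
    have "padic_res (x $ j) M = b j" for j
      using x True padic_res_mod_le[OF assms, of "x $ j"] unfolding res_box_def by auto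
    then show "x \<in> res_box (\<lambda>_. M) b \<inter> res_box (\<lambda>_. N) c" using x by (auto simp: res_box_def)
  qed simp
  then show ?thesis unfolding uniform_boxes_def by auto
next
  case False
  then obtain j where j: "c j mod int CARD('p) ^ M \<noteq> b j" by blast
  have "x \<notin> res_box (\<lambda>_. M) b \<inter> res_box (\<lambda>_. N) c" for x :: "'p padic_int ^ 'n"
    unfolding res_box_def using j padic_res_mod_le[OF assms, of "x $ j"] by auto
  \<comment> \<open>The residue at level 0 is always 0, so prescribing 1 there represents the empty
    set as a box.\<close>
  moreover have "x \<notin> res_box (\<lambda>_. 0) (\<lambda>_. 1)" for x :: "'p padic_int ^ 'n"
    unfolding res_box_def by simp
  ultimately have "(res_box (\<lambda>_. M) b \<inter> res_box (\<lambda>_. N) c :: ('p padic_int ^ 'n) set)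
      = res_box (\<lambda>_. 0) (\<lambda>_. 1)" by blast
  then show ?thesis unfolding uniform_boxes_def by blast
qed

lemma Int_stable_uniform_boxes: "Int_stable uniform_boxes"
proof (rule Int_stableI)
  fix A B :: "('p::prime_card padic_int ^ 'n::finite) set"
  assume "A \<in> uniform_boxes" "B \<in> uniform_boxes"
  then obtain M b N c where AB: "A = res_box (\<lambda>_. M) b" "B = res_box (\<lambda>_. N) c"
    unfolding uniform_boxes_def by auto
  show "A \<inter> B \<in> uniform_boxes"
    using res_box_Int[of M N b c] res_box_Int[of N M c b] unfolding AB
    by (cases "M \<le> N") (auto simp: Int_commute)
qed

lemma measure_eq_on_uniform_boxes:
  fixes M M' :: "('p::prime_card padic_int ^ 'n::finite) measure"
  assumes "sets M = sets borel" "sets M' = sets borel" "emeasure M UNIV = 1"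
    and eq: "\<And>N b. emeasure M (res_box (\<lambda>_. N) b) = emeasure M' (res_box (\<lambda>_. N) b)"
  shows "M = M'"
proof (rule measure_eqI_generator_eq[OF Int_stable_uniform_boxes, where \<Omega>=UNIV and A = "\<lambda>_. UNIV"])
  show "emeasure M X = emeasure M' X" if "X \<in> uniform_boxes" for X
    using that eq unfolding uniform_boxes_def by auto
  have "res_box (\<lambda>_. 0) (\<lambda>_. 0) = (UNIV :: ('p padic_int ^ 'n) set)"
    by (auto simp: res_box_def)
  then show "range (\<lambda>_::nat. UNIV :: ('p padic_int ^ 'n) set) \<subseteq> uniform_boxes"
    unfolding uniform_boxes_def by auto
qed (use assms sets_borel_uniform_boxes in auto)

lemma res_box_empty:
  fixes b :: "'n::finite \<Rightarrow> int"
  assumes "\<not> (0 \<le> b j \<and> b j < int CARD('p::prime_card) ^ n j)"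
  shows "(res_box n b :: ('p padic_int ^ 'n) set) = {}"
  using assms padic_res_bounds[where ?'p='p] unfolding res_box_def
  by (metis (mono_tags, lifting) Collect_empty_eq)

definition residues_upto :: "'p::prime_card itself \<Rightarrow> nat \<Rightarrow> ('n \<Rightarrow> int) set" where
  "residues_upto _ N = PiE UNIV (\<lambda>_. {0..<int CARD('p) ^ N})"

definition padic_translation_invariant :: "('p::prime_card padic_int ^ 'n::finite) measure \<Rightarrow> bool" where
  "padic_translation_invariant M \<longleftrightarrow> sets M = sets borel \<and> emeasure M UNIV = 1 \<and>
     (\<forall>a. \<forall>A\<in>sets M. emeasure M ((\<lambda>x. a + x) ` A) = emeasure M A)"

text \<open>The boxes of level \<open>N\<close> are translates of the one at 0 and partition the
  space, so the total mass 1 is shared equally.\<close>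

lemma emeasure_uniform_box_translation_invariant:
  fixes M :: "('p::prime_card padic_int ^ 'n::finite) measure" and b :: "'n \<Rightarrow> int"
  assumes M: "padic_translation_invariant M" and b: "\<And>j. 0 \<le> b j" "\<And>j. b j < int CARD('p) ^ N"
  shows "emeasure M (res_box (\<lambda>_. N) b) = 1 / of_nat (CARD('p) ^ N) ^ CARD('n)"
proof -
  let ?R = "residues_upto TYPE('p) N :: ('n \<Rightarrow> int) set"
  have sets: "sets M = sets borel" using M unfolding padic_translation_invariant_def by simp
  have box: "res_box (\<lambda>_. N) c \<in> sets M" for c
    using open_res_box sets by (metis borel_open)
  have eq: "emeasure M (res_box (\<lambda>_. N) c) = emeasure M (res_box (\<lambda>_. N) (\<lambda>_. 0))" if c: "c \<in> ?R" for c
  proof -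
    have cb: "c j mod int CARD('p) ^ N = c j" for j
      using c unfolding residues_upto_def by (auto simp: PiE_def Pi_def)
    define a where "a = (\<chi> j. (of_int (c j) :: 'p padic_int))"
    have "(res_box (\<lambda>_. N) c :: ('p padic_int ^ 'n) set) = (\<lambda>x. a + x) ` res_box (\<lambda>_. N) (\<lambda>_. 0)"
    proof (intro equalityI subsetI)
      fix x :: "'p padic_int ^ 'n" assume "x \<in> res_box (\<lambda>_. N) c"
      then have "x - a \<in> res_box (\<lambda>_. N) (\<lambda>_. 0)"
        unfolding res_box_def a_def by (simp add: padic_res_diff padic_res_of_int cb)
      then show "x \<in> (\<lambda>x. a + x) ` res_box (\<lambda>_. N) (\<lambda>_. 0)"
        by (intro image_eqI[of _ _ "x - a"]) simp_all
    next
      fix x :: "'p padic_int ^ 'n" assume "x \<in> (\<lambda>x. a + x) ` res_box (\<lambda>_. N) (\<lambda>_. 0)"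
      then show "x \<in> res_box (\<lambda>_. N) c"
        unfolding res_box_def a_def by (auto simp: padic_res_add padic_res_of_int cb)
    qed
    then show ?thesis using M box unfolding padic_translation_invariant_def by metis
  qed
  have fin: "finite ?R" unfolding residues_upto_def by (intro finite_PiE) auto
  have card: "card ?R = (CARD('p) ^ N) ^ CARD('n)"
    unfolding residues_upto_def by (subst card_PiE) (auto simp: nat_power_eq)
  have disj: "disjoint_family_on (res_box (\<lambda>_. N) :: _ \<Rightarrow> ('p padic_int ^ 'n) set) ?R"
    unfolding disjoint_family_on_def res_box_def by auto
  have cov: "(\<Union>c\<in>?R. res_box (\<lambda>_. N) c) = (UNIV :: ('p padic_int ^ 'n) set)"
  proof (intro equalityI subsetI)
    fix x :: "'p padic_int ^ 'n"
    have "(\<lambda>j. padic_res (x $ j) N) \<in> ?R"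
      unfolding residues_upto_def by (auto simp: padic_res_bounds)
    then show "x \<in> (\<Union>c\<in>?R. res_box (\<lambda>_. N) c)"
      by (rule UN_I) (simp add: res_box_def)
  qed simp
  have "(\<Sum>c\<in>?R. emeasure M (res_box (\<lambda>_. N) c)) = 1"
    using M cov by (subst sum_emeasure[OF _ disj fin]) (auto simp: box padic_translation_invariant_def)
  then have "of_nat ((CARD('p) ^ N) ^ CARD('n)) * emeasure M (res_box (\<lambda>_. N) (\<lambda>_. 0)) = 1"
    using eq card by simp
  moreover have "b \<in> ?R" unfolding residues_upto_def using b by auto
  ultimately have m: "of_nat ((CARD('p) ^ N) ^ CARD('n)) * emeasure M (res_box (\<lambda>_. N) b) = 1"
    using eq by simp
  show ?thesis
    using m by (metis ennreal_of_nat_neq_top mult_divide_eq_ennreal of_nat_eq_0_iff of_nat_power mult.commute mult_zero_left zero_neq_one)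
qed

lemma padic_translation_invariant_unique:
  fixes M M' :: "('p::prime_card padic_int ^ 'n::finite) measure"
  assumes "padic_translation_invariant M" "padic_translation_invariant M'"
  shows "M = M'"
proof (rule measure_eq_on_uniform_boxes)
  fix N and b :: "'n \<Rightarrow> int"
  show "emeasure M (res_box (\<lambda>_. N) b) = emeasure M' (res_box (\<lambda>_. N) b)"
  proof (cases "\<forall>j. 0 \<le> b j \<and> b j < int CARD('p) ^ N")
    case True
    then show ?thesis using assms by (simp add: emeasure_uniform_box_translation_invariant)
  next
    case False
    then have "(res_box (\<lambda>_. N) b :: ('p padic_int ^ 'n) set) = {}"
      using res_box_empty[of b _ "\<lambda>_. N", where ?'p='p] by blast
    then show ?thesis by simp
  qed
qed (use assms in \<open>auto simp: padic_translation_invariant_def\<close>)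

section \<open>Existence of the Haar measure through random digits\<close>

lemma sum_digits_bounds:
  fixes e :: "nat \<Rightarrow> int"
  assumes "\<And>l. 0 \<le> e l" "\<And>l. e l < q" 
  shows "0 \<le> (\<Sum>l<N. e l * q ^ l)" "(\<Sum>l<N. e l * q ^ l) < q ^ N"
proof -
  have q: "q > 0" using assms by (metis le_less_trans)
  show "0 \<le> (\<Sum>l<N. e l * q ^ l)" using assms q by (intro sum_nonneg) auto
  show "(\<Sum>l<N. e l * q ^ l) < q ^ N"
  proof (induction N)
    case (Suc N)
    have "e N * q ^ N \<le> (q - 1) * q ^ N" using assms(2)[of N] q by (intro mult_right_mono) auto
    then show ?case using Suc by (simp add: algebra_simps)
  qed simp
qed

lemma sum_digits_eq_iff:
  fixes e :: "nat \<Rightarrow> int"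
  assumes e: "\<And>l. 0 \<le> e l" "\<And>l. e l < q" and b: "0 \<le> b" "b < q ^ N"
  shows "(\<Sum>l<N. e l * q ^ l) = b \<longleftrightarrow> (\<forall>l<N. e l = b div q ^ l mod q)"
  using b
proof (induction N arbitrary: b)
  case (Suc N)
  have q: "q > 0" using e by (metis le_less_trans)
  let ?s = "\<Sum>l<N. e l * q ^ l"
  have s: "0 \<le> ?s" "?s < q ^ N" using sum_digits_bounds[OF e] by auto
  have bq: "b div q ^ N < q" "0 \<le> b div q ^ N"
  proof -
    have "b div q ^ N * q ^ N \<le> b" using q div_mult_mod_eq[of b "q ^ N"] pos_mod_sign[of "q ^ N" b]
      by (metis add.commute le_add_same_cancel2 zero_less_power)
    then have "b div q ^ N * q ^ N < q * q ^ N" using Suc.prems by simp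
    then show "b div q ^ N < q" using q by simp
    show "0 \<le> b div q ^ N" using Suc.prems q by (simp add: pos_imp_zdiv_nonneg_iff)
  qed
  have "?s + e N * q ^ N = b \<longleftrightarrow> ?s = b mod q ^ N \<and> e N = b div q ^ N"
  proof
    assume "?s + e N * q ^ N = b"
    then have "b mod q ^ N = ?s" "b div q ^ N = e N" using s q by auto
    then show "?s = b mod q ^ N \<and> e N = b div q ^ N" by simp
  next
    assume "?s = b mod q ^ N \<and> e N = b div q ^ N"
    then show "?s + e N * q ^ N = b" using mod_div_mult_eq[of b "q ^ N"] by simp
  qed
  also have "?s = b mod q ^ N \<longleftrightarrow> (\<forall>l<N. e l = b mod q ^ N div q ^ l mod q)"
    using q by (intro Suc.IH) auto
  also have "\<dots> \<longleftrightarrow> (\<forall>l<N. e l = b div q ^ l mod q)"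
  proof (intro all_cong1 imp_cong refl)
    fix l assume "l < N"
    have "b mod q ^ N div q ^ l mod q = b div q ^ l mod q"
    proof -
      have N: "q ^ N = q ^ l * q ^ (N - l)" using \<open>l < N\<close> by (simp flip: power_add)
      have "b mod q ^ N div q ^ l = b div q ^ l mod q ^ (N - l)"
        unfolding N using q by (simp add: mod_mult2_eq' zmod_zmult2_eq)
      moreover have "q dvd q ^ (N - l)" using \<open>l < N\<close> by simp
      ultimately show ?thesis by (simp add: mod_mod_cancel)
    qed
    then show "e l = b mod q ^ N div q ^ l mod q \<longleftrightarrow> e l = b div q ^ l mod q" by simp
  qed
  also have "e N = b div q ^ N \<longleftrightarrow> e N = b div q ^ N mod q" using bq by simp
  finally show ?case by (auto simp: less_Suc_eq)
qed simp

text \<open>Independent uniform base \<open>p\<close> digits in every coordinate define a random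
  vector whose law is the Haar measure.\<close>

definition digit_dist :: "'p::prime_card itself \<Rightarrow> int measure" where
  "digit_dist _ = measure_pmf (pmf_of_set {0..<int CARD('p)})"

text \<open>Digits are reduced modulo \<open>p\<close> so that the map is total on integer sequences
  and its values satisfy the compatibility condition of the type.\<close>

definition padic_of_digits :: "(nat \<times> 'n \<Rightarrow> int) \<Rightarrow> 'p::prime_card padic_int ^ 'n" where
  "padic_of_digits d = (\<chi> j. Abs_padic_int (\<lambda>N. \<Sum>l<N. (d (l, j) mod int CARD('p)) * int CARD('p) ^ l))"

lemma padic_res_of_digits:
  "padic_res ((padic_of_digits d :: 'p::prime_card padic_int ^ 'n) $ j) N
     = (\<Sum>l<N. (d (l, j) mod int CARD('p)) * int CARD('p) ^ l)"
proof -
  have "(\<Sum>l<Suc n. (d (l, j) mod int CARD('p)) * int CARD('p) ^ l) mod int CARD('p) ^ n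
      = (\<Sum>l<n. (d (l, j) mod int CARD('p)) * int CARD('p) ^ l)" for n
    using sum_digits_bounds[of "\<lambda>l. d (l, j) mod int CARD('p)" "int CARD('p)" n] by simp
  then show ?thesis unfolding padic_of_digits_def by (simp add: Abs_padic_int_inverse)
qed

definition padic_digit_space :: "'p::prime_card itself \<Rightarrow> (nat \<times> 'n::finite \<Rightarrow> int) measure" where
  "padic_digit_space p = PiM UNIV (\<lambda>_. digit_dist p)"

lemma emeasure_digit_dist:
  assumes "0 \<le> c" "c < int CARD('p::prime_card)"
  shows "emeasure (digit_dist TYPE('p)) {x. x mod int CARD('p) = c} = ennreal (1 / real CARD('p))"
proof -
  have "{0..<int CARD('p)} \<inter> {x. x mod int CARD('p) = c} = {c}" using assms by auto
  then show ?thesis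
    unfolding digit_dist_def measure_pmf.emeasure_eq_measure by (subst measure_pmf_of_set) auto
qed

definition padic_digit_measure :: "('p::prime_card padic_int ^ 'n::finite) measure" where
  "padic_digit_measure = distr (padic_digit_space TYPE('p)) borel padic_of_digits"

lemma vimage_res_box_digits:
  fixes b :: "'n::finite \<Rightarrow> int"
  assumes b: "\<And>j. 0 \<le> b j" "\<And>j. b j < int CARD('p::prime_card) ^ n j"
  shows "(padic_of_digits :: _ \<Rightarrow> 'p padic_int ^ 'n) -` res_box n b
     = {d. \<forall>i\<in>(SIGMA j:UNIV. {..<n j}). d (snd i, fst i) mod int CARD('p) 
          = b (fst i) div int CARD('p) ^ snd i mod int CARD('p)}"
  unfolding res_box_def using b by (auto simp: padic_res_of_digits sum_digits_eq_iff)

lemma space_padic_digit_space [simp]: "space (padic_digit_space p) = UNIV"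
  by (simp add: padic_digit_space_def digit_dist_def space_PiM)

lemma prob_space_digit_dist: "prob_space (digit_dist p)"
  unfolding digit_dist_def by (rule measure_pmf.prob_space_axioms)

text \<open>A box prescribes the first \<open>n j\<close> digits of coordinate \<open>j\<close>,
  each of them with probability \<open>1 / p\<close>.\<close>

lemma res_box_digits_emeasure:
  fixes b :: "'n::finite \<Rightarrow> int"
  assumes b: "\<And>j. 0 \<le> b j" "\<And>j. b j < int CARD('p::prime_card) ^ n j"
  shows "(padic_of_digits :: _ \<Rightarrow> 'p padic_int ^ 'n) -` res_box n b \<in> sets (padic_digit_space TYPE('p))"
    "emeasure (padic_digit_space TYPE('p)) ((padic_of_digits :: _ \<Rightarrow> 'p padic_int ^ 'n) -` res_box n b)
      = ennreal ((1 / real CARD('p)) ^ (\<Sum>j\<in>UNIV. n j))"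
proof -
  interpret D: product_prob_space "\<lambda>_. digit_dist TYPE('p)" "UNIV :: (nat \<times> 'n) set"
    by (intro product_prob_spaceI prob_space_digit_dist)
  let ?J = "(\<lambda>(j, l). (l, j)) ` (SIGMA j:UNIV. {..<n j})"
  let ?X = "\<lambda>i. {x. x mod int CARD('p) = b (snd i) div int CARD('p) ^ fst i mod int CARD('p)}"
  have inj: "inj_on (\<lambda>(j, l). (l, j)) (SIGMA j:UNIV. {..<n j})" by (auto simp: inj_on_def)
  have X: "?X i \<in> sets (digit_dist TYPE('p))" for i by (simp add: digit_dist_def)
  have eq: "(padic_of_digits :: _ \<Rightarrow> 'p padic_int ^ 'n) -` res_box n b
     = {d \<in> space (padic_digit_space TYPE('p)). \<forall>i\<in>?J. d i \<in> ?X i}"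
    unfolding vimage_res_box_digits[OF b] by (auto split: prod.splits)
  have fin: "finite ?J" by auto
  have "emeasure (padic_digit_space TYPE('p)) ((padic_of_digits :: _ \<Rightarrow> 'p padic_int ^ 'n) -` res_box n b)
      = (\<Prod>i\<in>?J. emeasure (digit_dist TYPE('p)) (?X i))"
    unfolding eq padic_digit_space_def using X fin by (intro D.emeasure_PiM_Collect) auto
  also have "\<dots> = (\<Prod>i\<in>?J. ennreal (1 / real CARD('p)))"
    by (intro prod.cong refl emeasure_digit_dist) auto
  also have "\<dots> = ennreal (1 / real CARD('p)) ^ card ?J" by simp
  also have "card ?J = (\<Sum>j\<in>UNIV. n j)"
    using inj by (subst card_image) (auto simp: card_SigmaI)
  finally show "emeasure (padic_digit_space TYPE('p)) ((padic_of_digits :: _ \<Rightarrow> 'p padic_int ^ 'n) -` res_box n b)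
      = ennreal ((1 / real CARD('p)) ^ (\<Sum>j\<in>UNIV. n j))"
    by (simp add: ennreal_power)
  show "(padic_of_digits :: _ \<Rightarrow> 'p padic_int ^ 'n) -` res_box n b \<in> sets (padic_digit_space TYPE('p))"
    unfolding eq padic_digit_space_def using X fin
    by (intro sets.sets_Collect_finite_All) (auto intro!: sets_Collect_single' simp: digit_dist_def)
qed

lemma measurable_padic_of_digits:
  "(padic_of_digits :: _ \<Rightarrow> 'p::prime_card padic_int ^ 'n::finite) \<in> borel_measurable (padic_digit_space TYPE('p))"
proof (rule measurable_sigma_sets[OF sets_borel_uniform_boxes])
  fix y :: "('p padic_int ^ 'n) set" assume "y \<in> uniform_boxes"
  then obtain N b where y: "y = res_box (\<lambda>_. N) b" unfolding uniform_boxes_def by auto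
  show "padic_of_digits -` y \<inter> space (padic_digit_space TYPE('p)) \<in> sets (padic_digit_space TYPE('p))"
  proof (cases "\<forall>j. 0 \<le> b j \<and> b j < int CARD('p) ^ N")
    case True
    then show ?thesis unfolding y using res_box_digits_emeasure(1)[of b "\<lambda>_. N", where ?'p='p] by simp
  next
    case False
    then have "(res_box (\<lambda>_. N) b :: ('p padic_int ^ 'n) set) = {}"
      using res_box_empty[of b _ "\<lambda>_. N", where ?'p='p] by blast
    then show ?thesis unfolding y by simp
  qed
qed auto

lemma emeasure_padic_digit_measure_res_box:
  fixes b :: "'n::finite \<Rightarrow> int"
  assumes b: "\<And>j. 0 \<le> b j" "\<And>j. b j < int CARD('p::prime_card) ^ n j"
  shows "emeasure (padic_digit_measure :: ('p padic_int ^ 'n) measure) (res_box n b)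
      = ennreal ((1 / real CARD('p)) ^ (\<Sum>j\<in>UNIV. n j))"
  unfolding padic_digit_measure_def
  using b
  by (subst emeasure_distr[OF measurable_padic_of_digits])
    (simp_all add: res_box_digits_emeasure(2) open_res_box)

lemma vimage_plus_res_box:
  fixes a :: "'p::prime_card padic_int ^ 'n::finite"
  assumes b: "\<And>j. 0 \<le> b j" "\<And>j. b j < int CARD('p) ^ n j"
  shows "(\<lambda>x. x - a) -` res_box n b = res_box n (\<lambda>j. (b j + padic_res (a $ j) (n j)) mod int CARD('p) ^ n j)"
proof -
  have "padic_res (x $ j - a $ j) (n j) = b j \<longleftrightarrow>
      padic_res (x $ j) (n j) = (b j + padic_res (a $ j) (n j)) mod int CARD('p) ^ n j" for x :: "'p padic_int ^ 'n" and j
  proof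
    assume "padic_res (x $ j - a $ j) (n j) = b j"
    then have "padic_res ((x $ j - a $ j) + a $ j) (n j) = (b j + padic_res (a $ j) (n j)) mod int CARD('p) ^ n j"
      by (simp only: padic_res_add)
    then show "padic_res (x $ j) (n j) = (b j + padic_res (a $ j) (n j)) mod int CARD('p) ^ n j"
      by (simp only: diff_add_cancel)
  next
    assume "padic_res (x $ j) (n j) = (b j + padic_res (a $ j) (n j)) mod int CARD('p) ^ n j"
    then show "padic_res (x $ j - a $ j) (n j) = b j" 
      using b[of j] by (simp add: padic_res_diff mod_diff_left_eq)
  qed
  then show ?thesis unfolding res_box_def by auto
qed

text \<open>Subtracting \<open>a\<close> pulls a box back to a box of the same levels, hence of the
  same mass; agreement on the generating pi-system extends to all Borel sets.\<close>

lemma padic_digit_measure_translation_invariant: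
  "padic_translation_invariant (padic_digit_measure :: ('p::prime_card padic_int ^ 'n::finite) measure)"
proof -
  let ?M = "padic_digit_measure :: ('p padic_int ^ 'n) measure"
  have sets: "sets ?M = sets borel" by (simp add: padic_digit_measure_def)
  have U: "emeasure ?M UNIV = 1"
  proof -
    have "res_box (\<lambda>_. 0) (\<lambda>_. 0) = (UNIV :: ('p padic_int ^ 'n) set)" by (auto simp: res_box_def)
    then show ?thesis using emeasure_padic_digit_measure_res_box[of "\<lambda>_::'n. 0" "\<lambda>_. 0", where ?'p='p] by simp
  qed
  have "emeasure ?M ((\<lambda>x. a + x) ` A) = emeasure ?M A" if A: "A \<in> sets ?M" for a A
  proof -
    have tm: "(\<lambda>x. x - a) \<in> measurable ?M ?M"
    proof (rule measurable_sigma_sets)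
      show "sets ?M = sigma_sets UNIV uniform_boxes" using sets sets_borel_uniform_boxes by simp
      fix y :: "('p padic_int ^ 'n) set" assume "y \<in> uniform_boxes"
      then obtain N b where y: "y = res_box (\<lambda>_. N) b" unfolding uniform_boxes_def by auto
      show "(\<lambda>x. x - a) -` y \<inter> space ?M \<in> sets ?M"
      proof (cases "\<forall>j. 0 \<le> b j \<and> b j < int CARD('p) ^ N")
        case True
        then show ?thesis unfolding y using sets
          by (subst vimage_plus_res_box) (auto simp: open_res_box padic_digit_measure_def)
      next
        case False
        then have "(res_box (\<lambda>_. N) b :: ('p padic_int ^ 'n) set) = {}"
          using res_box_empty[of b _ "\<lambda>_. N", where ?'p='p] by blast
        then show ?thesis unfolding y by simp
      qed
    qed auto
    have "distr ?M ?M (\<lambda>x. x - a) = ?M"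
    proof (rule measure_eq_on_uniform_boxes)
      show "emeasure (distr ?M ?M (\<lambda>x. x - a)) UNIV = 1"
        using tm U by (subst emeasure_distr) (auto simp: padic_digit_measure_def)
      fix N and b :: "'n \<Rightarrow> int"
      show "emeasure (distr ?M ?M (\<lambda>x. x - a)) (res_box (\<lambda>_. N) b) = emeasure ?M (res_box (\<lambda>_. N) b)"
      proof (cases "\<forall>j. 0 \<le> b j \<and> b j < int CARD('p) ^ N")
        case True
        have "emeasure (distr ?M ?M (\<lambda>x. x - a)) (res_box (\<lambda>_. N) b)
            = emeasure ?M ((\<lambda>x. x - a) -` res_box (\<lambda>_. N) b)"
          using tm by (subst emeasure_distr) (auto simp: sets open_res_box, simp add: padic_digit_measure_def)
        then show ?thesis using True
          by (simp add: vimage_plus_res_box emeasure_padic_digit_measure_res_box)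
      next
        case False
        then have "(res_box (\<lambda>_. N) b :: ('p padic_int ^ 'n) set) = {}"
          using res_box_empty[of b _ "\<lambda>_. N", where ?'p='p] by blast
        then show ?thesis by simp
      qed
    qed (auto simp: sets)
    then have "emeasure ?M A = emeasure ?M ((\<lambda>x. x - a) -` A \<inter> space ?M)"
      using tm A by (metis emeasure_distr)
    also have "(\<lambda>x. x - a) -` A \<inter> space ?M = (\<lambda>x. a + x) ` A"
      by (force simp: padic_digit_measure_def image_iff algebra_simps)
    finally show ?thesis by simp
  qed
  then show ?thesis unfolding padic_translation_invariant_def using sets U by blast
qed

lemma padic_haar_eq: "padic_haar = padic_digit_measure"
  unfolding padic_haar_def
  using padic_digit_measure_translation_invariant padic_translation_invariant_unique
  unfolding padic_translation_invariant_def by (intro the_equality) blast+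

lemma sets_padic_haar [simp, measurable_cong]: "sets padic_haar = sets borel"
  by (simp add: padic_haar_eq padic_digit_measure_def)

lemma space_padic_haar [simp]: "space padic_haar = UNIV"
  by (simp add: padic_haar_eq padic_digit_measure_def)

lemma prob_space_padic_haar: "prob_space (padic_haar :: ('p::prime_card padic_int ^ 'n::finite) measure)"
proof (intro prob_spaceI)
  have "emeasure (padic_digit_measure :: ('p padic_int ^ 'n) measure) UNIV = 1"
    using padic_digit_measure_translation_invariant unfolding padic_translation_invariant_def by blast
  then show "emeasure (padic_haar :: ('p padic_int ^ 'n) measure) (space padic_haar) = 1"
    by (simp only: space_padic_haar) (simp only: padic_haar_eq)
qed

lemma measure_padic_haar_res_box:
  fixes b :: "'n::finite \<Rightarrow> int"
  assumes b: "\<And>j. 0 \<le> b j" "\<And>j. b j < int CARD('p::prime_card) ^ n j"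
  shows "measure (padic_haar :: ('p padic_int ^ 'n) measure) (res_box n b)
      = (1 / real CARD('p)) ^ (\<Sum>j\<in>UNIV. n j)"
  by (simp add: padic_haar_eq measure_def emeasure_padic_digit_measure_res_box b)

subsection \<open>Characters trivial on \<open>1 + p\<close>\<close>

text \<open>Exchanging \<open>u i\<close> with the new value \<open>t\<close> is an involution on
  the pairs \<open>(u, t)\<close>. The identity isolates one variable of a sum over a product, so
  that a character sum in that variable can be evaluated first.\<close>

lemma sum_resample:
  fixes R :: "'i::finite \<Rightarrow> 'a set" and F :: "('i \<Rightarrow> 'a) \<Rightarrow> 'b::comm_semiring_1"
  assumes fin: "\<And>j. finite (R j)"
  shows "(\<Sum>u | \<forall>j. u j \<in> R j. \<Sum>t\<in>R i. F (u(i := t))) = of_nat (card (R i)) * (\<Sum>u | \<forall>j. u j \<in> R j. F u)"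
proof -
  let ?U = "{u. \<forall>j. u j \<in> R j}"
  have U: "?U = PiE UNIV R" by (auto simp: PiE_def)
  have finU: "finite ?U" unfolding U using fin by (intro finite_PiE) auto
  have "(\<Sum>u\<in>?U. \<Sum>t\<in>R i. F (u(i := t))) = (\<Sum>(u, t)\<in>?U \<times> R i. F (u(i := t)))"
    using finU fin by (simp add: sum.cartesian_product)
  also have "\<dots> = (\<Sum>(u, t)\<in>?U \<times> R i. F u)"
    by (rule sum.reindex_bij_witness[where i = "\<lambda>(u, t). (u(i := t), u i)" and j = "\<lambda>(u, t). (u(i := t), u i)"])
      auto
  also have "\<dots> = (\<Sum>u\<in>?U. \<Sum>t\<in>R i. F u)"
    using finU fin by (subst sum.cartesian_product) simp
  finally show ?thesis by (simp add: sum_distrib_left)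
qed

locale twisting_character =
  fixes chi :: "'p::prime_card padic_int \<Rightarrow> complex"
  assumes chi: "padic_character chi"
    and nontrivial: "\<exists>u. u dvd 1 \<and> chi u \<noteq> 1"
    and trivial: "\<And>u. of_nat CARD('p) dvd u - 1 \<Longrightarrow> chi u = 1"
begin

text \<open>The character induced on the residue field, extended by 0. Triviality on
  \<open>1 + p\<close> makes the choice of the representative irrelevant.\<close>

definition chi_mod :: "'p mod_ring \<Rightarrow> complex" where
  "chi_mod a = (if a = 0 then 0 else chi (of_int (to_int_mod_ring a)))"

lemma chi_mult: "u dvd 1 \<Longrightarrow> v dvd 1 \<Longrightarrow> chi (u * v) = chi u * chi v"
  using chi unfolding padic_character_def by blast

lemma chi_cong:
  assumes "u dvd 1" "padic_mod_p u = padic_mod_p v"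
  shows "chi u = chi v"
proof -
  have v: "v dvd 1" using assms by (simp add: padic_unit_iff_mod_p)
  obtain w where w: "1 = u * w" using assms(1) by (auto simp: dvd_def)
  have wu: "w dvd 1" using w by (metis dvd_triv_right)
  have "padic_mod_p (w * v) = padic_mod_p (u * w)" using assms(2) by (simp add: mult.commute)
  then have "of_nat CARD('p) dvd w * v - 1" unfolding padic_mod_p_eq_iff w[symmetric] .
  then have "chi (w * v) = 1" by (rule trivial)
  moreover have "u * (w * v) = v" using w by (simp flip: mult.assoc)
  moreover have "chi (u * (w * v)) = chi u * chi (w * v)"
    using assms(1) v wu by (intro chi_mult) auto
  ultimately show ?thesis by simp
qed

lemma chi_mod_of_unit: "u dvd 1 \<Longrightarrow> chi_mod (padic_mod_p u) = chi u"
  unfolding chi_mod_def by (auto simp: padic_unit_iff_mod_p intro!: chi_cong)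

lemma chi_mod_0 [simp]: "chi_mod 0 = 0"
  by (simp add: chi_mod_def)

lemma mod_ring_lift: "\<exists>u :: 'p padic_int. padic_mod_p u = a"
  by (intro exI[of _ "of_int (to_int_mod_ring a)"]) simp

lemma chi_mod_mult: "chi_mod (a * b) = chi_mod a * chi_mod b"
proof (cases "a = 0 \<or> b = 0")
  case False
  obtain u v :: "'p padic_int" where uv: "padic_mod_p u = a" "padic_mod_p v = b"
    using mod_ring_lift by metis
  have "u dvd 1" "v dvd 1" "u * v dvd 1" using False uv by (auto simp: padic_unit_iff_mod_p)
  then show ?thesis using uv chi_mult chi_mod_of_unit padic_mod_p_mult by metis
qed auto

lemma chi_mod_nontrivial: obtains c where "c \<noteq> 0" "chi_mod c \<noteq> 1"
  using nontrivial chi_mod_of_unit padic_unit_iff_mod_p by metis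

lemma sum_chi_mod: "(\<Sum>a\<in>UNIV. chi_mod a) = 0"
proof -
  obtain c where c: "c \<noteq> 0" "chi_mod c \<noteq> 1" by (rule chi_mod_nontrivial)
  have "(\<Sum>a\<in>UNIV. chi_mod a) = (\<Sum>a\<in>UNIV. chi_mod (c * a))"
    by (rule sum.reindex_bij_witness[where i = "\<lambda>a. c * a" and j = "\<lambda>a. a / c"]) (use c in auto)
  also have "\<dots> = chi_mod c * (\<Sum>a\<in>UNIV. chi_mod a)"
    by (simp add: chi_mod_mult sum_distrib_left)
  finally show ?thesis using c by (simp add: algebra_simps)
qed

text \<open>An affine map permutes the residue field, over which the character sums to 0; only the
  omitted term \<open>t = 0\<close> remains. This is the source of the minus sign that makes a fibre
  cancel.\<close>

lemma sum_chi_mod_affine: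
  assumes "c \<noteq> 0"
  shows "(\<Sum>t | t \<noteq> 0. chi_mod (g + c * t)) = - chi_mod g"
proof -
  have "(\<Sum>t\<in>UNIV. chi_mod (g + c * t)) = (\<Sum>a\<in>UNIV. chi_mod a)"
    by (rule sum.reindex_bij_witness[where j = "\<lambda>t. g + c * t" and i = "\<lambda>a. (a - g) / c"])
      (use assms in \<open>auto simp: field_simps\<close>)
  then have "(\<Sum>t\<in>UNIV. chi_mod (g + c * t)) = 0" by (simp add: sum_chi_mod)
  moreover have "(\<Sum>t\<in>UNIV. chi_mod (g + c * t)) = chi_mod (g + c * 0) + (\<Sum>t\<in>UNIV - {0}. chi_mod (g + c * t))"
    by (subst sum.remove[of _ 0]) auto
  moreover have "UNIV - {0} = {t :: 'p mod_ring. t \<noteq> 0}" by auto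
  ultimately show ?thesis by (simp add: add_eq_0_iff)
qed

text \<open>A value of norm greater than 1 would have infinitely many powers, against the finite
  image.\<close>

lemma norm_chi_le: "norm (chi u) \<le> 1" if "u dvd 1"
proof -
  have fin: "finite (chi ` {u. u dvd 1})" using chi unfolding padic_character_def by blast
  have pw: "u ^ n dvd 1 \<and> chi (u ^ n) = chi 1 * chi u ^ n" for n
    using that chi_mult[of 1 u] by (induction n) (auto simp: chi_mult is_unit_power_iff)
  have c1: "chi 1 = 1" using trivial[of 1] by simp
  show ?thesis
  proof (rule ccontr)
    assume "\<not> ?thesis"
    then have g: "norm (chi u) > 1" by simp
    have "inj (\<lambda>n. norm (chi u) ^ n)"
      using g by (intro strict_mono_imp_inj_on strict_monoI power_strict_increasing) auto
    then have "inj (\<lambda>n. chi (u ^ n))"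
      unfolding inj_def using pw c1 by (metis mult_1 norm_power)
    then have "infinite (range (\<lambda>n. chi (u ^ n)))" by (simp add: finite_image_iff)
    moreover have "range (\<lambda>n. chi (u ^ n)) \<subseteq> chi ` {u. u dvd 1}" using pw by blast
    ultimately show False using fin finite_subset by blast
  qed
qed

section \<open>The integrand as a function of the value of the polynomial\<close>

definition twisted_power :: "complex \<Rightarrow> 'p padic_int \<Rightarrow> complex" where
  "twisted_power s y = chi (padic_ac y) * of_real (padic_abs y) powr s"

text \<open>\<open>p_exp w\<close> is p^(-w), written as an exponential so that it is visibly entire
  and multiplicative.\<close>

definition p_exp :: "complex \<Rightarrow> complex" where
  "p_exp w = exp (- of_real (ln (real CARD('p))) * w)"

lemma p_exp_add: "p_exp (v + w) = p_exp v * p_exp w"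
  by (simp add: p_exp_def distrib_left exp_add algebra_simps flip: exp_add)

lemma p_exp_0 [simp]: "p_exp 0 = 1"
  by (simp add: p_exp_def)

lemma p_exp_of_nat: "p_exp (of_nat n) = of_real ((1 / real CARD('p)) ^ n)"
proof -
  have "p_exp (of_nat n) = of_real (exp (- (ln (real CARD('p)) * real n)))"
    by (simp add: p_exp_def exp_of_real flip: exp_of_real)
  also have "exp (- (ln (real CARD('p)) * real n)) = (1 / real CARD('p)) ^ n"
    by (simp add: exp_minus exp_of_nat2_mult power_one_over inverse_eq_divide)
  finally show ?thesis .
qed

lemma twisted_power_0 [simp]: "twisted_power s 0 = 0"
  by (simp add: twisted_power_def padic_abs_def)

lemma twisted_power_unit:
  assumes "u dvd 1"
  shows "twisted_power s (of_nat CARD('p) ^ n * u) = chi_mod (padic_mod_p u) * p_exp (of_nat n * s)"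
proof -
  have "complex_of_real (real CARD('p) powi - int n) powr s = p_exp (of_nat n * s)"
  proof -
    have pos: "real CARD('p) powi - int n > 0" by simp
    have "ln (real CARD('p) powi - int n) = - (real n * ln (real CARD('p)))"
      by (simp add: power_int_minus ln_inverse ln_realpow)
    then show ?thesis using pos
      by (simp add: powr_def p_exp_def Ln_of_real algebra_simps del: of_real_power_int)
  qed
  then show ?thesis unfolding twisted_power_def
    using assms by (simp add: padic_p_times_unit chi_mod_of_unit)
qed

lemma norm_twisted_power_le:
  assumes "Re s > 0"
  shows "norm (twisted_power s y) \<le> 1"
proof (cases "y = 0")
  case False
  then obtain u where u: "y = of_nat CARD('p) ^ padic_ord y * u" "u dvd 1" by (rule padic_unit_factor)
  have "norm (p_exp (of_nat (padic_ord y) * s)) \<le> 1"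
    using assms card_gt_1[where ?'p='p] by (simp add: p_exp_def)
  then show ?thesis using u twisted_power_unit[of u s "padic_ord y"] norm_chi_le[of u]
    by (simp add: norm_mult chi_mod_of_unit mult_le_one)
qed simp

text \<open>A change by a multiple of \<open>p ^ N\<close>, with \<open>N\<close> beyond the order
  of \<open>y\<close>, keeps the order and alters the unit part by a multiple of \<open>p\<close>
  only, to which a character trivial on \<open>1 + p\<close> is blind.\<close>

lemma twisted_power_cong:
  assumes d: "of_nat CARD('p) ^ N dvd y - y'" and nd: "\<not> of_nat CARD('p) ^ N dvd y"
  shows "twisted_power s y = twisted_power s y'"
proof -
  have "y \<noteq> 0" using nd by auto
  then obtain u where u: "y = of_nat CARD('p) ^ padic_ord y * u" "u dvd 1" by (rule padic_unit_factor)
  define n where "n = padic_ord y"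
  have n: "n < N" using nd \<open>y \<noteq> 0\<close> unfolding n_def by (simp add: padic_dvd_ord)
  obtain w where w: "y - y' = of_nat CARD('p) ^ N * w" using d by (auto simp: dvd_def)
  have N: "N = n + Suc (N - n - 1)" using n by simp
  define u' where "u' = u - of_nat CARD('p) * (of_nat CARD('p) ^ (N - n - 1) * w)"
  have "y' = of_nat CARD('p) ^ n * u - of_nat CARD('p) ^ N * w"
    using w u(1) unfolding n_def by (simp add: algebra_simps)
  also have "\<dots> = of_nat CARD('p) ^ n * u'"
    unfolding u'_def by (subst (1) N) (simp add: power_add algebra_simps)
  finally have y': "y' = of_nat CARD('p) ^ n * u'" .
  have m: "padic_mod_p u' = padic_mod_p u"
    unfolding u'_def by simp
  then have "u' dvd 1" using u(2) by (simp add: padic_unit_iff_mod_p)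
  then show ?thesis using u y' m twisted_power_unit unfolding n_def by metis
qed

lemma twisted_power_unit_mult:
  assumes "c dvd 1"
  shows "twisted_power s (c * y) = chi c * twisted_power s y"
proof (cases "y = 0")
  case False
  then obtain u where u: "y = of_nat CARD('p) ^ padic_ord y * u" "u dvd 1" by (rule padic_unit_factor)
  have "twisted_power s (c * y) = twisted_power s (of_nat CARD('p) ^ padic_ord y * (c * u))"
    by (subst u(1)) (simp add: mult_ac)
  also have "\<dots> = chi_mod (padic_mod_p (c * u)) * p_exp (of_nat (padic_ord y) * s)"
    using assms u(2) by (intro twisted_power_unit) simp
  also have "\<dots> = chi c * twisted_power s y"
    using twisted_power_unit[OF u(2), of s "padic_ord y"] u(1) assms
    by (simp add: chi_mod_mult chi_mod_of_unit)
  finally show ?thesis .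
qed simp

end

subsection \<open>Weighted initial forms\<close>

text \<open>Weights are integral rather than natural vectors, since fibres are also followed
  downwards by subtracting from a coordinate.\<close>

definition wt :: "int ^ 'n::finite \<Rightarrow> nat ^ 'n \<Rightarrow> int" where
  "wt k \<omega> = (\<Sum>i\<in>UNIV. k $ i * int (\<omega> $ i))"

definition wmin :: "('n::finite, 'a::zero) mpoly \<Rightarrow> int ^ 'n \<Rightarrow> int" where
  "wmin f k = Min (wt k ` Poly_Mapping.keys f)"

text \<open>Faces are handled as finite sets of exponents; the character sums depend on these alone,
  and only finitely many such sets occur.\<close>

definition wface :: "('n::finite, 'a::zero) mpoly \<Rightarrow> int ^ 'n \<Rightarrow> (nat ^ 'n) set" where
  "wface f k = {\<omega> \<in> Poly_Mapping.keys f. wt k \<omega> = wmin f k}"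

definition face_value :: "('n::finite, 'p::prime_card padic_int) mpoly \<Rightarrow> (nat ^ 'n) set \<Rightarrow> ('n \<Rightarrow> 'p mod_ring) \<Rightarrow> 'p mod_ring" where
  "face_value f E a = (\<Sum>\<omega>\<in>E. padic_mod_p (Poly_Mapping.lookup f \<omega>) * (\<Prod>i\<in>UNIV. a i ^ (\<omega> $ i)))"

definition face_deriv :: "('n::finite, 'p::prime_card padic_int) mpoly \<Rightarrow> (nat ^ 'n) set \<Rightarrow> 'n \<Rightarrow> ('n \<Rightarrow> 'p mod_ring) \<Rightarrow> 'p mod_ring" where
  "face_deriv f E i a = (\<Sum>\<omega>\<in>E. padic_mod_p (Poly_Mapping.lookup f \<omega>) *
     (of_nat (\<omega> $ i) * a i ^ (\<omega> $ i - 1) * (\<Prod>j\<in>UNIV - {i}. a j ^ (\<omega> $ j))))"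

definition nondegenerate_face :: "('n::finite, 'p::prime_card padic_int) mpoly \<Rightarrow> (nat ^ 'n) set \<Rightarrow> bool" where
  "nondegenerate_face f E \<longleftrightarrow> (\<forall>a. (\<forall>i. a i \<noteq> 0) \<and> face_value f E a = 0 \<longrightarrow> (\<exists>i. face_deriv f E i a \<noteq> 0))"

lemma dvd_prod_diff:
  fixes d :: "'a::comm_ring_1"
  assumes "\<And>i. i \<in> A \<Longrightarrow> d dvd x i - y i"
  shows "d dvd prod x A - prod y A"
  using assms
proof (induction A rule: infinite_finite_induct)
  case (insert i A)
  have "prod x (insert i A) - prod y (insert i A) = x i * (prod x A - prod y A) + (x i - y i) * prod y A"
    using insert by (simp add: algebra_simps)
  then show ?case using insert by auto
qed auto

lemma dvd_power_diff:
  fixes d :: "'a::comm_ring_1"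
  assumes "d dvd x - y"
  shows "d dvd x ^ n - y ^ n"
  using dvd_prod_diff[of "{..<n}" d "\<lambda>_. x" "\<lambda>_. y"] assms by simp

lemma dvd_mpoly_eval_diff:
  fixes x y :: "'a::comm_ring_1 ^ 'n::finite"
  assumes "\<And>i. d dvd x $ i - y $ i"
  shows "d dvd mpoly_eval f x - mpoly_eval f y"
  unfolding mpoly_eval_def sum_subtractf[symmetric] right_diff_distrib[symmetric]
  by (intro dvd_sum dvd_mult dvd_prod_diff dvd_power_diff assms)

text \<open>This is f(p^k u) divided by p^(m k): taking out the least power of \<open>p\<close>
  leaves the exponents \<open>wt k \<omega> - wmin f k\<close>.\<close>

definition rescaled :: "('n::finite, 'p::prime_card padic_int) mpoly \<Rightarrow> int ^ 'n \<Rightarrow> ('n \<Rightarrow> 'p padic_int) \<Rightarrow> 'p padic_int" where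
  "rescaled f k u = (\<Sum>\<omega>\<in>Poly_Mapping.keys f. Poly_Mapping.lookup f \<omega> * 
     of_nat CARD('p) ^ nat (wt k \<omega> - wmin f k) * (\<Prod>i\<in>UNIV. u i ^ (\<omega> $ i)))"

lemma wmin_le: "\<omega> \<in> Poly_Mapping.keys f \<Longrightarrow> wmin f k \<le> wt k \<omega>"
  unfolding wmin_def by simp

lemma wface_nonempty: "f \<noteq> 0 \<Longrightarrow> wface f k \<noteq> {}"
proof -
  assume "f \<noteq> 0"
  then have "wmin f k \<in> wt k ` Poly_Mapping.keys f" unfolding wmin_def by (intro Min_in) auto
  then show ?thesis by (auto simp: wface_def)
qed

lemma finite_wface [simp]: "finite (wface f k)"
  unfolding wface_def by simp

lemma wmin_nonneg:
  fixes k :: "int ^ 'n::finite"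
  assumes "f \<noteq> 0" "\<And>i. 0 \<le> k $ i"
  shows "0 \<le> wmin f k"
  unfolding wmin_def using assms by (subst Min_ge_iff) (auto simp: wt_def intro!: sum_nonneg)

lemma mpoly_eval_rescaled:
  fixes f :: "('n::finite, 'p::prime_card padic_int) mpoly" and k :: "int ^ 'n" and x :: "'p padic_int ^ 'n"
  assumes f: "f \<noteq> 0" and k: "\<And>i. 0 \<le> k $ i" and x: "\<And>i. x $ i = of_nat CARD('p) ^ nat (k $ i) * u i"
  shows "mpoly_eval f x = of_nat CARD('p) ^ nat (wmin f k) * rescaled f k u"
proof -
  have "(\<Prod>i\<in>UNIV. (x $ i) ^ (\<omega> $ i)) =
      of_nat CARD('p) ^ nat (wmin f k) * (of_nat CARD('p) ^ nat (wt k \<omega> - wmin f k) * (\<Prod>i\<in>UNIV. u i ^ (\<omega> $ i)))"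
    if "\<omega> \<in> Poly_Mapping.keys f" for \<omega>
  proof -
    have "int (\<Sum>i\<in>UNIV. nat (k $ i) * \<omega> $ i) = wt k \<omega>"
      unfolding wt_def using k by simp
    then have "(\<Sum>i\<in>UNIV. nat (k $ i) * \<omega> $ i) = nat (wmin f k) + nat (wt k \<omega> - wmin f k)"
      using wmin_le[OF that, of k] wmin_nonneg[OF f k] by linarith
    moreover have "(\<Prod>i\<in>UNIV. (x $ i) ^ (\<omega> $ i))
        = of_nat CARD('p) ^ (\<Sum>i\<in>UNIV. nat (k $ i) * \<omega> $ i) * (\<Prod>i\<in>UNIV. u i ^ (\<omega> $ i))"
      by (simp add: x power_mult_distrib prod.distrib power_sum flip: power_mult)
    ultimately show ?thesis by (simp add: power_add mult.assoc)
  qed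
  then show ?thesis unfolding mpoly_eval_def rescaled_def
    by (simp add: sum_distrib_left mult_ac)
qed

text \<open>Exponents off the face carry a positive power of \<open>p\<close> and disappear in the
  reduction.\<close>

lemma padic_mod_p_rescaled:
  fixes f :: "('n::finite, 'p::prime_card padic_int) mpoly"
  shows "padic_mod_p (rescaled f k u) = face_value f (wface f k) (\<lambda>i. padic_mod_p (u i))"
proof -
  have "padic_mod_p (rescaled f k u) = (\<Sum>\<omega>\<in>Poly_Mapping.keys f. 
      if wt k \<omega> = wmin f k then padic_mod_p (Poly_Mapping.lookup f \<omega>) * (\<Prod>i\<in>UNIV. padic_mod_p (u i) ^ (\<omega> $ i)) else 0)"
    unfolding rescaled_def padic_mod_p_sum
  proof (rule sum.cong[OF refl], goal_cases)
    case (1 \<omega>)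
    then show ?case using wmin_le[OF 1, of k] by auto
  qed
  also have "\<dots> = face_value f (wface f k) (\<lambda>i. padic_mod_p (u i))"
    unfolding face_value_def wface_def by (subst sum.inter_filter[symmetric]) auto
  finally show ?thesis .
qed

text \<open>Factoring t' - t out of t'^n - t^n gives an exact difference quotient \<open>h\<close>,
  whose reduction is the partial derivative. Where the derivative is nonzero, \<open>h\<close> is a
  unit, and the dependence on \<open>t\<close> is injective modulo every power of
  \<open>p\<close>.\<close>

lemma rescaled_diff:
  fixes f :: "('n::finite, 'p::prime_card padic_int) mpoly"
  assumes "padic_mod_p t = a i" "padic_mod_p t' = a i" "\<And>j. j \<noteq> i \<Longrightarrow> padic_mod_p (u j) = a j"
  obtains h where "rescaled f k (u(i := t')) - rescaled f k (u(i := t)) = (t' - t) * h"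
    "padic_mod_p h = face_deriv f (wface f k) i a"
proof -
  define r where "r n = (\<Sum>l<n. t ^ (n - Suc l) * t' ^ l)" for n
  define h where "h = (\<Sum>\<omega>\<in>Poly_Mapping.keys f. Poly_Mapping.lookup f \<omega> * 
     of_nat CARD('p) ^ nat (wt k \<omega> - wmin f k) * (r (\<omega> $ i) * (\<Prod>j\<in>UNIV - {i}. u j ^ (\<omega> $ j))))"
  have pd: "t' ^ n - t ^ n = (t' - t) * r n" for n
    using diff_power_eq_sum[of t' "n - 1" t] unfolding r_def
    by (cases n) (simp_all add: lessThan_Suc_atMost power_diff_sumr2 mult.commute)
  have rm: "padic_mod_p (r n) = of_nat n * a i ^ (n - 1)" for n
  proof -
    have "padic_mod_p (r n) = (\<Sum>l<n. a i ^ (n - Suc l) * a i ^ l)"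
      unfolding r_def using assms by simp
    also have "\<dots> = (\<Sum>l<n. a i ^ (n - 1))"
      by (rule sum.cong) (auto simp flip: power_add)
    finally show ?thesis by simp
  qed
  have pr: "(\<Prod>j\<in>UNIV. (u(i := v)) j ^ (\<omega> $ j)) = v ^ (\<omega> $ i) * (\<Prod>j\<in>UNIV - {i}. u j ^ (\<omega> $ j))" for v \<omega>
    by (subst prod.remove[of _ i]) (auto intro!: prod.cong)
  have "rescaled f k (u(i := t')) - rescaled f k (u(i := t)) = (t' - t) * h"
    unfolding rescaled_def h_def pr sum_subtractf[symmetric] sum_distrib_left
  proof (rule sum.cong[OF refl], goal_cases)
    case (1 \<omega>)
    show ?case using pd[of "\<omega> $ i"] by (simp flip: right_diff_distrib left_diff_distrib add: mult_ac)
  qed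
  moreover have "padic_mod_p h = face_deriv f (wface f k) i a"
  proof -
    have "padic_mod_p h = (\<Sum>\<omega>\<in>Poly_Mapping.keys f. if wt k \<omega> = wmin f k then 
        padic_mod_p (Poly_Mapping.lookup f \<omega>) *
        (of_nat (\<omega> $ i) * a i ^ (\<omega> $ i - 1) * (\<Prod>j\<in>UNIV - {i}. a j ^ (\<omega> $ j))) else 0)"
      unfolding h_def padic_mod_p_sum
    proof (rule sum.cong[OF refl], goal_cases)
      case (1 \<omega>)
      have "(\<Prod>j\<in>UNIV - {i}. padic_mod_p (u j) ^ (\<omega> $ j)) = (\<Prod>j\<in>UNIV - {i}. a j ^ (\<omega> $ j))"
        using assms(3) by (intro prod.cong) auto
      then show ?case using wmin_le[OF 1, of k] by (auto simp: rm)
    qed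
    also have "\<dots> = face_deriv f (wface f k) i a"
      unfolding face_deriv_def wface_def by (subst sum.inter_filter[symmetric]) auto
    finally show ?thesis .
  qed
  ultimately show ?thesis by (rule that)
qed

subsection \<open>The zeta integral as a sum over lattice points\<close>

lemma measurable_finite_level:
  fixes F :: "'p::prime_card padic_int ^ 'n::finite \<Rightarrow> complex"
  assumes "\<And>x y. (\<And>i. padic_res (x $ i) N = padic_res (y $ i) N) \<Longrightarrow> F x = F y"
  shows "F \<in> borel_measurable padic_haar"
proof (rule measurableI)
  fix A :: "complex set"
  have "open (F -` A)"
  proof (subst open_subopen, intro ballI)
    fix x assume x: "x \<in> F -` A"
    show "\<exists>T. open T \<and> x \<in> T \<and> T \<subseteq> F -` A"
    proof (intro exI conjI)
      show "open (res_box (\<lambda>_. N) (\<lambda>i. padic_res (x $ i) N) :: ('p padic_int ^ 'n) set)"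
        by (rule open_res_box)
      show "x \<in> res_box (\<lambda>_. N) (\<lambda>i. padic_res (x $ i) N)" by (simp add: res_box_def)
      show "res_box (\<lambda>_. N) (\<lambda>i. padic_res (x $ i) N) \<subseteq> F -` A"
      proof
        fix y :: "'p padic_int ^ 'n" assume "y \<in> res_box (\<lambda>_. N) (\<lambda>i. padic_res (x $ i) N)"
        then have "F y = F x" by (intro assms) (simp add: res_box_def)
        then show "y \<in> F -` A" using x by simp
      qed
    qed
  qed
  then show "F -` A \<inter> space padic_haar \<in> sets padic_haar" by simp
qed simp

lemma sets_res_box [measurable]: "res_box n b \<in> sets padic_haar"
  by (simp add: open_res_box)

lemma set_integral_res_box_const:
  fixes b :: "'n::finite \<Rightarrow> int" and c :: complex
    and F :: "'p::prime_card padic_int ^ 'n \<Rightarrow> complex"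
  assumes b: "\<And>j. 0 \<le> b j" "\<And>j. b j < int CARD('p) ^ n j"
    and F: "\<And>x. x \<in> res_box n b \<Longrightarrow> F x = c"
  shows "(LINT x : res_box n b | padic_haar. F x) = of_real ((1 / real CARD('p)) ^ (\<Sum>j\<in>UNIV. n j)) * c"
proof -
  interpret prob_space "padic_haar :: ('p padic_int ^ 'n) measure" by (rule prob_space_padic_haar)
  have "(LINT x : res_box n b | padic_haar. F x) = (LINT x : (res_box n b :: ('p padic_int ^ 'n) set) | padic_haar. c)"
    by (intro set_lebesgue_integral_cong) (auto simp: open_res_box F)
  also have "\<dots> = measure (padic_haar :: ('p padic_int ^ 'n) measure) (res_box n b) *\<^sub>R c"
    unfolding set_lebesgue_integral_def
    by (subst integral_scaleR_left)
      (auto intro!: integrable_real_indicator simp: open_res_box emeasure_eq_measure)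
  finally show ?thesis using measure_padic_haar_res_box[of b n, where ?'p='p] b by (simp add: scaleR_conv_of_real)
qed

section \<open>Integrals over one residue class of a shell\<close>

context twisting_character
begin

text \<open>The integrand need not be locally constant at the zeros of the polynomial. Cutting off
  the values divisible by \<open>p ^ N\<close> leaves a function of residues modulo
  \<open>p ^ N\<close>, and the loss disappears as \<open>N\<close> grows.\<close>

definition truncated_power :: "complex \<Rightarrow> nat \<Rightarrow> 'p padic_int \<Rightarrow> complex" where
  "truncated_power s N y = (if of_nat CARD('p) ^ N dvd y then 0 else twisted_power s y)"

lemma truncated_power_cong:
  assumes d: "of_nat CARD('p) ^ N dvd y - y'"
  shows "truncated_power s N y = truncated_power s N y'"
proof -
  have "of_nat CARD('p) ^ N dvd y \<longleftrightarrow> of_nat CARD('p) ^ N dvd y'"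
    using d by (metis dvd_diff_commute dvd_diff_left_iff padic_dvd_iff_res padic_res_eq_iff_dvd)
  then show ?thesis using twisted_power_cong[OF d] unfolding truncated_power_def by auto
qed

lemma truncated_power_tendsto:
  "(\<lambda>N. truncated_power s (c + N) y) \<longlonglongrightarrow> twisted_power s y"
proof (cases "y = 0")
  case False
  have "eventually (\<lambda>N. truncated_power s (c + N) y = twisted_power s y) sequentially"
    using eventually_gt_at_top[of "padic_ord y"]
    by eventually_elim (use False in \<open>auto simp: truncated_power_def padic_dvd_ord\<close>)
  then show ?thesis by (rule tendsto_eventually)
qed (simp add: truncated_power_def)

lemma measurable_truncated_power:
  fixes f :: "('n::finite, 'p padic_int) mpoly"
  shows "(\<lambda>x. truncated_power s N (mpoly_eval f x)) \<in> borel_measurable padic_haar"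
proof (rule measurable_finite_level[where N = N])
  fix x y :: "'p padic_int ^ 'n"
  assume "\<And>i. padic_res (x $ i) N = padic_res (y $ i) N"
  then have "of_nat CARD('p) ^ N dvd mpoly_eval f x - mpoly_eval f y"
    by (intro dvd_mpoly_eval_diff) (simp flip: padic_res_eq_iff_dvd)
  then show "truncated_power s N (mpoly_eval f x) = truncated_power s N (mpoly_eval f y)"
    by (rule truncated_power_cong)
qed

lemma measurable_twisted_power:
  fixes f :: "('n::finite, 'p padic_int) mpoly"
  shows "(\<lambda>x. twisted_power s (mpoly_eval f x)) \<in> borel_measurable padic_haar"
  by (rule borel_measurable_LIMSEQ_metric[OF measurable_truncated_power truncated_power_tendsto[of _ 0]])

lemma norm_truncated_power_le: "Re s > 0 \<Longrightarrow> norm (truncated_power s N y) \<le> 1"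
  using norm_twisted_power_le by (simp add: truncated_power_def)

lemma set_integrable_truncated_power:
  fixes f :: "('n::finite, 'p padic_int) mpoly"
  assumes "Re s > 0" "A \<in> sets padic_haar"
  shows "set_integrable padic_haar A (\<lambda>x. truncated_power s N (mpoly_eval f x))"
proof -
  interpret prob_space "padic_haar :: ('p padic_int ^ 'n) measure" by (rule prob_space_padic_haar)
  have "integrable padic_haar (\<lambda>x. truncated_power s N (mpoly_eval f x))"
    using assms by (intro integrable_const_bound[of _ 1] AE_I2 norm_truncated_power_le measurable_truncated_power)
  then show ?thesis using assms(2) unfolding set_integrable_def by (intro integrable_mult_indicator)
qed

lemma set_integrable_twisted_power:
  fixes f :: "('n::finite, 'p padic_int) mpoly"
  assumes "Re s > 0" "A \<in> sets padic_haar"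
  shows "set_integrable padic_haar A (\<lambda>x. twisted_power s (mpoly_eval f x))"
proof -
  interpret prob_space "padic_haar :: ('p padic_int ^ 'n) measure" by (rule prob_space_padic_haar)
  have "integrable padic_haar (\<lambda>x. twisted_power s (mpoly_eval f x))"
    using assms by (intro integrable_const_bound[of _ 1] AE_I2 norm_twisted_power_le measurable_twisted_power)
  then show ?thesis using assms(2) unfolding set_integrable_def by (intro integrable_mult_indicator)
qed

text \<open>The points with coordinates \<open>p ^ k i * u i\<close> where \<open>u i\<close>
  reduces to \<open>a i\<close>, written as a box so that their measure is known.\<close>

definition shell :: "int ^ 'n::finite \<Rightarrow> ('n \<Rightarrow> 'p mod_ring) \<Rightarrow> ('p padic_int ^ 'n) set" where
  "shell k a = res_box (\<lambda>i. Suc (nat (k $ i))) (\<lambda>i. to_int_mod_ring (a i) * int CARD('p) ^ nat (k $ i))"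

lemma to_int_mod_ring_bounds: "0 \<le> to_int_mod_ring (a :: 'p mod_ring)" "to_int_mod_ring a < int CARD('p)"
  using range_to_int_mod_ring[where ?'a='p] by (auto simp: set_eq_iff image_iff)

lemma padic_res_1_eq: "padic_res u 1 = to_int_mod_ring (padic_mod_p u)" for u :: "'p padic_int"
  unfolding padic_mod_p_def of_int_of_int_mod_ring
  using padic_res_bounds[of u 1] by (simp add: to_int_mod_ring_of_int_mod_ring)

lemma shell_iff:
  "x \<in> shell k a \<longleftrightarrow> (\<exists>u. \<forall>i. x $ i = of_nat CARD('p) ^ nat (k $ i) * u i \<and> padic_mod_p (u i) = a i)"
proof -
  have "padic_res y (Suc n) = to_int_mod_ring b * int CARD('p) ^ n \<longleftrightarrow>
     (\<exists>v. y = of_nat CARD('p) ^ n * v \<and> padic_mod_p v = b)" for y :: "'p padic_int" and n b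
  proof
    assume *: "padic_res y (Suc n) = to_int_mod_ring b * int CARD('p) ^ n"
    then have "padic_res y n = 0" using padic_res_mod_le[of n "Suc n" y] by simp
    then obtain v where v: "y = of_nat CARD('p) ^ n * v" by (auto simp: dvd_def simp flip: padic_dvd_iff_res)
    have "padic_res y (1 + n) = int CARD('p) ^ n * padic_res v 1" unfolding v by (rule padic_res_p_mult)
    then have "padic_res v 1 = to_int_mod_ring b" using * by simp
    then have "padic_mod_p v = b" unfolding padic_res_1_eq using injD[OF to_int_mod_ring_hom.inj_f] by auto
    then show "\<exists>v. y = of_nat CARD('p) ^ n * v \<and> padic_mod_p v = b" using v by blast
  next
    assume "\<exists>v. y = of_nat CARD('p) ^ n * v \<and> padic_mod_p v = b"
    then obtain v where v: "y = of_nat CARD('p) ^ n * v" "padic_mod_p v = b" by blast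
    have "padic_res y (1 + n) = int CARD('p) ^ n * padic_res v 1" unfolding v by (rule padic_res_p_mult)
    then show "padic_res y (Suc n) = to_int_mod_ring b * int CARD('p) ^ n"
      unfolding padic_res_1_eq v(2) by (simp add: mult.commute)
  qed
  then have "x \<in> shell k a \<longleftrightarrow> (\<forall>i. \<exists>v. x $ i = of_nat CARD('p) ^ nat (k $ i) * v \<and> padic_mod_p v = a i)"
    unfolding shell_def res_box_def by simp
  then show ?thesis by (simp add: choice_iff)
qed

lemma shell_bounds:
  fixes k :: "int ^ 'n::finite"
  shows "0 \<le> to_int_mod_ring (a i :: 'p mod_ring) * int CARD('p) ^ nat (k $ i)"
    "to_int_mod_ring (a i :: 'p mod_ring) * int CARD('p) ^ nat (k $ i) < int CARD('p) ^ Suc (nat (k $ i))"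
  using to_int_mod_ring_bounds[of "a i"] by auto

lemma set_integral_shell_nonzero:
  fixes f :: "('n::finite, 'p padic_int) mpoly" and k :: "int ^ 'n"
  assumes f: "f \<noteq> 0" and k: "\<And>i. 0 \<le> k $ i" and nz: "face_value f (wface f k) a \<noteq> 0"
  shows "(LINT x : shell k a | padic_haar. twisted_power s (mpoly_eval f x)) =
     of_real ((1 / real CARD('p)) ^ (\<Sum>i\<in>UNIV. Suc (nat (k $ i)))) *
     (chi_mod (face_value f (wface f k) a) * p_exp (of_nat (nat (wmin f k)) * s))"
  unfolding shell_def
proof (rule set_integral_res_box_const[OF shell_bounds])
  fix x :: "'p padic_int ^ 'n" 
  assume "x \<in> res_box (\<lambda>i. Suc (nat (k $ i))) (\<lambda>i. to_int_mod_ring (a i) * int CARD('p) ^ nat (k $ i))"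
  then have "x \<in> shell k a" by (simp add: shell_def)
  then obtain u where u: "\<And>i. x $ i = of_nat CARD('p) ^ nat (k $ i) * u i" "\<And>i. padic_mod_p (u i) = a i"
    by (auto simp: shell_iff)
  have m: "padic_mod_p (rescaled f k u) = face_value f (wface f k) a"
    by (simp add: padic_mod_p_rescaled u(2))
  then have "rescaled f k u dvd 1" using nz by (simp add: padic_unit_iff_mod_p)
  then show "twisted_power s (mpoly_eval f x) = chi_mod (face_value f (wface f k) a) * p_exp (of_nat (nat (wmin f k)) * s)"
    using mpoly_eval_rescaled[OF f k u(1)] twisted_power_unit m by simp
qed

lemma dvd_unit_mult_iff: "c dvd 1 \<Longrightarrow> d dvd c * y \<longleftrightarrow> d dvd y" for c d y :: "'p padic_int"
proof -
  assume "c dvd 1"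
  then obtain w where w: "1 = c * w" by (auto simp: dvd_def)
  have "y = w * (c * y)" by (simp add: w[symmetric] mult.assoc[symmetric] mult.commute[of w c])
  then show ?thesis by (metis dvd_mult)
qed

text \<open>Multiplication by a unit on which the character is not 1 permutes the multiples of
  \<open>p\<close> modulo \<open>p ^ M\<close> and scales the sum, which therefore vanishes.\<close>

lemma sum_truncated_power_multiples:
  "(\<Sum>r | r \<in> {0..<int CARD('p) ^ M} \<and> int CARD('p) dvd r. 
      truncated_power s (m + M) (of_nat CARD('p) ^ m * of_int r)) = 0"
proof -
  let ?S = "{r. r \<in> {0..<int CARD('p) ^ M} \<and> int CARD('p) dvd r}"
  let ?F = "\<lambda>r::int. truncated_power s (m + M) (of_nat CARD('p) ^ m * of_int r :: 'p padic_int)"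
  obtain c where c: "c \<noteq> 0" "chi_mod c \<noteq> 1" by (rule chi_mod_nontrivial)
  define C where "C = to_int_mod_ring c"
  have Cm: "padic_mod_p (of_int C) = c" by (simp add: C_def)
  have Cu: "(of_int C :: 'p padic_int) dvd 1" using c by (simp add: padic_unit_iff_mod_p C_def)
  have cop: "coprime C (int CARD('p) ^ M)"
  proof -
    have "C \<noteq> 0" "0 \<le> C" "C < int CARD('p)" using c to_int_mod_ring_bounds[of c] unfolding C_def by auto
    then have "\<not> int CARD('p) dvd C" using zdvd_not_zless by fastforce
    then have "coprime (int CARD('p)) C" using prime_card_int[where ?'a='p] prime_imp_coprime_int by blast
    then show ?thesis by (simp add: coprime_commute)
  qed
  have fin: "finite ?S" by (rule finite_subset[of _ "{0..<int CARD('p) ^ M}"]) auto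
  have maps: "(\<lambda>r. (C * r) mod int CARD('p) ^ M) ` ?S \<subseteq> ?S"
  proof (cases "M = 0")
    case False
    then have "int CARD('p) dvd int CARD('p) ^ M" by simp
    then show ?thesis by (auto simp: dvd_mod)
  qed auto
  have inj: "inj_on (\<lambda>r. (C * r) mod int CARD('p) ^ M) ?S"
  proof (rule inj_onI, goal_cases)
    case (1 r r')
    then have "[C * r = C * r'] (mod int CARD('p) ^ M)" by (simp add: cong_def)
    then have "[r = r'] (mod int CARD('p) ^ M)" using cop by (simp add: cong_mult_lcancel)
    then show ?case using 1 by (simp add: cong_def)
  qed
  have bij: "bij_betw (\<lambda>r. (C * r) mod int CARD('p) ^ M) ?S ?S"
    using endo_inj_surj[OF fin maps inj] inj by (simp add: bij_betw_def)
  have F: "?F ((C * r) mod int CARD('p) ^ M) = chi_mod c * ?F r" for r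
  proof -
    \<comment> \<open>Reducing \<open>C * r\<close> modulo \<open>p ^ M\<close> changes the argument
      by a multiple of \<open>p ^ (m + M)\<close>, which the truncation does not notice.\<close>
    define d where "d = (C * r) div int CARD('p) ^ M"
    have "C * r = d * int CARD('p) ^ M + (C * r) mod int CARD('p) ^ M"
      unfolding d_def by (rule div_mult_mod_eq[symmetric])
    then have "(of_int (C * r) :: 'p padic_int) - of_int ((C * r) mod int CARD('p) ^ M) = of_int d * of_nat CARD('p) ^ M"
      by (metis add_diff_cancel_right' of_int_diff of_int_mult of_int_of_nat_eq of_int_power)
    then have "of_nat CARD('p) ^ m * (of_int (C * r) :: 'p padic_int) - of_nat CARD('p) ^ m * of_int ((C * r) mod int CARD('p) ^ M)
        = of_nat CARD('p) ^ (m + M) * of_int d"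
      unfolding right_diff_distrib[symmetric] by (simp add: power_add mult_ac)
    then have "?F ((C * r) mod int CARD('p) ^ M) = ?F (C * r)"
      by (intro truncated_power_cong[symmetric]) simp
    also have "\<dots> = truncated_power s (m + M) (of_int C * (of_nat CARD('p) ^ m * of_int r))"
      by (simp add: mult_ac)
    also have "\<dots> = chi_mod c * ?F r"
      using dvd_unit_mult_iff[OF Cu] twisted_power_unit_mult[OF Cu] chi_mod_of_unit[OF Cu] Cm
      unfolding truncated_power_def by auto
    finally show ?thesis .
  qed
  have "(\<Sum>r\<in>?S. ?F r) = (\<Sum>r\<in>?S. ?F ((C * r) mod int CARD('p) ^ M))"
    by (rule sum.reindex_bij_betw[OF bij, symmetric])
  also have "\<dots> = chi_mod c * (\<Sum>r\<in>?S. ?F r)" unfolding F by (simp add: sum_distrib_left)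
  finally show ?thesis using c by (simp add: algebra_simps)
qed

text \<open>Where the reduced face polynomial has a simple zero, \<open>f\<close> is up to scaling a coordinate.\<close>

lemma sum_truncated_power_fibre:
  fixes f :: "('n::finite, 'p padic_int) mpoly" and k :: "int ^ 'n" and u :: "'n \<Rightarrow> int"
  assumes zero: "face_value f (wface f k) a = 0" and deriv: "face_deriv f (wface f k) i a \<noteq> 0"
    and u: "\<And>j. of_int (u j) = a j" and M: "M > 0"
  shows "(\<Sum>t | t \<in> {0..<int CARD('p) ^ M} \<and> of_int t = a i. 
      truncated_power s (m + M) (of_nat CARD('p) ^ m * rescaled f k (\<lambda>j. of_int ((u(i := t)) j)))) = 0"
proof -
  let ?R = "{t. t \<in> {0..<int CARD('p) ^ M} \<and> of_int t = a i}"
  let ?S = "{r. r \<in> {0..<int CARD('p) ^ M} \<and> int CARD('p) dvd r}"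
  define U where "U = (\<lambda>j. of_int (u j) :: 'p padic_int)"
  define g where "g t = rescaled f k (U(i := of_int t))" for t :: int
  have upd: "(\<lambda>j. of_int ((u(i := t)) j)) = U(i := of_int t)" for t by (auto simp: U_def)
  have Um: "padic_mod_p (U j) = a j" for j using u by (simp add: U_def)
  have g0: "padic_mod_p (g t) = 0" if "of_int t = a i" for t
  proof -
    have "(\<lambda>j. padic_mod_p ((U(i := of_int t)) j)) = a" using Um that by auto
    then show ?thesis unfolding g_def padic_mod_p_rescaled using zero by simp
  qed
  have finR: "finite ?R" by (rule finite_subset[of _ "{0..<int CARD('p) ^ M}"]) auto
  have finS: "finite ?S" by (rule finite_subset[of _ "{0..<int CARD('p) ^ M}"]) auto
  have maps: "(\<lambda>t. padic_res (g t) M) ` ?R \<subseteq> ?S"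
  proof (intro subsetI, elim imageE)
    fix r t assume t: "t \<in> ?R" and r: "r = padic_res (g t) M"
    have "padic_res (g t) 1 = 0" using g0[of t] t by (simp add: padic_mod_p_eq_0_iff padic_p_dvd_iff)
    then have "padic_res (g t) M mod int CARD('p) = 0"
      using padic_res_mod_le[of 1 M "g t"] M by simp
    then show "r \<in> ?S" using r padic_res_bounds[of "g t" M] by auto
  qed
  \<comment> \<open>The difference quotient is a unit here, so congruent values of \<open>g\<close>
    come from congruent arguments.\<close>
  have inj: "inj_on (\<lambda>t. padic_res (g t) M) ?R"
  proof (rule inj_onI)
    fix t t' assume t: "t \<in> ?R" "t' \<in> ?R" and eq: "padic_res (g t) M = padic_res (g t') M"
    obtain h where h: "g t' - g t = (of_int t' - of_int t) * h" "padic_mod_p h = face_deriv f (wface f k) i a"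
      unfolding g_def using rescaled_diff[of "of_int t" a i "of_int t'" U f k] t Um by auto
    have hu: "h dvd 1" using h(2) deriv by (simp add: padic_unit_iff_mod_p)
    have "of_nat CARD('p) ^ M dvd g t' - g t" using eq by (simp flip: padic_res_eq_iff_dvd)
    then have "of_nat CARD('p) ^ M dvd (of_int t' - of_int t :: 'p padic_int)"
      unfolding h(1) using dvd_unit_mult_iff[OF hu] by (simp add: mult.commute)
    then have "padic_res (of_int t' :: 'p padic_int) M = padic_res (of_int t :: 'p padic_int) M"
      by (simp flip: padic_res_eq_iff_dvd)
    then show "t = t'" using t by (simp add: padic_res_of_int)
  qed
  \<comment> \<open>Translation by a lift of \<open>a i\<close> matches the two residue classes.
    With equal cardinalities the injection hits every multiple of \<open>p\<close>.\<close>
  have card: "card ?R = card ?S"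
  proof -
    define A where "A = to_int_mod_ring (a i)"
    have Ai: "of_int A = a i" by (simp add: A_def)
    have pd: "int CARD('p) dvd int CARD('p) ^ M" using M by simp
    have z: "(of_int x :: 'p mod_ring) = 0 \<longleftrightarrow> int CARD('p) dvd x" for x
      using padic_mod_p_eq_0_iff[of "of_int x :: 'p padic_int"] padic_p_dvd_iff[of "of_int x :: 'p padic_int"]
      by (simp add: padic_res_of_int dvd_eq_mod_eq_0)
    have mm: "(of_int (x mod int CARD('p) ^ M) :: 'p mod_ring) = of_int x" for x
      by (metis of_int_mod_card mod_mod_cancel[OF pd])
    have "bij_betw (\<lambda>t. (t - A) mod int CARD('p) ^ M) ?R ?S"
    proof (rule bij_betw_byWitness[where f' = "\<lambda>r. (r + A) mod int CARD('p) ^ M"])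
      show "(\<lambda>t. (t - A) mod int CARD('p) ^ M) ` ?R \<subseteq> ?S"
      proof (intro subsetI, elim imageE)
        fix r t assume t: "t \<in> ?R" "r = (t - A) mod int CARD('p) ^ M"
        have "(of_int r :: 'p mod_ring) = 0" using t Ai by (simp add: mm)
        then show "r \<in> ?S" using t z by auto
      qed
      show "(\<lambda>r. (r + A) mod int CARD('p) ^ M) ` ?S \<subseteq> ?R"
      proof (intro subsetI, elim imageE)
        fix r t assume t: "t \<in> ?S" "r = (t + A) mod int CARD('p) ^ M"
        have "(of_int t :: 'p mod_ring) = 0" using t z by simp
        then have "(of_int r :: 'p mod_ring) = a i" using t Ai by (simp add: mm)
        then show "r \<in> ?R" using t by auto
      qed
    qed (auto simp: mod_simps)
    then show ?thesis by (rule bij_betw_same_card)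
  qed
  have bij: "bij_betw (\<lambda>t. padic_res (g t) M) ?R ?S"
    unfolding bij_betw_def
    using inj card_subset_eq[OF finS maps] card card_image[OF inj] by simp
  have F: "truncated_power s (m + M) (of_nat CARD('p) ^ m * g t)
      = truncated_power s (m + M) (of_nat CARD('p) ^ m * of_int (padic_res (g t) M))" for t
  proof (rule truncated_power_cong)
    have "padic_res (g t) M = padic_res (of_int (padic_res (g t) M) :: 'p padic_int) M"
      by (simp add: padic_res_of_int padic_res_mod_le)
    then have "of_nat CARD('p) ^ M dvd g t - of_int (padic_res (g t) M)" by (simp only: padic_res_eq_iff_dvd)
    then show "of_nat CARD('p) ^ (m + M) dvd of_nat CARD('p) ^ m * g t - of_nat CARD('p) ^ m * of_int (padic_res (g t) M)"
      by (simp add: power_add mult_dvd_mono flip: right_diff_distrib)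
  qed
  have "(\<Sum>t\<in>?R. truncated_power s (m + M) (of_nat CARD('p) ^ m * g t))
      = (\<Sum>t\<in>?R. truncated_power s (m + M) (of_nat CARD('p) ^ m * of_int (padic_res (g t) M)))"
    by (rule sum.cong[OF refl]) (rule F)
  also have "\<dots> = (\<Sum>r\<in>?S. truncated_power s (m + M) (of_nat CARD('p) ^ m * of_int r))"
    by (rule sum.reindex_bij_betw[OF bij])
  also have "\<dots> = 0" by (rule sum_truncated_power_multiples)
  finally show ?thesis unfolding upd g_def .
qed

end

lemma dvd_rescaled_diff:
  fixes d :: "'p::prime_card padic_int"
  assumes "\<And>i. d dvd u i - v i"
  shows "d dvd rescaled f k u - rescaled f k v"
  unfolding rescaled_def sum_subtractf[symmetric] right_diff_distrib[symmetric]
  by (intro dvd_sum dvd_mult dvd_prod_diff dvd_power_diff assms)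

lemma countable_int_vec: "countable (UNIV :: (int ^ 'n::finite) set)"
proof -
  have "countable (PiE (UNIV :: 'n set) (\<lambda>_. UNIV :: int set))" by (intro countable_PiE) auto
  then have "countable (vec_lambda ` (UNIV :: ('n \<Rightarrow> int) set))" by simp
  moreover have "vec_lambda ` (UNIV :: ('n \<Rightarrow> int) set) = UNIV"
    by (auto simp: image_iff) (metis vec_lambda_eta)
  ultimately show ?thesis by simp
qed

definition pos_points :: "(int ^ 'n::finite) set" where
  "pos_points = {k. \<forall>i. 1 \<le> k $ i}"

lemma bij_pos_points: "bij_betw (from_nat_into (pos_points :: (int ^ 'n::finite) set)) UNIV pos_points"
proof (rule bij_betw_from_nat_into)
  show "countable (pos_points :: (int ^ 'n) set)"
    using countable_int_vec by (rule countable_subset[rotated]) simp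
  have "inj (\<lambda>n::nat. (\<chi> i. int n + 1) :: int ^ 'n)" by (auto simp: inj_def vec_eq_iff)
  then have "infinite (range (\<lambda>n::nat. (\<chi> i. int n + 1) :: int ^ 'n))" by (simp add: finite_image_iff)
  moreover have "range (\<lambda>n::nat. (\<chi> i. int n + 1) :: int ^ 'n) \<subseteq> pos_points"
    by (auto simp: pos_points_def)
  ultimately show "infinite (pos_points :: (int ^ 'n) set)" using finite_subset by blast
qed

lemma null_coordinate_plane:
  "{x :: 'p::prime_card padic_int ^ 'n::finite. x $ i = 0} \<in> null_sets padic_haar"
proof -
  interpret prob_space "padic_haar :: ('p padic_int ^ 'n) measure" by (rule prob_space_padic_haar)
  let ?n = "\<lambda>N j. if j = i then N else 0"
  have eq: "{x :: 'p padic_int ^ 'n. x $ i = 0} = (\<Inter>N. res_box (?n N) (\<lambda>_. 0))"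
    by (auto simp: res_box_def intro!: padic_eqI[of _ 0])
  have sets: "{x :: 'p padic_int ^ 'n. x $ i = 0} \<in> sets padic_haar"
    unfolding eq by (intro sets.countable_INT) (auto simp: open_res_box)
  have "prob {x :: 'p padic_int ^ 'n. x $ i = 0} \<le> (1 / real CARD('p)) ^ N" for N
  proof -
    have "prob {x :: 'p padic_int ^ 'n. x $ i = 0} \<le> prob (res_box (?n N) (\<lambda>_. 0))"
      using eq by (intro finite_measure_mono) (auto simp: open_res_box)
    also have "\<dots> = (1 / real CARD('p)) ^ (\<Sum>j\<in>UNIV. ?n N j)"
      by (rule measure_padic_haar_res_box) auto
    also have "(\<Sum>j\<in>UNIV. ?n N j) = N" by simp
    finally show ?thesis .
  qed
  moreover have "(\<lambda>N. (1 / real CARD('p)) ^ N) \<longlonglongrightarrow> 0"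
    using card_gt_1[where ?'p='p] by (intro LIMSEQ_realpow_zero) auto
  ultimately have "prob {x :: 'p padic_int ^ 'n. x $ i = 0} \<le> 0"
    by (intro LIMSEQ_le_const) auto
  then have "prob {x :: 'p padic_int ^ 'n. x $ i = 0} = 0" using measure_nonneg by (metis order_antisym)
  then show ?thesis using sets by (simp add: null_sets_def emeasure_eq_measure)
qed

context twisting_character
begin

text \<open>On boxes of precision \<open>M\<close> in \<open>u\<close> the truncated integrand is
  constant. Summing first over the coordinate with nonzero derivative lets the value run through all
  multiples of \<open>p\<close>, where the sum is 0.\<close>

lemma set_integral_truncated_shell_zero:
  fixes f :: "('n::finite, 'p padic_int) mpoly" and k :: "int ^ 'n"
  assumes f: "f \<noteq> 0" and k: "\<And>i. 0 \<le> k $ i" and s: "Re s > 0" and M: "M > 0"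
    and zero: "face_value f (wface f k) a = 0" and deriv: "face_deriv f (wface f k) i a \<noteq> 0"
  shows "(LINT x : shell k a | padic_haar. truncated_power s (nat (wmin f k) + M) (mpoly_eval f x)) = 0"
proof -
  let ?m = "nat (wmin f k)"
  define R where "R j = {t. t \<in> {0..<int CARD('p) ^ M} \<and> of_int t = a j}" for j
  define U where "U = {u. \<forall>j. u j \<in> R j}"
  define lev where "lev = (\<lambda>j. M + nat (k $ j))"
  define box where "box u = (res_box lev (\<lambda>j. int CARD('p) ^ nat (k $ j) * u j) :: ('p padic_int ^ 'n) set)" for u
  define T where "T u = truncated_power s (?m + M) (of_nat CARD('p) ^ ?m * rescaled f k (\<lambda>j. of_int (u j)))" for u :: "'n \<Rightarrow> int"
  have finR: "finite (R j)" for j unfolding R_def by (rule finite_subset[of _ "{0..<int CARD('p) ^ M}"]) auto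
  have U_PiE: "U = PiE UNIV R" unfolding U_def by auto
  have finU: "finite U" unfolding U_PiE using finR by (intro finite_PiE) auto
  have box_iff: "x \<in> box u \<longleftrightarrow> (\<exists>v. \<forall>j. x $ j = of_nat CARD('p) ^ nat (k $ j) * v j \<and> padic_res (v j) M = u j)"
    for x u
  proof -
    have "padic_res y (M + n) = int CARD('p) ^ n * c \<longleftrightarrow>
        (\<exists>v. y = of_nat CARD('p) ^ n * v \<and> padic_res v M = c)" for y :: "'p padic_int" and n c
    proof
      assume *: "padic_res y (M + n) = int CARD('p) ^ n * c"
      then have "padic_res y n = 0" using padic_res_mod_le[of n "M + n" y] by simp
      then obtain v where v: "y = of_nat CARD('p) ^ n * v" by (auto simp: dvd_def simp flip: padic_dvd_iff_res)
      then show "\<exists>v. y = of_nat CARD('p) ^ n * v \<and> padic_res v M = c"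
        using * padic_res_p_mult[of n v M] by auto
    qed (auto simp: padic_res_p_mult)
    then have "x \<in> box u \<longleftrightarrow> (\<forall>j. \<exists>v. x $ j = of_nat CARD('p) ^ nat (k $ j) * v \<and> padic_res v M = u j)"
      unfolding box_def res_box_def lev_def by simp
    then show ?thesis by (simp add: choice_iff)
  qed
  have mod_eq: "of_int (padic_res v M) = padic_mod_p v" for v :: "'p padic_int"
    using padic_res_mod_le[of 1 M v] M unfolding padic_mod_p_def by (metis of_int_mod_card power_one_right Suc_leI One_nat_def)
  have shell_eq: "shell k a = (\<Union>u\<in>U. box u)"
  proof (intro equalityI subsetI)
    fix x assume "x \<in> shell k a"
    then obtain v where v: "\<And>i. x $ i = of_nat CARD('p) ^ nat (k $ i) * v i" "\<And>i. padic_mod_p (v i) = a i"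
      by (auto simp: shell_iff)
    have "(\<lambda>j. padic_res (v j) M) \<in> U"
      unfolding U_def R_def using v(2) by (auto simp: padic_res_bounds mod_eq)
    moreover have "x \<in> box (\<lambda>j. padic_res (v j) M)" using v(1) by (auto simp: box_iff)
    ultimately show "x \<in> (\<Union>u\<in>U. box u)" by blast
  next
    fix x assume "x \<in> (\<Union>u\<in>U. box u)"
    then obtain u v where "u \<in> U" "\<And>j. x $ j = of_nat CARD('p) ^ nat (k $ j) * v j" "\<And>j. padic_res (v j) M = u j"
      by (auto simp: box_iff)
    then show "x \<in> shell k a"
      unfolding shell_iff U_def R_def by (intro exI[of _ v]) (auto simp flip: mod_eq)
  qed
  have const: "truncated_power s (?m + M) (mpoly_eval f x) = T u" if x: "x \<in> box u" for x u
  proof -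
    obtain v where v: "\<And>j. x $ j = of_nat CARD('p) ^ nat (k $ j) * v j" "\<And>j. padic_res (v j) M = u j"
      using x by (auto simp: box_iff)
    have "of_nat CARD('p) ^ M dvd v j - of_int (u j)" for j
    proof -
      have "padic_res (v j) M = padic_res (of_int (u j) :: 'p padic_int) M"
        unfolding v(2)[symmetric] by (simp add: padic_res_of_int padic_res_mod_le)
      then show ?thesis by (simp only: padic_res_eq_iff_dvd)
    qed
    then have "of_nat CARD('p) ^ M dvd rescaled f k v - rescaled f k (\<lambda>j. of_int (u j))"
      by (rule dvd_rescaled_diff)
    then have "of_nat CARD('p) ^ (?m + M) dvd of_nat CARD('p) ^ ?m * rescaled f k v
        - of_nat CARD('p) ^ ?m * rescaled f k (\<lambda>j. of_int (u j))"
      unfolding right_diff_distrib[symmetric] power_add by (rule mult_dvd_mono[OF dvd_refl])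
    then show ?thesis unfolding T_def mpoly_eval_rescaled[OF f k v(1)] by (rule truncated_power_cong)
  qed
  have disj: "disjoint_family_on box U"
    unfolding disjoint_family_on_def box_def res_box_def by auto
  have "(LINT x : shell k a | padic_haar. truncated_power s (?m + M) (mpoly_eval f x)) =
      (\<Sum>u\<in>U. LINT x : box u | padic_haar. truncated_power s (?m + M) (mpoly_eval f x))"
    unfolding shell_eq using finU disj
    by (rule set_integral_finite_Union) (auto intro!: set_integrable_truncated_power s simp: box_def open_res_box)
  also have "\<dots> = (\<Sum>u\<in>U. of_real ((1 / real CARD('p)) ^ (\<Sum>j\<in>UNIV. lev j)) * T u)"
  proof (rule sum.cong[OF refl])
    fix u assume u: "u \<in> U"
    have b: "0 \<le> int CARD('p) ^ nat (k $ j) * u j" "int CARD('p) ^ nat (k $ j) * u j < int CARD('p) ^ lev j" for j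
    proof -
      have "u j \<in> R j" using u unfolding U_def by blast
      then have "0 \<le> u j" "u j < int CARD('p) ^ M" unfolding R_def by auto
      then show "0 \<le> int CARD('p) ^ nat (k $ j) * u j" "int CARD('p) ^ nat (k $ j) * u j < int CARD('p) ^ lev j"
        unfolding lev_def by (auto simp: power_add mult.commute)
    qed
    show "(LINT x : box u | padic_haar. truncated_power s (?m + M) (mpoly_eval f x)) =
        of_real ((1 / real CARD('p)) ^ (\<Sum>j\<in>UNIV. lev j)) * T u"
      unfolding box_def
      by (rule set_integral_res_box_const[OF b const]) (simp add: box_def)
  qed
  also have "(\<Sum>u\<in>U. of_real ((1 / real CARD('p)) ^ (\<Sum>j\<in>UNIV. lev j)) * T u)
      = of_real ((1 / real CARD('p)) ^ (\<Sum>j\<in>UNIV. lev j)) * (\<Sum>u\<in>U. T u)"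
    by (simp add: sum_distrib_left)
  also have "(\<Sum>u\<in>U. T u) = 0"
  proof -
    have "of_nat (card (R i)) * (\<Sum>u | \<forall>j. u j \<in> R j. T u) = (\<Sum>u | \<forall>j. u j \<in> R j. \<Sum>t\<in>R i. T (u(i := t)))"
      using finR by (rule sum_resample[symmetric])
    also have "\<dots> = 0"
    proof (rule sum.neutral, safe)
      fix u assume "\<forall>j. u j \<in> R j"
      then have "of_int (u j) = a j" for j unfolding R_def by blast
      then show "(\<Sum>t\<in>R i. T (u(i := t))) = 0"
        unfolding T_def R_def by (rule sum_truncated_power_fibre[OF zero deriv _ M])
    qed
    finally have *: "of_nat (card (R i)) * (\<Sum>u\<in>U. T u) = 0" unfolding U_def .
    \<comment> \<open>The lift of \<open>a i\<close> shows that \<open>R i\<close> is not empty, so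
      that its cardinality can be cancelled.\<close>
    have "int CARD('p) ^ 1 \<le> int CARD('p) ^ M"
      using M card_gt_1[where ?'p='p] by (intro power_increasing) auto
    then have "to_int_mod_ring (a i) < int CARD('p) ^ M"
      using to_int_mod_ring_bounds(2)[of "a i"] by (metis less_le_trans power_one_right)
    then have "to_int_mod_ring (a i) \<in> R i"
      unfolding R_def using to_int_mod_ring_bounds(1)[of "a i"] by simp
    then have "card (R i) \<noteq> 0" using finR[of i] by auto
    then show ?thesis using * by simp
  qed
  finally show ?thesis by simp
qed

lemma sets_shell: "shell k a \<in> sets padic_haar"
  unfolding shell_def by (rule sets_res_box)

text \<open>Dominated convergence with the constant bound 1 removes the truncation.\<close>

lemma set_integral_shell_zero:
  fixes f :: "('n::finite, 'p padic_int) mpoly" and k :: "int ^ 'n"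
  assumes f: "f \<noteq> 0" and k: "\<And>i. 0 \<le> k $ i" and s: "Re s > 0"
    and zero: "face_value f (wface f k) a = 0" and deriv: "face_deriv f (wface f k) i a \<noteq> 0"
  shows "(LINT x : shell k a | padic_haar. twisted_power s (mpoly_eval f x)) = 0"
proof -
  interpret prob_space "padic_haar :: ('p padic_int ^ 'n) measure" by (rule prob_space_padic_haar)
  let ?m = "nat (wmin f k)"
  have lim: "(\<lambda>M. LINT x : shell k a | padic_haar. truncated_power s (?m + M) (mpoly_eval f x))
      \<longlonglongrightarrow> (LINT x : shell k a | padic_haar. twisted_power s (mpoly_eval f x))"
    unfolding set_lebesgue_integral_def
  proof (rule integral_dominated_convergence[where w = "\<lambda>_. 1"])
    show "AE x in padic_haar. norm (indicat_real (shell k a) x *\<^sub>R truncated_power s (?m + M) (mpoly_eval f x)) \<le> 1" for M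
      using norm_truncated_power_le[OF s] by (intro AE_I2) (auto simp: indicator_def)
    show "AE x in padic_haar. (\<lambda>M. indicat_real (shell k a) x *\<^sub>R truncated_power s (?m + M) (mpoly_eval f x))
        \<longlonglongrightarrow> indicat_real (shell k a) x *\<^sub>R twisted_power s (mpoly_eval f x)"
      by (intro AE_I2 tendsto_intros truncated_power_tendsto)
    show "(\<lambda>x. indicat_real (shell k a) x *\<^sub>R twisted_power s (mpoly_eval f x)) \<in> borel_measurable padic_haar"
      using sets_shell by (intro borel_measurable_scaleR measurable_twisted_power borel_measurable_indicator)
    show "(\<lambda>x. indicat_real (shell k a) x *\<^sub>R truncated_power s (?m + M) (mpoly_eval f x)) \<in> borel_measurable padic_haar" for M
      using sets_shell by (intro borel_measurable_scaleR measurable_truncated_power borel_measurable_indicator)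
  qed simp
  have ev: "eventually (\<lambda>M. (LINT x : shell k a | padic_haar. truncated_power s (?m + M) (mpoly_eval f x)) = 0) sequentially"
    using eventually_gt_at_top[of 0]
    by eventually_elim (rule set_integral_truncated_shell_zero[OF f k s _ zero deriv])
  show ?thesis using LIMSEQ_unique[OF lim tendsto_eventually[OF ev]] .
qed

text \<open>The factor p^(-n) is the relative measure of one residue class in the scaled lattice of
  a shell; it is put here so that the remaining factor is a pure power of \<open>p\<close>.\<close>

definition face_sum :: "('n::finite, 'p padic_int) mpoly \<Rightarrow> (nat ^ 'n) set \<Rightarrow> complex" where
  "face_sum f E = of_real ((1 / real CARD('p)) ^ CARD('n)) * (\<Sum>a | \<forall>i. a i \<noteq> 0. chi_mod (face_value f E a))"

definition full_shell :: "int ^ 'n::finite \<Rightarrow> ('p padic_int ^ 'n) set" where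
  "full_shell k = (\<Union>a\<in>{a. \<forall>i. a i \<noteq> 0}. shell k a)"

lemma finite_torus: "finite {a :: 'n::finite \<Rightarrow> 'p mod_ring. \<forall>i. a i \<noteq> 0}"
  by (rule finite_subset[OF subset_UNIV]) simp

text \<open>Nondegeneracy sorts the residue classes: where the face polynomial is nonzero the
  integrand is constant, and elsewhere some derivative is nonzero and the integral vanishes.\<close>

lemma set_integral_full_shell:
  fixes f :: "('n::finite, 'p padic_int) mpoly" and k :: "int ^ 'n"
  assumes f: "f \<noteq> 0" and k: "\<And>i. 0 \<le> k $ i" and s: "Re s > 0"
    and nd: "nondegenerate_face f (wface f k)"
  shows "(LINT x : full_shell k | padic_haar. twisted_power s (mpoly_eval f x)) =
     face_sum f (wface f k) * p_exp (of_int (\<Sum>i\<in>UNIV. k $ i) + of_int (wmin f k) * s)"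
proof -
  let ?A = "{a :: 'n \<Rightarrow> 'p mod_ring. \<forall>i. a i \<noteq> 0}"
  have "a = b" if "x \<in> shell k a" "x \<in> shell k b" for x :: "'p padic_int ^ 'n" and a b
  proof
    fix i
    from that obtain u v where "x $ i = of_nat CARD('p) ^ nat (k $ i) * u i" "padic_mod_p (u i) = a i"
        "x $ i = of_nat CARD('p) ^ nat (k $ i) * v i" "padic_mod_p (v i) = b i"
      unfolding shell_iff by blast
    then show "a i = b i" by (metis padic_p_mult_cancel)
  qed
  then have disj: "disjoint_family_on (shell k :: _ \<Rightarrow> ('p padic_int ^ 'n) set) ?A"
    unfolding disjoint_family_on_def by blast
  have sumK: "(\<Sum>i\<in>UNIV. Suc (nat (k $ i))) = CARD('n) + nat (\<Sum>i\<in>UNIV. k $ i)"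
  proof -
    have "int (\<Sum>i\<in>UNIV. nat (k $ i)) = (\<Sum>i\<in>UNIV. k $ i)" using k by simp
    then have "(\<Sum>i\<in>UNIV. nat (k $ i)) = nat (\<Sum>i\<in>UNIV. k $ i)" by linarith
    then show ?thesis by (simp only: Suc_eq_plus1 sum.distrib) simp
  qed
  have pe: "p_exp (of_int (\<Sum>i\<in>UNIV. k $ i) + of_int (wmin f k) * s)
      = of_real ((1 / real CARD('p)) ^ nat (\<Sum>i\<in>UNIV. k $ i)) * p_exp (of_nat (nat (wmin f k)) * s)"
  proof -
    have "complex_of_int (\<Sum>i\<in>UNIV. k $ i) = of_nat (nat (\<Sum>i\<in>UNIV. k $ i))"
      using k by (simp add: sum_nonneg)
    moreover have "complex_of_int (wmin f k) = of_nat (nat (wmin f k))"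
      using wmin_nonneg[OF f k] by simp
    ultimately show ?thesis by (simp only: p_exp_add p_exp_of_nat)
  qed
  have "(LINT x : full_shell k | padic_haar. twisted_power s (mpoly_eval f x)) =
     (\<Sum>a\<in>?A. LINT x : shell k a | padic_haar. twisted_power s (mpoly_eval f x))"
    unfolding full_shell_def using finite_torus disj
    by (rule set_integral_finite_Union) (auto intro!: set_integrable_twisted_power s sets_shell[unfolded sets_padic_haar] simp: sets_shell)
  also have "\<dots> = (\<Sum>a\<in>?A. of_real ((1 / real CARD('p)) ^ (\<Sum>i\<in>UNIV. Suc (nat (k $ i)))) *
     (chi_mod (face_value f (wface f k) a) * p_exp (of_nat (nat (wmin f k)) * s)))"
  proof (rule sum.cong[OF refl])
    fix a :: "'n \<Rightarrow> 'p mod_ring" assume a: "a \<in> ?A"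
    show "(LINT x : shell k a | padic_haar. twisted_power s (mpoly_eval f x)) =
       of_real ((1 / real CARD('p)) ^ (\<Sum>i\<in>UNIV. Suc (nat (k $ i)))) *
     (chi_mod (face_value f (wface f k) a) * p_exp (of_nat (nat (wmin f k)) * s))"
    proof (cases "face_value f (wface f k) a = 0")
      case True
      then obtain i where "face_deriv f (wface f k) i a \<noteq> 0" using nd a unfolding nondegenerate_face_def by blast
      then show ?thesis using True set_integral_shell_zero[OF f k s True] by simp
    qed (rule set_integral_shell_nonzero[OF f k])
  qed
  also have "\<dots> = face_sum f (wface f k) * p_exp (of_int (\<Sum>i\<in>UNIV. k $ i) + of_int (wmin f k) * s)"
    unfolding face_sum_def pe sumK by (simp add: sum_distrib_left sum_distrib_right power_add mult_ac)
  finally show ?thesis .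
qed

lemma full_shell_iff:
  fixes x :: "'p padic_int ^ 'n::finite" and k :: "int ^ 'n"
  assumes k: "\<And>i. 0 \<le> k $ i"
  shows "x \<in> full_shell k \<longleftrightarrow> (\<forall>i. x $ i \<noteq> 0 \<and> int (padic_ord (x $ i)) = k $ i)"
proof
  assume "x \<in> full_shell k"
  then obtain a where "\<And>i. a i \<noteq> 0" "x \<in> shell k a" unfolding full_shell_def by blast
  then obtain u where u: "\<And>i. a i \<noteq> 0" "\<And>i. x $ i = of_nat CARD('p) ^ nat (k $ i) * u i" "\<And>i. padic_mod_p (u i) = a i"
    unfolding shell_iff by blast
  have "u i dvd 1" for i using u(1,3) by (simp add: padic_unit_iff_mod_p)
  then show "\<forall>i. x $ i \<noteq> 0 \<and> int (padic_ord (x $ i)) = k $ i"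
    unfolding u(2) using k by (simp add: padic_p_times_unit(1,2))
next
  assume *: "\<forall>i. x $ i \<noteq> 0 \<and> int (padic_ord (x $ i)) = k $ i"
  have "\<exists>u. x $ i = of_nat CARD('p) ^ nat (k $ i) * u \<and> u dvd 1" for i
    using * padic_unit_factor[of "x $ i"] by (metis nat_int)
  then obtain u where u: "\<And>i. x $ i = of_nat CARD('p) ^ nat (k $ i) * u i" "\<And>i. u i dvd 1" by metis
  then have "x \<in> shell k (\<lambda>i. padic_mod_p (u i))" unfolding shell_iff by blast
  then show "x \<in> full_shell k" using u(2) unfolding full_shell_def padic_unit_iff_mod_p by blast
qed

text \<open>Up to the null set where a coordinate vanishes, the domain is the disjoint union of the
  shells. The integrand has norm at most 1, so the measures of the shells dominate; by absolute
  convergence the enumeration of \<open>pos_points\<close> becomes irrelevant.\<close>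

theorem zeta0_integral_has_sum:
  fixes f :: "('n::finite, 'p padic_int) mpoly"
  assumes f: "f \<noteq> 0" and s: "Re s > 0"
    and nd: "\<And>k. k \<in> pos_points \<Longrightarrow> nondegenerate_face f (wface f k)"
  shows "((\<lambda>k. face_sum f (wface f k) * p_exp (of_int (\<Sum>i\<in>UNIV. k $ i) + of_int (wmin f k) * s))
     has_sum zeta0_integral f chi s) pos_points"
proof -
  interpret prob_space "padic_haar :: ('p padic_int ^ 'n) measure" by (rule prob_space_padic_haar)
  let ?D = "{x :: 'p padic_int ^ 'n. \<forall>i. of_nat CARD('p) dvd x $ i}"
  let ?F = "\<lambda>x :: 'p padic_int ^ 'n. twisted_power s (mpoly_eval f x)"
  define e where "e = from_nat_into (pos_points :: (int ^ 'n) set)"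
  have e: "bij_betw e UNIV pos_points" unfolding e_def by (rule bij_pos_points)
  have ep: "e n \<in> pos_points" for n using e by (auto simp: bij_betw_def)
  then have e0: "0 \<le> e n $ i" for n i unfolding pos_points_def by (metis mem_Collect_eq order_trans zero_le_one)
  define A where "A n = (full_shell (e n) :: ('p padic_int ^ 'n) set)" for n
  have setsA: "A n \<in> sets padic_haar" for n
    unfolding A_def full_shell_def using finite_torus by (intro sets.finite_UN) (auto simp: sets_shell[unfolded sets_padic_haar])
  have disj: "A i \<inter> A j = {}" if "i \<noteq> j" for i j
  proof (rule ccontr)
    assume "A i \<inter> A j \<noteq> {}"
    then obtain x where "x \<in> A i" "x \<in> A j" by blast
    then have "e i = e j" unfolding A_def full_shell_iff[OF e0] vec_eq_iff by metis
    then show False using that e by (auto simp: bij_betw_def inj_def)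
  qed
  have UA: "(\<Union>n. A n) = ?D - (\<Union>i. {x. x $ i = 0})"
  proof (intro equalityI subsetI)
    fix x assume "x \<in> (\<Union>n. A n)"
    then obtain n where "x \<in> A n" by blast
    then have n: "\<And>i. x $ i \<noteq> 0" "\<And>i. int (padic_ord (x $ i)) = e n $ i"
      unfolding A_def full_shell_iff[OF e0] by auto
    have "1 \<le> e n $ i" for i using ep[of n] unfolding pos_points_def by blast
    then have "1 \<le> padic_ord (x $ i)" for i using n(2)[of i] by (metis of_nat_1 of_nat_le_iff)
    then have "of_nat CARD('p) dvd x $ i" for i using padic_dvd_ord[OF n(1)[of i], of 1] by simp
    then show "x \<in> ?D - (\<Union>i. {x. x $ i = 0})" using n(1) by blast
  next
    fix x assume x: "x \<in> ?D - (\<Union>i. {x. x $ i = 0})"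
    define k where "k = (\<chi> i. int (padic_ord (x $ i)))"
    have "k \<in> pos_points" unfolding pos_points_def k_def
    proof safe
      fix i
      have "x $ i \<noteq> 0" "of_nat CARD('p) ^ 1 dvd x $ i" using x by auto
      then have "1 \<le> padic_ord (x $ i)" using padic_dvd_ord by blast
      then show "1 \<le> (\<chi> i. int (padic_ord (x $ i))) $ i" by simp
    qed
    then obtain n where n: "e n = k" using e by (metis bij_betw_imp_surj_on imageE)
    have "x \<in> A n" unfolding A_def full_shell_iff[OF e0] using x by (simp add: n k_def)
    then show "x \<in> (\<Union>n. A n)" by blast
  qed
  have setsD: "?D \<in> sets padic_haar"
  proof -
    have "?D = res_box (\<lambda>_. 1) (\<lambda>_. 0)" by (simp add: res_box_def padic_p_dvd_iff)
    then show ?thesis by (simp add: open_res_box)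
  qed
  have N: "(\<Union>i. {x :: 'p padic_int ^ 'n. x $ i = 0}) \<in> null_sets padic_haar"
    by (intro null_sets.finite_UN null_coordinate_plane) auto
  have setsUA: "(\<Union>n. A n) \<in> sets padic_haar" using setsA by blast
  have "zeta0_integral f chi s = (LINT x : ?D | padic_haar. ?F x)"
    by (simp add: zeta0_integral_def twisted_power_def)
  also have "\<dots> = (LINT x : (\<Union>n. A n) | padic_haar. ?F x)"
  proof (rule set_integral_null_delta[OF _ setsD setsUA])
    show "integrable padic_haar ?F"
      using set_integrable_twisted_power[OF s sets.top, of f] by (simp add: set_integrable_def)
    have "?D - (\<Union>n. A n) \<union> ((\<Union>n. A n) - ?D) \<subseteq> (\<Union>i. {x :: 'p padic_int ^ 'n. x $ i = 0})"
      unfolding UA by auto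
    then show "?D - (\<Union>n. A n) \<union> ((\<Union>n. A n) - ?D) \<in> null_sets padic_haar"
      using N setsD setsUA by (intro null_sets_subset[OF N]) auto
  qed
  also have "\<dots> = suminf (\<lambda>n. LINT x : A n | padic_haar. ?F x)"
    using setsA disj by (rule lebesgue_integral_countable_add) (use setsUA s in \<open>auto intro!: set_integrable_twisted_power\<close>)
  finally have Z: "zeta0_integral f chi s = suminf (\<lambda>n. LINT x : A n | padic_haar. ?F x)" .
  have norm: "norm (LINT x : A n | padic_haar. ?F x) \<le> prob (A n)" for n
  proof -
    have "norm (LINT x : A n | padic_haar. ?F x) \<le> (LINT x | padic_haar. norm (indicat_real (A n) x *\<^sub>R ?F x))"
      unfolding set_lebesgue_integral_def by (rule integral_norm_bound)
    also have "\<dots> \<le> (LINT x | padic_haar. indicat_real (A n) x)"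
    proof (rule integral_mono)
      show "integrable padic_haar (\<lambda>x. norm (indicat_real (A n) x *\<^sub>R ?F x))"
        using set_integrable_twisted_power[OF s setsA, where f = f] unfolding set_integrable_def by (rule integrable_norm)
      show "integrable padic_haar (indicat_real (A n))"
        using setsA by (intro integrable_real_indicator) (auto simp: emeasure_eq_measure)
      show "norm (indicat_real (A n) x *\<^sub>R ?F x) \<le> indicat_real (A n) x" for x
        using norm_twisted_power_le[OF s] by (auto simp: indicator_def)
    qed
    finally show ?thesis by simp
  qed
  have "(\<lambda>n. prob (A n)) sums prob (\<Union>n. A n)"
  proof (rule finite_measure_UNION)
    show "range A \<subseteq> sets padic_haar" using setsA by blast
    show "disjoint_family A" unfolding disjoint_family_on_def using disj by blast
  qed
  then have "summable (\<lambda>n. prob (A n))" by (rule sums_summable)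
  then have summ: "summable (\<lambda>n. norm (LINT x : A n | padic_haar. ?F x))"
  proof (rule summable_comparison_test'[where N = 0])
    show "norm (norm (LINT x : A n | padic_haar. ?F x)) \<le> prob (A n)" for n
      using norm[of n] by (simp only: real_norm_def abs_norm_cancel)
  qed
  have "(\<lambda>n. LINT x : A n | padic_haar. ?F x) sums zeta0_integral f chi s"
    using summable_norm_cancel[OF summ] Z by (simp add: sums_iff)
  then have "((\<lambda>n. LINT x : A n | padic_haar. ?F x) has_sum zeta0_integral f chi s) UNIV"
    using summ by (intro norm_summable_imp_has_sum)
  moreover have "(LINT x : A n | padic_haar. ?F x)
      = (\<lambda>k. face_sum f (wface f k) * p_exp (of_int (\<Sum>i\<in>UNIV. k $ i) + of_int (wmin f k) * s)) (e n)" for n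
    unfolding A_def by (rule set_integral_full_shell[OF f e0 s nd[OF ep]])
  ultimately have "((\<lambda>n. (\<lambda>k. face_sum f (wface f k) * p_exp (of_int (\<Sum>i\<in>UNIV. k $ i) + of_int (wmin f k) * s)) (e n))
     has_sum zeta0_integral f chi s) UNIV" by simp
  then show ?thesis using has_sum_reindex_bij_betw[OF e] by blast
qed

end

subsection \<open>Rational generating functions of polyhedral sets\<close>

text \<open>The notion is closed under sums, constant multiples and division by an entire function
  that does not vanish at the point, which are the operations that build a generating
  function.\<close>

definition continues_regularly :: "complex \<Rightarrow> (complex \<Rightarrow> complex) \<Rightarrow> bool" where
  "continues_regularly s\<^sub>0 g \<longleftrightarrow>
     (\<exists>F. F meromorphic_on UNIV \<and> F analytic_on {s\<^sub>0} \<and> (\<forall>s. Re s > 0 \<longrightarrow> F s = g s))"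

lemma continues_regularly_cong:
  assumes "continues_regularly s\<^sub>0 g" "\<And>s. Re s > 0 \<Longrightarrow> g s = h s"
  shows "continues_regularly s\<^sub>0 h"
  using assms unfolding continues_regularly_def by metis

lemma continues_regularly_entire:
  assumes "g analytic_on UNIV"
  shows "continues_regularly s\<^sub>0 g"
  unfolding continues_regularly_def
  using assms analytic_on_imp_meromorphic_on analytic_on_subset by blast

lemma continues_regularly_add:
  assumes "continues_regularly s\<^sub>0 g" "continues_regularly s\<^sub>0 h"
  shows "continues_regularly s\<^sub>0 (\<lambda>s. g s + h s)"
proof -
  obtain F G where "F meromorphic_on UNIV" "F analytic_on {s\<^sub>0}" "\<forall>s. Re s > 0 \<longrightarrow> F s = g s"
    "G meromorphic_on UNIV" "G analytic_on {s\<^sub>0}" "\<forall>s. Re s > 0 \<longrightarrow> G s = h s"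
    using assms unfolding continues_regularly_def by blast
  then show ?thesis unfolding continues_regularly_def
    by (intro exI[of _ "\<lambda>s. F s + G s"]) (auto intro!: meromorphic_intros analytic_intros)
qed

lemma continues_regularly_cmult:
  assumes "continues_regularly s\<^sub>0 g"
  shows "continues_regularly s\<^sub>0 (\<lambda>s. c * g s)"
proof -
  obtain F where "F meromorphic_on UNIV" "F analytic_on {s\<^sub>0}" "\<forall>s. Re s > 0 \<longrightarrow> F s = g s"
    using assms unfolding continues_regularly_def by blast
  then show ?thesis unfolding continues_regularly_def
    by (intro exI[of _ "\<lambda>s. c * F s"]) (auto intro!: meromorphic_intros analytic_intros)
qed

lemma continues_regularly_sum:
  assumes "\<And>i. i \<in> I \<Longrightarrow> continues_regularly s\<^sub>0 (g i)"
  shows "continues_regularly s\<^sub>0 (\<lambda>s. \<Sum>i\<in>I. g i s)"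
  using assms
proof (induction I rule: infinite_finite_induct)
  case (insert i I)
  then show ?case by (simp add: continues_regularly_add)
qed (auto intro!: continues_regularly_entire analytic_intros)

lemma continues_regularly_divide:
  assumes "continues_regularly s\<^sub>0 g" "d analytic_on UNIV" "d s\<^sub>0 \<noteq> 0"
  shows "continues_regularly s\<^sub>0 (\<lambda>s. g s / d s)"
proof -
  obtain F where "F meromorphic_on UNIV" "F analytic_on {s\<^sub>0}" "\<forall>s. Re s > 0 \<longrightarrow> F s = g s"
    using assms unfolding continues_regularly_def by blast
  then show ?thesis unfolding continues_regularly_def
    using assms(3) analytic_on_subset[OF assms(2), of "{s\<^sub>0}"] analytic_on_imp_meromorphic_on[OF assms(2)]
    by (intro exI[of _ "\<lambda>s. F s / d s"]) (auto intro!: meromorphic_intros analytic_on_divide)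
qed

definition nat_span :: "(int ^ 'n::finite) set \<Rightarrow> (int ^ 'n) set \<Rightarrow> (int ^ 'n) set" where
  "nat_span W B = {b + (\<Sum>w\<in>W. int (r w) *s w) |b r. b \<in> B}"

definition additive_form :: "(int ^ 'n::finite \<Rightarrow> int) \<Rightarrow> bool" where
  "additive_form l \<longleftrightarrow> (\<forall>x y. l (x + y) = l x + l y)"

lemma additive_form_add: "additive_form l \<Longrightarrow> l (x + y) = l x + l y"
  by (simp add: additive_form_def)

lemma additive_form_0 [simp]: "additive_form l \<Longrightarrow> l 0 = 0"
  using additive_form_add[of l 0 0] by simp

lemma additive_form_diff: "additive_form l \<Longrightarrow> l (x - y) = l x - l y"
  using additive_form_add[of l "x - y" y] by simp

lemma additive_form_sum: "additive_form l \<Longrightarrow> l (\<Sum>w\<in>W. g w) = (\<Sum>w\<in>W. l (g w))"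
  by (induction W rule: infinite_finite_induct) (simp_all add: additive_form_add)

lemma additive_form_nat_scale: "additive_form l \<Longrightarrow> l (int r *s w) = int r * l w"
proof (induction r)
  case 0
  have "int 0 *s w = 0" by (simp add: vec_eq_iff)
  then show ?case using 0 by simp
next
  case (Suc r)
  have "int (Suc r) *s w = w + int r *s w" by (simp add: vec_eq_iff algebra_simps)
  then show ?case using Suc by (simp add: additive_form_add algebra_simps)
qed

text \<open>Generators on which \<open>l\<close> is positive occur only boundedly often at a fixed
  level. Their finitely many combinations move into the base set, and only the generators in the
  kernel of \<open>l\<close> stay free.\<close>

lemma nat_span_level:
  assumes "finite W" "finite B" and l: "additive_form l" "\<And>w. w \<in> W \<Longrightarrow> 0 \<le> l w"
  obtains B' where "finite B'" "{x \<in> nat_span W B. l x = v} \<subseteq> nat_span {w \<in> W. l w = 0} B'"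
proof -
  define W1 where "W1 = {w \<in> W. l w \<noteq> 0}"
  \<comment> \<open>For one base point \<open>b\<close> the multiplicities are at most
    \<open>\<bar>v - l b\<bar>\<close>; the sum serves all base points at once.\<close>
  define N where "N = nat (\<Sum>b\<in>B. \<bar>v - l b\<bar>)"
  define B' where "B' = (\<lambda>(b, r). b + (\<Sum>w\<in>W1. int (r w) *s w)) ` (B \<times> PiE W1 (\<lambda>_. {..N}))"
  have finW1: "finite W1" using assms(1) unfolding W1_def by simp
  have "finite B'" unfolding B'_def using assms(2) finW1 by (intro finite_imageI finite_cartesian_product finite_PiE) auto
  moreover have "x \<in> nat_span {w \<in> W. l w = 0} B'" if x: "x \<in> nat_span W B" "l x = v" for x
  proof -
    obtain b r where b: "b \<in> B" and xr: "x = b + (\<Sum>w\<in>W. int (r w) *s w)" using x unfolding nat_span_def by blast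
    have W: "W = W1 \<union> {w \<in> W. l w = 0}" "W1 \<inter> {w \<in> W. l w = 0} = {}" unfolding W1_def by auto
    have split: "(\<Sum>w\<in>W. int (r w) *s w) = (\<Sum>w\<in>W1. int (r w) *s w) + (\<Sum>w\<in>{w \<in> W. l w = 0}. int (r w) *s w)"
      using finW1 assms(1) W(2) by (subst W(1), subst sum.union_disjoint) auto
    have lv: "v - l b = (\<Sum>w\<in>W. int (r w) * l w)"
      using x(2) l(1) unfolding xr by (simp add: additive_form_add additive_form_sum additive_form_nat_scale)
    have "r w \<le> N" if w: "w \<in> W1" for w
    proof -
      have "int (r w) * 1 \<le> int (r w) * l w" using w l(2)[of w] unfolding W1_def by (intro mult_left_mono) auto
      also have "\<dots> \<le> (\<Sum>w\<in>W. int (r w) * l w)"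
        using w assms(1) l(2) unfolding W1_def by (intro member_le_sum) auto
      also have "\<dots> \<le> \<bar>v - l b\<bar>" using lv by simp
      also have "\<dots> \<le> (\<Sum>b\<in>B. \<bar>v - l b\<bar>)" using b assms(2) by (intro member_le_sum) auto
      finally show ?thesis unfolding N_def by simp
    qed
    then have "restrict r W1 \<in> PiE W1 (\<lambda>_. {..N})" by auto
    moreover have "(\<Sum>w\<in>W1. int (restrict r W1 w) *s w) = (\<Sum>w\<in>W1. int (r w) *s w)" by (rule sum.cong) auto
    ultimately have "b + (\<Sum>w\<in>W1. int (r w) *s w) \<in> B'"
      unfolding B'_def using b by (intro image_eqI[of _ _ "(b, restrict r W1)"]) auto
    then show ?thesis unfolding nat_span_def xr split
      by (auto intro!: exI[of _ "b + (\<Sum>w\<in>W1. int (r w) *s w)"] exI[of _ r] simp: add.assoc)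
  qed
  ultimately show ?thesis by (intro that[of B']) auto
qed

lemma finite_int_vec_box: "finite {b :: int ^ 'n::finite. \<forall>i. \<bar>b $ i\<bar> \<le> N}"
proof -
  have "{b :: int ^ 'n. \<forall>i. \<bar>b $ i\<bar> \<le> N} \<subseteq> vec_lambda ` (PiE UNIV (\<lambda>_. {-N..N}))"
  proof
    fix b :: "int ^ 'n" assume b: "b \<in> {b. \<forall>i. \<bar>b $ i\<bar> \<le> N}"
    then have "(\<lambda>i. b $ i) \<in> PiE UNIV (\<lambda>_. {-N..N})" by (auto simp: abs_le_iff minus_le_iff)
    then show "b \<in> vec_lambda ` (PiE UNIV (\<lambda>_. {-N..N}))" by (intro image_eqI[of _ _ "\<lambda>i. b $ i"]) auto
  qed
  then show ?thesis by (rule finite_subset) (intro finite_imageI finite_PiE, auto)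
qed

text \<open>Gordan's lemma: removing the integral parts of the coefficients leaves an integral
  vector in a bounded box.\<close>

lemma nat_span_of_real_span:
  assumes W: "finite W"
  obtains B where "finite B" "\<And>k r. (\<And>w. w \<in> W \<Longrightarrow> 0 \<le> r w) \<Longrightarrow> 
     (\<And>i. real_of_int (k $ i) = (\<Sum>w\<in>W. r w * real_of_int (w $ i))) \<Longrightarrow> k \<in> nat_span W B"
proof -
  define N where "N = (\<Sum>w\<in>W. \<Sum>i\<in>UNIV. \<bar>w $ i\<bar>)"
  have *: "k \<in> nat_span W {b. \<forall>i. \<bar>b $ i\<bar> \<le> N}"
    if r: "\<And>w. w \<in> W \<Longrightarrow> 0 \<le> r w" and k: "\<And>i. real_of_int (k $ i) = (\<Sum>w\<in>W. r w * real_of_int (w $ i))" for k r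
  proof -
    define m where "m w = nat \<lfloor>r w\<rfloor>" for w
    define b where "b = k - (\<Sum>w\<in>W. int (m w) *s w)"
    have "\<bar>b $ i\<bar> \<le> N" for i
    proof -
      have "real_of_int (b $ i) = (\<Sum>w\<in>W. (r w - real (m w)) * real_of_int (w $ i))"
        unfolding b_def by (simp add: k sum_subtractf algebra_simps)
      also have "\<bar>\<dots>\<bar> \<le> (\<Sum>w\<in>W. \<bar>(r w - real (m w)) * real_of_int (w $ i)\<bar>)" by (rule sum_abs)
      also have "\<dots> \<le> (\<Sum>w\<in>W. \<bar>real_of_int (w $ i)\<bar>)"
      proof (rule sum_mono)
        fix w assume "w \<in> W"
        then have "0 \<le> r w" by (rule r)
        then have "real (m w) = of_int \<lfloor>r w\<rfloor>" unfolding m_def by simp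
        then have "\<bar>r w - real (m w)\<bar> \<le> 1" by linarith
        then show "\<bar>(r w - real (m w)) * real_of_int (w $ i)\<bar> \<le> \<bar>real_of_int (w $ i)\<bar>"
          by (simp add: abs_mult mult_left_le_one_le)
      qed
      also have "\<dots> \<le> (\<Sum>w\<in>W. real_of_int (\<Sum>i\<in>UNIV. \<bar>w $ i\<bar>))"
      proof (rule sum_mono)
        fix w :: "int ^ 'a"
        have "\<bar>w $ i\<bar> \<le> (\<Sum>i\<in>UNIV. \<bar>w $ i\<bar>)" by (rule member_le_sum) auto
        then show "\<bar>real_of_int (w $ i)\<bar> \<le> real_of_int (\<Sum>i\<in>UNIV. \<bar>w $ i\<bar>)" by linarith
      qed
      finally have "real_of_int \<bar>b $ i\<bar> \<le> real_of_int N" unfolding N_def by simp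
      then show ?thesis by (simp only: of_int_le_iff)
    qed
    then show ?thesis unfolding nat_span_def
      by (auto intro!: exI[of _ b] exI[of _ m] simp: b_def)
  qed
  show ?thesis by (rule that[OF finite_int_vec_box[of N]], rule *)
qed

section \<open>Summation over a polyhedral set of lattice points\<close>

context twisting_character
begin

text \<open>\<open>\<mu>\<close> stands for a linear form, whereas \<open>wmin\<close> is linear
  only where a fixed exponent attains the minimum. Linearity turns translation by a ray into
  multiplication by its weight.\<close>

definition weight :: "(int ^ 'n::finite \<Rightarrow> int) \<Rightarrow> complex \<Rightarrow> int ^ 'n \<Rightarrow> complex" where
  "weight \<mu> s k = p_exp (of_int (\<Sum>i\<in>UNIV. k $ i) + of_int (\<mu> k) * s)"

lemma weight_add: "additive_form \<mu> \<Longrightarrow> weight \<mu> s (k + w) = weight \<mu> s k * weight \<mu> s w"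
  unfolding weight_def p_exp_add[symmetric]
  by (simp add: additive_form_add sum.distrib algebra_simps)

lemma weight_analytic: "(\<lambda>s. weight \<mu> s k) analytic_on UNIV"
  unfolding weight_def p_exp_def by (intro analytic_intros)

text \<open>
  One ray \<open>w\<close> at a time: \<open>1 - weight w\<close> times the sum over \<open>P\<close> is the sum over the points of \<open>P\<close> that
  leave \<open>P\<close> when \<open>w\<close> is subtracted. These are sorted by the first inequality that is then violated,
  which takes only finitely many values on them and becomes an equation.
\<close>

lemma polyhedral_sum_continues:
  fixes \<mu> :: "int ^ 'n::finite \<Rightarrow> int" and L :: "((int ^ 'n \<Rightarrow> int) \<times> int) list"
  assumes \<mu>: "additive_form \<mu>"
    and L: "\<And>l c. (l, c) \<in> set L \<Longrightarrow> additive_form l"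
    and LW: "\<And>l c w. (l, c) \<in> set L \<Longrightarrow> w \<in> W \<Longrightarrow> 0 \<le> l w"
    and P0: "\<And>k w. w \<in> W \<Longrightarrow> k + w \<in> P0 \<longleftrightarrow> k \<in> P0"
    and fin: "finite W" "finite B"
    and span: "{k \<in> P0. \<forall>(l, c)\<in>set L. c \<le> l k} \<subseteq> nat_span W B"
    and summ: "\<And>s. Re s > 0 \<Longrightarrow> weight \<mu> s summable_on {k \<in> P0. \<forall>(l, c)\<in>set L. c \<le> l k}"
    and reg: "\<And>w. w \<in> W \<Longrightarrow> weight \<mu> s\<^sub>0 w \<noteq> 1"
    and conv: "\<And>w s. w \<in> W \<Longrightarrow> Re s > 0 \<Longrightarrow> weight \<mu> s w \<noteq> 1"
  shows "continues_regularly s\<^sub>0 (\<lambda>s. infsum (weight \<mu> s) {k \<in> P0. \<forall>(l, c)\<in>set L. c \<le> l k})"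
  using L LW P0 fin span summ reg conv
proof (induction "length L" arbitrary: L P0 W B rule: less_induct)
  case less
  let ?P = "{k \<in> P0. \<forall>(l, c)\<in>set L. c \<le> l k}"
  show ?case
  \<comment> \<open>Without generators the set is finite; otherwise every piece has one inequality
    less. If no inequality is left, \<open>I\<close> is empty and the sum is 0.\<close>
  proof (cases "W = {}")
    case True
    then have "?P \<subseteq> B" using less.prems(6) unfolding nat_span_def by auto
    then have "finite ?P" using less.prems(5) finite_subset by blast
    then show ?thesis
      by (intro continues_regularly_entire) (auto intro!: analytic_intros weight_analytic)
  next
    case False
    then obtain w where w: "w \<in> W" by blast
    \<comment> \<open>\<open>j\<close> is the first inequality violated after subtracting
      \<open>w\<close>, and \<open>v\<close> is its value before the subtraction.\<close>
    define I where "I = (SIGMA j:{..<length L}. {snd (L ! j)..<snd (L ! j) + fst (L ! j) w})"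
    define P0' where "P0' = (\<lambda>(j, v). {k \<in> P0. fst (L ! j) k = v})"
    \<comment> \<open>The inequalities before \<open>j\<close> survive the subtraction of
      \<open>w\<close>, whence their raised bounds; those after \<open>j\<close> keep
      theirs.\<close>
    define L' where "L' = (\<lambda>(j::nat, v::int). map (\<lambda>(l, c). (l, c + l w)) (take j L) @ drop (Suc j) L)"
    define D' where "D' = (\<lambda>jv. {k \<in> P0' jv. \<forall>(l, c)\<in>set (L' jv). c \<le> l k})"
    define D where "D = {k \<in> ?P. k - w \<notin> ?P}"
    have mem: "fst (L ! j) \<in> fst ` set L" "(fst (L ! j), snd (L ! j)) \<in> set L" if "j < length L" for j
      using that by auto
    have D'_iff: "k \<in> D' (j, v) \<longleftrightarrow> k \<in> P0 \<and> fst (L ! j) k = v \<and>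
        (\<forall>i<j. snd (L ! i) + fst (L ! i) w \<le> fst (L ! i) k) \<and>
        (\<forall>i<length L. j < i \<longrightarrow> snd (L ! i) \<le> fst (L ! i) k)" if j: "j < length L" for j v k
    proof -
      have 1: "(\<forall>(l, c)\<in>set (take j L). c + l w \<le> l k) \<longleftrightarrow> (\<forall>i<j. snd (L ! i) + fst (L ! i) w \<le> fst (L ! i) k)"
        using j by (simp add: all_set_conv_all_nth case_prod_beta)
      have 2: "(\<forall>(l, c)\<in>set (drop (Suc j) L). c \<le> l k) \<longleftrightarrow> (\<forall>i<length L. j < i \<longrightarrow> snd (L ! i) \<le> fst (L ! i) k)"
      proof
        assume a: "\<forall>(l, c)\<in>set (drop (Suc j) L). c \<le> l k"
        show "\<forall>i<length L. j < i \<longrightarrow> snd (L ! i) \<le> fst (L ! i) k"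
        proof (intro allI impI)
          fix i assume i: "i < length L" "j < i"
          have "drop (Suc j) L ! (i - Suc j) = L ! i" using i by simp
          moreover have "i - Suc j < length (drop (Suc j) L)" using i by simp
          ultimately have "L ! i \<in> set (drop (Suc j) L)" by (metis nth_mem)
          then show "snd (L ! i) \<le> fst (L ! i) k" using a by (auto split: prod.splits)
        qed
      next
        assume a: "\<forall>i<length L. j < i \<longrightarrow> snd (L ! i) \<le> fst (L ! i) k"
        show "\<forall>(l, c)\<in>set (drop (Suc j) L). c \<le> l k"
        proof (intro ballI, clarify)
          fix l c assume "(l, c) \<in> set (drop (Suc j) L)"
          then obtain i where "i < length L - Suc j" "L ! (Suc j + i) = (l, c)"
            by (auto simp: in_set_conv_nth)
          then show "c \<le> l k" using a[rule_format, of "Suc j + i"] by simp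
        qed
      qed
      show ?thesis unfolding D'_def P0'_def L'_def using 1 2 by (auto simp: ball_Un)
    qed
    have P_iff: "k \<in> ?P \<longleftrightarrow> k \<in> P0 \<and> (\<forall>i<length L. snd (L ! i) \<le> fst (L ! i) k)" for k
      by (simp add: all_set_conv_all_nth case_prod_beta)
    have add: "fst (L ! i) (k - w) = fst (L ! i) k - fst (L ! i) w" if "i < length L" for i k
      using less.prems(1)[OF mem(2)[OF that]] by (rule additive_form_diff)
    have nn: "0 \<le> fst (L ! i) w" if "i < length L" for i
      using less.prems(2)[OF mem(2)[OF that] w] .
    have P0w: "k - w \<in> P0 \<longleftrightarrow> k \<in> P0" for k using less.prems(3)[OF w, of "k - w"] by simp
    have D_eq: "D = (\<Union>jv\<in>I. D' jv)"
    proof (intro equalityI subsetI)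
      fix k assume k: "k \<in> D"
      then have kP: "k \<in> P0" "\<forall>i<length L. snd (L ! i) \<le> fst (L ! i) k" and "k - w \<notin> ?P"
        unfolding D_def P_iff by auto
      then have ex: "\<exists>i. i < length L \<and> fst (L ! i) k < snd (L ! i) + fst (L ! i) w"
        unfolding P_iff P0w using add by force
      define j where "j = (LEAST i. i < length L \<and> fst (L ! i) k < snd (L ! i) + fst (L ! i) w)"
      have j: "j < length L" "fst (L ! j) k < snd (L ! j) + fst (L ! j) w"
        using LeastI_ex[OF ex] unfolding j_def by auto
      have less: "snd (L ! i) + fst (L ! i) w \<le> fst (L ! i) k" if "i < j" for i
      proof -
        have "\<not> (i < length L \<and> fst (L ! i) k < snd (L ! i) + fst (L ! i) w)"
          using that unfolding j_def by (rule not_less_Least)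
        then show ?thesis using that j(1) by auto
      qed
      have "(j, fst (L ! j) k) \<in> I" unfolding I_def using j kP by auto
      moreover have "k \<in> D' (j, fst (L ! j) k)" unfolding D'_iff[OF j(1)] using kP less by auto
      ultimately show "k \<in> (\<Union>jv\<in>I. D' jv)" by blast
    next
      fix k assume "k \<in> (\<Union>jv\<in>I. D' jv)"
      then obtain j v where j: "j < length L" "snd (L ! j) \<le> v" "v < snd (L ! j) + fst (L ! j) w" and k: "k \<in> D' (j, v)"
        unfolding I_def by auto
      note k' = k[unfolded D'_iff[OF j(1)]]
      have "snd (L ! i) \<le> fst (L ! i) k" if i: "i < length L" for i
        using k' j i nn[OF i] by (cases i j rule: linorder_cases) force+
      then have "k \<in> ?P" using k' unfolding P_iff by blast
      moreover have "k - w \<notin> ?P" using k' j add[OF j(1)] unfolding P_iff by force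
      ultimately show "k \<in> D" unfolding D_def by blast
    qed
    have disj: "D' jv \<inter> D' jv' = {}" if "jv \<in> I" "jv' \<in> I" "jv \<noteq> jv'" for jv jv'
    proof -
      have *: "D' (j, v) \<inter> D' (j', v') = {}" if "(j, v) \<in> I" "(j', v') \<in> I" "j < j'" for j v j' v'
      proof -
        have "j < length L" "j' < length L" "v < snd (L ! j) + fst (L ! j) w" using that unfolding I_def by auto
        then show ?thesis using that(3) by (force simp: D'_iff)
      qed
      have **: "D' (j, v) \<inter> D' (j, v') = {}" if "(j, v) \<in> I" "v \<noteq> v'" for j v v'
      proof -
        have "j < length L" using that unfolding I_def by auto
        then show ?thesis using that(2) by (auto simp: D'_iff)
      qed
      obtain j v j' v' where jv: "jv = (j, v)" "jv' = (j', v')" by (metis surj_pair)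
      show ?thesis using that *[of j v j' v'] *[of j' v' j v] **[of j v v'] unfolding jv
        by (cases j j' rule: linorder_cases) auto
    qed
    have finI: "finite I" unfolding I_def by auto
    have D'P: "D' jv \<subseteq> ?P" if "jv \<in> I" for jv using D_eq that unfolding D_def by blast
    have piece: "continues_regularly s\<^sub>0 (\<lambda>s. infsum (weight \<mu> s) (D' jv))" if jv: "jv \<in> I" for jv
    proof -
      obtain j v where jv': "jv = (j, v)" by (metis surj_pair)
      have j: "j < length L" using jv unfolding jv' I_def by auto
      let ?l = "fst (L ! j)"
      let ?W = "{u \<in> W. ?l u = 0}"
      have la: "additive_form ?l" using less.prems(1)[OF mem(2)[OF j]] .
      obtain B' where B': "finite B'" "{x \<in> nat_span W B. ?l x = v} \<subseteq> nat_span ?W B'"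
        using nat_span_level[OF less.prems(4,5) la less.prems(2)[OF mem(2)[OF j]]] by blast
      have setL': "\<exists>c'. (l, c') \<in> set L" if "(l, c) \<in> set (L' jv)" for l c
        using that unfolding L'_def jv' by (auto dest: in_set_takeD in_set_dropD)
      show ?thesis unfolding D'_def
      proof (rule less.hyps[of "L' jv" "?W" "P0' jv" "B'"])
        show "length (L' jv) < length L" unfolding L'_def jv' using j by simp
        show "additive_form l" if "(l, c) \<in> set (L' jv)" for l c
          using setL'[OF that] less.prems(1) by blast
        show "0 \<le> l u" if "(l, c) \<in> set (L' jv)" "u \<in> ?W" for l c u
          using setL'[OF that(1)] less.prems(2) that(2) by blast
        show "k + u \<in> P0' jv \<longleftrightarrow> k \<in> P0' jv" if "u \<in> ?W" for k u
          unfolding P0'_def jv' using that less.prems(3) la by (auto simp: additive_form_add)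
        show "{k \<in> P0' jv. \<forall>(l, c)\<in>set (L' jv). c \<le> l k} \<subseteq> nat_span ?W B'"
        proof
          fix k assume k: "k \<in> {k \<in> P0' jv. \<forall>(l, c)\<in>set (L' jv). c \<le> l k}"
          then have "k \<in> D' jv" unfolding D'_def .
          then have "k \<in> nat_span W B" using D'P[OF jv] less.prems(6) by blast
          then show "k \<in> nat_span ?W B'" using B'(2) k unfolding P0'_def jv' by blast
        qed
        show "weight \<mu> s summable_on {k \<in> P0' jv. \<forall>(l, c)\<in>set (L' jv). c \<le> l k}" if "Re s > 0" for s
          using less.prems(7)[OF that] D'P[OF jv] unfolding D'_def by (rule summable_on_subset_banach)
      qed (use B'(1) less.prems(4,8,9) in auto)
    qed
    have key: "infsum (weight \<mu> s) ?P = (\<Sum>jv\<in>I. infsum (weight \<mu> s) (D' jv)) / (1 - weight \<mu> s w)" if s: "Re s > 0" for s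
    proof -
      note sm = less.prems(7)[OF s]
      let ?Q = "(\<lambda>k. k + w) ` ?P"
      have QP: "?Q \<subseteq> ?P"
      proof (intro subsetI, elim imageE)
        fix x k assume k: "k \<in> ?P" "x = k + w"
        have "fst (L ! i) (k + w) = fst (L ! i) k + fst (L ! i) w" if "i < length L" for i
          using less.prems(1)[OF mem(2)[OF that]] by (rule additive_form_add)
        then show "x \<in> ?P" using k nn less.prems(3)[OF w, of k] unfolding P_iff by force
      qed
      have DQ: "D = ?P - ?Q" unfolding D_def
      proof (intro equalityI subsetI)
        fix k assume k: "k \<in> {k \<in> ?P. k - w \<notin> ?P}"
        have "k \<notin> ?Q" using k by force
        then show "k \<in> ?P - ?Q" using k by blast
      next
        fix k assume k: "k \<in> ?P - ?Q"
        have "k - w \<notin> ?P" using k image_eqI[of k "\<lambda>k. k + w" "k - w" ?P] by auto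
        then show "k \<in> {k \<in> ?P. k - w \<notin> ?P}" using k by blast
      qed
      have "infsum (weight \<mu> s) ?Q = infsum (weight \<mu> s \<circ> (\<lambda>k. k + w)) ?P"
        by (rule infsum_reindex) (auto simp: inj_on_def)
      also have "weight \<mu> s \<circ> (\<lambda>k. k + w) = (\<lambda>k. weight \<mu> s w * weight \<mu> s k)"
        using \<mu> by (auto simp: weight_add)
      also have "infsum (\<lambda>k. weight \<mu> s w * weight \<mu> s k) ?P = weight \<mu> s w * infsum (weight \<mu> s) ?P"
        by (rule infsum_cmult_right) (use sm in auto)
      finally have Q: "infsum (weight \<mu> s) ?Q = weight \<mu> s w * infsum (weight \<mu> s) ?P" .
      have "infsum (weight \<mu> s) D = infsum (weight \<mu> s) ?P - infsum (weight \<mu> s) ?Q"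
        unfolding DQ by (rule infsum_Diff[OF sm summable_on_subset_banach[OF sm QP] QP])
      then have "infsum (weight \<mu> s) ?P * (1 - weight \<mu> s w) = infsum (weight \<mu> s) D"
        unfolding Q by (simp add: algebra_simps)
      also have "infsum (weight \<mu> s) D = (\<Sum>jv\<in>I. infsum (weight \<mu> s) (D' jv))"
        unfolding D_eq using finI disj D'P
        by (intro sum_infsum[symmetric] summable_on_subset_banach[OF sm]) auto
      finally show ?thesis using less.prems(9)[OF w s] by (simp add: field_simps)
    qed
    have "continues_regularly s\<^sub>0 (\<lambda>s. (\<Sum>jv\<in>I. infsum (weight \<mu> s) (D' jv)) / (1 - weight \<mu> s w))"
      using piece less.prems(8)[OF w]
      by (intro continues_regularly_divide continues_regularly_sum) (auto intro!: analytic_intros weight_analytic)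
    then show ?thesis by (rule continues_regularly_cong) (simp add: key)
  qed
qed

end

no_notation fps_nth (infixl \<open>$\<close> 75)

subsection \<open>Faces of the Newton polyhedron cut out by integral weights\<close>

definition int_vec :: "int ^ 'n::finite \<Rightarrow> real ^ 'n" where
  "int_vec k = (\<chi> i. real_of_int (k $ i))"

lemma int_vec_nth [simp]: "int_vec k $ i = real_of_int (k $ i)"
  by (simp add: int_vec_def)

lemma real_vec_nth [simp]: "real_vec w $ i = real (w $ i)"
  by (simp add: real_vec_def)

lemma real_vec_inject [simp]: "real_vec w = real_vec w' \<longleftrightarrow> w = w'"
  by (simp add: vec_eq_iff)

lemma inner_int_vec: "int_vec k \<bullet> real_vec w = real_of_int (wt k w)"
  by (simp add: inner_vec_def wt_def)

lemma int_vec_0 [simp]: "int_vec 0 = 0"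
  by (simp add: vec_eq_iff)

lemma int_vec_eq_0_iff [simp]: "int_vec k = 0 \<longleftrightarrow> k = 0"
  by (simp add: vec_eq_iff)

definition wt_face :: "('n::finite, 'a::zero) mpoly \<Rightarrow> int ^ 'n \<Rightarrow> (real ^ 'n) set" where
  "wt_face f k = newton_polyhedron f \<inter> {x. int_vec k \<bullet> x = real_of_int (wmin f k)}"

lemma convex_newton_polyhedron: "convex (newton_polyhedron f)"
  by (simp add: newton_polyhedron_def)

lemma newton_polyhedron_memI:
  "w \<in> Poly_Mapping.keys f \<Longrightarrow> (\<And>i. 0 \<le> r $ i) \<Longrightarrow> real_vec w + r \<in> newton_polyhedron f"
  unfolding newton_polyhedron_def by (rule hull_inc) blast

lemma real_vec_in_newton_polyhedron: "w \<in> Poly_Mapping.keys f \<Longrightarrow> real_vec w \<in> newton_polyhedron f"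
  using newton_polyhedron_memI[of w f 0] by simp

text \<open>The sum of the polytope of exponents and the orthant is convex and contains all the
  shifted orthants, hence their hull.\<close>

lemma newton_polyhedron_decomp:
  assumes "x \<in> newton_polyhedron f"
  obtains a r where "x = a + r" "a \<in> convex hull (real_vec ` Poly_Mapping.keys f)" "\<And>i. 0 \<le> r $ i"
proof -
  let ?H = "convex hull (real_vec ` Poly_Mapping.keys f)"
  let ?O = "{r :: real ^ 'a. \<forall>i. 0 \<le> r $ i}"
  have "convex ?O" by (auto simp: convex_def)
  then have cv: "convex (\<Union>a\<in>?H. \<Union>r\<in>?O. {a + r})" by (intro convex_sums) auto
  have "newton_polyhedron f \<subseteq> (\<Union>a\<in>?H. \<Union>r\<in>?O. {a + r})"
    unfolding newton_polyhedron_def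
  proof (rule hull_minimal[where S = convex, OF _ cv], safe)
    fix w r assume "w \<in> Poly_Mapping.keys f" "\<forall>i. 0 \<le> (r :: real ^ 'a) $ i"
    then have "real_vec w \<in> ?H" "r \<in> ?O" by (auto intro: hull_inc)
    then show "real_vec w + r \<in> (\<Union>a\<in>?H. \<Union>r\<in>?O. {a + r})" by blast
  qed
  then show ?thesis using assms that by blast
qed

lemma inner_nonneg:
  fixes x y :: "real ^ 'n::finite"
  assumes "\<And>i. 0 \<le> x $ i" "\<And>i. 0 \<le> y $ i"
  shows "0 \<le> x \<bullet> y"
  using assms by (auto simp: inner_vec_def intro!: sum_nonneg)

lemma wmin_le_inner:
  fixes k :: "int ^ 'n::finite"
  assumes k: "\<And>i. 0 \<le> k $ i" and x: "x \<in> newton_polyhedron f"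
  shows "real_of_int (wmin f k) \<le> int_vec k \<bullet> x"
proof -
  obtain a r where x: "x = a + r" "a \<in> convex hull (real_vec ` Poly_Mapping.keys f)" "\<And>i. 0 \<le> r $ i"
    using newton_polyhedron_decomp[OF x] by blast
  have "convex hull (real_vec ` Poly_Mapping.keys f) \<subseteq> {x. int_vec k \<bullet> x \<ge> real_of_int (wmin f k)}"
    by (rule hull_minimal) (auto simp: inner_int_vec wmin_le convex_halfspace_ge)
  then have "real_of_int (wmin f k) \<le> int_vec k \<bullet> a" using x(2) by auto
  moreover have "0 \<le> int_vec k \<bullet> r" using k x(3) by (intro inner_nonneg) auto
  ultimately show ?thesis by (simp add: x(1) inner_add_right)
qed

text \<open>Both summands of a minimal point must be minimal: the polytope part uses only exponents
  of the face, the orthant part only coordinates of weight 0.\<close>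

lemma wt_face_decomp:
  fixes k :: "int ^ 'n::finite"
  assumes k: "\<And>i. 0 \<le> k $ i" and x: "x \<in> wt_face f k"
  obtains a r where "x = a + r" "a \<in> convex hull (real_vec ` wface f k)" "\<And>i. 0 \<le> r $ i"
    "\<And>i. k $ i \<noteq> 0 \<Longrightarrow> r $ i = 0"
proof -
  let ?m = "real_of_int (wmin f k)"
  obtain a r where x': "x = a + r" "a \<in> convex hull (real_vec ` Poly_Mapping.keys f)" and r: "\<And>i. 0 \<le> r $ i"
    using x newton_polyhedron_decomp[of x f] unfolding wt_face_def by blast
  have kr: "0 \<le> int_vec k \<bullet> r" using k r by (intro inner_nonneg) auto
  obtain u where u: "\<forall>y\<in>real_vec ` Poly_Mapping.keys f. 0 \<le> u y" "sum u (real_vec ` Poly_Mapping.keys f) = 1"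
      "(\<Sum>y\<in>real_vec ` Poly_Mapping.keys f. u y *\<^sub>R y) = a"
    using x'(2) by (auto simp: convex_hull_finite)
  let ?V = "real_vec ` Poly_Mapping.keys f"
  have ge: "0 \<le> int_vec k \<bullet> y - ?m" if "y \<in> ?V" for y using that by (auto simp: inner_int_vec wmin_le)
  have ka: "int_vec k \<bullet> a - ?m = (\<Sum>y\<in>?V. u y * (int_vec k \<bullet> y - ?m))"
    using u(2) unfolding u(3)[symmetric]
    by (simp add: inner_sum_right right_diff_distrib sum_subtractf flip: sum_distrib_right)
  have ka0: "0 \<le> int_vec k \<bullet> a - ?m" unfolding ka using u(1) ge by (intro sum_nonneg mult_nonneg_nonneg) auto
  have "int_vec k \<bullet> a + int_vec k \<bullet> r = ?m" using x unfolding wt_face_def x'(1) by (simp add: inner_add_right)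
  then have z: "int_vec k \<bullet> a - ?m = 0" "int_vec k \<bullet> r = 0" using ka0 kr by auto
  have u0: "u y = 0" if "y \<in> ?V" "y \<notin> real_vec ` wface f k" for y
  proof -
    have "u y * (int_vec k \<bullet> y - ?m) = 0"
      using z(1) u(1) ge that unfolding ka by (subst (asm) sum_nonneg_eq_0_iff) auto
    moreover have "int_vec k \<bullet> y \<noteq> ?m" using that by (auto simp: inner_int_vec wface_def)
    ultimately show ?thesis by simp
  qed
  have sub: "real_vec ` wface f k \<subseteq> ?V" by (auto simp: wface_def)
  have "(\<Sum>y\<in>real_vec ` wface f k. u y *\<^sub>R y) = (\<Sum>y\<in>?V. u y *\<^sub>R y)"
    using u0 sub by (intro sum.mono_neutral_left) auto
  moreover have "sum u (real_vec ` wface f k) = sum u ?V"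
    using u0 sub by (intro sum.mono_neutral_left) auto
  moreover have "\<forall>y\<in>real_vec ` wface f k. 0 \<le> u y" using u(1) sub by blast
  ultimately have "a \<in> convex hull (real_vec ` wface f k)"
    unfolding u(2) u(3) by (subst convex_hull_finite) auto
  moreover have "r $ i = 0" if "k $ i \<noteq> 0" for i
  proof -
    have "(\<Sum>i\<in>UNIV. real_of_int (k $ i) * r $ i) = 0" using z(2) by (simp add: inner_vec_def)
    then have "real_of_int (k $ i) * r $ i = 0" using k r by (subst (asm) sum_nonneg_eq_0_iff) auto
    then show ?thesis using that by simp
  qed
  ultimately show ?thesis using that x'(1) r by blast
qed

lemma convex_wt_face: "convex (wt_face f k)"
  unfolding wt_face_def by (intro convex_Int convex_newton_polyhedron convex_hyperplane)

lemma real_vec_in_wt_face: "w \<in> wface f k \<Longrightarrow> real_vec w \<in> wt_face f k"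
  unfolding wt_face_def wface_def by (auto simp: inner_int_vec real_vec_in_newton_polyhedron)

lemma real_vec_in_wt_face_iff: "w \<in> Poly_Mapping.keys f \<Longrightarrow> real_vec w \<in> wt_face f k \<longleftrightarrow> w \<in> wface f k"
  unfolding wt_face_def wface_def by (auto simp: inner_int_vec real_vec_in_newton_polyhedron)

lemma newton_polyhedron_add:
  assumes "x \<in> newton_polyhedron f" "\<And>i. 0 \<le> r $ i"
  shows "x + r \<in> newton_polyhedron f"
proof -
  obtain a q where x: "x = a + q" "a \<in> convex hull (real_vec ` Poly_Mapping.keys f)" "\<And>i. 0 \<le> q $ i"
    using newton_polyhedron_decomp[OF assms(1)] by blast
  have "convex hull ((\<lambda>y. (q + r) + y) ` real_vec ` Poly_Mapping.keys f) \<subseteq> newton_polyhedron f"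
  proof (rule hull_minimal[where S = convex, OF _ convex_newton_polyhedron], safe)
    fix w assume "w \<in> Poly_Mapping.keys f"
    then show "q + r + real_vec w \<in> newton_polyhedron f"
      using newton_polyhedron_memI[of w f "q + r"] x(3) assms(2) by (simp add: add.commute)
  qed
  moreover have "(q + r) + a \<in> (\<lambda>y. (q + r) + y) ` (convex hull (real_vec ` Poly_Mapping.keys f))"
    using x(2) by blast
  ultimately show ?thesis unfolding convex_hull_translation x(1) by (auto simp: add_ac)
qed

lemma wt_face_add_axis:
  assumes "x \<in> wt_face f k" "k $ j = 0" "0 \<le> t"
  shows "x + t *\<^sub>R axis j 1 \<in> wt_face f k"
proof -
  have "x + t *\<^sub>R axis j 1 \<in> newton_polyhedron f"
    using assms by (intro newton_polyhedron_add) (auto simp: wt_face_def axis_def)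
  moreover have "int_vec k \<bullet> axis j 1 = 0" using assms(2) by (simp add: inner_axis)
  ultimately show ?thesis using assms(1) unfolding wt_face_def by (simp add: inner_add_right)
qed

lemma newton_face_wt_face:
  fixes k :: "int ^ 'n::finite"
  assumes "f \<noteq> 0" and k: "\<And>i. 0 \<le> k $ i"
  shows "newton_face f (wt_face f k)"
proof -
  have "wt_face f k \<noteq> {}" using wface_nonempty[OF assms(1), of k] real_vec_in_wt_face by blast
  moreover have "wt_face f k exposed_face_of newton_polyhedron f"
    unfolding wt_face_def
    by (rule exposed_face_of_Int_supporting_hyperplane_ge[OF convex_newton_polyhedron]) (rule wmin_le_inner[OF k])
  ultimately show ?thesis unfolding newton_face_def by blast
qed

text \<open>With all weights positive, no orthant part is left.\<close>

lemma compact_wt_face: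
  fixes k :: "int ^ 'n::finite"
  assumes k: "\<And>i. 0 < k $ i"
  shows "wt_face f k = convex hull (real_vec ` wface f k)" "compact (wt_face f k)"
proof -
  show "wt_face f k = convex hull (real_vec ` wface f k)"
  proof (intro equalityI subsetI)
    fix x assume "x \<in> wt_face f k"
    then obtain a r where "x = a + r" "a \<in> convex hull (real_vec ` wface f k)" "\<And>i. 0 \<le> r $ i"
        "\<And>i. k $ i \<noteq> 0 \<Longrightarrow> r $ i = 0"
      using wt_face_decomp[of k x f] k by (metis less_imp_le)
    moreover from this have "r = 0" using k by (simp add: vec_eq_iff) (metis less_irrefl)
    ultimately show "x \<in> convex hull (real_vec ` wface f k)" by simp
  next
    have "convex hull (real_vec ` wface f k) \<subseteq> wt_face f k"
      by (rule hull_minimal) (auto simp: real_vec_in_wt_face convex_wt_face)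
    then show "x \<in> wt_face f k" if "x \<in> convex hull (real_vec ` wface f k)" for x using that by blast
  qed
  then show "compact (wt_face f k)" by (simp add: finite_imp_compact_convex_hull)
qed

subsection \<open>Non-degeneracy on the faces cut out by positive weights\<close>

lemma mpoly_eval_superset:
  assumes "finite S" "Poly_Mapping.keys g \<subseteq> S"
  shows "mpoly_eval g x = (\<Sum>w\<in>S. Poly_Mapping.lookup g w * (\<Prod>i\<in>UNIV. (x $ i) ^ (w $ i)))"
  unfolding mpoly_eval_def using assms
  by (intro sum.mono_neutral_left) (auto simp: in_keys_iff)

lemma mpoly_eval_add: "mpoly_eval (g + h) x = mpoly_eval g x + mpoly_eval h x"
proof -
  let ?S = "Poly_Mapping.keys g \<union> Poly_Mapping.keys h"
  have "Poly_Mapping.keys (g + h) \<subseteq> ?S" by (rule Poly_Mapping.keys_add)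
  then show ?thesis
    by (simp add: mpoly_eval_superset[of ?S] lookup_add distrib_right sum.distrib)
qed

lemma mpoly_eval_single: "mpoly_eval (Poly_Mapping.single w c) x = c * (\<Prod>i\<in>UNIV. (x $ i) ^ (w $ i))"
  by (subst mpoly_eval_superset[of "{w}"]) auto

lemma mpoly_eval_sum: "mpoly_eval (\<Sum>i\<in>I. g i) x = (\<Sum>i\<in>I. mpoly_eval (g i) x)"
proof (induction I rule: infinite_finite_induct)
  case (insert i I)
  then show ?case by (simp add: mpoly_eval_add)
qed (simp_all add: mpoly_eval_def)

lemma mpoly_eval_deriv:
  fixes x :: "'a::comm_ring_1 ^ 'n::finite"
  assumes "finite S" "Poly_Mapping.keys g \<subseteq> S"
  shows "mpoly_eval (mpoly_deriv i g) x = (\<Sum>w\<in>S. Poly_Mapping.lookup g w *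
     (of_nat (w $ i) * (x $ i) ^ (w $ i - 1) * (\<Prod>j\<in>UNIV - {i}. (x $ j) ^ (w $ j))))"
proof -
  have pr: "(\<Prod>j\<in>UNIV. (x $ j) ^ ((w - axis i 1) $ j)) = (x $ i) ^ (w $ i - 1) * (\<Prod>j\<in>UNIV - {i}. (x $ j) ^ (w $ j))"
    for w :: "nat ^ 'n"
    by (subst prod.remove[of _ i]) (auto simp: axis_def intro!: prod.cong)
  have "mpoly_eval (mpoly_deriv i g) x = (\<Sum>w\<in>Poly_Mapping.keys g. Poly_Mapping.lookup g w *
     (of_nat (w $ i) * (x $ i) ^ (w $ i - 1) * (\<Prod>j\<in>UNIV - {i}. (x $ j) ^ (w $ j))))"
    unfolding mpoly_deriv_def mpoly_eval_sum mpoly_eval_single pr by (simp add: mult_ac)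
  also have "\<dots> = (\<Sum>w\<in>S. Poly_Mapping.lookup g w *
     (of_nat (w $ i) * (x $ i) ^ (w $ i - 1) * (\<Prod>j\<in>UNIV - {i}. (x $ j) ^ (w $ j))))"
    using assms by (intro sum.mono_neutral_left) (auto simp: in_keys_iff)
  finally show ?thesis .
qed

text \<open>Positive weights cut out compact faces, and restricting to the real face keeps exactly
  the exponents in \<open>wface f k\<close>.\<close>

lemma nondegenerate_wface:
  fixes f :: "('n::finite, 'p::prime_card padic_int) mpoly" and k :: "int ^ 'n"
  assumes f: "f \<noteq> 0" and nd: "nondegenerate_mod_p f" and k: "\<And>i. 0 < k $ i"
  shows "nondegenerate_face f (wface f k)"
  unfolding nondegenerate_face_def
proof (intro allI impI, elim conjE, rule ccontr)
  fix a :: "'n \<Rightarrow> 'p mod_ring" 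
  assume a: "\<forall>i. a i \<noteq> 0" and v: "face_value f (wface f k) a = 0" and d: "\<nexists>i. face_deriv f (wface f k) i a \<noteq> 0"
  let ?t = "wt_face f k"
  define g where "g = Poly_Mapping.map padic_mod_p (mpoly_restrict ?t f)"
  have fin: "finite {w. (if real_vec w \<in> ?t then Poly_Mapping.lookup f w else 0) \<noteq> 0}"
    by (rule finite_subset[of _ "Poly_Mapping.keys f"]) (auto simp: in_keys_iff)
  have lr: "Poly_Mapping.lookup (mpoly_restrict ?t f) w = (if w \<in> wface f k then Poly_Mapping.lookup f w else 0)" for w
    unfolding mpoly_restrict_def Abs_poly_mapping_inverse[OF CollectI, OF fin]
    using real_vec_in_wt_face_iff[of w f k] by (auto simp: wface_def in_keys_iff)
  have lg: "Poly_Mapping.lookup g w = (if w \<in> wface f k then padic_mod_p (Poly_Mapping.lookup f w) else 0)" for w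
    unfolding g_def Poly_Mapping.map.rep_eq lr by (auto simp: when_def)
  have keys: "Poly_Mapping.keys g \<subseteq> wface f k" by (auto simp: in_keys_iff lg split: if_splits)
  have "mpoly_eval g (\<chi> i. a i) = face_value f (wface f k) a"
    unfolding mpoly_eval_superset[OF finite_wface keys] face_value_def by (rule sum.cong) (auto simp: lg)
  moreover have "mpoly_eval (mpoly_deriv i g) (\<chi> i. a i) = face_deriv f (wface f k) i a" for i
    unfolding mpoly_eval_deriv[OF finite_wface keys] face_deriv_def by (rule sum.cong) (auto simp: lg)
  moreover have "newton_face f ?t" "compact ?t"
    using newton_face_wt_face[OF f, of k] compact_wt_face(2)[OF k] k less_imp_le by blast+
  ultimately show False
    using nd a v d unfolding nondegenerate_mod_p_def Let_def g_def[symmetric]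
    by (metis (no_types, lifting) g_def vec_lambda_beta)
qed

subsection \<open>Facet normals as extreme rays\<close>

text \<open>\<open>d\<close> is constant on the face of \<open>v\<close>: it is orthogonal to the
  differences of its exponents and to its unbounded coordinate directions.\<close>

definition tight :: "(3, 'a::zero) mpoly \<Rightarrow> int ^ 3 \<Rightarrow> real ^ 3 \<Rightarrow> bool" where
  "tight f v d \<longleftrightarrow> (\<forall>w\<in>wface f v. \<forall>w'\<in>wface f v. d \<bullet> (real_vec w - real_vec w') = 0) \<and> (\<forall>j. v $ j = 0 \<longrightarrow> d $ j = 0)"

text \<open>The face of \<open>v\<close> is a facet exactly when the vectors constant on it form a
  line. Stated through exponents, this gives the primitive facet normals as integral
  vectors.\<close>

definition is_ray :: "(3, 'a::zero) mpoly \<Rightarrow> int ^ 3 \<Rightarrow> bool" where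
  "is_ray f v \<longleftrightarrow> v \<noteq> 0 \<and> (\<forall>i. 0 \<le> v $ i) \<and> Gcd (range (\<lambda>i. nat (v $ i))) = 1 \<and>
     (\<forall>d. tight f v d \<longrightarrow> (\<exists>c. d = c *\<^sub>R int_vec v))"

definition nat_vec :: "int ^ 'n::finite \<Rightarrow> nat ^ 'n" where
  "nat_vec v = (\<chi> i. nat (v $ i))"

text \<open>Cross multiplication gives \<open>v $ j * w $ i = w $ j * v $ i\<close> for all
  \<open>i\<close>; taking the gcd over \<open>i\<close> leaves
  \<open>v $ j = w $ j\<close>.\<close>

lemma primitive_parallel_eq:
  fixes v w :: "nat ^ 'n::finite"
  assumes prim: "Gcd (range (\<lambda>i. v $ i)) = 1" "Gcd (range (\<lambda>i. w $ i)) = 1"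
    and par: "real_vec w = c *\<^sub>R real_vec v"
  shows "v = w"
proof -
  have "\<exists>j. v $ j \<noteq> 0"
  proof (rule ccontr)
    assume "\<not> ?thesis"
    then have "Gcd (range (\<lambda>i. v $ i)) = 0" by simp
    then show False using prim(1) by simp
  qed
  then obtain j where j: "v $ j \<noteq> 0" by blast
  have w: "real (w $ i) = c * real (v $ i)" for i using par by (simp add: vec_eq_iff)
  have "real (v $ j * w $ i) = real (w $ j * v $ i)" for i by (simp add: w)
  then have *: "v $ j * w $ i = w $ j * v $ i" for i by (metis of_nat_eq_iff)
  have "(*) (v $ j) ` range (\<lambda>i. w $ i) = (*) (w $ j) ` range (\<lambda>i. v $ i)"
    using * by (auto simp: image_iff)
  then have "Gcd ((*) (v $ j) ` range (\<lambda>i. w $ i)) = Gcd ((*) (w $ j) ` range (\<lambda>i. v $ i))" by simp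
  moreover have "Gcd ((*) c ` A) = c * Gcd A" for c :: nat and A :: "nat set"
    by (simp add: Gcd_mult)
  ultimately have "v $ j * Gcd (range (\<lambda>i. w $ i)) = w $ j * Gcd (range (\<lambda>i. v $ i))" by (simp only:)
  then have vw: "v $ j = w $ j" unfolding prim by simp
  have "w $ i = v $ i" for i using *[of i] j unfolding vw by simp
  then show ?thesis by (simp add: vec_eq_iff)
qed

lemma real_vec_nat_vec:
  fixes v :: "int ^ 'n::finite"
  shows "(\<And>i. 0 \<le> v $ i) \<Longrightarrow> real_vec (nat_vec v) = int_vec v"
  by (simp add: vec_eq_iff nat_vec_def)

lemma is_ray_parallel_eq:
  assumes "is_ray f v" "is_ray g w" "int_vec w = c *\<^sub>R int_vec v"
  shows "v = w"
proof -
  have "nat_vec v = nat_vec w"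
    using assms by (intro primitive_parallel_eq[of _ _ c]) (auto simp: is_ray_def nat_vec_def real_vec_nat_vec[unfolded nat_vec_def])
  then show ?thesis using assms unfolding is_ray_def nat_vec_def vec_eq_iff
    by (metis int_nat_eq vec_lambda_beta)
qed

lemma aff_dim_newton_polyhedron:
  fixes f :: "('n::finite, 'a::zero) mpoly"
  assumes "f \<noteq> 0"
  shows "aff_dim (newton_polyhedron f) = int CARD('n)"
proof -
  obtain w where w: "w \<in> Poly_Mapping.keys f" using assms by (meson all_not_in_conv keys_eq_empty)
  let ?B = "box (real_vec w) (real_vec w + 1)"
  have "?B \<subseteq> newton_polyhedron f"
  proof
    fix x assume "x \<in> ?B"
    then have "real_vec w + (x - real_vec w) \<in> newton_polyhedron f"
      using w by (intro newton_polyhedron_memI) (auto simp: mem_box_cart less_imp_le)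
    then show "x \<in> newton_polyhedron f" by simp
  qed
  then have "aff_dim ?B \<le> aff_dim (newton_polyhedron f)" by (rule aff_dim_subset)
  moreover have "?B \<noteq> {}"
  proof -
    have "real_vec w + (\<chi> i. 1/2) \<in> ?B" by (simp add: mem_box_cart)
    then show ?thesis by blast
  qed
  then have "aff_dim ?B = int DIM(real ^ 'n)" by (intro aff_dim_open open_box)
  ultimately show ?thesis using aff_dim_le_DIM[of "newton_polyhedron f"] by simp
qed

text \<open>The dictionary from rays to facets. The orthogonal complement of the directions of the
  face is the line of \<open>v\<close>, so the face has dimension 2 and the \<open>THE\<close> in
  \<open>facet_normal\<close> selects \<open>v\<close>; the infimum in \<open>newton_m\<close> is
  attained at an exponent of the face.\<close>

lemma is_ray_facet:
  assumes f: "f \<noteq> 0" and v: "is_ray f v"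
  shows "newton_facet f (wt_face f v)" "facet_normal (wt_face f v) = nat_vec v"
    "newton_m f (nat_vec v) = real_of_int (wmin f v)"
    "newton_sigma (nat_vec v) = real_of_int (\<Sum>i\<in>UNIV. v $ i)"
proof -
  have v0: "0 \<le> v $ i" for i using v unfolding is_ray_def by blast
  have vn: "v \<noteq> 0" using v unfolding is_ray_def by blast
  note rv = real_vec_nat_vec[OF v0]
  obtain A where A: "A \<in> wface f v" using wface_nonempty[OF f] by blast
  let ?T = "wt_face f v"
  have AT: "real_vec A \<in> ?T" using A by (rule real_vec_in_wt_face)
  \<comment> \<open>The face contains a ray in every coordinate direction of weight 0, which makes
    that coordinate of \<open>d\<close> vanish.\<close>
  have perp: "\<exists>c. d = c *\<^sub>R int_vec v" if d: "\<And>x y. x \<in> ?T \<Longrightarrow> y \<in> ?T \<Longrightarrow> d \<bullet> (x - y) = 0" for d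
  proof -
    have "d $ j = 0" if j: "v $ j = 0" for j
    proof -
      have "real_vec A + 1 *\<^sub>R axis j 1 \<in> ?T" by (rule wt_face_add_axis[OF AT j]) simp
      then have "d \<bullet> (real_vec A + axis j 1 - real_vec A) = 0" using AT by (intro d) simp_all
      then show ?thesis by (simp add: inner_axis)
    qed
    then have "tight f v d" unfolding tight_def using d real_vec_in_wt_face by blast
    then show ?thesis using v unfolding is_ray_def by blast
  qed
  have vT: "int_vec v \<bullet> (x - y) = 0" if "x \<in> ?T" "y \<in> ?T" for x y
    using that unfolding wt_face_def by (simp add: inner_diff_right)
  show "newton_m f (nat_vec v) = real_of_int (wmin f v)"
    unfolding newton_m_def rv
  proof (rule cInf_eq_minimum)
    show "real_of_int (wmin f v) \<in> (\<bullet>) (int_vec v) ` newton_polyhedron f"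
      using AT unfolding wt_face_def by (intro image_eqI[of _ _ "real_vec A"]) auto
  qed (auto intro: wmin_le_inner[OF v0])
  show "newton_sigma (nat_vec v) = real_of_int (\<Sum>i\<in>UNIV. v $ i)"
    using v0 by (simp add: newton_sigma_def nat_vec_def)
  show "facet_normal ?T = nat_vec v" unfolding facet_normal_def
  proof (rule the_equality)
    show "nat_vec v \<noteq> 0 \<and> Gcd (range (\<lambda>i. nat_vec v $ i)) = 1 \<and> (\<forall>x\<in>?T. \<forall>y\<in>?T. real_vec (nat_vec v) \<bullet> (x - y) = 0)"
    proof (intro conjI ballI)
      show "nat_vec v \<noteq> 0"
      proof
        assume "nat_vec v = 0"
        then have "v $ i \<le> 0" for i by (simp add: nat_vec_def vec_eq_iff)
        then have "v = 0" using v0 by (simp add: vec_eq_iff order_antisym)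
        then show False using vn by simp
      qed
      show "Gcd (range (\<lambda>i. nat_vec v $ i)) = 1" using v by (simp add: is_ray_def nat_vec_def)
    qed (simp add: rv vT)
  next
    fix u :: "nat ^ 3"
    assume u: "u \<noteq> 0 \<and> Gcd (range (\<lambda>i. u $ i)) = 1 \<and> (\<forall>x\<in>?T. \<forall>y\<in>?T. real_vec u \<bullet> (x - y) = 0)"
    then obtain c where "real_vec u = c *\<^sub>R int_vec v" using perp by blast
    then have "real_vec u = c *\<^sub>R real_vec (nat_vec v)" unfolding rv .
    moreover have "Gcd (range (\<lambda>i. nat_vec v $ i)) = 1" using v by (simp add: is_ray_def nat_vec_def)
    ultimately have "nat_vec v = u" using u primitive_parallel_eq by blast
    then show "u = nat_vec v" by simp
  qed
  have "aff_dim ?T = 2"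
  proof -
    define U where "U = span ((+) (- real_vec A) ` ?T)"
    have "{y \<in> UNIV. \<forall>x\<in>U. orthogonal x y} = span {int_vec v}"
    proof (intro equalityI subsetI)
      fix y assume y: "y \<in> {y \<in> UNIV. \<forall>x\<in>U. orthogonal x y}"
      have "y \<bullet> (x - x') = 0" if "x \<in> ?T" "x' \<in> ?T" for x x'
      proof -
        have "- real_vec A + x \<in> U" "- real_vec A + x' \<in> U" unfolding U_def using that by (auto intro: span_base)
        then have "(- real_vec A + x) \<bullet> y = 0" "(- real_vec A + x') \<bullet> y = 0" using y by (auto simp: orthogonal_def)
        then show ?thesis by (simp add: inner_diff_right inner_diff_left inner_add_left inner_commute)
      qed
      then obtain c where "y = c *\<^sub>R int_vec v" using perp by blast
      then show "y \<in> span {int_vec v}" unfolding span_singleton by blast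
    next
      fix y assume "y \<in> span {int_vec v}"
      then obtain c where y: "y = c *\<^sub>R int_vec v" by (auto simp: span_singleton)
      have "orthogonal y x" if "x \<in> U" for x
        using that unfolding U_def
      proof (rule orthogonal_to_span)
        fix z assume "z \<in> (+) (- real_vec A) ` ?T"
        then show "orthogonal y z" using vT[OF _ AT] unfolding y by (auto simp: orthogonal_def)
      qed
      then show "y \<in> {y \<in> UNIV. \<forall>x\<in>U. orthogonal x y}" by (simp add: orthogonal_commute)
    qed
    then have "dim (span {int_vec v}) + dim U = dim (UNIV :: (real ^ 3) set)"
      using dim_subspace_orthogonal_to_vectors[of U UNIV] unfolding U_def by simp
    moreover have "dim (span {int_vec v}) = 1" using vn by (simp add: dim_insert)
    ultimately have "dim U = 2" by simp
    then show ?thesis using aff_dim_eq_dim[of "real_vec A" ?T] AT unfolding U_def by (simp add: hull_inc)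
  qed
  then show "newton_facet f ?T"
    unfolding newton_facet_def using newton_face_wt_face[OF f v0] aff_dim_newton_polyhedron[OF f] by simp
qed

subsection \<open>The combinatorics of a B1-facet\<close>

text \<open>The common core of both kinds of B1-facets. Exponents at height 1 other than
  \<open>C\<close> arise only in the noncompact case, beyond \<open>C\<close> in a free direction
  \<open>j\<close>; a positive weight is smaller at \<open>C\<close>, so they never lie on its
  face.\<close>

definition b1_apex :: "(3, 'a::zero) mpoly \<Rightarrow> int ^ 3 \<Rightarrow> 3 \<Rightarrow> nat ^ 3 \<Rightarrow> bool" where
  "b1_apex f v i C \<longleftrightarrow> 0 < v $ i \<and> C \<in> wface f v \<and> C $ i = 1 \<and> (\<exists>A\<in>wface f v. A $ i = 0) \<and>
     (\<forall>w\<in>wface f v. w $ i = 0 \<or> (w $ i = 1 \<and>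
        (w = C \<or> (\<exists>j. v $ j = 0 \<and> C $ j < w $ j \<and> (\<forall>l. l \<noteq> j \<longrightarrow> w $ l = C $ l)))))"

lemma noncompact_for_iff:
  assumes f: "f \<noteq> 0" and v0: "\<And>i. 0 \<le> v $ i"
  shows "noncompact_for j (wt_face f v) \<longleftrightarrow> v $ j = 0"
proof
  obtain A where "A \<in> wface f v" using wface_nonempty[OF f] by blast
  then have A: "real_vec A \<in> wt_face f v" by (rule real_vec_in_wt_face)
  assume "noncompact_for j (wt_face f v)"
  then have "real_vec A + axis j 1 \<in> wt_face f v" using A unfolding noncompact_for_def by blast
  then have "int_vec v \<bullet> axis j 1 = 0" using A unfolding wt_face_def by (simp add: inner_add_right)
  then show "v $ j = 0" by (simp add: inner_axis)
next
  assume "v $ j = 0"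
  then show "noncompact_for j (wt_face f v)"
    unfolding noncompact_for_def using wt_face_add_axis[of _ f v j 1] by simp
qed

text \<open>Otherwise the hull would lie in an open half space. Applied to a negated set, the lemma
  also finds maximal coordinates.\<close>

lemma convex_hull_coord_extreme:
  fixes S :: "(real ^ 'n::finite) set"
  assumes a: "a \<in> convex hull S" and c: "\<And>y. y \<in> S \<Longrightarrow> c \<le> y $ i" and ac: "a $ i \<le> c"
  shows "\<exists>y\<in>S. y $ i = c"
proof (rule ccontr)
  assume "\<not> ?thesis"
  then have "S \<subseteq> {y. axis i 1 \<bullet> y > c}" using c by (force simp: inner_axis')
  then have "convex hull S \<subseteq> {y. axis i 1 \<bullet> y > c}" by (rule hull_minimal) (rule convex_halfspace_gt)
  then show False using a ac by (auto simp: inner_axis')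
qed

text \<open>A simplex is bounded, which forces all weights to be positive; the face is then the hull
  of its exponents, and the heights 0 and 1 are attained at exponents.\<close>

lemma B1_simplex_apex:
  assumes f: "f \<noteq> 0" and v0: "\<And>i. 0 \<le> v $ i" and B1: "B1_simplex i (wt_face f v)"
  shows "\<exists>C. b1_apex f v i C"
proof -
  let ?T = "wt_face f v"
  obtain S where S: "\<not> affine_dependent S" "card S = 3" "?T = convex hull S"
    using B1 unfolding B1_simplex_def simplex_def by auto
  have finS: "finite S" using S(2) by (metis card.infinite zero_neq_numeral)
  have ext: "x extreme_point_of ?T \<longleftrightarrow> x \<in> S" for x
    unfolding S(3) by (rule extreme_point_of_convex_hull_affine_independent[OF S(1)])
  define S0 S1 where "S0 = {x \<in> S. x $ i = 0}" and "S1 = {x \<in> S. x $ i = 1}"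
  have c0: "card S0 = 2" and c1: "card S1 = 1"
    using B1 unfolding B1_simplex_def ext S0_def S1_def by auto
  have "S0 \<union> S1 = S"
  proof (rule card_subset_eq[OF finS])
    have "card (S0 \<union> S1) = 3" using c0 c1 finS by (subst card_Un_disjoint) (auto simp: S0_def S1_def)
    then show "card (S0 \<union> S1) = card S" using S(2) by simp
  qed (auto simp: S0_def S1_def)
  moreover obtain c where c: "S1 = {c}" using c1 by (auto simp: card_1_singleton_iff)
  ultimately have Sc: "S = insert c S0" "c \<notin> S0" by (auto simp: S0_def S1_def)
  have ci: "c $ i = 1" using c by (auto simp: S1_def)
  \<comment> \<open>The coordinate \<open>i\<close> of a point of the simplex is its barycentric
    weight at the vertex \<open>c\<close>.\<close>
  have coord: "0 \<le> x $ i" "x $ i \<le> 1" "x $ i = 1 \<Longrightarrow> x = c" if x: "x \<in> ?T" for x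
  proof -
    obtain u where u: "\<forall>y\<in>S. 0 \<le> u y" "sum u S = 1" "(\<Sum>y\<in>S. u y *\<^sub>R y) = x"
      using x finS unfolding S(3) by (auto simp: convex_hull_finite)
    have finS0: "finite S0" using finS unfolding S0_def by simp
    have "x $ i = (\<Sum>y\<in>S. u y * y $ i)" unfolding u(3)[symmetric] by simp
    also have "\<dots> = u c * c $ i + (\<Sum>y\<in>S0. u y * y $ i)" unfolding Sc(1) using Sc(2) finS0 by simp
    also have "(\<Sum>y\<in>S0. u y * y $ i) = 0" by (rule sum.neutral) (auto simp: S0_def)
    finally have xi: "x $ i = u c" using ci by simp
    have s: "u c + sum u S0 = 1" using u(2) Sc finS0 by simp
    have p: "0 \<le> u y" if "y \<in> S0" for y using u(1) that Sc(1) by auto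
    then have "0 \<le> sum u S0" by (rule sum_nonneg)
    then show "0 \<le> x $ i" "x $ i \<le> 1" using xi s u(1) Sc(1) by auto
    assume "x $ i = 1"
    then have uc: "u c = 1" "sum u S0 = 0" using xi s by auto
    then have "\<forall>y\<in>S0. u y = 0" using p finS0 by (subst (asm) sum_nonneg_eq_0_iff) auto
    then show "x = c" using u(3) Sc finS0 uc(1) by simp
  qed
  have comp: "bounded ?T" unfolding S(3) using finS by (intro compact_imp_bounded finite_imp_compact_convex_hull)
  have vpos: "v $ j > 0" for j
  proof (rule ccontr)
    assume "\<not> v $ j > 0"
    then have vj: "v $ j = 0" using v0[of j] by simp
    obtain B where B: "\<And>x. x \<in> ?T \<Longrightarrow> norm x \<le> B" using comp by (auto simp: bounded_iff)
    have cT: "c \<in> ?T" unfolding S(3) using Sc(1) by (simp add: hull_inc)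
    let ?x = "c + (\<bar>B\<bar> + \<bar>c $ j\<bar> + 1) *\<^sub>R axis j 1"
    have "?x \<in> ?T" by (rule wt_face_add_axis[OF cT vj]) simp
    then have "norm ?x \<le> B" by (rule B)
    moreover have "\<bar>?x $ j\<bar> \<le> norm ?x" by (rule component_le_norm_cart)
    ultimately show False by (simp add: axis_def)
  qed
  note T = compact_wt_face(1)[OF vpos]
  have W: "w $ i = 0 \<or> w $ i = 1" "w $ i = 1 \<Longrightarrow> real_vec w = c" if "w \<in> wface f v" for w
    using coord[OF real_vec_in_wt_face[OF that]] by auto
  have "c \<in> convex hull (real_vec ` wface f v)" using Sc(1) unfolding T[symmetric] S(3) by (simp add: hull_inc)
  then have "- c \<in> convex hull (uminus ` real_vec ` wface f v)"
    by (metis convex_hull_linear_image image_eqI linear_uminus)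
  then have "\<exists>y\<in>uminus ` real_vec ` wface f v. y $ i = -1"
    by (rule convex_hull_coord_extreme) (use W ci in force)+
  then obtain C where C: "C \<in> wface f v" "C $ i = 1" by auto
  obtain a where a: "a \<in> S0" using c0 by fastforce
  then have "a \<in> convex hull (real_vec ` wface f v)" unfolding T[symmetric] S(3) Sc(1) by (simp add: hull_inc)
  then have "\<exists>y\<in>real_vec ` wface f v. y $ i = 0"
    by (rule convex_hull_coord_extreme) (use a in \<open>auto simp: S0_def\<close>)
  then obtain A where A: "A \<in> wface f v" "A $ i = 0" by auto
  have "w = C" if "w \<in> wface f v" "w $ i = 1" for w
    using W(2)[OF that] W(2)[OF C] real_vec_inject by metis
  then have "b1_apex f v i C" unfolding b1_apex_def using C A W(1) vpos by blast
  then show ?thesis by blast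
qed

text \<open>On the projected segment the coordinate \<open>i\<close> runs from 0 to 1, so all
  exponents at height 1 project to \<open>b\<close> and differ only in the free coordinate
  \<open>j\<close>. The apex is the one with the least coordinate \<open>j\<close>.\<close>

lemma noncompact_B1_apex:
  assumes f: "f \<noteq> 0" and v0: "\<And>i. 0 \<le> v $ i" and B1: "noncompact_B1 i (wt_face f v)"
  shows "\<exists>C. b1_apex f v i C"
proof -
  let ?T = "wt_face f v"
  obtain j a b where j: "{l. noncompact_for l ?T} = {j}" "j \<noteq> i" and seg: "forget_coord j ` ?T = closed_segment a b"
      and ab: "a $ i = 0" "b $ i = 1"
    using B1 unfolding noncompact_B1_def by blast
  have vj: "v $ l = 0 \<longleftrightarrow> l = j" for l using j(1) noncompact_for_iff[OF f v0] by auto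
  have vi: "0 < v $ i" using vj[of i] j(2) v0[of i] by auto
  have fi: "forget_coord j x $ i = x $ i" for x using j(2) by (simp add: forget_coord_def)
  have co: "0 \<le> x $ i \<and> x $ i \<le> 1 \<and> (x $ i = 1 \<longrightarrow> forget_coord j x = b)" if x: "x \<in> ?T" for x
  proof -
    have "forget_coord j x \<in> closed_segment a b" using x seg by blast
    then obtain t where t: "0 \<le> t" "t \<le> 1" "forget_coord j x = (1 - t) *\<^sub>R a + t *\<^sub>R b"
      by (auto simp: closed_segment_def)
    have "x $ i = t" using t(3) ab fi[of x] by simp
    then show ?thesis using t by auto
  qed
  have W: "w $ i = 0 \<or> w $ i = 1" if "w \<in> wface f v" for w
    using co[OF real_vec_in_wt_face[OF that]] by auto
  have ex0: "\<exists>A\<in>wface f v. A $ i = 0"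
  proof -
    have "a \<in> forget_coord j ` ?T" unfolding seg by simp
    then obtain x where x: "x \<in> ?T" "forget_coord j x = a" by blast
    then have xi: "x $ i = 0" using fi[of x] ab by simp
    obtain q r where qr: "x = q + r" "q \<in> convex hull (real_vec ` wface f v)" "\<And>l. 0 \<le> r $ l"
      using wt_face_decomp[OF v0 x(1)] by metis
    have "q $ i \<le> 0" using xi qr(1) qr(3)[of i] by simp
    then have "\<exists>y\<in>real_vec ` wface f v. y $ i = 0"
      by (intro convex_hull_coord_extreme[OF qr(2)]) auto
    then show ?thesis by auto
  qed
  have ex1: "\<exists>C\<in>wface f v. C $ i = 1"
  proof -
    have "b \<in> forget_coord j ` ?T" unfolding seg by simp
    then obtain x where x: "x \<in> ?T" "forget_coord j x = b" by blast
    then have xi: "x $ i = 1" using fi[of x] ab by simp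
    obtain q r where qr: "x = q + r" "q \<in> convex hull (real_vec ` wface f v)" "\<And>l. 0 \<le> r $ l" "\<And>l. v $ l \<noteq> 0 \<Longrightarrow> r $ l = 0"
      using wt_face_decomp[OF v0 x(1)] by metis
    have qi: "q $ i = 1" using xi qr(1) qr(4)[of i] vi by simp
    have "- q \<in> convex hull (uminus ` real_vec ` wface f v)"
      using qr(2) by (metis convex_hull_linear_image image_eqI linear_uminus)
    then have "\<exists>y\<in>uminus ` real_vec ` wface f v. y $ i = -1"
      by (rule convex_hull_coord_extreme) (use W qi in force)+
    then show ?thesis by auto
  qed
  obtain C0 where "C0 \<in> wface f v \<and> C0 $ i = 1" using ex1 by blast
  from ex_has_least_nat[of "\<lambda>w. w \<in> wface f v \<and> w $ i = 1", OF this, of "\<lambda>w. w $ j"]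
  obtain C where C: "C \<in> wface f v \<and> C $ i = 1"
    and Cmin: "\<And>w. w \<in> wface f v \<Longrightarrow> w $ i = 1 \<Longrightarrow> C $ j \<le> w $ j"
    by blast
  have "w = C \<or> (\<exists>j. v $ j = 0 \<and> C $ j < w $ j \<and> (\<forall>l. l \<noteq> j \<longrightarrow> w $ l = C $ l))"
    if w: "w \<in> wface f v" "w $ i = 1" for w
  proof -
    have "forget_coord j (real_vec w) = b" "forget_coord j (real_vec C) = b"
      using co[OF real_vec_in_wt_face[OF w(1)]] co[OF real_vec_in_wt_face[of C f v]] w C by auto
    then have fc: "forget_coord j (real_vec w) $ l = forget_coord j (real_vec C) $ l" for l by simp
    have "w $ l = C $ l" if "l \<noteq> j" for l using fc[of l] that by (simp add: forget_coord_def)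
    then have eq: "\<forall>l. l \<noteq> j \<longrightarrow> w $ l = C $ l" by blast
    show ?thesis
    proof (cases "w $ j = C $ j")
      case True
      then have "w = C" using eq by (auto simp: vec_eq_iff)
      then show ?thesis by simp
    next
      case False
      then have "C $ j < w $ j" using Cmin[OF w] by simp
      then show ?thesis using eq vj by blast
    qed
  qed
  then have "b1_apex f v i C" unfolding b1_apex_def using C ex0 W vi by blast
  then show ?thesis by blast
qed

lemma B1_facet_apex:
  assumes "f \<noteq> 0" "\<And>i. 0 \<le> v $ i" "B1_facet f i (wt_face f v)"
  shows "\<exists>C. b1_apex f v i C"
  using assms B1_simplex_apex noncompact_B1_apex unfolding B1_facet_def by blast

subsection \<open>Cones of the dual fan\<close>

text \<open>The closed cone of the normal fan dual to an exponent \<open>A\<close>: the nonnegative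
  directions whose minimum over the polyhedron is attained at \<open>A\<close>.\<close>

definition newton_cone :: "(3, 'a::zero) mpoly \<Rightarrow> nat ^ 3 \<Rightarrow> (real ^ 3) set" where
  "newton_cone f A = {x. (\<forall>i. 0 \<le> x $ i) \<and> (\<forall>w\<in>Poly_Mapping.keys f. 0 \<le> x \<bullet> (real_vec w - real_vec A))}"

definition rays_at :: "(3, 'a::zero) mpoly \<Rightarrow> nat ^ 3 \<Rightarrow> (int ^ 3) set" where
  "rays_at f A = {v. is_ray f v \<and> A \<in> wface f v}"

text \<open>The exponents of its face and its zero coordinates decide which vectors are tight, so
  they determine a primitive ray.\<close>

lemma finite_rays: "finite {v. is_ray f v}"
proof (rule finite_imageD)
  let ?h = "\<lambda>v. (wface f v, {j. v $ j = 0})"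
  show "finite (?h ` {v. is_ray f v})"
    by (rule finite_subset[of _ "Pow (Poly_Mapping.keys f) \<times> Pow UNIV"]) (auto simp: wface_def)
  show "inj_on ?h {v. is_ray f v}"
  proof (rule inj_onI)
    fix v w assume v: "v \<in> {v. is_ray f v}" "w \<in> {v. is_ray f v}" and eq: "?h v = ?h w"
    have "tight f v (int_vec w)"
    proof -
      have "wface f v = wface f w" "\<forall>j. v $ j = 0 \<longrightarrow> w $ j = 0" using eq by auto
      then show ?thesis unfolding tight_def
        by (auto simp: inner_diff_right inner_int_vec wface_def)
    qed
    then obtain c where "int_vec w = c *\<^sub>R int_vec v" using v unfolding is_ray_def by blast
    then show "v = w" using v is_ray_parallel_eq by blast
  qed
qed

lemma exists_small_perturbation:
  fixes \<alpha> \<beta> :: "'s \<Rightarrow> real"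
  assumes "finite S" "\<And>s. s \<in> S \<Longrightarrow> 0 < \<alpha> s"
  shows "\<exists>e>0. \<forall>s\<in>S. e * \<bar>\<beta> s\<bar> \<le> \<alpha> s"
  using assms
proof (induction S rule: finite_induct)
  case (insert s S)
  then obtain e where e: "e > 0" "\<forall>s\<in>S. e * \<bar>\<beta> s\<bar> \<le> \<alpha> s" by auto
  let ?e = "min e (\<alpha> s / (\<bar>\<beta> s\<bar> + 1))"
  have as: "0 < \<alpha> s" using insert by simp
  have pos: "?e > 0" using e as by simp
  have "?e * \<bar>\<beta> s\<bar> \<le> \<alpha> s / (\<bar>\<beta> s\<bar> + 1) * \<bar>\<beta> s\<bar>" by (intro mult_right_mono) auto
  also have "\<dots> \<le> \<alpha> s" using as by (simp add: field_simps)
  finally have "?e * \<bar>\<beta> s\<bar> \<le> \<alpha> s" .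
  moreover have "?e * \<bar>\<beta> t\<bar> \<le> \<alpha> t" if "t \<in> S" for t
  proof -
    have "?e * \<bar>\<beta> t\<bar> \<le> e * \<bar>\<beta> t\<bar>" by (intro mult_right_mono) auto
    then show ?thesis using e(2) that by fastforce
  qed
  ultimately show ?case using pos by (intro exI[of _ ?e]) auto
qed (auto intro: exI[of _ 1])

lemma cross3_int_vec: "\<exists>q. cross3 (int_vec a) (int_vec b) = int_vec q"
  by (rule exI[of _ "vector [a$2 * b$3 - a$3 * b$2, a$3 * b$1 - a$1 * b$3, a$1 * b$2 - a$2 * b$1]"])
    (simp add: vec_eq_iff cross3_def forall_3)

text \<open>The cross product of two independent integral normals spans the line; if all normals
  were parallel, the solutions would form more than a line.\<close>

lemma integral_line:
  fixes N :: "(int ^ 3) set" and e :: "real ^ 3"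
  assumes e: "e \<noteq> 0" "\<And>n. n \<in> N \<Longrightarrow> int_vec n \<bullet> e = 0"
    and line: "\<And>d. (\<And>n. n \<in> N \<Longrightarrow> int_vec n \<bullet> d = 0) \<Longrightarrow> \<exists>c. d = c *\<^sub>R e"
  obtains q c where "q \<noteq> 0" "int_vec q = c *\<^sub>R e"
proof -
  have "\<exists>m\<in>N. \<exists>n\<in>N. cross3 (int_vec m) (int_vec n) \<noteq> 0"
  proof (rule ccontr)
    assume "\<not> ?thesis"
    then have par: "cross3 (int_vec m) (int_vec n) = 0" if "m \<in> N" "n \<in> N" for m n using that by blast
    have False if y: "y \<noteq> 0" "y \<bullet> e = 0" "\<And>n. n \<in> N \<Longrightarrow> int_vec n \<bullet> y = 0" for y
    proof -
      obtain c where "y = c *\<^sub>R e" using line[OF y(3)] by blast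
      then show False using y(1,2) by simp
    qed
    note * = this
    show False
    proof (cases "\<exists>m\<in>N. m \<noteq> 0")
      case True
      then obtain m where m: "m \<in> N" "m \<noteq> 0" by blast
      let ?y = "cross3 (int_vec m) e"
      have "int_vec n \<bullet> ?y = 0" if n: "n \<in> N" for n
      proof -
        have "int_vec n \<bullet> cross3 (int_vec m) e = cross3 (int_vec n) (int_vec m) \<bullet> e"
          by (simp add: cross3_def inner_vec_def sum_3 algebra_simps)
        then show ?thesis using par[OF n m(1)] by simp
      qed
      moreover have "?y \<bullet> e = 0" by (simp add: dot_cross_self)
      moreover have "?y \<noteq> 0"
      proof
        assume "?y = 0"
        then have "norm (cross3 (int_vec m) e)^2 = 0" by simp
        then have "(norm (int_vec m) * norm e)^2 = 0" using e(2)[OF m(1)] norm_and_cross_eq_0[of "int_vec m" e] \<open>?y = 0\<close> by auto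
        then show False using m e by simp
      qed
      ultimately show False using * by blast
    next
      case False
      obtain y :: "real ^ 3" where "y \<noteq> 0" "orthogonal e y"
        using orthogonal_to_vector_exists[of e] by auto
      moreover have "int_vec n \<bullet> y = 0" if "n \<in> N" for n using False that by auto
      ultimately show False using *[of y] by (auto simp: orthogonal_def inner_commute)
    qed
  qed
  then obtain m n where mn: "m \<in> N" "n \<in> N" "cross3 (int_vec m) (int_vec n) \<noteq> 0" by blast
  obtain q where q: "cross3 (int_vec m) (int_vec n) = int_vec q" using cross3_int_vec by blast
  have qn: "q \<noteq> 0" using mn(3) q by auto
  have "cross3 e (cross3 (int_vec m) (int_vec n)) = 0"
    using e(2)[OF mn(1)] e(2)[OF mn(2)] by (simp add: Lagrange inner_commute)
  then have "collinear {0, e, int_vec q}" unfolding q by (simp add: cross_eq_0)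
  then obtain c where "int_vec q = c *\<^sub>R e" using e(1) by (auto simp: collinear_lemma)
  then show ?thesis by (rule that[OF qn])
qed

lemma wface_eq_cone:
  assumes A: "A \<in> Poly_Mapping.keys f" and v: "int_vec v \<in> newton_cone f A"
  shows "wmin f v = wt v A" "w \<in> wface f v \<longleftrightarrow> w \<in> Poly_Mapping.keys f \<and> wt v w = wt v A"
proof -
  have "wt v A \<le> wt v w" if "w \<in> Poly_Mapping.keys f" for w
  proof -
    have "0 \<le> int_vec v \<bullet> (real_vec w - real_vec A)" using v that unfolding newton_cone_def by blast
    then have "real_of_int (wt v A) \<le> real_of_int (wt v w)" by (simp add: inner_diff_right inner_int_vec)
    then show ?thesis by (simp only: of_int_le_iff)
  qed
  then show 1: "wmin f v = wt v A" unfolding wmin_def using A by (intro Min_eqI) auto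
  show "w \<in> wface f v \<longleftrightarrow> w \<in> Poly_Mapping.keys f \<and> wt v w = wt v A"
    unfolding wface_def 1 by blast
qed

text \<open>At an extreme point of the slice the active constraints leave only the line through it:
  any further direction, made tangent to the slice, could be followed a little both ways. The active
  constraints are integral, so this line contains a primitive integral vector.\<close>

lemma extreme_slice_ray:
  assumes A: "A \<in> Poly_Mapping.keys f"
    and e: "e extreme_point_of {x \<in> newton_cone f A. (\<Sum>i\<in>UNIV. x $ i) = 1}"
  obtains v c where "v \<in> rays_at f A" "e = c *\<^sub>R int_vec v" "0 \<le> c"
proof -
  let ?V = "Poly_Mapping.keys f"
  let ?P = "{x \<in> newton_cone f A. (\<Sum>i\<in>UNIV. x $ i) = 1}"
  define T where "T = {w \<in> ?V. e \<bullet> (real_vec w - real_vec A) = 0}"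
  define N where "N = (\<lambda>w. \<chi> i. int (w $ i) - int (A $ i)) ` T \<union> (\<lambda>j. axis j 1) ` {j. e $ j = 0}"
  have eP: "e \<in> newton_cone f A" "(\<Sum>i\<in>UNIV. e $ i) = 1" using e by (auto simp: extreme_point_of_def)
  have e0: "e \<noteq> 0" using eP(2) by auto
  have ivT: "int_vec (\<chi> i. int (w $ i) - int (A $ i)) = real_vec w - real_vec A" for w :: "nat ^ 3" by (simp add: vec_eq_iff)
  have ivj: "int_vec (axis j 1) = axis j 1" for j :: 3 by (simp add: vec_eq_iff axis_def)
  have line: "\<exists>c. d = c *\<^sub>R e" if d: "\<And>n. n \<in> N \<Longrightarrow> int_vec n \<bullet> d = 0" for d
  proof -
    have dT: "d \<bullet> (real_vec w - real_vec A) = 0" if "w \<in> T" for w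
      using d[of "\<chi> i. int (w $ i) - int (A $ i)"] that unfolding N_def ivT by (auto simp: ivT inner_commute)
    have dj: "d $ j = 0" if "e $ j = 0" for j
      using d[of "axis j 1"] that unfolding N_def by (auto simp: ivj inner_axis')
    \<comment> \<open>Subtracting a multiple of \<open>e\<close> makes the coordinates sum to 0, so
      that moving along \<open>d'\<close> stays in the slice.\<close>
    define d' where "d' = d - (\<Sum>i\<in>UNIV. d $ i) *\<^sub>R e"
    have s0: "(\<Sum>i\<in>UNIV. d' $ i) = 0"
      unfolding d'_def using eP(2) by (simp add: sum_subtractf flip: sum_distrib_left)
    have d'T: "d' \<bullet> (real_vec w - real_vec A) = 0" if "w \<in> T" for w
      using dT[OF that] that unfolding d'_def T_def by (simp add: inner_diff_left)
    have d'j: "d' $ j = 0" if "e $ j = 0" for j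
      using dj[OF that] that unfolding d'_def by simp
    have "d' = 0"
    proof (rule ccontr)
      assume nz: "d' \<noteq> 0"
      have "\<exists>h>0. \<forall>w\<in>?V - T. h * \<bar>d' \<bullet> (real_vec w - real_vec A)\<bar> \<le> e \<bullet> (real_vec w - real_vec A)"
      proof (rule exists_small_perturbation)
        fix w assume w: "w \<in> ?V - T"
        then have "0 \<le> e \<bullet> (real_vec w - real_vec A)" using eP(1) unfolding newton_cone_def by blast
        then show "0 < e \<bullet> (real_vec w - real_vec A)" using w unfolding T_def by auto
      qed simp
      then obtain h1 where h1: "h1 > 0" "\<And>w. w \<in> ?V - T \<Longrightarrow> h1 * \<bar>d' \<bullet> (real_vec w - real_vec A)\<bar> \<le> e \<bullet> (real_vec w - real_vec A)"
        by blast
      have "\<exists>h>0. \<forall>j\<in>{j. e $ j \<noteq> 0}. h * \<bar>d' $ j\<bar> \<le> e $ j"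
      proof (rule exists_small_perturbation)
        fix j assume "j \<in> {j. e $ j \<noteq> 0}"
        moreover have "0 \<le> e $ j" using eP(1) unfolding newton_cone_def by blast
        ultimately show "0 < e $ j" by auto
      qed simp
      then obtain h2 where h2: "h2 > 0" "\<And>j. e $ j \<noteq> 0 \<Longrightarrow> h2 * \<bar>d' $ j\<bar> \<le> e $ j" by blast
      define h where "h = min h1 h2"
      have h: "h > 0" "h \<le> h1" "h \<le> h2" using h1 h2 by (auto simp: h_def)
      have inP: "e + (z * h) *\<^sub>R d' \<in> ?P" if z: "\<bar>z\<bar> = 1" for z
      proof -
        have 1: "\<bar>z * h * y\<bar> = h * \<bar>y\<bar>" for y using z h(1) by (simp add: abs_mult)
        have "0 \<le> (e + (z * h) *\<^sub>R d') $ j" for j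
        proof (cases "e $ j = 0")
          case True
          then show ?thesis using d'j by simp
        next
          case False
          have "h * \<bar>d' $ j\<bar> \<le> h2 * \<bar>d' $ j\<bar>" using h by (intro mult_right_mono) auto
          then have "\<bar>z * h * d' $ j\<bar> \<le> e $ j" using h2(2)[OF False] unfolding 1 by linarith
          then show ?thesis by simp
        qed
        moreover have "0 \<le> (e + (z * h) *\<^sub>R d') \<bullet> (real_vec w - real_vec A)" if w: "w \<in> ?V" for w
        proof (cases "w \<in> T")
          case True
          then show ?thesis using d'T[OF True] unfolding T_def by (simp add: inner_add_left)
        next
          case False
          let ?y = "d' \<bullet> (real_vec w - real_vec A)"
          have "h * \<bar>?y\<bar> \<le> h1 * \<bar>?y\<bar>" using h by (intro mult_right_mono) auto
          then have "\<bar>z * h * ?y\<bar> \<le> e \<bullet> (real_vec w - real_vec A)" using h1(2)[of w] w False unfolding 1 by force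
          then show ?thesis by (simp add: inner_add_left)
        qed
        ultimately have "e + (z * h) *\<^sub>R d' \<in> newton_cone f A" unfolding newton_cone_def by blast
        moreover have "(\<Sum>i\<in>UNIV. (e + (z * h) *\<^sub>R d') $ i) = 1"
          using eP(2) s0 by (simp add: sum.distrib flip: sum_distrib_left)
        ultimately show ?thesis by blast
      qed
      let ?x = "e + (1 * h) *\<^sub>R d'" and ?y = "e + ((-1) * h) *\<^sub>R d'"
      have "e = midpoint ?x ?y" by (simp add: midpoint_def vec_eq_iff)
      moreover have "?x \<noteq> ?y" using nz h(1) by (auto simp: vec_eq_iff)
      ultimately have "e \<in> open_segment ?x ?y" by (metis midpoint_in_open_segment)
      moreover have "?x \<in> ?P" "?y \<in> ?P" using inP[of 1] inP[of "-1"] by auto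
      ultimately show False using e unfolding extreme_point_of_def by blast
    qed
    then show ?thesis unfolding d'_def by (intro exI[of _ "\<Sum>i\<in>UNIV. d $ i"]) simp
  qed
  have "int_vec n \<bullet> e = 0" if "n \<in> N" for n
    using that unfolding N_def T_def by (auto simp: ivT ivj inner_commute[of _ e] inner_axis)
  then obtain q c where q: "q \<noteq> 0" "int_vec q = c *\<^sub>R e" using integral_line[OF e0 _ line] by blast
  have e_nn: "0 \<le> e $ i" for i using eP(1) unfolding newton_cone_def by blast
  have c0: "c \<noteq> 0" using q by auto
  \<comment> \<open>The sign of \<open>q\<close> is not known, but \<open>e\<close> is nonnegative;
    absolute values turn \<open>q\<close> into a positive multiple of \<open>e\<close>.\<close>
  define q' where "q' = (\<chi> i. \<bar>q $ i\<bar>)"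
  have q': "real_of_int (q' $ i) = \<bar>c\<bar> * e $ i" for i
  proof -
    have "int_vec q $ i = (c *\<^sub>R e) $ i" unfolding q(2) ..
    then have "real_of_int (q $ i) = c * e $ i" by simp
    then show ?thesis using e_nn[of i] by (simp add: abs_mult q'_def)
  qed
  define D where "D = Gcd (range (\<lambda>i. nat (q' $ i)))"
  have Dd: "D dvd nat (q' $ i)" for i unfolding D_def by (rule Gcd_dvd) simp
  have q'0: "q' \<noteq> 0" using q(1) by (simp add: q'_def vec_eq_iff)
  have D0: "D \<noteq> 0"
  proof
    assume "D = 0"
    then have "nat (q' $ i) = 0" for i using Dd[of i] by simp
    then show False using q'0 by (simp add: q'_def vec_eq_iff)
  qed
  define v where "v = (\<chi> i. q' $ i div int D)"
  have vD: "q' $ i = int D * v $ i" for i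
  proof -
    have "int (nat (q' $ i)) = q' $ i" by (simp add: q'_def)
    moreover have "int D dvd int (nat (q' $ i))" using Dd[of i] by (simp only: int_dvd_int_iff)
    ultimately have "int D dvd q' $ i" by simp
    then show ?thesis by (simp add: v_def)
  qed
  have v0: "0 \<le> v $ i" for i unfolding v_def by (simp add: q'_def div_int_pos_iff)
  have ve: "int_vec v = (\<bar>c\<bar> / real D) *\<^sub>R e"
  proof -
    have "real D * real_of_int (v $ i) = \<bar>c\<bar> * e $ i" for i
      using q'[of i] unfolding vD[of i] by simp
    then show ?thesis using D0 by (simp add: vec_eq_iff field_simps)
  qed
  have ve': "e = (real D / \<bar>c\<bar>) *\<^sub>R int_vec v" unfolding ve using D0 c0 by simp
  have pos: "\<bar>c\<bar> / real D > 0" using c0 D0 by simp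
  have "Gcd (range (\<lambda>i. nat (v $ i))) = 1"
  proof -
    have "nat (q' $ i) = D * nat (v $ i)" for i unfolding vD by (simp add: nat_mult_distrib)
    then have eq: "range (\<lambda>i. nat (q' $ i)) = (*) D ` range (\<lambda>i. nat (v $ i))" by (auto simp: image_iff)
    have "D = Gcd ((*) D ` range (\<lambda>i. nat (v $ i)))" using D_def[unfolded eq] .
    also have "\<dots> = D * Gcd (range (\<lambda>i. nat (v $ i)))" by (simp add: Gcd_mult)
    finally show ?thesis using D0 by simp
  qed
  moreover have vn: "v \<noteq> 0" using e0 ve' by auto
  moreover have vcone: "int_vec v \<in> newton_cone f A"
    using eP(1) pos unfolding ve newton_cone_def by (auto intro!: mult_nonneg_nonneg)
  moreover have "\<exists>c. d = c *\<^sub>R int_vec v" if d: "tight f v d" for d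
  proof -
    note W = wface_eq_cone[OF A vcone]
    have Av: "A \<in> wface f v" using A W by simp
    have "int_vec n \<bullet> d = 0" if "n \<in> N" for n
      using that unfolding N_def
    proof (elim UnE imageE)
      fix w assume n: "n = (\<chi> i. int (w $ i) - int (A $ i))" and w: "w \<in> T"
      have "int_vec v \<bullet> (real_vec w - real_vec A) = 0" using w unfolding ve T_def by simp
      then have "real_of_int (wt v w) = real_of_int (wt v A)" by (simp add: inner_diff_right inner_int_vec)
      then have "w \<in> wface f v" using W w unfolding T_def by simp
      then show ?thesis using d Av unfolding tight_def n ivT by (simp add: inner_commute)
    next
      fix j assume n: "n = axis j 1" and j: "j \<in> {j. e $ j = 0}"
      have "int_vec v $ j = ((\<bar>c\<bar> / real D) *\<^sub>R e) $ j" unfolding ve ..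
      then have "real_of_int (v $ j) = 0" using j by simp
      then show ?thesis using d unfolding tight_def n ivj by (simp add: inner_axis')
    qed
    then obtain c' where "d = c' *\<^sub>R e" using line by blast
    then have "d = (c' * (real D / \<bar>c\<bar>)) *\<^sub>R int_vec v" by (subst (asm) ve') simp
    then show ?thesis by blast
  qed
  ultimately have "is_ray f v" unfolding is_ray_def using v0 by blast
  moreover have "A \<in> wface f v" using A wface_eq_cone[OF A vcone] by simp
  ultimately show ?thesis using that[of v "real D / \<bar>c\<bar>"] ve' unfolding rays_at_def by simp
qed

text \<open>The slice of coordinate sum 1 is compact and convex, hence the hull of its extreme
  points, and these lie on rays.\<close>

lemma newton_cone_generated:
  assumes A: "A \<in> Poly_Mapping.keys f" and x: "x \<in> newton_cone f A"
  obtains r where "\<And>v. 0 \<le> r v" "x = (\<Sum>v\<in>rays_at f A. r v *\<^sub>R int_vec v)"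
proof -
  let ?V = "Poly_Mapping.keys f"
  let ?P = "{x \<in> newton_cone f A. (\<Sum>i\<in>UNIV. x $ i) = 1}"
  let ?R = "rays_at f A"
  define G where "G = {x. \<exists>r. (\<forall>v. 0 \<le> r v) \<and> x = (\<Sum>v\<in>?R. r v *\<^sub>R int_vec v)}"
  have finR: "finite ?R" using finite_rays by (rule finite_subset[rotated]) (auto simp: rays_at_def)
  have GI: "y \<in> G" if "\<And>v. 0 \<le> r v" "y = (\<Sum>v\<in>?R. r v *\<^sub>R int_vec v)" for y r
    unfolding G_def using that by blast
  have convG: "convex G"
  proof (rule convexI)
    fix a b :: "real ^ 3" and s t :: real
    assume ab: "a \<in> G" "b \<in> G" and st: "0 \<le> s" "0 \<le> t" "s + t = 1"
    obtain r1 r2 where r: "\<forall>v. 0 \<le> r1 v" "a = (\<Sum>v\<in>?R. r1 v *\<^sub>R int_vec v)" "\<forall>v. 0 \<le> r2 v" "b = (\<Sum>v\<in>?R. r2 v *\<^sub>R int_vec v)"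
      using ab unfolding G_def by blast
    have "s *\<^sub>R a + t *\<^sub>R b = (\<Sum>v\<in>?R. (s * r1 v + t * r2 v) *\<^sub>R int_vec v)"
      unfolding r(2,4) by (simp add: scaleR_sum_right scaleR_add_left sum.distrib)
    then show "s *\<^sub>R a + t *\<^sub>R b \<in> G" using r st by (intro GI[of "\<lambda>v. s * r1 v + t * r2 v"]) auto
  qed
  have scaleG: "c *\<^sub>R y \<in> G" if "y \<in> G" "0 \<le> c" for c y
  proof -
    obtain r where r: "\<forall>v. 0 \<le> r v" "y = (\<Sum>v\<in>?R. r v *\<^sub>R int_vec v)" using \<open>y \<in> G\<close> unfolding G_def by blast
    have "c *\<^sub>R y = (\<Sum>v\<in>?R. (c * r v) *\<^sub>R int_vec v)" unfolding r(2) by (simp add: scaleR_sum_right)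
    then show ?thesis using r(1) \<open>0 \<le> c\<close> by (intro GI[of "\<lambda>v. c * r v"]) auto
  qed
  have rayG: "int_vec v \<in> G" if "v \<in> ?R" for v
  proof -
    have "int_vec v = (\<Sum>u\<in>?R. (if u = v then 1 else 0) *\<^sub>R int_vec u)"
      using that finR by (simp add: if_distrib[of "\<lambda>c. c *\<^sub>R _"] cong: if_cong)
    then show ?thesis by (intro GI[of "\<lambda>u. if u = v then 1 else 0"]) auto
  qed
  have xn: "0 \<le> x $ i" for i using x unfolding newton_cone_def by blast
  define s where "s = (\<Sum>i\<in>UNIV. x $ i)"
  have "x \<in> G"
  proof (cases "s = 0")
    case True
    then have "x = 0" unfolding s_def using xn by (subst (asm) sum_nonneg_eq_0_iff) (auto simp: vec_eq_iff)
    then show ?thesis by (intro GI[of "\<lambda>_. 0"]) auto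
  next
    case False
    then have s: "s > 0" unfolding s_def using xn by (simp add: sum_nonneg order_less_le)
    define y where "y = (1 / s) *\<^sub>R x"
    have ys: "(\<Sum>i\<in>UNIV. y $ i) = 1" unfolding y_def using s by (simp add: s_def flip: sum_divide_distrib)
    have yP: "y \<in> ?P" using x s ys unfolding newton_cone_def y_def by auto
    have Peq: "?P = (\<Inter>i. {x. axis i 1 \<bullet> x \<ge> 0}) \<inter> (\<Inter>w\<in>?V. {x. (real_vec w - real_vec A) \<bullet> x \<ge> 0}) \<inter> {x. 1 \<bullet> x = 1}"
      unfolding newton_cone_def by (auto simp: inner_axis' inner_commute[of _ "_ - _"] inner_vec_def[of 1])
    have cl: "closed ?P" unfolding Peq by (intro closed_Int closed_INT ballI closed_halfspace_ge closed_hyperplane)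
    have cv: "convex ?P" unfolding Peq by (intro convex_Int convex_INT convex_halfspace_ge convex_hyperplane)
    have "bounded ?P"
    proof (rule boundedI)
      fix z assume z: "z \<in> ?P"
      have "norm z \<le> (\<Sum>i\<in>UNIV. \<bar>z $ i\<bar>)" by (rule norm_le_l1_cart)
      also have "\<dots> = (\<Sum>i\<in>UNIV. z $ i)" using z by (intro sum.cong) (auto simp: newton_cone_def)
      finally show "norm z \<le> 1" using z by simp
    qed
    then have "compact ?P" using cl by (simp add: compact_eq_bounded_closed)
    then have "?P = convex hull {e. e extreme_point_of ?P}" using cv by (rule Krein_Milman_Minkowski)
    also have "\<dots> \<subseteq> G"
    proof (rule hull_minimal[where S = convex, OF _ convG], safe)
      fix e assume "e extreme_point_of ?P"
      then obtain v c where "v \<in> ?R" "e = c *\<^sub>R int_vec v" "0 \<le> c" using extreme_slice_ray[OF A] by blast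
      then show "e \<in> G" using scaleG rayG by simp
    qed
    finally have "y \<in> G" using yP by blast
    then have "s *\<^sub>R y \<in> G" using s by (intro scaleG) auto
    then show ?thesis unfolding y_def using s by simp
  qed
  then show ?thesis using that unfolding G_def by blast
qed

subsection \<open>Corners of the dual cones at a B1-facet\<close>

definition lin_form :: "int ^ 'n::finite \<Rightarrow> int ^ 'n \<Rightarrow> int" where
  "lin_form q k = (\<Sum>i\<in>UNIV. q $ i * k $ i)"

lemma inner_int_int: "int_vec q \<bullet> int_vec k = real_of_int (lin_form q k)"
  by (simp add: inner_vec_def lin_form_def)

lemma additive_lin_form: "additive_form (lin_form q)"
  by (simp add: additive_form_def lin_form_def distrib_left sum.distrib)

text \<open>As a linear form, \<open>C - A\<close> is nonnegative on the dual cone of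
  \<open>A\<close> if \<open>C\<close> is an exponent, and it vanishes on the weights that do not
  separate the two.\<close>

definition edge :: "nat ^ 'n::finite \<Rightarrow> nat ^ 'n \<Rightarrow> int ^ 'n" where
  "edge C A = (\<chi> i. int (C $ i) - int (A $ i))"

lemma int_vec_edge: "int_vec (edge C A) = real_vec C - real_vec A"
  by (simp add: vec_eq_iff edge_def)

lemma lin_form_edge: "lin_form (edge C A) k = wt k C - wt k A"
  by (simp add: lin_form_def edge_def wt_def algebra_simps sum_subtractf)

lemma index_3_cases:
  fixes i :: 3
  obtains a b where "a \<noteq> i" "b \<noteq> i" "a \<noteq> b" "UNIV = {i, a, b}"
proof -
  consider "i = 1" | "i = 2" | "i = 3" using exhaust_3 by blast
  then show ?thesis
  proof cases
    case 1
    then show ?thesis using that[of 2 3] UNIV_3 by auto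
  next
    case 2
    then show ?thesis using that[of 1 3] UNIV_3 by auto
  next
    case 3
    then show ?thesis using that[of 1 2] UNIV_3 by auto
  qed
qed

lemma sum_index_3:
  fixes i a b :: 3
  assumes "a \<noteq> i" "b \<noteq> i" "a \<noteq> b" "UNIV = {i, a, b}"
  shows "(\<Sum>j\<in>UNIV. g j) = g i + g a + g b"
  unfolding assms(4) using assms(1-3) by (simp add: add.assoc)

lemma rays_at_D:
  assumes "v \<in> rays_at f A"
  shows "is_ray f v" "A \<in> wface f v" "A \<in> Poly_Mapping.keys f" "int_vec v \<in> newton_cone f A" "0 \<le> v $ i" "v \<noteq> 0"
proof -
  show 1: "is_ray f v" "A \<in> wface f v" using assms by (auto simp: rays_at_def)
  then show "A \<in> Poly_Mapping.keys f" "0 \<le> v $ i" "v \<noteq> 0" by (auto simp: wface_def is_ray_def)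
  have "0 \<le> int_vec v \<bullet> (real_vec w - real_vec A)" if "w \<in> Poly_Mapping.keys f" for w
    using wmin_le[OF that, of v] 1(2) by (simp add: inner_diff_right inner_int_vec wface_def)
  then show "int_vec v \<in> newton_cone f A" using 1(1) unfolding newton_cone_def is_ray_def by simp
qed

lemma newton_cone_inner: "x \<in> newton_cone f A \<Longrightarrow> C \<in> Poly_Mapping.keys f \<Longrightarrow> 0 \<le> int_vec (edge C A) \<bullet> x"
  unfolding newton_cone_def int_vec_edge by (simp add: inner_commute)

lemma pos_point_in_cone:
  assumes "k \<in> pos_points" "A \<in> wface f k"
  shows "int_vec k \<in> newton_cone f A"
proof -
  have "0 \<le> int_vec k \<bullet> (real_vec w - real_vec A)" if "w \<in> Poly_Mapping.keys f" for w
    using wmin_le[OF that, of k] assms(2) by (simp add: inner_diff_right inner_int_vec wface_def)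
  moreover have "0 \<le> k $ i" for i
    using assms(1) unfolding pos_points_def by (metis mem_Collect_eq order_trans zero_le_one)
  ultimately show ?thesis unfolding newton_cone_def by simp
qed

text \<open>A constraint that vanishes on a sum of two vectors of the cone vanishes on each of them,
  so \<open>x\<close> is tight for \<open>r\<close>.\<close>

lemma ray_extreme:
  assumes r: "r \<in> rays_at f A" and xy: "int_vec r = x + y" "x \<in> newton_cone f A" "y \<in> newton_cone f A"
  shows "\<exists>c. x = c *\<^sub>R int_vec r"
proof -
  have z: "x \<bullet> (real_vec w - real_vec A) = 0" if w: "w \<in> wface f r" for w
  proof -
    have "int_vec r \<bullet> (real_vec w - real_vec A) = 0"
      using w rays_at_D(2)[OF r] by (simp add: inner_diff_right inner_int_vec wface_def)
    moreover have "0 \<le> x \<bullet> (real_vec w - real_vec A)" "0 \<le> y \<bullet> (real_vec w - real_vec A)"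
      using xy w unfolding newton_cone_def wface_def by auto
    ultimately show ?thesis unfolding xy(1) by (simp add: inner_add_left)
  qed
  have "tight f r x" unfolding tight_def
  proof (intro conjI ballI allI impI)
    fix w w' assume "w \<in> wface f r" "w' \<in> wface f r"
    then show "x \<bullet> (real_vec w - real_vec w') = 0" using z[of w] z[of w'] by (simp add: inner_diff_right)
  next
    fix j assume "r $ j = 0"
    then have "x $ j + y $ j = 0" using arg_cong[OF xy(1), of "\<lambda>z. z $ j"] by simp
    moreover have "0 \<le> x $ j" "0 \<le> y $ j" using xy unfolding newton_cone_def by auto
    ultimately show "x $ j = 0" by simp
  qed
  then show ?thesis using rays_at_D(1)[OF r] unfolding is_ray_def by blast
qed

lemma newton_cone_add: "x \<in> newton_cone f A \<Longrightarrow> y \<in> newton_cone f A \<Longrightarrow> x + y \<in> newton_cone f A"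
  unfolding newton_cone_def by (auto simp: inner_add_left)

lemma newton_cone_scale: "x \<in> newton_cone f A \<Longrightarrow> 0 \<le> c \<Longrightarrow> c *\<^sub>R x \<in> newton_cone f A"
  unfolding newton_cone_def by auto

lemma newton_cone_0: "0 \<in> newton_cone f A"
  unfolding newton_cone_def by auto

lemma ray_extreme_ray:
  assumes r: "r \<in> rays_at f A" and u: "u \<in> rays_at f A" and eq: "int_vec r = a *\<^sub>R int_vec u + y"
    and "0 < a" "y \<in> newton_cone f A"
  shows "u = r"
proof -
  have "a *\<^sub>R int_vec u \<in> newton_cone f A"
    using \<open>0 < a\<close> by (intro newton_cone_scale rays_at_D(4)[OF u]) auto
  then obtain c where c: "a *\<^sub>R int_vec u = c *\<^sub>R int_vec r"
    using ray_extreme[OF r eq _ assms(5)] by blast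
  have "(1 / a) *\<^sub>R (a *\<^sub>R int_vec u) = (1 / a) *\<^sub>R (c *\<^sub>R int_vec r)" unfolding c ..
  then have "int_vec u = (c / a) *\<^sub>R int_vec r" using \<open>0 < a\<close> by simp
  then show ?thesis using is_ray_parallel_eq[OF rays_at_D(1)[OF r] rays_at_D(1)[OF u]] by auto
qed

lemma int_vec_axis: "int_vec (axis i 1) = axis i 1"
  by (simp add: vec_eq_iff axis_def)

lemma axis_in_newton_cone: "A $ i = 0 \<Longrightarrow> int_vec (axis i 1) \<in> newton_cone f A"
  unfolding newton_cone_def int_vec_axis by (simp add: inner_axis') (simp add: axis_def)

text \<open>An exponent beyond \<open>C\<close> in a free direction costs strictly more under a
  positive weight.\<close>

lemma b1_apex_unique:
  assumes v: "b1_apex f v i C" and k: "k \<in> pos_points" "wface f k \<subseteq> wface f v" and w: "w \<in> wface f k" "w $ i = 1"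
  shows "w = C"
proof (rule ccontr)
  assume "w \<noteq> C"
  moreover have "w \<in> wface f v" using k(2) w by blast
  ultimately obtain j where j: "v $ j = 0" "C $ j < w $ j" "\<forall>l. l \<noteq> j \<longrightarrow> w $ l = C $ l"
    using v w(2) unfolding b1_apex_def by (metis zero_neq_one)
  have "wt k w - wt k C = (\<Sum>l\<in>UNIV. if l = j then k $ j * (int (w $ j) - int (C $ j)) else 0)"
    unfolding wt_def sum_subtractf[symmetric] using j(3) by (intro sum.cong) (auto simp: algebra_simps)
  then have "wt k w - wt k C = k $ j * (int (w $ j) - int (C $ j))" by simp
  moreover have "1 \<le> k $ j" using k(1) unfolding pos_points_def by blast
  ultimately have "wt k C < wt k w" using j(2) by (smt (verit) mult_pos_pos of_nat_less_iff)
  moreover have "C \<in> Poly_Mapping.keys f" using v unfolding b1_apex_def wface_def by blast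
  ultimately show False using w(1) wmin_le[of C f k] unfolding wface_def by auto
qed

lemma b1_apex_coord: "b1_apex f v i C \<Longrightarrow> w \<in> wface f v \<Longrightarrow> w $ i = 0 \<or> w $ i = 1"
  unfolding b1_apex_def by blast

text \<open>The last hypothesis makes the projections of \<open>y\<close> and \<open>v\<close> to
  the coordinates \<open>a\<close> and \<open>b\<close> proportional, and \<open>l\<close> recovers
  the coordinate \<open>i\<close> from these.\<close>

lemma plane_line:
  fixes v :: "int ^ 3" and l g y :: "real ^ 3"
  assumes ind: "a \<noteq> i" "b \<noteq> i" "a \<noteq> b" "UNIV = {i, a, b}"
    and vab: "v $ a \<noteq> 0 \<or> v $ b \<noteq> 0" and li: "l $ i = 1" and lv: "l \<bullet> int_vec v = 0" and ly: "l \<bullet> y = 0"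
    and g: "real_of_int (v $ b) * y $ a = real_of_int (v $ a) * y $ b"
  shows "\<exists>c. y = c *\<^sub>R int_vec v"
proof -
  let ?va = "real_of_int (v $ a)" and ?vb = "real_of_int (v $ b)"
  define n where "n = ?va^2 + ?vb^2"
  have n: "n > 0" using vab unfolding n_def by (auto simp: sum_power2_gt_zero_iff)
  define c where "c = (?va * y $ a + ?vb * y $ b) / n"
  have "n * y $ a = ?va * (?va * y $ a) + ?vb * (?vb * y $ a)" unfolding n_def by (simp add: power2_eq_square algebra_simps)
  also have "\<dots> = (?va * y $ a + ?vb * y $ b) * ?va" unfolding g by (simp add: algebra_simps)
  finally have ya: "y $ a = c * ?va" unfolding c_def using n by (simp add: field_simps)
  have "n * y $ b = ?va * (?va * y $ b) + ?vb * (?vb * y $ b)" unfolding n_def by (simp add: power2_eq_square algebra_simps)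
  also have "\<dots> = (?va * y $ a + ?vb * y $ b) * ?vb" unfolding g[symmetric] by (simp add: algebra_simps)
  finally have yb: "y $ b = c * ?vb" unfolding c_def using n by (simp add: field_simps)
  have "y $ i + l $ a * y $ a + l $ b * y $ b = 0" using ly li unfolding inner_vec_def by (simp add: sum_index_3[OF ind])
  moreover have "real_of_int (v $ i) + l $ a * ?va + l $ b * ?vb = 0" using lv li unfolding inner_vec_def by (simp add: sum_index_3[OF ind])
  then have "c * (real_of_int (v $ i) + l $ a * ?va + l $ b * ?vb) = 0" by simp
  ultimately have yi: "y $ i = c * real_of_int (v $ i)" unfolding ya yb by (simp add: algebra_simps)
  have "y $ j = c * real_of_int (v $ j)" for j
    using ind(4) ya yb yi by (metis UNIV_I insertE singletonD)
  then show ?thesis by (intro exI[of _ c]) (simp add: vec_eq_iff)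
qed

text \<open>
  In the cone dual to a vertex \<open>A\<close> the ray \<open>v\<close> of a B1-facet with apex \<open>C\<close> has two neighbours: the
  coordinate direction of the facet and a ray \<open>w\<close> on the wall dual to the edge \<open>A C\<close>. The form \<open>g\<close>
  vanishes on the wall spanned by \<open>v\<close> and the coordinate direction.
\<close>

lemma corner:
  fixes f :: "(3, 'a::zero) mpoly"
  assumes b1: "b1_apex f v i C" and v: "v \<in> rays_at f A" and Ai: "A $ i = 0"
    and nax: "\<exists>a. a \<noteq> i \<and> v $ a \<noteq> 0" and k1: "k1 \<in> pos_points" "wface f k1 = {A}"
  obtains w g where
    "g $ i = 0" "lin_form g v = 0" "\<And>x. x \<in> newton_cone f A \<Longrightarrow> 0 \<le> int_vec g \<bullet> x"
    "\<And>k. k \<in> pos_points \<Longrightarrow> wface f k = {A} \<Longrightarrow> 0 < lin_form g k"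
    "\<And>y. int_vec (edge C A) \<bullet> y = 0 \<Longrightarrow> int_vec g \<bullet> y = 0 \<Longrightarrow> \<exists>c. y = c *\<^sub>R int_vec v"
    "w \<in> rays_at f A" "lin_form (edge C A) w = 0" "0 < lin_form g w"
    "\<And>j. j \<noteq> i \<Longrightarrow> v $ j = 0 \<Longrightarrow> 0 < int_vec g $ j"
proof -
  obtain a b where ind: "a \<noteq> i" "b \<noteq> i" "a \<noteq> b" "UNIV = {i, a, b}" by (rule index_3_cases)
  have indj: "j = a \<or> j = b" if "j \<noteq> i" for j using ind(4) that by auto
  note s3 = sum_index_3[OF ind]
  let ?l = "int_vec (edge C A)"
  let ?V = "Poly_Mapping.keys f"
  let ?va = "real_of_int (v $ a)" and ?vb = "real_of_int (v $ b)"
  have vi: "0 < v $ i" and CE: "C \<in> wface f v" and Ci: "C $ i = 1" using b1 unfolding b1_apex_def by auto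
  have v0: "0 \<le> v $ j" for j using rays_at_D(5)[OF v] .
  have AE: "A \<in> wface f v" using rays_at_D(2)[OF v] .
  have AV: "A \<in> ?V" and CV: "C \<in> ?V" using AE CE by (auto simp: wface_def)
  have vab: "v $ a \<noteq> 0 \<or> v $ b \<noteq> 0" using nax indj by auto
  have k1c: "int_vec k1 \<in> newton_cone f A" using k1 by (intro pos_point_in_cone) auto
  have li: "?l $ i = 1" using Ci Ai by (simp add: edge_def)
  have lv: "?l \<bullet> int_vec v = 0"
    using AE CE by (simp add: inner_int_int lin_form_edge wface_def)
  have inn: "x \<bullet> y = x $ i * y $ i + x $ a * y $ a + x $ b * y $ b" for x y :: "real ^ 3"
    unfolding inner_vec_def by (simp add: s3)
  define n where "n = ?va^2 + ?vb^2"
  have n: "n > 0" using vab unfolding n_def by (auto simp: sum_power2_gt_zero_iff)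
  \<comment> \<open>A form without coordinate \<open>i\<close> that kills \<open>v\<close> is a
    multiple of the determinant with \<open>v\<close> in the coordinates \<open>a\<close> and
    \<open>b\<close>.\<close>
  have par: "\<exists>m. \<forall>x. y \<bullet> x = m * (?vb * x $ a - ?va * x $ b)" if "y $ i = 0" "y \<bullet> int_vec v = 0" for y :: "real ^ 3"
  proof -
    define m where "m = (y $ a * ?vb - y $ b * ?va) / n"
    have r: "y $ a * ?va + y $ b * ?vb = 0" using that by (simp add: inn)
    have "n * (m * ?vb) = (y $ a * ?vb - y $ b * ?va) * ?vb" unfolding m_def using n by simp
    also have "\<dots> = n * y $ a - (y $ a * ?va + y $ b * ?vb) * ?va" unfolding n_def by (simp add: power2_eq_square algebra_simps)
    finally have ya: "y $ a = m * ?vb" using n r by simp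
    have "n * (m * ?va) = (y $ a * ?vb - y $ b * ?va) * ?va" unfolding m_def using n by simp
    also have "\<dots> = (y $ a * ?va + y $ b * ?vb) * ?vb - n * y $ b" unfolding n_def by (simp add: power2_eq_square algebra_simps)
    finally have "n * (m * ?va) = n * (- y $ b)" using r by simp
    then have "m * ?va = - y $ b" using n by (simp only: mult_cancel_left) auto
    then have yb: "y $ b = - (m * ?va)" by simp
    have "y \<bullet> x = m * (?vb * x $ a - ?va * x $ b)" for x using that(1) by (simp add: inn ya yb algebra_simps)
    then show ?thesis by blast
  qed
  \<comment> \<open>The form comes from a second exponent of the facet at height 0 or, if there is
    none, from an unbounded direction of the facet. Without either, the facet would have only the
    exponents \<open>A\<close> and \<open>C\<close>, too few for a line of normals.\<close>
  have "\<exists>y :: real ^ 3. y $ i = 0 \<and> y \<bullet> int_vec v = 0 \<and> (\<forall>x\<in>newton_cone f A. 0 \<le> y \<bullet> x) \<and>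
      (\<forall>k\<in>pos_points. wface f k = {A} \<longrightarrow> 0 < y \<bullet> int_vec k)"
  proof (cases "\<exists>w\<in>wface f v. w $ i = 0 \<and> w \<noteq> A")
    case True
    then obtain w where w: "w \<in> wface f v" "w $ i = 0" "w \<noteq> A" by blast
    have wV: "w \<in> ?V" using w by (simp add: wface_def)
    have "0 < int_vec (edge w A) \<bullet> int_vec k" if k: "k \<in> pos_points" "wface f k = {A}" for k
    proof -
      have "wt k w \<noteq> wmin f k" "wt k A = wmin f k" using k w wV by (auto simp: wface_def)
      then have "wt k A < wt k w" using wmin_le[OF wV, of k] by simp
      then show ?thesis by (simp add: inner_int_int lin_form_edge)
    qed
    moreover have "int_vec (edge w A) \<bullet> int_vec v = 0" using w AE by (simp add: inner_int_int lin_form_edge wface_def)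
    moreover have "int_vec (edge w A) $ i = 0" using w Ai by (simp add: edge_def)
    ultimately show ?thesis using newton_cone_inner[OF _ wV] by blast
  next
    case False
    have "\<exists>j. j \<noteq> i \<and> v $ j = 0"
    proof (rule ccontr)
      assume nz: "\<not> ?thesis"
      then have nz': "v $ j \<noteq> 0" for j using vi by (cases "j = i") auto
      have E: "w = A \<or> w = C" if "w \<in> wface f v" for w
        using that False b1 nz' unfolding b1_apex_def by blast
      define d :: "real ^ 3" where "d = (\<chi> j. if j = a then ?vb else if j = b then - ?va else - (?l $ a * ?vb - ?l $ b * ?va))"
      have dd: "d $ a = ?vb" "d $ b = - ?va" "d $ i = - (?l $ a * ?vb - ?l $ b * ?va)"
        unfolding d_def using ind by auto
      have "?l \<bullet> d = 0" using li by (simp add: inn dd)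
      then have "d \<bullet> (real_vec w - real_vec w') = 0" if "w \<in> wface f v" "w' \<in> wface f v" for w w'
        using E[OF that(1)] E[OF that(2)] unfolding int_vec_edge by (auto simp: inner_commute inner_diff_right inner_diff_left)
      then have "tight f v d" unfolding tight_def using nz' by blast
      then obtain c where "d = c *\<^sub>R int_vec v" using rays_at_D(1)[OF v] unfolding is_ray_def by blast
      then have cc: "?vb = c * ?va" "- ?va = c * ?vb" using dd(1,2) by auto
      have "?vb * ?vb = ?vb * (c * ?va)" by (rule arg_cong[OF cc(1)])
      also have "\<dots> = ?va * (c * ?vb)" by (simp only: mult_ac)
      also have "\<dots> = ?va * (- ?va)" by (rule arg_cong[OF cc(2)[symmetric]])
      finally have "?vb * ?vb + ?va * ?va = 0" by simp
      then show False using n unfolding n_def by (simp add: power2_eq_square add.commute)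
    qed
    then obtain j where j: "j \<noteq> i" "v $ j = 0" by blast
    have "axis j 1 \<bullet> x = x $ j" for x :: "real ^ 3" by (simp add: inner_axis')
    moreover have "0 < k $ j" if "k \<in> pos_points" for k :: "int ^ 3"
      using that unfolding pos_points_def by (metis mem_Collect_eq less_le_trans zero_less_one)
    ultimately show ?thesis using j
      by (intro exI[of _ "axis j 1"]) (auto simp: axis_def newton_cone_def)
  qed
  then obtain y where y: "y $ i = 0" "y \<bullet> int_vec v = 0" "\<And>x. x \<in> newton_cone f A \<Longrightarrow> 0 \<le> y \<bullet> x"
      "\<And>k. k \<in> pos_points \<Longrightarrow> wface f k = {A} \<Longrightarrow> 0 < y \<bullet> int_vec k" by blast
  obtain m where m: "\<And>x. y \<bullet> x = m * (?vb * x $ a - ?va * x $ b)" using par[OF y(1,2)] by blast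
  have m0: "m \<noteq> 0" using y(4)[OF k1] m by auto
  \<comment> \<open>\<open>g\<close> is the determinant with \<open>v\<close>, taken with the sign
    that makes it nonnegative on the cone.\<close>
  define sg :: int where "sg = (if m > 0 then 1 else - 1)"
  have msg: "m = \<bar>m\<bar> * real_of_int sg" "real_of_int sg * real_of_int sg = 1" unfolding sg_def by auto
  define g :: "int ^ 3" where "g = (\<chi> j. if j = a then sg * v $ b else if j = b then - (sg * v $ a) else 0)"
  have gc: "g $ a = sg * v $ b" "g $ b = - (sg * v $ a)" "g $ i = 0" unfolding g_def using ind by auto
  have gx: "int_vec g \<bullet> x = real_of_int sg * (?vb * x $ a - ?va * x $ b)" for x
    by (simp add: inn gc algebra_simps)
  have yg: "y \<bullet> x = \<bar>m\<bar> * (int_vec g \<bullet> x)" for x unfolding m gx using msg by (metis mult.assoc)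
  have g3: "0 \<le> int_vec g \<bullet> x" if "x \<in> newton_cone f A" for x
    using y(3)[OF that] m0 unfolding yg by (simp add: zero_le_mult_iff)
  have g4: "0 < lin_form g k" if "k \<in> pos_points" "wface f k = {A}" for k
    using y(4)[OF that] m0 unfolding yg by (simp add: zero_less_mult_iff inner_int_int)
  have g5: "\<exists>c. z = c *\<^sub>R int_vec v" if "?l \<bullet> z = 0" "int_vec g \<bullet> z = 0" for z
  proof (rule plane_line[OF ind vab li lv that(1)])
    have "sg \<noteq> 0" by (simp add: sg_def)
    then show "?vb * z $ a = ?va * z $ b" using that(2) unfolding gx by simp
  qed
  \<comment> \<open>A direction inside the wall \<open>?l = 0\<close> along which \<open>g\<close>
    increases; small steps from \<open>v\<close> along it turn out to stay in the cone.\<close>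
  define d :: "real ^ 3" where "d = (\<chi> j. if j = a then real_of_int sg * ?vb else if j = b then - (real_of_int sg * ?va)
      else - (?l $ a * (real_of_int sg * ?vb) - ?l $ b * (real_of_int sg * ?va)))"
  have dd: "d $ a = real_of_int sg * ?vb" "d $ b = - (real_of_int sg * ?va)"
      "d $ i = - (?l $ a * (real_of_int sg * ?vb) - ?l $ b * (real_of_int sg * ?va))"
    unfolding d_def using ind by auto
  have ld: "?l \<bullet> d = 0" using li by (simp add: inn dd)
  have gd: "int_vec g \<bullet> d = n"
  proof -
    have "int_vec g \<bullet> d = (real_of_int sg * real_of_int sg) * (?vb * ?vb + ?va * ?va)"
      unfolding gx dd by (simp add: algebra_simps)
    then show ?thesis unfolding msg(2) n_def by (simp add: power2_eq_square)
  qed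
  \<comment> \<open>A form without coordinate \<open>i\<close> that vanishes at \<open>v\<close> is
    a multiple of \<open>g\<close>, and its sign at \<open>k1\<close> makes the factor nonnegative;
    therefore \<open>d\<close> respects all such constraints.\<close>
  have M: "\<exists>e\<ge>0. \<forall>x. z \<bullet> x = e * (int_vec g \<bullet> x)" if z: "z $ i = 0" "z \<bullet> int_vec v = 0" "0 \<le> z \<bullet> int_vec k1" for z
  proof -
    obtain e where e: "\<And>x. z \<bullet> x = e * (?vb * x $ a - ?va * x $ b)" using par[OF z(1,2)] by blast
    have e': "z \<bullet> x = (e * real_of_int sg) * (int_vec g \<bullet> x)" for x
    proof -
      let ?X = "?vb * x $ a - ?va * x $ b"
      have "(e * real_of_int sg) * (real_of_int sg * ?X) = (real_of_int sg * real_of_int sg) * (e * ?X)"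
        by (simp only: mult_ac)
      then show ?thesis unfolding e gx msg(2) by simp
    qed
    have "0 < int_vec g \<bullet> int_vec k1" using g4[OF k1] by (simp add: inner_int_int)
    then have "0 \<le> e * real_of_int sg" using z(3) unfolding e' by (simp add: zero_le_mult_iff)
    then show ?thesis using e' by blast
  qed
  have ax: "axis j 1 $ i = (0 :: real)" if "j \<noteq> i" for j using that by (simp add: axis_def)
  have k1n: "0 \<le> int_vec k1 $ j" for j using k1c unfolding newton_cone_def by blast
  have dj: "0 \<le> d $ j" if "v $ j = 0" for j
  proof -
    have ji: "j \<noteq> i" using vi that by auto
    have "\<exists>e\<ge>0. \<forall>x. axis j 1 \<bullet> x = e * (int_vec g \<bullet> x)"
      using ji that k1n by (intro M) (auto simp: ax inner_axis')
    then obtain e where e: "e \<ge> 0" "axis j 1 \<bullet> d = e * (int_vec g \<bullet> d)" by blast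
    then show ?thesis using n unfolding gd by (simp add: inner_axis')
  qed
  have dE: "0 \<le> d \<bullet> (real_vec w - real_vec A)" if w: "w \<in> wface f v" for w
  proof (cases "w $ i = 0")
    case True
    have "\<exists>e\<ge>0. \<forall>x. int_vec (edge w A) \<bullet> x = e * (int_vec g \<bullet> x)"
    proof (rule M)
      show "int_vec (edge w A) $ i = 0" using True Ai by (simp add: edge_def)
      show "int_vec (edge w A) \<bullet> int_vec v = 0" using w AE by (simp add: inner_int_int lin_form_edge wface_def)
      show "0 \<le> int_vec (edge w A) \<bullet> int_vec k1" using w k1c by (intro newton_cone_inner) (auto simp: wface_def)
    qed
    then obtain e where "e \<ge> 0" "int_vec (edge w A) \<bullet> d = e * (int_vec g \<bullet> d)" by blast
    then show ?thesis using n unfolding gd int_vec_edge by (simp add: inner_commute)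
  next
    case False
    show ?thesis
    proof (cases "w = C")
      case True
      then show ?thesis using ld unfolding int_vec_edge by (simp add: inner_commute)
    next
      case nC: False
      then obtain j where j: "v $ j = 0" "C $ j < w $ j" "\<forall>l. l \<noteq> j \<longrightarrow> w $ l = C $ l"
        using b1 w False unfolding b1_apex_def by metis
      have eq: "real_vec w - real_vec A = (real_vec C - real_vec A) + real (w $ j - C $ j) *\<^sub>R axis j 1"
        using j(2,3) by (auto simp: vec_eq_iff axis_def of_nat_diff)
      have "d \<bullet> (real_vec w - real_vec A) = d \<bullet> (real_vec C - real_vec A) + real (w $ j - C $ j) * d $ j"
        unfolding eq inner_add_right inner_scaleR_right inner_axis by simp
      then show ?thesis using ld dj[OF j(1)] unfolding int_vec_edge by (simp add: inner_commute)
    qed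
  qed
  have "\<exists>h>0. \<forall>w\<in>?V - wface f v. h * \<bar>d \<bullet> (real_vec w - real_vec A)\<bar> \<le> int_vec v \<bullet> (real_vec w - real_vec A)"
  proof (rule exists_small_perturbation)
    fix w assume w: "w \<in> ?V - wface f v"
    then have "wmin f v < wt v w" using wmin_le[of w f v] unfolding wface_def by auto
    then show "0 < int_vec v \<bullet> (real_vec w - real_vec A)" using AE by (simp add: inner_diff_right inner_int_vec wface_def)
  qed simp
  then obtain h1 where h1: "h1 > 0" "\<And>w. w \<in> ?V - wface f v \<Longrightarrow> h1 * \<bar>d \<bullet> (real_vec w - real_vec A)\<bar> \<le> int_vec v \<bullet> (real_vec w - real_vec A)"
    by blast
  have "\<exists>h>0. \<forall>j\<in>{j. v $ j \<noteq> 0}. h * \<bar>d $ j\<bar> \<le> int_vec v $ j"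
    by (rule exists_small_perturbation) (use v0 in \<open>auto simp: order_less_le\<close>)
  then obtain h2 where h2: "h2 > 0" "\<And>j. v $ j \<noteq> 0 \<Longrightarrow> h2 * \<bar>d $ j\<bar> \<le> int_vec v $ j" by blast
  define h where "h = min h1 h2"
  have h: "h > 0" "h \<le> h1" "h \<le> h2" using h1 h2 by (auto simp: h_def)
  \<comment> \<open>A point of the wall with \<open>g > 0\<close>. All rays with nonzero coefficient
    in its expansion lie on the wall, and one of them has \<open>g > 0\<close>.\<close>
  define x where "x = int_vec v + h *\<^sub>R d"
  have xc: "x \<in> newton_cone f A"
  proof -
    have "0 \<le> x $ j" for j
    proof (cases "v $ j = 0")
      case True
      then show ?thesis using dj[OF True] h unfolding x_def by simp
    next
      case False
      have "h * \<bar>d $ j\<bar> \<le> h2 * \<bar>d $ j\<bar>" using h by (intro mult_right_mono) auto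
      then have "h * \<bar>d $ j\<bar> \<le> int_vec v $ j" using h2(2)[OF False] by linarith
      moreover have "\<bar>h * d $ j\<bar> = h * \<bar>d $ j\<bar>" using h by (simp add: abs_mult)
      ultimately show ?thesis unfolding x_def by simp
    qed
    moreover have "0 \<le> x \<bullet> (real_vec w - real_vec A)" if w: "w \<in> ?V" for w
    proof (cases "w \<in> wface f v")
      case True
      then have "int_vec v \<bullet> (real_vec w - real_vec A) = 0" using AE by (simp add: inner_diff_right inner_int_vec wface_def)
      then show ?thesis using dE[OF True] h unfolding x_def by (simp add: inner_add_left)
    next
      case False
      let ?y = "d \<bullet> (real_vec w - real_vec A)"
      have "h * \<bar>?y\<bar> \<le> h1 * \<bar>?y\<bar>" using h by (intro mult_right_mono) auto
      then have "h * \<bar>?y\<bar> \<le> int_vec v \<bullet> (real_vec w - real_vec A)" using h1(2)[of w] w False by force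
      moreover have "\<bar>h * ?y\<bar> = h * \<bar>?y\<bar>" using h by (simp add: abs_mult)
      ultimately show ?thesis unfolding x_def inner_add_left inner_scaleR_left by linarith
    qed
    ultimately show ?thesis unfolding newton_cone_def by blast
  qed
  obtain r where r: "\<And>u. 0 \<le> r u" "x = (\<Sum>u\<in>rays_at f A. r u *\<^sub>R int_vec u)"
    using newton_cone_generated[OF AV xc] by blast
  have finR: "finite (rays_at f A)" using finite_rays by (rule finite_subset[rotated]) (auto simp: rays_at_def)
  have gv: "lin_form g v = 0" using gx[of "int_vec v"] by (simp add: inner_int_int)
  have "?l \<bullet> x = 0" using lv ld unfolding x_def by (simp add: inner_add_right)
  then have lx: "(\<Sum>u\<in>rays_at f A. r u * (?l \<bullet> int_vec u)) = 0" unfolding r(2) by (simp add: inner_sum_right)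
  have lu: "r u * (?l \<bullet> int_vec u) = 0" if "u \<in> rays_at f A" for u
  proof -
    have "\<forall>u\<in>rays_at f A. 0 \<le> r u * (?l \<bullet> int_vec u)"
      using newton_cone_inner[OF rays_at_D(4) CV] r(1) by simp
    then show ?thesis using lx finR that by (subst (asm) sum_nonneg_eq_0_iff) auto
  qed
  have "int_vec g \<bullet> x = h * n" using gv gd unfolding x_def by (simp add: inner_add_right inner_int_int)
  then have "(\<Sum>u\<in>rays_at f A. r u * (int_vec g \<bullet> int_vec u)) > 0"
    using h n unfolding r(2) by (simp add: inner_sum_right)
  then obtain w where w: "w \<in> rays_at f A" "0 < r w * (int_vec g \<bullet> int_vec w)"
    by (metis (no_types, lifting) not_less sum_nonpos)
  then have rw: "r w \<noteq> 0" "0 < int_vec g \<bullet> int_vec w" using r(1)[of w] g3[OF rays_at_D(4)[OF w(1)]]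
    by (auto simp: zero_less_mult_iff)
  have "?l \<bullet> int_vec w = 0" using lu[OF w(1)] rw by simp
  moreover have "0 < int_vec g $ j" if ji: "j \<noteq> i" "v $ j = 0" for j
  proof -
    have "\<exists>e\<ge>0. \<forall>x. axis j 1 \<bullet> x = e * (int_vec g \<bullet> x)"
      using ji k1n by (intro M) (auto simp: ax inner_axis')
    then obtain e where e: "e \<ge> 0" "axis j 1 \<bullet> (axis j 1 :: real ^ 3) = e * (int_vec g \<bullet> axis j 1)" by blast
    then have "1 = e * int_vec g $ j" by (simp add: inner_axis)
    then show ?thesis using e(1) by (metis zero_less_mult_pos zero_less_one order_le_less mult_zero_left zero_neq_one)
  qed
  ultimately show ?thesis
    by (intro that[of g w, OF gc(3) gv g3 g4 g5 w(1)]) (use rw in \<open>auto simp: inner_int_int\<close>)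
qed

subsection \<open>Cancelling fibres\<close>

definition up :: "int ^ 3 \<Rightarrow> 3 \<Rightarrow> int \<Rightarrow> int ^ 3" where
  "up k i t = (\<chi> j. k $ j + (if j = i then t else 0))"

lemma up_nth [simp]: "up k i t $ j = k $ j + (if j = i then t else 0)"
  by (simp add: up_def)

lemma up_0 [simp]: "up k i 0 = k"
  by (simp add: vec_eq_iff)

lemma up_up: "up (up k i t) i s = up k i (t + s)"
  by (simp add: vec_eq_iff)

lemma wt_up: "wt (up k i t) w = wt k w + t * int (w $ i)"
  by (simp add: wt_def distrib_right sum.distrib if_distrib[of "\<lambda>z. z * _"] cong: if_cong)

lemma int_vec_up: "int_vec (up k i t) = int_vec k + real_of_int t *\<^sub>R axis i 1"
  by (simp add: vec_eq_iff axis_def)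

lemma up_face:
  assumes k: "k \<in> pos_points" and t: "0 < t" and ne: "w0 \<in> wface f k" "w0 $ i = 0"
  shows "up k i t \<in> pos_points" "wmin f (up k i t) = wmin f k" "wface f (up k i t) = {w \<in> wface f k. w $ i = 0}"
proof -
  show "up k i t \<in> pos_points" using k t unfolding pos_points_def by (auto intro: add_increasing2)
  have le: "wmin f k + t * int (w $ i) \<le> wt (up k i t) w" if "w \<in> Poly_Mapping.keys f" for w
    using wmin_le[OF that, of k] by (simp add: wt_up)
  have le': "wmin f k \<le> wt (up k i t) w" if "w \<in> Poly_Mapping.keys f" for w
    using le[OF that] t by (smt (verit) mult_nonneg_nonneg of_nat_0_le_iff)
  have w0: "w0 \<in> Poly_Mapping.keys f" "wt (up k i t) w0 = wmin f k" using ne by (auto simp: wt_up wface_def)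
  show 1: "wmin f (up k i t) = wmin f k"
    unfolding wmin_def[of f "up k i t"] using le' w0 by (intro Min_eqI) (auto simp: image_iff intro!: bexI[of _ w0])
  show "wface f (up k i t) = {w \<in> wface f k. w $ i = 0}"
  proof (intro equalityI subsetI)
    fix w assume w: "w \<in> wface f (up k i t)"
    then have wV: "w \<in> Poly_Mapping.keys f" and e: "wt k w + t * int (w $ i) = wmin f k"
      unfolding wface_def 1 by (auto simp: wt_up)
    have "t * int (w $ i) \<le> 0" using e wmin_le[OF wV, of k] by linarith
    then have "w $ i = 0" using t by (simp add: mult_le_0_iff)
    then show "w \<in> {w \<in> wface f k. w $ i = 0}" using wV e unfolding wface_def by simp
  next
    fix w assume "w \<in> {w \<in> wface f k. w $ i = 0}"
    then show "w \<in> wface f (up k i t)" unfolding wface_def 1 by (auto simp: wt_up)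
  qed
qed

definition corner_data :: "(3, 'a::zero) mpoly \<Rightarrow> int ^ 3 \<Rightarrow> 3 \<Rightarrow> nat ^ 3 \<Rightarrow> nat ^ 3 \<Rightarrow> int ^ 3 \<Rightarrow> int ^ 3 \<Rightarrow> bool" where
  "corner_data f v i C A w g \<longleftrightarrow>
    g $ i = 0 \<and> lin_form g v = 0 \<and> (\<forall>x\<in>newton_cone f A. 0 \<le> int_vec g \<bullet> x) \<and>
    (\<forall>k\<in>pos_points. wface f k = {A} \<longrightarrow> 0 < lin_form g k) \<and>
    (\<forall>y. int_vec (edge C A) \<bullet> y = 0 \<longrightarrow> int_vec g \<bullet> y = 0 \<longrightarrow> (\<exists>c. y = c *\<^sub>R int_vec v)) \<and>
    w \<in> rays_at f A \<and> lin_form (edge C A) w = 0 \<and> 0 < lin_form g w"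

lemma corner_dataD:
  assumes "corner_data f v i C A w g"
  shows "g $ i = 0" "lin_form g v = 0" "\<And>x. x \<in> newton_cone f A \<Longrightarrow> 0 \<le> int_vec g \<bullet> x"
    "\<And>k. k \<in> pos_points \<Longrightarrow> wface f k = {A} \<Longrightarrow> 0 < lin_form g k"
    "\<And>y. int_vec (edge C A) \<bullet> y = 0 \<Longrightarrow> int_vec g \<bullet> y = 0 \<Longrightarrow> \<exists>c. y = c *\<^sub>R int_vec v"
    "w \<in> rays_at f A" "lin_form (edge C A) w = 0" "0 < lin_form g w"
  using assms unfolding corner_data_def by simp_all

lemma corner_data_exists:
  assumes "b1_apex f v i C" "v \<in> rays_at f A" "A $ i = 0" "\<exists>a. a \<noteq> i \<and> v $ a \<noteq> 0"
    "k1 \<in> pos_points" "wface f k1 = {A}"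
  shows "\<exists>w g. corner_data f v i C A w g"
proof (rule corner[OF assms])
  fix w g
  assume "g $ i = 0" "lin_form g v = 0" "\<And>x. x \<in> newton_cone f A \<Longrightarrow> 0 \<le> int_vec g \<bullet> x"
    "\<And>k. k \<in> pos_points \<Longrightarrow> wface f k = {A} \<Longrightarrow> 0 < lin_form g k"
    "\<And>y. int_vec (edge C A) \<bullet> y = 0 \<Longrightarrow> int_vec g \<bullet> y = 0 \<Longrightarrow> \<exists>c. y = c *\<^sub>R int_vec v"
    "w \<in> rays_at f A" "lin_form (edge C A) w = 0" "0 < lin_form g w"
  then have "corner_data f v i C A w g" unfolding corner_data_def by simp
  then show ?thesis by (intro exI)
qed

text \<open>The combinatorics is separated from the characters: \<open>c\<close> is the coefficient
  of a face and \<open>\<kappa>\<close> the ratio between a pyramid of height 1 and its base, later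
  1/(p - 1). \<open>Q\<close> is the set of normals to be removed.\<close>

locale b1_configuration =
  fixes f :: "(3, 'a::zero) mpoly" and Q :: "(int ^ 3) set" and c :: "(nat ^ 3) set \<Rightarrow> complex" and \<kappa> :: complex
  assumes f0: "f \<noteq> 0"
    and Q_ray: "v \<in> Q \<Longrightarrow> is_ray f v"
    and Q_off_axis: "v \<in> Q \<Longrightarrow> A \<in> wface f v \<Longrightarrow> A $ i = 0 \<Longrightarrow> \<exists>a. a \<noteq> i \<and> v $ a \<noteq> 0"
    and Q_apex: "v \<in> Q \<Longrightarrow> \<exists>i C. b1_apex f v i C"
    and Q_pair: "v \<in> Q \<Longrightarrow> w \<in> Q \<Longrightarrow> A \<in> wface f v \<Longrightarrow> A \<in> wface f w \<Longrightarrow> C \<in> wface f v \<Longrightarrow>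
       C \<in> wface f w \<Longrightarrow> A \<noteq> C \<Longrightarrow> \<exists>i C1 C2. b1_apex f v i C1 \<and> b1_apex f w i C2"
    and c_edge: "k \<in> pos_points \<Longrightarrow> wface f k = insert C E \<Longrightarrow> C \<notin> E \<Longrightarrow> C $ i = 1 \<Longrightarrow> E \<noteq> {} \<Longrightarrow>
       (\<And>w. w \<in> E \<Longrightarrow> w $ i = 0) \<Longrightarrow> c (wface f k) = - (\<kappa> * c E)"
    and c_apex: "C $ i = 1 \<Longrightarrow> c {C} = 0"
    and kappa: "\<kappa> \<noteq> 0"
begin

text \<open>A facet may be a B1-facet for several variables. One of them is fixed here;
  \<open>same_dirn\<close> shows that the choices agree for two facets sharing an edge at a vertex
  of nonzero coefficient.\<close>

definition dirn :: "int ^ 3 \<Rightarrow> 3" where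
  "dirn v = (SOME i. \<exists>C. b1_apex f v i C)"

definition apex :: "int ^ 3 \<Rightarrow> nat ^ 3" where
  "apex v = (SOME C. b1_apex f v (dirn v) C)"

lemma apex: "v \<in> Q \<Longrightarrow> b1_apex f v (dirn v) (apex v)"
  unfolding apex_def dirn_def using Q_apex by (metis (mono_tags, lifting) someI_ex)

lemma rays_atI: "v \<in> Q \<Longrightarrow> A \<in> wface f v \<Longrightarrow> v \<in> rays_at f A"
  using Q_ray unfolding rays_at_def by blast

text \<open>The hypotheses put \<open>axis u 1\<close> into the span of \<open>v\<close> and
  \<open>v'\<close>. A negative coefficient would exhibit one of the rays as a combination of the
  other and the axis, against extremality. With nonnegative coefficients neither ray can occur,
  since each has a nonzero coordinate other than \<open>u\<close>.\<close>

lemma coplanar: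
  assumes v: "v \<in> Q" "A \<in> wface f v" and v': "v' \<in> Q" "A \<in> wface f v'" and ne: "v \<noteq> v'" and Au: "A $ u = 0"
    and d: "d \<noteq> 0" "d \<bullet> int_vec v = 0" "d \<bullet> int_vec v' = 0" "d $ u = 0"
  shows False
proof -
  note r = rays_atI[OF v] and r' = rays_atI[OF v']
  let ?e = "axis u 1 :: real ^ 3"
  have nn: "0 \<le> v $ j" "0 \<le> v' $ j" for j using rays_at_D(5)[OF r] rays_at_D(5)[OF r'] by auto
  have "int_vec v \<notin> span {int_vec v'}"
  proof
    assume "int_vec v \<in> span {int_vec v'}"
    then obtain k where "int_vec v = k *\<^sub>R int_vec v'" unfolding span_singleton by blast
    then show False using is_ray_parallel_eq[OF rays_at_D(1)[OF r'] rays_at_D(1)[OF r]] ne by blast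
  qed
  moreover have "int_vec v' \<noteq> 0" using rays_at_D(6)[OF r'] by simp
  ultimately have ind: "independent {int_vec v, int_vec v'}" "int_vec v \<noteq> int_vec v'"
    using span_base[of "int_vec v'" "{int_vec v'}"] by (auto simp: independent_insert)
  have "{x. d \<bullet> x = 0} \<subseteq> span {int_vec v, int_vec v'}"
    using ind d by (intro card_ge_dim_independent) (auto simp: dim_hyperplane)
  moreover have "d \<bullet> ?e = 0" using d(4) by (simp add: inner_axis)
  ultimately have "?e \<in> span {int_vec v, int_vec v'}" by blast
  then obtain \<alpha> \<beta> where "?e - \<alpha> *\<^sub>R int_vec v - \<beta> *\<^sub>R int_vec v' = 0"
    unfolding span_insert span_empty by auto
  then have e: "?e = \<alpha> *\<^sub>R int_vec v + \<beta> *\<^sub>R int_vec v'" by (simp add: algebra_simps)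
  have co: "?e $ j = \<alpha> * real_of_int (v $ j) + \<beta> * real_of_int (v' $ j)" for j
    using arg_cong[OF e, of "\<lambda>x. x $ j"] by simp
  have neg: False if "x < 0" and zz: "z \<in> rays_at f A" "z' \<in> rays_at f A" "z \<noteq> z'" "?e = x *\<^sub>R int_vec z + y *\<^sub>R int_vec z'" for x y z z'
  proof -
    have "1 = x * real_of_int (z $ u) + y * real_of_int (z' $ u)"
      using arg_cong[OF zz(4), of "\<lambda>x. x $ u"] by (simp add: axis_def)
    moreover have "x * real_of_int (z $ u) \<le> 0" using \<open>x < 0\<close> rays_at_D(5)[OF zz(1), of u] by (simp add: mult_le_0_iff)
    moreover have "0 \<le> z' $ u" using rays_at_D(5)[OF zz(2)] .
    ultimately have y: "0 < y" by (smt (verit) mult_nonpos_nonneg of_int_0_le_iff)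
    have ez: "int_vec z' = (- x / y) *\<^sub>R int_vec z + (1 / y) *\<^sub>R ?e"
      using zz(4) y by (simp add: vec_eq_iff field_simps)
    have cz: "(1 / y) *\<^sub>R ?e \<in> newton_cone f A"
      using y axis_in_newton_cone[OF Au] unfolding int_vec_axis by (intro newton_cone_scale) auto
    have "0 < - x / y" using \<open>x < 0\<close> y by (intro divide_pos_pos) auto
    then have "z = z'" by (rule ray_extreme_ray[OF zz(2,1) ez _ cz])
    then show False using zz(3) by blast
  qed
  have na: "\<not> 0 < \<alpha>" if "0 \<le> \<beta>"
  proof
    assume a: "0 < \<alpha>"
    obtain j where j: "j \<noteq> u" "v $ j \<noteq> 0" using Q_off_axis[OF v Au] by blast
    then have "0 < \<alpha> * real_of_int (v $ j)" using a nn(1)[of j] by simp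
    moreover have "0 \<le> \<beta> * real_of_int (v' $ j)" using that nn(2)[of j] by simp
    ultimately show False using co[of j] j(1) by (simp add: axis_def)
  qed
  have nb: "\<not> 0 < \<beta>" if "0 \<le> \<alpha>"
  proof
    assume a: "0 < \<beta>"
    obtain j where j: "j \<noteq> u" "v' $ j \<noteq> 0" using Q_off_axis[OF v' Au] by blast
    then have "0 < \<beta> * real_of_int (v' $ j)" using a nn(2)[of j] by simp
    moreover have "0 \<le> \<alpha> * real_of_int (v $ j)" using that nn(1)[of j] by simp
    ultimately show False using co[of j] j(1) by (simp add: axis_def)
  qed
  have e': "?e = \<beta> *\<^sub>R int_vec v' + \<alpha> *\<^sub>R int_vec v" using e by (simp only: add.commute)
  have a: "0 \<le> \<alpha>"
  proof (rule ccontr)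
    assume "\<not> 0 \<le> \<alpha>"
    then have "\<alpha> < 0" by simp
    then show False by (rule neg[OF _ r r' ne e])
  qed
  have b: "0 \<le> \<beta>"
  proof (rule ccontr)
    assume "\<not> 0 \<le> \<beta>"
    then have "\<beta> < 0" by simp
    then show False by (rule neg[OF _ r' r ne[symmetric] e'])
  qed
  have "\<alpha> = 0" "\<beta> = 0" using na[OF b] nb[OF a] a b by auto
  then show False using co[of u] by (simp add: axis_def)
qed

text \<open>In each of the two variables only one exponent has height 1, and it is \<open>C\<close>
  both times; the other exponents lie on a coordinate axis, where the weight leaves only
  \<open>A\<close>. Then \<open>axis i 1 - axis u 1\<close> is tight, although its entries have
  opposite signs and the ray is nonnegative.\<close>

lemma double_apex:
  assumes z: "is_ray f z" and b: "b1_apex f z i C1" "b1_apex f z u C2" and iu: "i \<noteq> u"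
    and AC: "A \<in> wface f z" "C \<in> wface f z" "A $ i = 0" "A $ u = 0" "C $ i = 1" "C $ u = 1"
  shows False
proof -
  obtain a b where ind: "a \<noteq> i" "b \<noteq> i" "a \<noteq> b" "UNIV = {i, a, b}" by (rule index_3_cases)
  obtain j where j: "j \<noteq> i" "u \<noteq> i" "u \<noteq> j" "UNIV = {i, u, j}"
  proof (cases "u = a")
    case True
    then show ?thesis using ind that[of b] by auto
  next
    case False
    then have "u = b" using ind(4) iu by (metis UNIV_I insertE singletonD)
    then show ?thesis using ind that[of a] by auto
  qed
  have s3: "(\<Sum>m\<in>UNIV. g m) = g i + g u + g j" for g :: "3 \<Rightarrow> int"
    using sum_index_3[OF j(2,1,3,4)] .
  have zi: "0 < z $ i" "0 < z $ u" using b unfolding b1_apex_def by auto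
  have wz: "wt z w = wt z A" if "w \<in> wface f z" for w using that AC(1) by (simp add: wface_def)
  have "wt z C = z $ i + z $ u + z $ j * int (C $ j)" "wt z A = z $ j * int (A $ j)"
    using AC by (simp_all add: wt_def s3)
  then have zj: "z $ j \<noteq> 0" using wz[OF AC(2)] zi by auto
  have nz: "z $ m \<noteq> 0" for m using zi zj j(4) by (metis UNIV_I insertE less_irrefl singletonD)
  have one: "w = C1" if "w \<in> wface f z" "w $ i = 1" for w using b(1) that nz unfolding b1_apex_def by (metis zero_neq_one)
  have two: "w = C2" if "w \<in> wface f z" "w $ u = 1" for w using b(2) that nz unfolding b1_apex_def by (metis zero_neq_one)
  have E: "w = A \<or> w = C" if w: "w \<in> wface f z" for w
  proof (cases "w $ i = 0")
    case True
    then have "w \<noteq> C" using AC by auto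
    then have "w $ u \<noteq> 1" using two[OF w] two[OF AC(2,6)] by auto
    then have "w $ u = 0" using b1_apex_coord[OF b(2) w] by auto
    then have "wt z w = z $ j * int (w $ j)" using True by (simp add: wt_def s3)
    moreover have "wt z A = z $ j * int (A $ j)" using AC by (simp add: wt_def s3)
    ultimately have "w $ j = A $ j" using wz[OF w] zj by simp
    then have "w $ m = A $ m" for m using True \<open>w $ u = 0\<close> AC j(4) by (metis UNIV_I insertE singletonD)
    then show ?thesis by (simp add: vec_eq_iff)
  next
    case False
    then have "w $ i = 1" using b1_apex_coord[OF b(1) w] by auto
    then show ?thesis using one[OF w] one[OF AC(2,5)] by simp
  qed
  define d :: "real ^ 3" where "d = axis i 1 - axis u 1"
  have dC: "d \<bullet> real_vec C = d \<bullet> real_vec A" using AC by (simp add: d_def inner_diff_left inner_axis')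
  have "tight f z d" unfolding tight_def
  proof (intro conjI ballI allI impI)
    fix w w' assume "w \<in> wface f z" "w' \<in> wface f z"
    then show "d \<bullet> (real_vec w - real_vec w') = 0" using E[of w] E[of w'] dC by (auto simp: inner_diff_right)
  qed (use nz in auto)
  then obtain k where k: "d = k *\<^sub>R int_vec z" using z unfolding is_ray_def by blast
  have k1: "1 = k * real_of_int (z $ i)" using arg_cong[OF k, of "\<lambda>x. x $ i"] iu by (simp add: d_def axis_def)
  have k2: "- 1 = k * real_of_int (z $ u)" using arg_cong[OF k, of "\<lambda>x. x $ u"] iu by (simp add: d_def axis_def)
  show False
  proof (cases "0 \<le> k")
    case True
    then have "0 \<le> k * real_of_int (z $ u)" using zi by (intro mult_nonneg_nonneg) auto
    then show False using k2 by simp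
  next
    case False
    then have "k * real_of_int (z $ i) \<le> 0" using zi by (intro mult_nonpos_nonneg) auto
    then show False using k1 by simp
  qed
qed

lemma coord_ne_1: "c {A} \<noteq> 0 \<Longrightarrow> A $ u \<noteq> 1"
  using c_apex by blast

text \<open>By \<open>coplanar\<close> the shared edge cannot lie in the coordinate plane of a B1
  variable, so \<open>C\<close> has height 1 for every such variable. \<open>double_apex\<close>
  leaves one variable for each facet, and \<open>Q_pair\<close> provides a common one.\<close>

lemma same_dirn:
  assumes vw: "v \<in> Q" "w \<in> Q" "v \<noteq> w" and A: "A \<in> wface f v" "A \<in> wface f w" and C: "C \<in> wface f v" "C \<in> wface f w"
    and AC: "A \<noteq> C" and cA: "c {A} \<noteq> 0"
  shows "dirn v = dirn w"
proof -
  have *: "A $ u = 0 \<and> C $ u = 1" if z: "z = v \<or> z = w" "b1_apex f z u C'" for z u C'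
  proof -
    have zE: "A \<in> wface f z" "C \<in> wface f z" using z(1) A C by auto
    have Au: "A $ u = 0" using b1_apex_coord[OF z(2) zE(1)] coord_ne_1[OF cA, of u] by auto
    have "C $ u \<noteq> 0"
    proof
      assume Cu: "C $ u = 0"
      have "int_vec (edge C A) \<noteq> 0" using AC unfolding int_vec_edge by simp
      moreover have "int_vec (edge C A) \<bullet> int_vec v = 0" "int_vec (edge C A) \<bullet> int_vec w = 0"
        using A C by (auto simp: inner_int_int lin_form_edge wface_def)
      moreover have "int_vec (edge C A) $ u = 0" using Au Cu by (simp add: edge_def)
      ultimately show False by (intro coplanar[OF vw(1) A(1) vw(2) A(2) vw(3) Au])
    qed
    then show ?thesis using Au b1_apex_coord[OF z(2) zE(2)] by auto
  qed
  obtain u C1 C2 where u: "b1_apex f v u C1" "b1_apex f w u C2" using Q_pair[OF vw(1,2) A C AC] by blast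
  have "dirn v = u"
    using double_apex[OF Q_ray[OF vw(1)] apex[OF vw(1)] u(1) _ A(1) C(1)] *[OF _ apex[OF vw(1)]] *[OF _ u(1)] by auto
  moreover have "dirn w = u"
    using double_apex[OF Q_ray[OF vw(2)] apex[OF vw(2)] u(2) _ A(2) C(2)] *[OF _ apex[OF vw(2)]] *[OF _ u(2)] by auto
  ultimately show ?thesis by simp
qed

text \<open>The feet of the fibres. Points with coefficient 0 contribute nothing and are left out;
  the lower part of a foot then has nonzero coefficient as well.\<close>

definition base :: "(int ^ 3) set" where
  "base = {k \<in> pos_points. c (wface f k) \<noteq> 0 \<and> (\<exists>v\<in>Q. wface f k \<subseteq> wface f v \<and> apex v \<in> wface f k)}"

definition chosen :: "int ^ 3 \<Rightarrow> int ^ 3" where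
  "chosen k = (SOME v. v \<in> Q \<and> wface f k \<subseteq> wface f v \<and> apex v \<in> wface f k)"

definition lower :: "int ^ 3 \<Rightarrow> (nat ^ 3) set" where
  "lower k = {w \<in> wface f k. w $ dirn (chosen k) = 0}"

definition fibre :: "(int ^ 3) \<times> nat \<Rightarrow> int ^ 3" where
  "fibre = (\<lambda>(k, t). up k (dirn (chosen k)) (int t))"

definition killed :: "(int ^ 3) set" where
  "killed = fibre ` (base \<times> UNIV)"

text \<open>Under a positive weight the face is a pyramid: a single exponent lies above the
  plane.\<close>

lemma star:
  assumes k: "k \<in> pos_points" and v: "v \<in> Q" "wface f k \<subseteq> wface f v" "apex v \<in> wface f k"
  shows "wface f k = insert (apex v) {w \<in> wface f k. w $ dirn v = 0}" "apex v $ dirn v = 1"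
proof -
  show 1: "apex v $ dirn v = 1" using apex[OF v(1)] unfolding b1_apex_def by blast
  have "w $ dirn v = 0 \<or> w = apex v" if "w \<in> wface f k" for w
    using b1_apex_coord[OF apex[OF v(1)], of w] b1_apex_unique[OF apex[OF v(1)] k v(2) that] that v(2) by blast
  then show "wface f k = insert (apex v) {w \<in> wface f k. w $ dirn v = 0}" using v(3) by blast
qed

lemma baseD:
  assumes "k \<in> base"
  shows "k \<in> pos_points" "chosen k \<in> Q" "wface f k \<subseteq> wface f (chosen k)" "apex (chosen k) \<in> wface f k"
    "wface f k = insert (apex (chosen k)) (lower k)" "apex (chosen k) $ dirn (chosen k) = 1"
    "lower k \<noteq> {}" "c (wface f k) = - (\<kappa> * c (lower k))" "c (lower k) \<noteq> 0"
proof -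
  have ex: "\<exists>v. v \<in> Q \<and> wface f k \<subseteq> wface f v \<and> apex v \<in> wface f k" using assms unfolding base_def by blast
  have ch: "chosen k \<in> Q \<and> wface f k \<subseteq> wface f (chosen k) \<and> apex (chosen k) \<in> wface f k"
    unfolding chosen_def using ex by (rule someI_ex)
  then show b: "chosen k \<in> Q" "wface f k \<subseteq> wface f (chosen k)" "apex (chosen k) \<in> wface f k" by auto
  show kp: "k \<in> pos_points" using assms unfolding base_def by blast
  have cn: "c (wface f k) \<noteq> 0" using assms unfolding base_def by blast
  show e: "wface f k = insert (apex (chosen k)) (lower k)" "apex (chosen k) $ dirn (chosen k) = 1"
    using star[OF kp b] unfolding lower_def by auto
  show ne: "lower k \<noteq> {}"
  proof
    assume "lower k = {}"
    then have "wface f k = {apex (chosen k)}" using e(1) by simp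
    then show False using cn c_apex[OF e(2)] by simp
  qed
  show "c (wface f k) = - (\<kappa> * c (lower k))"
    by (rule c_edge[OF kp e(1) _ e(2) ne]) (use e(2) in \<open>auto simp: lower_def\<close>)
  then show "c (lower k) \<noteq> 0" using cn by auto
qed

lemma baseI:
  assumes "k \<in> pos_points" "v \<in> Q" "wface f k \<subseteq> wface f v" "apex v \<in> wface f k"
    and "{w \<in> wface f k. w $ dirn v = 0} = E" "E \<noteq> {}" "c E \<noteq> 0"
  shows "k \<in> base"
proof -
  have "c (wface f k) = - (\<kappa> * c E)"
    by (rule c_edge[OF assms(1) star(1)[OF assms(1-4), unfolded assms(5)] _ star(2)[OF assms(1-4)] assms(6)])
      (use star(2)[OF assms(1-4)] assms(5) in auto)
  then show ?thesis unfolding base_def using assms kappa by auto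
qed

lemma fibre_face:
  assumes k: "k \<in> base" and t: "0 < t"
  shows "fibre (k, t) \<in> pos_points" "wmin f (fibre (k, t)) = wmin f k" "wface f (fibre (k, t)) = lower k"
proof -
  obtain w where "w \<in> lower k" using baseD(7)[OF k] by blast
  then have "w \<in> wface f k" "w $ dirn (chosen k) = 0" unfolding lower_def by auto
  note up_face[OF baseD(1)[OF k] _ this, of "int t"]
  then show "fibre (k, t) \<in> pos_points" "wmin f (fibre (k, t)) = wmin f k" "wface f (fibre (k, t)) = lower k"
    using t unfolding fibre_def lower_def by auto
qed

lemma fibre_0 [simp]: "fibre (k, 0) = k"
  unfolding fibre_def by simp

lemma base_killed: "k \<in> base \<Longrightarrow> k \<in> killed"
  unfolding killed_def by (intro image_eqI[of _ _ "(k, 0)"]) auto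

lemma lower_in_fibre: "k \<in> base \<Longrightarrow> 0 < t \<Longrightarrow> w \<in> wface f (fibre (k, t)) \<Longrightarrow> w $ dirn (chosen k) = 0 \<and> w \<in> wface f k"
  using fibre_face(3)[of k t] unfolding lower_def by auto

text \<open>Such a point would have a face in the coordinate plane of the first facet that contains
  two exponents common to both facets, which \<open>coplanar\<close> excludes.\<close>

lemma fibre_at_foot:
  assumes k0: "k0 \<in> base" and k1: "k1 \<in> base" and t: "0 < t" and eq: "k1 = fibre (k0, t)"
  shows False
proof -
  let ?v = "chosen k0" and ?v' = "chosen k1"
  note b0 = baseD[OF k0] and b1 = baseD[OF k1]
  have low: "w $ dirn ?v = 0" "w \<in> wface f ?v" "w \<in> wface f ?v'" if "w \<in> wface f k1" for w
    using lower_in_fibre[OF k0 t, of w] that b0(3) b1(3) unfolding eq[symmetric] by auto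
  obtain A where A: "A \<in> lower k1" using b1(7) by blast
  then have A': "A \<in> wface f k1" "A $ dirn ?v' = 0" unfolding lower_def by auto
  let ?C = "apex ?v'"
  have ne: "A \<noteq> ?C" using A'(2) b1(6) by auto
  have "dirn ?v \<noteq> dirn ?v'" using low(1)[OF b1(4)] b1(6) by auto
  then have vv: "?v \<noteq> ?v'" by auto
  have "int_vec (edge ?C A) \<noteq> 0" using ne unfolding int_vec_edge by simp
  moreover have "int_vec (edge ?C A) \<bullet> int_vec ?v = 0" "int_vec (edge ?C A) \<bullet> int_vec ?v' = 0"
    using low[OF A'(1)] low[OF b1(4)] by (auto simp: inner_int_int lin_form_edge wface_def)
  moreover have "int_vec (edge ?C A) $ dirn ?v = 0" using low(1)[OF A'(1)] low(1)[OF b1(4)] by (simp add: edge_def)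
  ultimately show False
    by (rule coplanar[OF b0(2) low(2)[OF A'(1)] b1(2) low(3)[OF A'(1)] vv low(1)[OF A'(1)]])
qed


text \<open>
  If the fibres over two different edges \<open>A C\<close>, \<open>A C'\<close> in different directions \<open>i\<close>, \<open>i'\<close> met, then \<open>A\<close> would lie
  on a coordinate axis and one of the edges, say \<open>A C\<close>, in the coordinate plane of \<open>i'\<close>. Then the cone
  dual to \<open>A\<close> is spanned by the first facet normal and two coordinate directions.
\<close>

lemma axis_corner_rays:
  assumes v: "v \<in> Q" "A \<in> wface f v" and b: "b1_apex f v i C" and AC: "A $ i = 0" "A $ u = 0" "C $ u = 0" and iu: "u \<noteq> i"
    and k: "k \<in> pos_points" "wface f k = {A}" and v': "v' \<in> Q" "A \<in> wface f v'"
  shows "v' = v"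
proof (rule ccontr)
  assume ne: "v' \<noteq> v"
  note r = rays_atI[OF v] and r' = rays_atI[OF v']
  obtain a b where ind: "a \<noteq> i" "b \<noteq> i" "a \<noteq> b" "UNIV = {i, a, b}" by (rule index_3_cases)
  obtain j where j: "j \<noteq> i" "u \<noteq> j" "UNIV = {i, u, j}"
  proof (cases "u = a")
    case True
    then show ?thesis using ind that[of b] by auto
  next
    case False
    then have "u = b" using ind(4) iu by (metis UNIV_I insertE singletonD)
    then show ?thesis using ind that[of a] by auto
  qed
  have s3: "(\<Sum>m\<in>UNIV. g m) = g i + g u + g j" for g :: "3 \<Rightarrow> real"
    using sum_index_3[OF iu j(1,2,3)] .
  have nax: "\<exists>a. a \<noteq> i \<and> v $ a \<noteq> 0" using Q_off_axis[OF v AC(1)] .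
  obtain w g where wg: "corner_data f v i C A w g"
    using corner_data_exists[OF b r AC(1) nax k] by blast
  note g = corner_dataD[OF wg]
  have b': "0 < v $ i" "C \<in> wface f v" "C $ i = 1" using b unfolding b1_apex_def by auto
  let ?l = "int_vec (edge C A)"
  let ?eu = "axis u 1 :: real ^ 3" and ?ei = "axis i 1 :: real ^ 3"
  have li: "?l $ i = 1" "?l $ u = 0" using b' AC by (auto simp: edge_def)
  have lv: "?l \<bullet> int_vec v = 0" using v(2) b'(2) by (simp add: inner_int_int lin_form_edge wface_def)
  have "real_of_int (v $ i) + ?l $ j * real_of_int (v $ j) = 0" using lv li unfolding inner_vec_def by (simp add: s3)
  then have vj: "v $ j \<noteq> 0" using b'(1) by auto
  then have vj0: "0 < v $ j" using rays_at_D(5)[OF r, of j] by simp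
  have gu: "0 \<le> int_vec g \<bullet> ?eu" using g(3)[OF axis_in_newton_cone[OF AC(2)]] unfolding int_vec_axis .
  have gun: "int_vec g \<bullet> ?eu \<noteq> 0"
  proof
    assume "int_vec g \<bullet> ?eu = 0"
    moreover have "?l \<bullet> ?eu = 0" using li by (simp add: inner_axis)
    ultimately obtain m where m: "?eu = m *\<^sub>R int_vec v" using g(5) by blast
    have "0 = m * real_of_int (v $ j)" using arg_cong[OF m, of "\<lambda>x. x $ j"] j by (simp add: axis_def)
    then have "m = 0" using vj by simp
    then show False using arg_cong[OF m, of "\<lambda>x. x $ u"] by (simp add: axis_def)
  qed
  have c1: "0 \<le> ?l \<bullet> int_vec v'"
    using newton_cone_inner[OF rays_at_D(4)[OF r'], of C] b'(2) by (simp add: wface_def)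
  \<comment> \<open>The coefficients of \<open>v'\<close> with respect to \<open>v\<close>,
    \<open>?eu\<close> and \<open>?ei\<close>: \<open>\<alpha>\<close> is read off at the coordinate
    \<open>j\<close>, \<open>\<beta>\<close> by \<open>g\<close> and \<open>\<gamma>\<close> by the
    edge form.\<close>
  define \<gamma> where "\<gamma> = ?l \<bullet> int_vec v'"
  define \<alpha> where "\<alpha> = real_of_int (v' $ j) / real_of_int (v $ j)"
  define \<beta> where "\<beta> = (int_vec g \<bullet> int_vec v') / (int_vec g \<bullet> ?eu)"
  have nonneg: "0 \<le> \<alpha>" "0 \<le> \<beta>" "0 \<le> \<gamma>"
    using c1 vj0 rays_at_D(5)[OF r', of j] gu g(3)[OF rays_at_D(4)[OF r']] unfolding \<alpha>_def \<beta>_def \<gamma>_def by auto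
  define y where "y = int_vec v' - (\<alpha> *\<^sub>R int_vec v + \<beta> *\<^sub>R ?eu + \<gamma> *\<^sub>R ?ei)"
  have "?l \<bullet> y = 0" unfolding y_def using lv li by (simp add: inner_diff_right inner_add_right inner_axis \<gamma>_def)
  moreover have "int_vec g \<bullet> y = 0"
  proof -
    have "int_vec g \<bullet> int_vec v = 0" using g(2) by (simp add: inner_int_int)
    moreover have "int_vec g \<bullet> ?ei = 0" using g(1) by (simp add: inner_axis)
    ultimately show ?thesis unfolding y_def using gun by (simp add: inner_diff_right inner_add_right \<beta>_def)
  qed
  ultimately obtain m where m: "y = m *\<^sub>R int_vec v" using g(5) by blast
  have "y $ j = 0" unfolding y_def \<alpha>_def using vj j by (simp add: axis_def)
  then have "m = 0" using m vj by simp
  then have e: "int_vec v' = \<alpha> *\<^sub>R int_vec v + (\<beta> *\<^sub>R ?eu + \<gamma> *\<^sub>R ?ei)" using m unfolding y_def by simp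
  have cone: "\<beta> *\<^sub>R ?eu + \<gamma> *\<^sub>R ?ei \<in> newton_cone f A"
    using axis_in_newton_cone[OF AC(2)] axis_in_newton_cone[OF AC(1)] nonneg unfolding int_vec_axis
    by (intro newton_cone_add newton_cone_scale)
  have a0: "\<alpha> = 0"
  proof (rule ccontr)
    assume "\<alpha> \<noteq> 0"
    then have "0 < \<alpha>" using nonneg by simp
    then have "v = v'" using ray_extreme_ray[OF r' r e _ cone] by blast
    then show False using ne by simp
  qed
  have co: "real_of_int (v' $ m) = \<beta> * ?eu $ m + \<gamma> * ?ei $ m" for m
    using arg_cong[OF e, of "\<lambda>x. x $ m"] a0 by simp
  have "int_vec g \<bullet> int_vec v' = \<beta> * (int_vec g \<bullet> ?eu)" unfolding \<beta>_def using gun by simp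
  \<comment> \<open>\<open>v'\<close> is now a sum of vectors on two axes. Extremality puts it on
    one of them, against \<open>Q_off_axis\<close>.\<close>
  obtain z z' :: "real ^ 3" where zz: "z = \<beta> *\<^sub>R ?eu" "z' = \<gamma> *\<^sub>R ?ei" by blast
  have zc: "z \<in> newton_cone f A" "z' \<in> newton_cone f A"
    using axis_in_newton_cone[OF AC(2)] axis_in_newton_cone[OF AC(1)] nonneg unfolding int_vec_axis zz
    by (auto intro!: newton_cone_scale)
  have "int_vec v' = z + z'" using e a0 unfolding zz by simp
  then obtain m where m: "z = m *\<^sub>R int_vec v'" using ray_extreme[OF r' _ zc] by blast
  obtain p where p: "p \<noteq> u" "v' $ p \<noteq> 0" using Q_off_axis[OF v' AC(2)] by blast
  obtain q where q: "q \<noteq> i" "v' $ q \<noteq> 0" using Q_off_axis[OF v' AC(1)] by blast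
  have "v' $ j = 0" using co[of j] j by (simp add: axis_def)
  then have "v' $ u \<noteq> 0" "v' $ i \<noteq> 0" using p q j(3) by (metis UNIV_I insertE singletonD)+
  moreover have "m * real_of_int (v' $ i) = 0" using arg_cong[OF m, of "\<lambda>x. x $ i"] iu unfolding zz by (simp add: axis_def)
  moreover have "\<beta> = m * real_of_int (v' $ u)" using arg_cong[OF m, of "\<lambda>x. x $ u"] unfolding zz by (simp add: axis_def)
  moreover have "real_of_int (v' $ u) = \<beta>" using co[of u] iu by (simp add: axis_def)
  ultimately show False by simp
qed

text \<open>Fibres in different directions can meet above their feet only where the face is a vertex
  \<open>A\<close> on the third axis. A common apex is excluded by \<open>same_dirn\<close>. With
  different apexes the inequalities at the two feet push one apex into the other coordinate plane,
  which \<open>axis_corner_rays\<close> excludes.\<close>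

lemma fibres_disjoint:
  assumes k0: "k0 \<in> base" and k1: "k1 \<in> base" and t: "0 < t" "0 < t'" and eq: "fibre (k0, t) = fibre (k1, t')"
    and dn: "dirn (chosen k0) \<noteq> dirn (chosen k1)"
  shows False
proof -
  let ?v = "chosen k0" and ?v' = "chosen k1"
  let ?i = "dirn ?v" and ?u = "dirn ?v'" and ?C = "apex ?v" and ?C' = "apex ?v'"
  note b0 = baseD[OF k0] and b1 = baseD[OF k1]
  define k where "k = fibre (k0, t)"
  have kp: "k \<in> pos_points" and E0: "wface f k = lower k0" and E1: "wface f k = lower k1"
    using fibre_face[OF k0 t(1)] fibre_face[OF k1 t(2)] eq unfolding k_def by auto
  obtain A where A: "A \<in> wface f k" using b0(7) E0 by blast
  have z: "w $ ?i = 0" "w $ ?u = 0" "w \<in> wface f k0" "w \<in> wface f k1" if "w \<in> wface f k" for w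
    using that E0 E1 unfolding lower_def by auto
  obtain a b where ind: "a \<noteq> ?i" "b \<noteq> ?i" "a \<noteq> b" "UNIV = {?i, a, b}" by (rule index_3_cases)
  obtain j where j: "UNIV = {?i, ?u, j}" "j \<noteq> ?i" "?u \<noteq> j"
  proof (cases "?u = a")
    case True
    then show ?thesis using ind that[of b] by auto
  next
    case False
    then have "?u = b" using ind(4) dn by (metis UNIV_I insertE singletonD)
    then show ?thesis using ind that[of a] by auto
  qed
  have s3: "(\<Sum>m\<in>UNIV. g m) = g ?i + g ?u + g j" for g :: "3 \<Rightarrow> int"
    using sum_index_3[OF dn[symmetric] j(2,3,1)] .
  have kj: "k $ j \<noteq> 0" using kp unfolding pos_points_def by (metis mem_Collect_eq not_one_le_zero)
  have single: "wface f k = {A}"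
  proof -
    have "w = A" if w: "w \<in> wface f k" for w
    proof -
      have "wt k w = wt k A" using w A by (simp add: wface_def)
      then have "k $ j * int (w $ j) = k $ j * int (A $ j)" using z[OF w] z[OF A] by (simp add: wt_def s3)
      then have "w $ j = A $ j" using kj by simp
      then have "w $ m = A $ m" for m using z[OF w] z[OF A] j(1) by (metis UNIV_I insertE singletonD)
      then show ?thesis by (simp add: vec_eq_iff)
    qed
    then show ?thesis using A by blast
  qed
  have cA: "c {A} \<noteq> 0" using b0(9) E0 single by simp
  have Av: "A \<in> wface f ?v" "A \<in> wface f ?v'" using z[OF A] b0(3) b1(3) by auto
  have vv: "?v \<noteq> ?v'" using dn by auto
  have CE: "?C \<in> wface f k0" "?C' \<in> wface f k1" "?C $ ?i = 1" "?C' $ ?u = 1" using b0 b1 by auto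
  have e0: "wface f k0 = insert ?C {A}" "wface f k1 = insert ?C' {A}" using b0(5) b1(5) E0 E1 single by auto
  have ACn: "A \<noteq> ?C" "A \<noteq> ?C'" using z[OF A] CE by auto
  show False
  proof (cases "?C = ?C'")
    case True
    have "dirn ?v = dirn ?v'"
      by (rule same_dirn[OF b0(2) b1(2) vv Av _ _ ACn(1) cA]) (use b0(3,4) b1(3,4) True in auto)
    then show False using dn by simp
  next
    case False
    have wk: "wt k0 w = wt k w - int t * int (w $ ?i)" "wt k1 w = wt k w - int t' * int (w $ ?u)" for w
    proof -
      have "wt x w = wt (fibre (x, s)) w - int s * int (w $ dirn (chosen x))" for x s
        by (simp add: fibre_def wt_up)
      from this[of k0 t] this[of k1 t'] show "wt k0 w = wt k w - int t * int (w $ ?i)" "wt k1 w = wt k w - int t' * int (w $ ?u)"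
        using eq unfolding k_def by simp_all
    qed
    \<comment> \<open>At each foot the apex of the other facet lies strictly above the
      minimum.\<close>
    have ge: "wt k0 A < wt k0 ?C'" "wt k1 A < wt k1 ?C"
    proof -
      have V: "?C \<in> Poly_Mapping.keys f" "?C' \<in> Poly_Mapping.keys f" using CE unfolding wface_def by auto
      have "?C' \<notin> wface f k0" "?C \<notin> wface f k1" using e0 False ACn by auto
      then show "wt k0 A < wt k0 ?C'" "wt k1 A < wt k1 ?C"
        using V z[OF A] wmin_le[OF V(2), of k0] wmin_le[OF V(1), of k1] unfolding wface_def by auto
    qed
    have eqs: "wt k0 A = wt k0 ?C" "wt k1 A = wt k1 ?C'" using CE(1,2) z(3,4)[OF A] by (simp_all add: wface_def)
    have i1: "wt k A = wt k ?C - int t" "wt k A = wt k ?C' - int t'"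
      using eqs CE(3,4) z(1,2)[OF A] by (simp_all add: wk)
    have lt: "int t * int (?C' $ ?i) < int t'" "int t' * int (?C $ ?u) < int t"
      using ge i1 z(1,2)[OF A] by (simp_all add: wk)
    have "?C' $ ?i = 0 \<or> ?C $ ?u = 0"
    proof (rule ccontr)
      assume "\<not> ?thesis"
      then have one: "1 \<le> int (?C' $ ?i)" "1 \<le> int (?C $ ?u)" by auto
      have "int t * 1 \<le> int t * int (?C' $ ?i)" using one(1) by (rule mult_left_mono) simp
      moreover have "int t' * 1 \<le> int t' * int (?C $ ?u)" using one(2) by (rule mult_left_mono) simp
      ultimately show False using lt by linarith
    qed
    then show False
    proof
      assume Cu: "?C $ ?u = 0"
      have "?v' = ?v"
        by (rule axis_corner_rays[OF b0(2) Av(1) apex[OF b0(2)] z(1,2)[OF A] Cu dn[symmetric] kp single b1(2) Av(2)])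
      then show False using vv by simp
    next
      assume Cu: "?C' $ ?i = 0"
      have "?v = ?v'"
        by (rule axis_corner_rays[OF b1(2) Av(2) apex[OF b1(2)] z(2,1)[OF A] Cu dn kp single b0(2) Av(1)])
      then show False using vv by simp
    qed
  qed
qed

text \<open>If two fibres with the same direction meet, one foot lies on the other fibre; different
  directions are excluded by \<open>fibres_disjoint\<close>.\<close>

lemma inj_fibre: "inj_on fibre (base \<times> UNIV)"
proof (rule inj_onI, clarify)
  fix k0 t k1 t' assume k: "k0 \<in> base" "k1 \<in> base" and eq: "fibre (k0, t) = fibre (k1, t')"
  show "k0 = k1 \<and> t = t'"
  proof (cases "dirn (chosen k0) = dirn (chosen k1)")
    case True
    have *: False if kk: "x \<in> base" "y \<in> base" "dirn (chosen x) = dirn (chosen y)" "fibre (x, s) = fibre (y, s')" "s < s'" for x y s s'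
    proof -
      have "x = up (fibre (x, s)) (dirn (chosen x)) (- int s)" unfolding fibre_def by (simp add: up_up)
      also have "\<dots> = fibre (y, s' - s)" unfolding kk(4) unfolding fibre_def using kk(3,5) by (simp add: up_up of_nat_diff)
      finally show False using fibre_at_foot[OF kk(2,1), of "s' - s"] kk(5) by simp
    qed
    have "t = t'" using *[OF k True eq] *[OF k(2,1) True[symmetric] eq[symmetric]] by (metis linorder_neqE_nat)
    moreover have "x = up (fibre (x, s)) (dirn (chosen x)) (- int s)" for x s unfolding fibre_def by (simp add: up_up)
    then have "k0 = k1" using eq True \<open>t = t'\<close> by metis
    ultimately show ?thesis by blast
  next
    case False
    consider "t = 0" "t' = 0" | "t = 0" "0 < t'" | "0 < t" "t' = 0" | "0 < t" "0 < t'" by auto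
    then show ?thesis
    proof cases
      case 1
      then show ?thesis using eq by simp
    next
      case 2
      then show ?thesis using fibre_at_foot[OF k(2,1) 2(2)] eq by simp
    next
      case 3
      then show ?thesis using fibre_at_foot[OF k 3(1)] eq by simp
    next
      case 4
      then show ?thesis using fibres_disjoint[OF k _ _ eq False] by blast
    qed
  qed
qed

end

text \<open>Coordinates with respect to \<open>axis i 1\<close>, \<open>v\<close> and
  \<open>w\<close>. The edge form and \<open>g\<close> read off the first and the last, and
  \<open>h\<close> is an integral form negatively proportional to the middle one.\<close>

lemma corner_decomposition:
  assumes b1: "b1_apex f v i C" and v: "v \<in> rays_at f A" and A: "A $ i = 0" and cd: "corner_data f v i C A w g"
  shows "\<exists>h a b. (\<forall>x. x = (int_vec (edge C A) \<bullet> x) *\<^sub>R axis i 1 + a x *\<^sub>R int_vec v + b x *\<^sub>R int_vec w) \<and>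
    (\<forall>x. 0 < a x \<longleftrightarrow> int_vec h \<bullet> x < 0) \<and> (\<forall>x. a x = 0 \<longleftrightarrow> int_vec h \<bullet> x = 0) \<and>
    (\<forall>x. 0 \<le> b x \<longleftrightarrow> 0 \<le> int_vec g \<bullet> x) \<and> (\<forall>x. 0 < b x \<longleftrightarrow> 0 < int_vec g \<bullet> x) \<and> lin_form h v < 0"
proof -
  note g = corner_dataD[OF cd]
  have b: "0 < v $ i" "C \<in> wface f v" "C $ i = 1" using b1 unfolding b1_apex_def by auto
  define l where "l = int_vec (edge C A)"
  define s :: "real ^ 3" where "s = 1"
  define gw where "gw = lin_form g w"
  define sw where "sw = (\<Sum>j\<in>UNIV. w $ j)"
  \<comment> \<open>Applying the coordinate sum \<open>s\<close> to the expansion of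
    \<open>x\<close> and solving for the coefficient of \<open>v\<close> yields this form, up to the
    factor \<open>- gw * (s \<bullet> int_vec v)\<close>.\<close>
  define h :: "int ^ 3" where "h = (\<chi> j. gw * (edge C A $ j - 1) + sw * g $ j)"
  have gw: "0 < gw" "int_vec g \<bullet> int_vec w = real_of_int gw" using g(8) unfolding gw_def by (auto simp: inner_int_int)
  have sx: "s \<bullet> x = (\<Sum>j\<in>UNIV. x $ j)" for x unfolding s_def inner_vec_def by simp
  have sw: "s \<bullet> int_vec w = real_of_int sw" unfolding sx sw_def by simp
  have "int_vec h = real_of_int gw *\<^sub>R (l - s) + real_of_int sw *\<^sub>R int_vec g"
    by (simp add: vec_eq_iff h_def l_def s_def)
  then have hx: "int_vec h \<bullet> x = real_of_int gw * (l \<bullet> x - s \<bullet> x) + real_of_int sw * (int_vec g \<bullet> x)" for x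
    by (simp add: inner_add_left inner_diff_left)
  have "v $ i \<le> (\<Sum>j\<in>UNIV. v $ j)" using rays_at_D(5)[OF v] by (intro member_le_sum) auto
  then have "0 < (\<Sum>j\<in>UNIV. v $ j)" using b(1) by linarith
  moreover have "s \<bullet> int_vec v = real_of_int (\<Sum>j\<in>UNIV. v $ j)" unfolding sx by simp
  ultimately have sv: "0 < s \<bullet> int_vec v" by (simp del: of_int_sum)
  have lv: "l \<bullet> int_vec v = 0"
    using b(2) rays_at_D(2)[OF v] unfolding l_def by (simp add: inner_int_int lin_form_edge wface_def)
  have lw: "l \<bullet> int_vec w = 0" using g(7) unfolding l_def by (simp add: inner_int_int)
  have gv: "int_vec g \<bullet> int_vec v = 0" using g(2) by (simp add: inner_int_int)
  have ei: "l \<bullet> axis i 1 = 1" "int_vec g \<bullet> axis i 1 = 0" "s \<bullet> axis i 1 = 1"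
    using b(3) A g(1) unfolding l_def s_def by (auto simp: inner_axis edge_def)
  define a where "a = (\<lambda>x. - (int_vec h \<bullet> x) / (real_of_int gw * (s \<bullet> int_vec v)))"
  define b' where "b' = (\<lambda>x. (int_vec g \<bullet> x) / real_of_int gw)"
  have dec: "x = (l \<bullet> x) *\<^sub>R axis i 1 + a x *\<^sub>R int_vec v + b' x *\<^sub>R int_vec w" for x
  proof -
    define y where "y = x - ((l \<bullet> x) *\<^sub>R axis i 1 + a x *\<^sub>R int_vec v + b' x *\<^sub>R int_vec w)"
    have "l \<bullet> y = 0" unfolding y_def by (simp add: inner_diff_right inner_add_right lv lw ei)
    moreover have "int_vec g \<bullet> y = 0" unfolding y_def using gw
      by (simp add: inner_diff_right inner_add_right gv ei b'_def)
    ultimately obtain m where m: "y = m *\<^sub>R int_vec v" using g(5) unfolding l_def by blast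
    have asv: "a x * (s \<bullet> int_vec v) = - (int_vec h \<bullet> x) / real_of_int gw" using sv unfolding a_def by simp
    have "s \<bullet> y = s \<bullet> x - (l \<bullet> x + a x * (s \<bullet> int_vec v) + b' x * real_of_int sw)"
      unfolding y_def by (simp add: inner_diff_right inner_add_right sw ei)
    also have "\<dots> = 0" unfolding asv b'_def hx using gw(1) by (simp add: field_simps)
    finally have "m * (s \<bullet> int_vec v) = 0" unfolding m by simp
    then have "y = 0" using sv m by simp
    then show ?thesis unfolding y_def by simp
  qed
  have "0 < a x \<longleftrightarrow> int_vec h \<bullet> x < 0" "a x = 0 \<longleftrightarrow> int_vec h \<bullet> x = 0" for x
    using gw(1) sv unfolding a_def by (auto simp: zero_less_divide_iff divide_less_0_iff zero_less_mult_iff mult_less_0_iff)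
  moreover have "0 \<le> b' x \<longleftrightarrow> 0 \<le> int_vec g \<bullet> x" "0 < b' x \<longleftrightarrow> 0 < int_vec g \<bullet> x" for x
    using gw(1) unfolding b'_def by (simp_all add: zero_le_divide_iff zero_less_divide_iff not_less_iff_gr_or_eq)
  moreover have "int_vec h \<bullet> int_vec v < 0" unfolding hx using gw(1) sv by (simp add: lv gv)
  then have "lin_form h v < 0" unfolding inner_int_int by simp
  ultimately show ?thesis using dec unfolding l_def by (intro exI[of _ h] exI[of _ a] exI[of _ b'] conjI allI)
qed

lemma up_zero_plane:
  assumes "A \<in> wface f k" "A \<in> wface f (up k i t)" "A $ i = 0"
  shows "{w \<in> wface f (up k i t). w $ i = 0} = {w \<in> wface f k. w $ i = 0}"
  using assms unfolding wface_def by (auto simp: wt_up)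

section \<open>Half-spaces that cut off the removed points at a vertex\<close>

context b1_configuration
begin

lemma killedI:
  assumes "k0 \<in> pos_points" "v \<in> Q" "wface f k0 \<subseteq> wface f v" "apex v \<in> wface f k0"
    and "{w \<in> wface f k0. w $ dirn v = 0} = E" "E \<noteq> {}" "c E \<noteq> 0"
    and d: "k0 \<in> base \<Longrightarrow> dirn (chosen k0) = dirn v" and k: "k0 = up k (dirn v) (- t)" "0 \<le> t"
  shows "k \<in> killed"
proof -
  have b: "k0 \<in> base" by (rule baseI[OF assms(1-7)])
  have "k = up k0 (dirn v) t" unfolding k(1) by (simp add: up_up)
  then have "k = fibre (k0, nat t)" unfolding fibre_def using d[OF b] k(2) by simp
  then show ?thesis using b unfolding killed_def by (intro image_eqI[of _ _ "(k0, nat t)"]) auto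
qed

text \<open>Among points with face \<open>{A}\<close>, the inequality \<open>h >= 0\<close> holds at
  all that survive and fails on the fibres of \<open>v\<close>. It holds at the other rays and at
  the axes in the cone, and its boundary in the cone is spanned by the direction of \<open>v\<close>
  and the neighbour \<open>w\<close>, which allows \<open>v\<close> to be eliminated.\<close>

definition corner_form :: "int ^ 3 \<Rightarrow> nat ^ 3 \<Rightarrow> int ^ 3 \<Rightarrow> int ^ 3 \<Rightarrow> bool" where
  "corner_form v A h w \<longleftrightarrow>
    w \<in> rays_at f A \<and> w \<noteq> v \<and> lin_form (edge (apex v) A) w = 0 \<and> lin_form h v < 0 \<and>
    (\<forall>k. k \<in> pos_points \<longrightarrow> wface f k = {A} \<longrightarrow> k \<notin> killed \<longrightarrow> 0 \<le> lin_form h k \<and>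
      (\<exists>a b. a \<le> 0 \<and> 0 < b \<and> int_vec k = real_of_int (lin_form (edge (apex v) A) k) *\<^sub>R axis (dirn v) 1 +
        a *\<^sub>R int_vec v + b *\<^sub>R int_vec w)) \<and>
    (\<forall>k0 t. k0 \<in> base \<longrightarrow> chosen k0 = v \<longrightarrow> 0 < t \<longrightarrow> wface f (fibre (k0, t)) = {A} \<longrightarrow> lin_form h (fibre (k0, t)) < 0) \<and>
    (\<forall>r. r \<in> rays_at f A \<longrightarrow> r \<noteq> v \<longrightarrow> 0 \<le> lin_form h r) \<and> (\<forall>j. A $ j = 0 \<longrightarrow> 0 \<le> h $ j) \<and>
    (\<forall>y. y \<in> newton_cone f A \<longrightarrow> int_vec h \<bullet> y = 0 \<longrightarrow>
      (\<exists>\<alpha> \<beta>. 0 \<le> \<alpha> \<and> 0 \<le> \<beta> \<and> y = \<alpha> *\<^sub>R axis (dirn v) 1 + \<beta> *\<^sub>R int_vec w))"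

text \<open>A point with \<open>h < 0\<close> has a positive coefficient at \<open>v\<close>;
  lowered until the edge form is 0, it becomes a combination of \<open>v\<close> and
  \<open>w\<close> whose face contains the apex, that is, a foot. Conversely, a foot whose
  coefficient at \<open>v\<close> is nonpositive would split the ray \<open>w\<close> into parts
  along the foot and along \<open>v\<close>, which makes \<open>w\<close> parallel to the foot and
  then to \<open>v\<close>.\<close>

lemma corner_form_exists:
  assumes v: "v \<in> Q" "A \<in> wface f v" and cA: "c {A} \<noteq> 0" and k1: "k1 \<in> pos_points" "wface f k1 = {A}"
  shows "\<exists>h w. corner_form v A h w"
proof -
  define i where "i = dirn v"
  define C where "C = apex v"
  have b1: "b1_apex f v i C" unfolding i_def C_def by (rule apex[OF v(1)])
  have b: "0 < v $ i" "C \<in> wface f v" "C $ i = 1" using b1 unfolding b1_apex_def by auto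
  have Ai: "A $ i = 0" using b1_apex_coord[OF b1 v(2)] coord_ne_1[OF cA, of i] by auto
  have AC: "A \<noteq> C" using Ai b(3) by auto
  note r = rays_atI[OF v]
  have CV: "C \<in> Poly_Mapping.keys f" and AV: "A \<in> Poly_Mapping.keys f" using b(2) v(2) unfolding wface_def by auto
  obtain w g where cd: "corner_data f v i C A w g"
    using corner_data_exists[OF b1 r Ai Q_off_axis[OF v Ai] k1] by blast
  note g = corner_dataD[OF cd]
  define l where "l = int_vec (edge C A)"
  obtain h a \<beta> where dec: "\<And>x. x = (l \<bullet> x) *\<^sub>R axis i 1 + a x *\<^sub>R int_vec v + \<beta> x *\<^sub>R int_vec w"
    and a: "\<And>x. 0 < a x \<longleftrightarrow> int_vec h \<bullet> x < 0" "\<And>x. a x = 0 \<longleftrightarrow> int_vec h \<bullet> x = 0"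
    and be: "\<And>x. 0 \<le> \<beta> x \<longleftrightarrow> 0 \<le> int_vec g \<bullet> x" "\<And>x. 0 < \<beta> x \<longleftrightarrow> 0 < int_vec g \<bullet> x" and hv: "lin_form h v < 0"
    using corner_decomposition[OF b1 r Ai cd] unfolding l_def by auto
  note wr = g(6)
  have wv: "w \<noteq> v" using g(2,8) by auto
  have lw: "lin_form (edge (apex v) A) w = 0" using g(7) unfolding C_def .
  have l0: "l \<bullet> int_vec v = 0" "l \<bullet> int_vec w = 0" "l \<bullet> axis i 1 = 1"
  proof -
    show "l \<bullet> int_vec v = 0" using b(2) v(2) unfolding l_def inner_int_int lin_form_edge by (simp add: wface_def)
    show "l \<bullet> int_vec w = 0" using g(7) unfolding l_def inner_int_int by simp
    show "l \<bullet> axis i 1 = 1" using b(3) Ai unfolding l_def by (simp add: inner_axis edge_def)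
  qed
  have lpos: "0 \<le> l \<bullet> x" if "x \<in> newton_cone f A" for x using newton_cone_inner[OF that CV] unfolding l_def .
  have bpos: "0 \<le> \<beta> x" if "x \<in> newton_cone f A" for x using g(3)[OF that] be(1) by simp
  have ei: "axis i 1 \<in> newton_cone f A" using axis_in_newton_cone[OF Ai] unfolding int_vec_axis .
  note vc = rays_at_D(4)[OF r] and wc = rays_at_D(4)[OF wr]
  have rest: "(l \<bullet> x) *\<^sub>R axis i 1 + \<beta> x *\<^sub>R int_vec w \<in> newton_cone f A" if "x \<in> newton_cone f A" for x
    by (intro newton_cone_add newton_cone_scale ei wc lpos bpos that)
  have dec': "x = a x *\<^sub>R int_vec v + ((l \<bullet> x) *\<^sub>R axis i 1 + \<beta> x *\<^sub>R int_vec w)" for x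
  proof -
    have "(l \<bullet> x) *\<^sub>R axis i 1 + a x *\<^sub>R int_vec v + \<beta> x *\<^sub>R int_vec w = a x *\<^sub>R int_vec v + ((l \<bullet> x) *\<^sub>R axis i 1 + \<beta> x *\<^sub>R int_vec w)"
      by (simp add: algebra_simps)
    then show ?thesis using dec[of x] by (rule trans[rotated])
  qed
  have H1: "0 \<le> lin_form h k" if k: "k \<in> pos_points" "wface f k = {A}" "k \<notin> killed" for k
  proof (rule ccontr)
    assume "\<not> ?thesis"
    then have "int_vec h \<bullet> int_vec k < 0" unfolding inner_int_int by simp
    then have ak: "0 < a (int_vec k)" using a(1) by blast
    define t where "t = lin_form (edge C A) k"
    have t: "l \<bullet> int_vec k = real_of_int t" unfolding l_def t_def inner_int_int ..
    have kc: "int_vec k \<in> newton_cone f A" using pos_point_in_cone[OF k(1), of A f] k(2) by simp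
    have t0: "0 \<le> t" using lpos[OF kc] unfolding t by simp
    have bk: "0 \<le> \<beta> (int_vec k)" by (rule bpos[OF kc])
    define k0 where "k0 = up k i (- t)"
    have k0e: "int_vec k0 = a (int_vec k) *\<^sub>R int_vec v + \<beta> (int_vec k) *\<^sub>R int_vec w"
      using dec[of "int_vec k"] unfolding k0_def int_vec_up t by (simp add: algebra_simps)
    have k0p: "k0 \<in> pos_points" unfolding pos_points_def
    proof (intro CollectI allI)
      fix j
      show "1 \<le> k0 $ j"
      proof (cases "j = i")
        case True
        have "real_of_int (k0 $ i) = a (int_vec k) * real_of_int (v $ i) + \<beta> (int_vec k) * real_of_int (w $ i)"
          using arg_cong[OF k0e, of "\<lambda>x. x $ i"] by simp
        moreover have "0 < a (int_vec k) * real_of_int (v $ i)" using ak b(1) by simp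
        moreover have "0 \<le> \<beta> (int_vec k) * real_of_int (w $ i)" using bk rays_at_D(5)[OF wr, of i] by simp
        ultimately show ?thesis using True by simp
      next
        case False
        then show ?thesis using k(1) unfolding k0_def pos_points_def by simp
      qed
    qed
    have k0c: "int_vec k0 \<in> newton_cone f A" unfolding k0e
      using ak bk by (intro newton_cone_add newton_cone_scale vc wc) auto
    note E0 = wface_eq_cone[OF AV k0c]
    have A0: "A \<in> wface f k0" using AV E0(1) unfolding wface_def by simp
    have "l \<bullet> int_vec k0 = 0" unfolding k0e by (simp add: inner_add_right l0)
    then have "lin_form (edge C A) k0 = 0" unfolding l_def inner_int_int by simp
    then have C0: "C \<in> wface f k0" using A0 CV by (simp add: lin_form_edge wface_def)
    \<comment> \<open>The edge form of \<open>u\<close> is nonnegative at \<open>v\<close> and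
      \<open>w\<close> and vanishes at \<open>k0\<close>; since the coefficient of \<open>v\<close>
      is positive, it vanishes at \<open>v\<close>.\<close>
    have sub: "wface f k0 \<subseteq> wface f v"
    proof
      fix u assume u: "u \<in> wface f k0"
      then have uV: "u \<in> Poly_Mapping.keys f" by (simp add: wface_def)
      let ?d = "int_vec (edge u A)"
      have "lin_form (edge u A) k0 = 0" using u A0 by (simp add: lin_form_edge wface_def)
      then have "?d \<bullet> int_vec k0 = 0" unfolding inner_int_int by simp
      then have "a (int_vec k) * (?d \<bullet> int_vec v) + \<beta> (int_vec k) * (?d \<bullet> int_vec w) = 0"
        unfolding k0e by (simp add: inner_add_right)
      moreover have "0 \<le> \<beta> (int_vec k) * (?d \<bullet> int_vec w)" using bk newton_cone_inner[OF wc uV] by simp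
      ultimately have "a (int_vec k) * (?d \<bullet> int_vec v) \<le> 0" by linarith
      then have "?d \<bullet> int_vec v \<le> 0" using ak by (simp add: mult_le_0_iff)
      then have "?d \<bullet> int_vec v = 0" using newton_cone_inner[OF vc uV] by linarith
      then have "wt v u = wt v A" unfolding inner_int_int lin_form_edge by simp
      then show "u \<in> wface f v" using v(2) uV by (simp add: wface_def)
    qed
    have low: "{u \<in> wface f k0. u $ dirn v = 0} = {A}"
      using up_zero_plane[of A f k i "- t"] k(2) A0 Ai unfolding k0_def i_def by auto
    have "k \<in> killed"
    proof (rule killedI[OF k0p v(1) sub _ low _ cA _ _ t0])
      show "apex v \<in> wface f k0" using C0 unfolding C_def .
      show "k0 = up k (dirn v) (- t)" unfolding k0_def i_def ..
      assume kb: "k0 \<in> base"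
      show "dirn (chosen k0) = dirn v"
      proof (cases "chosen k0 = v")
        case False
        note bd = baseD[OF kb]
        have "A \<in> wface f (chosen k0)" "C \<in> wface f (chosen k0)" using bd(3) A0 C0 by auto
        then show ?thesis using same_dirn[OF bd(2) v(1) False _ v(2) _ b(2) AC cA] by simp
      qed simp
    qed simp
    then show False using k(3) by simp
  qed
  have H1D: "0 \<le> lin_form h k \<and> (\<exists>a b. a \<le> 0 \<and> 0 < b \<and> int_vec k = real_of_int (lin_form (edge (apex v) A) k) *\<^sub>R axis (dirn v) 1 +
        a *\<^sub>R int_vec v + b *\<^sub>R int_vec w)" if k: "k \<in> pos_points" "wface f k = {A}" "k \<notin> killed" for k
  proof -
    have "0 \<le> int_vec h \<bullet> int_vec k" using H1[OF k] unfolding inner_int_int by simp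
    then have "a (int_vec k) \<le> 0" using a(1)[of "int_vec k"] by linarith
    moreover have "0 < int_vec g \<bullet> int_vec k" using g(4)[OF k(1,2)] unfolding inner_int_int by simp
    then have "0 < \<beta> (int_vec k)" using be(2) by blast
    moreover have "int_vec k = real_of_int (lin_form (edge (apex v) A) k) *\<^sub>R axis (dirn v) 1 + a (int_vec k) *\<^sub>R int_vec v + \<beta> (int_vec k) *\<^sub>R int_vec w"
      using dec[of "int_vec k"] unfolding l_def inner_int_int i_def C_def .
    ultimately show ?thesis using H1[OF k] by blast
  qed
  have H2: "lin_form h (fibre (k0, t)) < 0" if k0: "k0 \<in> base" "chosen k0 = v" and t: "0 < t" and E: "wface f (fibre (k0, t)) = {A}" for k0 t
  proof (rule ccontr)
    assume nh: "\<not> ?thesis"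
    define k where "k = fibre (k0, t)"
    note bd = baseD[OF k0(1), unfolded k0(2)]
    have "0 \<le> int_vec h \<bullet> int_vec k" using nh unfolding inner_int_int k_def by simp
    then have ak: "a (int_vec k) \<le> 0" using a(1)[of "int_vec k"] by linarith
    have "k \<in> pos_points" "wface f k = {A}" using fibre_face(1)[OF k0(1) t] E unfolding k_def by auto
    from g(4)[OF this] have "0 < int_vec g \<bullet> int_vec k" unfolding inner_int_int by simp
    then have bk: "0 < \<beta> (int_vec k)" using be(2) by blast
    have A0: "A \<in> wface f k0" using lower_in_fibre[OF k0(1) t, of A] E by simp
    have C0: "C \<in> wface f k0" using bd(4) unfolding C_def .
    have kk: "int_vec k = int_vec k0 + real t *\<^sub>R axis i 1"
      unfolding k_def fibre_def i_def using k0(2) by (simp add: int_vec_up)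
    have "l \<bullet> int_vec k0 = 0" unfolding l_def inner_int_int lin_form_edge using A0 C0 by (simp add: wface_def)
    then have "l \<bullet> int_vec k = real t" unfolding kk by (simp add: inner_add_right l0)
    then have e: "int_vec k0 = a (int_vec k) *\<^sub>R int_vec v + \<beta> (int_vec k) *\<^sub>R int_vec w"
      using dec[of "int_vec k"] kk by (simp add: algebra_simps)
    define x where "x = (1 / \<beta> (int_vec k)) *\<^sub>R int_vec k0"
    define y where "y = (- a (int_vec k) / \<beta> (int_vec k)) *\<^sub>R int_vec v"
    have k0c: "int_vec k0 \<in> newton_cone f A" by (rule pos_point_in_cone[OF bd(1) A0])
    have "0 \<le> - a (int_vec k) / \<beta> (int_vec k)" using ak bk by (intro divide_nonneg_pos) auto
    then have xy: "x \<in> newton_cone f A" "y \<in> newton_cone f A"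
      unfolding x_def y_def using bk by (intro newton_cone_scale k0c vc; simp)+
    have "int_vec w = x + y" unfolding x_def y_def e using bk by (simp add: vec_eq_iff field_simps)
    then obtain m where m: "x = m *\<^sub>R int_vec w" using ray_extreme[OF wr _ xy] by blast
    have "int_vec k0 = \<beta> (int_vec k) *\<^sub>R x" unfolding x_def using bk by simp
    then obtain q where q: "int_vec k0 = q *\<^sub>R int_vec w" unfolding m by auto
    have qj: "real_of_int (k0 $ j) = q * real_of_int (w $ j)" for j using arg_cong[OF q, of "\<lambda>x. x $ j"] by simp
    have k0j: "1 \<le> k0 $ j" for j using bd(1) unfolding pos_points_def by simp
    have wj: "w $ j \<noteq> 0" for j using qj[of j] k0j[of j] by auto
    have Ewv: "u \<in> wface f v" if "u \<in> wface f w" for u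
    proof -
      have "lin_form (edge u A) w = 0" using that rays_at_D(2)[OF wr] by (simp add: lin_form_edge wface_def)
      then have "int_vec (edge u A) \<bullet> int_vec k0 = 0" unfolding q by (simp add: inner_int_int)
      then have "wt k0 u = wt k0 A" unfolding inner_int_int lin_form_edge by simp
      then have "u \<in> wface f k0" using A0 that by (simp add: wface_def)
      then show ?thesis using bd(3) by auto
    qed
    have "tight f w (int_vec v)" unfolding tight_def
    proof (intro conjI ballI allI impI)
      fix u u' assume "u \<in> wface f w" "u' \<in> wface f w"
      then show "int_vec v \<bullet> (real_vec u - real_vec u') = 0"
        using Ewv[of u] Ewv[of u'] by (simp add: inner_diff_right inner_int_vec wface_def)
    qed (use wj in auto)
    then obtain z where z: "int_vec v = z *\<^sub>R int_vec w" using rays_at_D(1)[OF wr] unfolding is_ray_def by blast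
    have "int_vec g \<bullet> int_vec v = 0" "0 < int_vec g \<bullet> int_vec w" using g(2,8) by (auto simp: inner_int_int)
    then have "z = 0" unfolding z by simp
    then have "real_of_int (v $ i) = 0" using arg_cong[OF z, of "\<lambda>x. x $ i"] by simp
    then show False using b(1) by simp
  qed
  have H3: "0 \<le> lin_form h u" if u: "u \<in> rays_at f A" "u \<noteq> v" for u
  proof (rule ccontr)
    assume "\<not> ?thesis"
    then have "0 < a (int_vec u)" using a(1)[of "int_vec u"] unfolding inner_int_int by simp
    from ray_extreme_ray[OF u(1) r dec' this rest[OF rays_at_D(4)[OF u(1)]]] show False using u(2) by simp
  qed
  have H3c: "0 \<le> h $ j" if j: "A $ j = 0" for j
  proof (rule ccontr)
    let ?e = "axis j 1 :: real ^ 3"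
    assume "\<not> ?thesis"
    then have "int_vec h \<bullet> ?e < 0" by (simp add: inner_axis)
    then have aj: "0 < a ?e" using a(1) by blast
    have ec: "?e \<in> newton_cone f A" using axis_in_newton_cone[OF j] unfolding int_vec_axis .
    obtain m where m: "m \<noteq> j" "v $ m \<noteq> 0" using Q_off_axis[OF v j] by blast
    have "?e $ m = a ?e * real_of_int (v $ m) + ((l \<bullet> ?e) *\<^sub>R axis i 1 + \<beta> ?e *\<^sub>R int_vec w) $ m"
      using arg_cong[OF dec'[of ?e], of "\<lambda>x. x $ m"] by simp
    moreover have "0 \<le> ((l \<bullet> ?e) *\<^sub>R axis i 1 + \<beta> ?e *\<^sub>R int_vec w) $ m" using rest[OF ec] unfolding newton_cone_def by blast
    moreover have "0 < v $ m" using rays_at_D(5)[OF r, of m] m(2) by linarith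
    then have "0 < a ?e * real_of_int (v $ m)" using aj by simp
    moreover have "?e $ m = 0" using m(1) by (simp add: axis_def)
    ultimately show False by linarith
  qed
  have H4: "\<exists>\<alpha> \<gamma>. 0 \<le> \<alpha> \<and> 0 \<le> \<gamma> \<and> y = \<alpha> *\<^sub>R axis (dirn v) 1 + \<gamma> *\<^sub>R int_vec w"
    if y: "y \<in> newton_cone f A" "int_vec h \<bullet> y = 0" for y
  proof -
    have "a y = 0" using y(2) a(2) by blast
    then have "y = (l \<bullet> y) *\<^sub>R axis (dirn v) 1 + \<beta> y *\<^sub>R int_vec w" using dec[of y] unfolding i_def by simp
    then show ?thesis using lpos[OF y(1)] bpos[OF y(1)] by blast
  qed
  have "corner_form v A h w"
    unfolding corner_form_def by (intro conjI allI impI wr wv lw hv H1 H2 H3 H3c H4 H1D[THEN conjunct2])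
  then show ?thesis by blast
qed

end

section \<open>Conic hulls, and the inequalities describing the weights with a given face\<close>

definition conic_hull :: "(int ^ 'n::finite) set \<Rightarrow> (real ^ 'n) set" where
  "conic_hull W = {y. \<exists>r. (\<forall>w\<in>W. 0 \<le> r w) \<and> y = (\<Sum>w\<in>W. r w *\<^sub>R int_vec w)}"

lemma conic_hull_add: "x \<in> conic_hull W \<Longrightarrow> y \<in> conic_hull W \<Longrightarrow> x + y \<in> conic_hull W"
proof -
  assume "x \<in> conic_hull W" "y \<in> conic_hull W"
  then obtain p q where p: "\<forall>w\<in>W. 0 \<le> p w" "x = (\<Sum>w\<in>W. p w *\<^sub>R int_vec w)"
    and q: "\<forall>w\<in>W. 0 \<le> q w" "y = (\<Sum>w\<in>W. q w *\<^sub>R int_vec w)" unfolding conic_hull_def by auto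
  then show ?thesis unfolding conic_hull_def
    by (intro CollectI exI[of _ "\<lambda>w. p w + q w"]) (auto simp: scaleR_left_distrib sum.distrib)
qed

lemma conic_hull_scale: "x \<in> conic_hull W \<Longrightarrow> 0 \<le> a \<Longrightarrow> a *\<^sub>R x \<in> conic_hull W"
proof -
  assume "x \<in> conic_hull W" and a: "0 \<le> a"
  then obtain p where p: "\<forall>w\<in>W. 0 \<le> p w" "x = (\<Sum>w\<in>W. p w *\<^sub>R int_vec w)" unfolding conic_hull_def by auto
  then show ?thesis unfolding conic_hull_def using a
    by (intro CollectI exI[of _ "\<lambda>w. a * p w"]) (auto simp: scaleR_sum_right)
qed

lemma conic_hull_0: "0 \<in> conic_hull W"
  unfolding conic_hull_def by (intro CollectI exI[of _ "\<lambda>_. 0"]) auto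

lemma conic_hull_base:
  assumes "finite W" "w \<in> W"
  shows "int_vec w \<in> conic_hull W"
proof -
  have "(\<Sum>u\<in>W. (if u = w then 1 else 0 :: real) *\<^sub>R int_vec u) = (\<Sum>u\<in>W. if u = w then int_vec u else 0)"
    by (intro sum.cong) auto
  then have "(\<Sum>u\<in>W. (if u = w then 1 else 0 :: real) *\<^sub>R int_vec u) = int_vec w" using assms by simp
  then show ?thesis unfolding conic_hull_def by (intro CollectI exI[of _ "\<lambda>u. if u = w then 1 else 0"]) auto
qed

lemma conic_hull_sum: "finite I \<Longrightarrow> (\<And>i. i \<in> I \<Longrightarrow> g i \<in> conic_hull W) \<Longrightarrow> (\<Sum>i\<in>I. g i) \<in> conic_hull W"
  by (induction I rule: finite_induct) (auto intro: conic_hull_0 conic_hull_add)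

lemma lin_form_axis: "lin_form q (axis j 1) = q $ j"
proof -
  have "lin_form q (axis j 1) = (\<Sum>m\<in>UNIV. if m = j then q $ j else 0)"
    unfolding lin_form_def axis_def by (intro sum.cong) auto
  then show ?thesis by simp
qed

lemma finite_rays_at: "finite (rays_at f A)"
  using finite_rays by (rule finite_subset[rotated]) (auto simp: rays_at_def)

text \<open>All bounds are 1: over the integers, strict positivity of the coordinates and of the
  edge forms off the face is a closed inequality.\<close>

definition face_forms :: "(3, 'a::zero) mpoly \<Rightarrow> nat ^ 3 \<Rightarrow> (nat ^ 3) set \<Rightarrow> ((int ^ 3 \<Rightarrow> int) \<times> int) set" where
  "face_forms f A \<epsilon> = range (\<lambda>i. (\<lambda>k. k $ i, 1)) \<union> (\<lambda>w. (lin_form (edge w A), 1)) ` (Poly_Mapping.keys f - \<epsilon>)"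

lemma finite_face_forms: "finite (face_forms f A \<epsilon>)"
  unfolding face_forms_def by simp

lemma face_forms_additive: "(l, b) \<in> face_forms f A \<epsilon> \<Longrightarrow> additive_form l"
  unfolding face_forms_def using additive_lin_form by (auto simp: additive_form_def)

lemma face_forms_nonneg:
  assumes "(l, b) \<in> face_forms f A \<epsilon>" "int_vec w \<in> newton_cone f A"
  shows "0 \<le> l w"
proof -
  have "0 \<le> int_vec w $ i" for i using assms(2) unfolding newton_cone_def by blast
  then have "0 \<le> w $ i" for i by simp
  moreover have "0 \<le> lin_form (edge u A) w" if "u \<in> Poly_Mapping.keys f" for u
    using newton_cone_inner[OF assms(2) that] unfolding inner_int_int by simp
  ultimately show ?thesis using assms(1) unfolding face_forms_def by auto
qed

lemma face_points_eq:
  assumes A: "A \<in> \<epsilon>" and sub: "\<epsilon> \<subseteq> Poly_Mapping.keys f"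
  shows "{k \<in> pos_points. wface f k = \<epsilon>} = {k. (\<forall>w\<in>\<epsilon>. wt k w = wt k A) \<and> (\<forall>(l, b)\<in>face_forms f A \<epsilon>. b \<le> l k)}"
    (is "?L = ?R")
proof (intro equalityI subsetI)
  fix k assume "k \<in> ?L"
  then have k: "k \<in> pos_points" and E: "wface f k = \<epsilon>" by auto
  have "wt k A < wt k w" if "w \<in> Poly_Mapping.keys f - \<epsilon>" for w
    using wmin_le[of w f k] that E A unfolding wface_def by (auto simp: less_le)
  then have "1 \<le> lin_form (edge w A) k" if "w \<in> Poly_Mapping.keys f - \<epsilon>" for w
    using that unfolding lin_form_edge by (simp add: int_one_le_iff_zero_less)
  moreover have "wt k w = wt k A" if "w \<in> \<epsilon>" for w using that A unfolding E[symmetric] by (simp add: wface_def)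
  ultimately show "k \<in> ?R" using k unfolding face_forms_def pos_points_def by auto
next
  fix k assume "k \<in> ?R"
  then have eq: "\<And>w. w \<in> \<epsilon> \<Longrightarrow> wt k w = wt k A" and k: "\<And>i. 1 \<le> k $ i"
    and gt: "\<And>w. w \<in> Poly_Mapping.keys f - \<epsilon> \<Longrightarrow> 1 \<le> wt k w - wt k A"
    unfolding face_forms_def lin_form_edge[symmetric] by auto
  have AV: "A \<in> Poly_Mapping.keys f" using A sub by auto
  have gt': "wt k A < wt k w" if "w \<in> Poly_Mapping.keys f - \<epsilon>" for w using gt[OF that] by simp
  have "wt k A \<le> wt k w" if "w \<in> Poly_Mapping.keys f" for w using eq[of w] gt'[of w] that by (cases "w \<in> \<epsilon>") auto
  then have m: "wmin f k = wt k A" unfolding wmin_def using AV by (intro Min_eqI) auto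
  have "x \<in> Poly_Mapping.keys f \<and> wt k x = wt k A \<longleftrightarrow> x \<in> \<epsilon>" for x
    using eq[of x] gt'[of x] sub by (cases "x \<in> \<epsilon>") auto
  then have "wface f k = \<epsilon>" unfolding wface_def m by simp
  then show "k \<in> ?L" using k unfolding pos_points_def by simp
qed

section \<open>Generators of the remaining sets\<close>

context b1_configuration
begin

text \<open>Two neighbouring facets of \<open>Q\<close> would share the edge, the direction and the
  apex. Comparing the expansions of a surviving point at the two corners would write
  \<open>w\<close> as a positive multiple of its other neighbour \<open>w'\<close> plus a
  nonnegative multiple of \<open>v\<close>, against extremality.\<close>

lemma corner_neighbour_notin_Q:
  assumes v: "v \<in> Q" "A \<in> wface f v" and cA: "c {A} \<noteq> 0" and cf: "corner_form v A h w"
    and k: "k \<in> pos_points" "wface f k = {A}" "k \<notin> killed"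
  shows "w \<notin> Q"
proof
  assume wQ: "w \<in> Q"
  note F = cf[unfolded corner_form_def]
  have wr: "w \<in> rays_at f A" and wv: "w \<noteq> v" and lw: "lin_form (edge (apex v) A) w = 0" using F by blast+
  define C where "C = apex v"
  define i where "i = dirn v"
  have b1: "b1_apex f v i C" unfolding i_def C_def by (rule apex[OF v(1)])
  have b: "0 < v $ i" "C \<in> wface f v" "C $ i = 1" using b1 unfolding b1_apex_def by auto
  have Ai: "A $ i = 0" using b1_apex_coord[OF b1 v(2)] coord_ne_1[OF cA, of i] by auto
  have AC: "A \<noteq> C" using Ai b(3) by auto
  note Aw = rays_at_D(2)[OF wr]
  have CV: "C \<in> Poly_Mapping.keys f" using b(2) unfolding wface_def by auto
  have Cw: "C \<in> wface f w" using lw Aw CV unfolding C_def[symmetric] lin_form_edge by (simp add: wface_def)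
  have dw: "dirn w = i" using same_dirn[OF wQ v(1) wv Aw v(2) Cw b(2) AC cA] unfolding i_def .
  obtain a b where ab: "a \<le> 0" "0 < b" "int_vec k = real_of_int (lin_form (edge C A) k) *\<^sub>R axis i 1 + a *\<^sub>R int_vec v + b *\<^sub>R int_vec w"
    using F k unfolding C_def i_def by blast
  \<comment> \<open>Otherwise \<open>C\<close> lies beyond the apex of \<open>w\<close> in a
    direction with \<open>w $ j = 0\<close>. Minimality of \<open>v\<close> at \<open>C\<close>
    gives \<open>v $ j = 0\<close>, and the expansion of \<open>k\<close> gives
    \<open>k $ j = 0\<close>.\<close>
  have aw: "apex w = C"
  proof (rule ccontr)
    assume ne: "apex w \<noteq> C"
    have b1w: "b1_apex f w i (apex w)" using apex[OF wQ] unfolding dw .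
    then have cw: "apex w \<in> wface f w" "apex w $ i = 1" unfolding b1_apex_def by auto
    have "C = apex w \<or> (\<exists>j. w $ j = 0 \<and> apex w $ j < C $ j \<and> (\<forall>l. l \<noteq> j \<longrightarrow> C $ l = apex w $ l))"
      using b1w Cw b(3) unfolding b1_apex_def by auto
    then obtain j where j: "w $ j = 0" "apex w $ j < C $ j" "\<And>l. l \<noteq> j \<Longrightarrow> C $ l = apex w $ l" using ne by auto
    have ji: "j \<noteq> i" using j(2) b(3) cw(2) by auto
    have "lin_form (edge C (apex w)) v = (\<Sum>l\<in>UNIV. if l = j then (int (C $ j) - int (apex w $ j)) * v $ j else 0)"
      unfolding lin_form_def edge_def using j(3) by (intro sum.cong) auto
    then have "wt v C - wt v (apex w) = (int (C $ j) - int (apex w $ j)) * v $ j" unfolding lin_form_edge by simp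
    moreover have "wt v C \<le> wt v (apex w)" using wmin_le[of "apex w" f v] cw(1) b(2) by (simp add: wface_def)
    ultimately have "v $ j \<le> 0" using j(2) by (smt (verit) mult_pos_pos of_nat_less_iff)
    then have "v $ j = 0" using rays_at_D(5)[OF rays_atI[OF v], of j] by simp
    then have "real_of_int (k $ j) = 0" using arg_cong[OF ab(3), of "\<lambda>x. x $ j"] ji j(1) by (simp add: axis_def)
    moreover have "1 \<le> k $ j" using k(1) unfolding pos_points_def by simp
    ultimately show False by simp
  qed
  obtain h' w' where "corner_form w A h' w'" using corner_form_exists[OF wQ Aw cA k(1,2)] by blast
  note F' = this[unfolded corner_form_def]
  have wr': "w' \<in> rays_at f A" and ww': "w' \<noteq> w" using F' by blast+
  obtain a' b' where ab': "a' \<le> 0" "0 < b'" "int_vec k = real_of_int (lin_form (edge C A) k) *\<^sub>R axis i 1 + a' *\<^sub>R int_vec w + b' *\<^sub>R int_vec w'"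
    using F' k unfolding dw aw by blast
  have eq: "(b - a') *\<^sub>R int_vec w = b' *\<^sub>R int_vec w' + (- a) *\<^sub>R int_vec v"
    using ab(3) ab'(3) by (simp add: algebra_simps)
  have p: "0 < b - a'" using ab ab' by simp
  have "int_vec w = (1 / (b - a')) *\<^sub>R ((b - a') *\<^sub>R int_vec w)" using p by simp
  also have "\<dots> = (b' / (b - a')) *\<^sub>R int_vec w' + (- a / (b - a')) *\<^sub>R int_vec v"
    unfolding eq by (simp add: scaleR_right_distrib scaleR_right_diff_distrib)
  finally have e: "int_vec w = (b' / (b - a')) *\<^sub>R int_vec w' + (- a / (b - a')) *\<^sub>R int_vec v" .
  have "(- a / (b - a')) *\<^sub>R int_vec v \<in> newton_cone f A"
    using p ab(1) by (intro newton_cone_scale rays_at_D(4)[OF rays_atI[OF v]] divide_nonneg_pos) auto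
  moreover have "0 < b' / (b - a')" using p ab' by simp
  ultimately have "w' = w" using ray_extreme_ray[OF wr wr' e] by blast
  then show False using ww' by simp
qed

lemma killed_rays:
  assumes "k \<in> killed"
  shows "\<exists>v\<in>Q. wface f k \<subseteq> wface f v"
proof -
  obtain k0 t where k: "k0 \<in> base" "k = fibre (k0, t)" using assms unfolding killed_def by auto
  note bd = baseD[OF k(1)]
  have "wface f k \<subseteq> wface f k0"
  proof (cases "t = 0")
    case True
    then show ?thesis using k(2) by simp
  next
    case False
    then show ?thesis using lower_in_fibre[OF k(1), of t] k(2) by auto
  qed
  then show ?thesis using bd(2,3) by blast
qed

text \<open>A surviving face inside a facet of \<open>Q\<close> avoids the apex and hence lies in
  the coordinate plane. With two exponents in it, lowering the point along the direction of
  \<open>v\<close> would end on a multiple of \<open>v\<close>, whose fibre removes the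
  point.\<close>

lemma remaining_face:
  assumes v: "v \<in> Q" "\<epsilon> \<subseteq> wface f v" and c: "c \<epsilon> \<noteq> 0" and A: "A \<in> \<epsilon>"
    and k: "k \<in> pos_points" "wface f k = \<epsilon>" "k \<notin> killed"
  shows "\<epsilon> = {A}"
proof (rule ccontr)
  assume ne: "\<epsilon> \<noteq> {A}"
  define i where "i = dirn v"
  define C where "C = apex v"
  have b1: "b1_apex f v i C" unfolding i_def C_def by (rule apex[OF v(1)])
  have b: "0 < v $ i" "C \<in> wface f v" "C $ i = 1" using b1 unfolding b1_apex_def by auto
  have sub: "wface f k \<subseteq> wface f v" using v(2) k(2) by simp
  have Cn: "C \<notin> wface f k"
  proof
    assume "C \<in> wface f k"
    then have "k \<in> base" unfolding base_def using k c v sub unfolding C_def by blast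
    then show False using base_killed k(3) by blast
  qed
  have z: "w $ i = 0" if "w \<in> wface f k" for w
  proof (rule ccontr)
    assume "w $ i \<noteq> 0"
    then have "w $ i = 1" using b1_apex_coord[OF b1, of w] sub that by auto
    then show False using b1_apex_unique[OF b1 k(1) sub that] Cn that by simp
  qed
  obtain B where B: "B \<in> \<epsilon>" "B \<noteq> A" using ne A by blast
  have AE: "A \<in> wface f k" "B \<in> wface f k" using A B k(2) by auto
  have Av: "A \<in> wface f v" "B \<in> wface f v" using AE sub by auto
  note r = rays_atI[OF v(1) Av(1)]
  have AV: "A \<in> Poly_Mapping.keys f" "C \<in> Poly_Mapping.keys f" using Av b(2) unfolding wface_def by auto
  define t where "t = lin_form (edge C A) k"
  define k0 where "k0 = up k i (- t)"
  let ?l = "int_vec (edge C A)" and ?d = "int_vec (edge B A)"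
  have kc: "int_vec k \<in> newton_cone f A" by (rule pos_point_in_cone[OF k(1) AE(1)])
  have t0: "0 \<le> t" using newton_cone_inner[OF kc AV(2)] unfolding t_def inner_int_int by simp
  have li: "?l $ i = 1" using b(3) z[OF AE(1)] by (simp add: edge_def)
  have di: "?d $ i = 0" using z[OF AE(1)] z[OF AE(2)] by (simp add: edge_def)
  have lv: "?l \<bullet> int_vec v = 0" unfolding inner_int_int lin_form_edge using b(2) Av by (simp add: wface_def)
  have dv: "?d \<bullet> int_vec v = 0" unfolding inner_int_int lin_form_edge using Av by (simp add: wface_def)
  have lk: "?l \<bullet> int_vec k = real_of_int t" unfolding inner_int_int t_def ..
  have dk: "?d \<bullet> int_vec k = 0" unfolding inner_int_int lin_form_edge using AE by (simp add: wface_def)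
  have lk0: "?l \<bullet> int_vec k0 = 0" unfolding k0_def int_vec_up using lk li by (simp add: inner_add_right inner_diff_right inner_axis)
  have dk0: "?d \<bullet> int_vec k0 = 0" unfolding k0_def int_vec_up using dk di by (simp add: inner_add_right inner_diff_right inner_axis)
  obtain a b where ind: "a \<noteq> i" "b \<noteq> i" "a \<noteq> b" "UNIV = {i, a, b}" by (rule index_3_cases)
  have s3: "(\<Sum>m\<in>UNIV. g m) = g i + g a + g b" for g :: "3 \<Rightarrow> real" using sum_index_3[OF ind] .
  have dv': "?d $ a * real_of_int (v $ a) + ?d $ b * real_of_int (v $ b) = 0"
    using dv di unfolding inner_vec_def by (simp add: s3)
  have dk': "?d $ a * int_vec k0 $ a + ?d $ b * int_vec k0 $ b = 0"
    using dk0 di unfolding inner_vec_def by (simp add: s3)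
  have dn: "?d $ a \<noteq> 0 \<or> ?d $ b \<noteq> 0"
  proof (rule ccontr)
    assume "\<not> ?thesis"
    then have "?d $ m = 0" for m using di ind(4) by (metis UNIV_I insertE singletonD)
    then have "B $ m = A $ m" for m by (simp add: edge_def)
    then show False using B(2) by (simp add: vec_eq_iff)
  qed
  \<comment> \<open>\<open>v\<close> and \<open>k0\<close> are both orthogonal to the edge from
    \<open>A\<close> to \<open>B\<close>, which has no component in direction \<open>i\<close>;
    their projections to the other two coordinates are therefore proportional.\<close>
  have cross: "real_of_int (v $ b) * int_vec k0 $ a = real_of_int (v $ a) * int_vec k0 $ b"
  proof (cases "?d $ a = 0")
    case True
    then have "real_of_int (v $ b) = 0" "int_vec k0 $ b = 0" using dn dv' dk' by auto
    then show ?thesis by simp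
  next
    case False
    have "?d $ a * (real_of_int (v $ b) * int_vec k0 $ a - real_of_int (v $ a) * int_vec k0 $ b) =
      real_of_int (v $ b) * (?d $ a * int_vec k0 $ a + ?d $ b * int_vec k0 $ b) -
      int_vec k0 $ b * (?d $ a * real_of_int (v $ a) + ?d $ b * real_of_int (v $ b))" by (simp add: algebra_simps)
    then have "?d $ a * (real_of_int (v $ b) * int_vec k0 $ a - real_of_int (v $ a) * int_vec k0 $ b) = 0"
      unfolding dv' dk' by simp
    then show ?thesis using False by simp
  qed
  obtain j where j: "j \<noteq> i" "v $ j \<noteq> 0" using Q_off_axis[OF v(1) Av(1) z[OF AE(1)]] by blast
  have vab: "v $ a \<noteq> 0 \<or> v $ b \<noteq> 0" using j ind(4) by (metis UNIV_I insertE singletonD)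
  obtain m where m: "int_vec k0 = m *\<^sub>R int_vec v" using plane_line[OF ind vab li lv lk0 cross] by blast
  have mj: "real_of_int (k0 $ n) = m * real_of_int (v $ n)" for n using arg_cong[OF m, of "\<lambda>x. x $ n"] by simp
  have kj: "1 \<le> k0 $ n" if "n \<noteq> i" for n using k(1) that unfolding k0_def pos_points_def by simp
  have "0 < v $ j" using rays_at_D(5)[OF r, of j] j(2) by simp
  moreover have "0 < m * real_of_int (v $ j)" using mj[of j] kj[OF j(1)] by simp
  ultimately have m0: "0 < m" by (simp add: zero_less_mult_iff)
  have k0i: "1 \<le> k0 $ i"
  proof -
    have "0 < real_of_int (k0 $ i)" unfolding mj using m0 b(1) by simp
    then show ?thesis by simp
  qed
  have k0p: "k0 \<in> pos_points" unfolding pos_points_def using kj k0i by (intro CollectI allI) metis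
  have k0c: "int_vec k0 \<in> newton_cone f A" unfolding m using m0 by (intro newton_cone_scale rays_at_D(4)[OF r]) simp
  have dd: "wt k0 u = wt k0 A \<longleftrightarrow> wt v u = wt v A" for u
  proof -
    have "real_of_int (lin_form (edge u A) k0) = m * real_of_int (lin_form (edge u A) v)"
      unfolding inner_int_int[symmetric] m by simp
    then have "lin_form (edge u A) k0 = 0 \<longleftrightarrow> lin_form (edge u A) v = 0" using m0 by (metis less_irrefl mult_eq_0_iff of_int_eq_0_iff)
    then show ?thesis unfolding lin_form_edge by simp
  qed
  have E0: "wface f k0 = wface f v"
    using wface_eq_cone[OF AV(1) k0c] wface_eq_cone[OF AV(1) rays_at_D(4)[OF r]] dd by auto
  have low: "{w \<in> wface f k0. w $ dirn v = 0} = \<epsilon>"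
  proof -
    have "{w \<in> wface f k0. w $ i = 0} = {w \<in> wface f k. w $ i = 0}"
      using up_zero_plane[of A f k i "- t"] AE(1) E0 Av(1) z[OF AE(1)] unfolding k0_def by simp
    then show ?thesis using z k(2) unfolding i_def by auto
  qed
  have "k \<in> killed"
  proof (rule killedI[OF k0p v(1) _ _ low _ c _ _ t0])
    show "wface f k0 \<subseteq> wface f v" using E0 by simp
    show "apex v \<in> wface f k0" using E0 b(2) unfolding C_def by simp
    show "\<epsilon> \<noteq> {}" using A by auto
    show "k0 = up k (dirn v) (- t)" unfolding k0_def i_def ..
    assume kb: "k0 \<in> base"
    note bd = baseD[OF kb]
    have vn: "v $ n \<noteq> 0" for n using mj[of n] k0p unfolding pos_points_def by (auto dest: spec[of _ n])
    have "tight f v (int_vec (chosen k0))" unfolding tight_def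
    proof (intro conjI ballI allI impI)
      fix u u' assume "u \<in> wface f v" "u' \<in> wface f v"
      then have "u \<in> wface f (chosen k0)" "u' \<in> wface f (chosen k0)" using bd(3) E0 by auto
      then show "int_vec (chosen k0) \<bullet> (real_vec u - real_vec u') = 0" by (simp add: inner_diff_right inner_int_vec wface_def)
    qed (use vn in auto)
    then obtain q where "int_vec (chosen k0) = q *\<^sub>R int_vec v" using rays_at_D(1)[OF r] unfolding is_ray_def by blast
    then have "v = chosen k0" by (rule is_ray_parallel_eq[OF Q_ray[OF v(1)] Q_ray[OF bd(2)]])
    then show "dirn (chosen k0) = dirn v" by simp
  qed
  then show False using k(3) by simp
qed

text \<open>
  Near a corner \<open>A\<close> the facets of \<open>Q\<close> are removed one at a time: a nonnegative combination on which the
  form \<open>h v\<close> is nonnegative can be rewritten without \<open>v\<close>, since \<open>h v\<close> is negative at \<open>v\<close> only and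
  the face \<open>h v = 0\<close> of the cone is generated by a coordinate direction and a facet outside \<open>Q\<close>.
\<close>

lemma eliminate_rays:
  assumes T: "finite T" "T \<subseteq> rays_at f A \<inter> Q"
    and W: "W = (rays_at f A - Q) \<union> {axis i 1 |i. A $ i = 0}"
    and cf: "\<And>v. v \<in> T \<Longrightarrow> corner_form v A (h v) (w v) \<and> w v \<notin> Q \<and> A $ dirn v = 0"
    and x: "x \<in> conic_hull W" and q: "\<And>v. v \<in> T \<Longrightarrow> 0 \<le> q v"
    and hy: "\<And>v. v \<in> T \<Longrightarrow> 0 \<le> int_vec (h v) \<bullet> (x + (\<Sum>v\<in>T. q v *\<^sub>R int_vec v))"
  shows "x + (\<Sum>v\<in>T. q v *\<^sub>R int_vec v) \<in> conic_hull W"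
  using T cf x q hy
proof (induction T arbitrary: x q rule: finite_induct)
  case empty
  then show ?case by simp
next
  case (insert v T)
  have finW: "finite W" unfolding W by (simp add: finite_rays_at)
  have Wc: "int_vec u \<in> newton_cone f A" if "u \<in> W" for u
    using that rays_at_D(4)[of u f A] axis_in_newton_cone[of A] unfolding W by blast
  have hull_cone: "y \<in> newton_cone f A" if yW: "y \<in> conic_hull W" for y
  proof -
    obtain r where r: "\<forall>u\<in>W. 0 \<le> r u" "y = (\<Sum>u\<in>W. r u *\<^sub>R int_vec u)" using yW unfolding conic_hull_def by auto
    have "(\<Sum>u\<in>F. r u *\<^sub>R int_vec u) \<in> newton_cone f A" if "finite F" "F \<subseteq> W" for F
      using that
    proof (induction F rule: finite_induct)
      case empty
      then show ?case by (simp add: newton_cone_0)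
    next
      case (insert u F)
      have "r u *\<^sub>R int_vec u \<in> newton_cone f A" using insert.prems r(1) by (intro newton_cone_scale Wc) auto
      then show ?case using insert by (simp add: newton_cone_add)
    qed
    then show ?thesis unfolding r(2) using finW by blast
  qed
  have cv: "corner_form v A (h v) (w v)" "w v \<notin> Q" "A $ dirn v = 0" using insert.prems(2)[of v] by auto
  note F = cv(1)[unfolded corner_form_def]
  have vr: "v \<in> rays_at f A" using insert.prems(1) by auto
  have hv: "lin_form (h v) v < 0" using F by blast
  have hr: "0 \<le> lin_form (h v) r" if "r \<in> rays_at f A" "r \<noteq> v" for r using F that by blast
  have ha: "0 \<le> h v $ j" if "A $ j = 0" for j using F that by blast
  have wr: "w v \<in> rays_at f A" using F by blast
  have h4: "\<exists>\<alpha> \<beta>. 0 \<le> \<alpha> \<and> 0 \<le> \<beta> \<and> y = \<alpha> *\<^sub>R axis (dirn v) 1 + \<beta> *\<^sub>R int_vec (w v)"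
    if "y \<in> newton_cone f A" "int_vec (h v) \<bullet> y = 0" for y using F that by blast
  let ?S = "\<Sum>u\<in>T. q u *\<^sub>R int_vec u"
  define z where "z = x + ?S"
  have tot: "x + (\<Sum>u\<in>insert v T. q u *\<^sub>R int_vec u) = q v *\<^sub>R int_vec v + z"
    using insert.hyps unfolding z_def by simp
  have qv: "0 \<le> q v" and qT: "\<And>u. u \<in> T \<Longrightarrow> 0 \<le> q u" using insert.prems(4) by auto
  have TQ: "T \<subseteq> rays_at f A \<inter> Q" using insert.prems(1) by auto
  have hz: "0 \<le> int_vec (h v) \<bullet> z"
  proof -
    have "0 \<le> int_vec (h v) \<bullet> int_vec u" if "u \<in> W" for u
    proof -
      have "0 \<le> lin_form (h v) u" using that hr[of u] ha insert.prems(1) unfolding W by (auto simp: lin_form_axis)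
      then show ?thesis unfolding inner_int_int by simp
    qed
    then have "0 \<le> int_vec (h v) \<bullet> x" using insert.prems(3) unfolding conic_hull_def by (auto simp: inner_sum_right intro!: sum_nonneg)
    moreover have "0 \<le> int_vec (h v) \<bullet> ?S" unfolding inner_sum_right
    proof (intro sum_nonneg)
      fix u assume u: "u \<in> T"
      then have "0 \<le> lin_form (h v) u" using TQ insert.hyps by (intro hr) auto
      then show "0 \<le> int_vec (h v) \<bullet> q u *\<^sub>R int_vec u" using qT[OF u] by (simp add: inner_int_int)
    qed
    ultimately show ?thesis unfolding z_def by (simp add: inner_add_right)
  qed
  have zc: "z \<in> newton_cone f A"
  proof -
    have "?S \<in> newton_cone f A"
      using insert.hyps(1) TQ qT
      by (induction T rule: finite_induct) (auto simp: newton_cone_0 intro!: newton_cone_add newton_cone_scale rays_at_D(4))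
    then show ?thesis unfolding z_def using hull_cone[OF insert.prems(3)] by (intro newton_cone_add)
  qed
  define \<eta> where "\<eta> = - (int_vec (h v) \<bullet> int_vec v)"
  have \<eta>: "0 < \<eta>" unfolding \<eta>_def inner_int_int using hv by simp
  have le: "q v * \<eta> \<le> int_vec (h v) \<bullet> z"
    using insert.prems(5)[of v] unfolding tot \<eta>_def by (simp add: inner_add_right)
  \<comment> \<open>\<open>\<mu>\<close> is the share of \<open>z\<close> that balances the negative
    value of \<open>h v\<close> at \<open>q v *\<^sub>R int_vec v\<close>, so that \<open>y\<close>
    lies on the boundary \<open>h v = 0\<close>.\<close>
  obtain \<mu> where mu: "0 \<le> \<mu>" "\<mu> \<le> 1" "q v * \<eta> = \<mu> * (int_vec (h v) \<bullet> z)"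
  proof (cases "int_vec (h v) \<bullet> z = 0")
    case True
    then have "q v * \<eta> \<le> 0" using le by simp
    then have "q v = 0" using qv \<eta> by (simp add: mult_le_0_iff)
    then show ?thesis using that[of 0] by simp
  next
    case False
    then have "0 < int_vec (h v) \<bullet> z" using hz by simp
    then show ?thesis using that[of "q v * \<eta> / (int_vec (h v) \<bullet> z)"] le qv \<eta> by (simp add: divide_le_eq)
  qed
  define y where "y = q v *\<^sub>R int_vec v + \<mu> *\<^sub>R z"
  have "y \<in> newton_cone f A" unfolding y_def using qv mu(1) zc by (intro newton_cone_add newton_cone_scale rays_at_D(4)[OF vr])
  moreover have "int_vec (h v) \<bullet> y = - (q v * \<eta>) + \<mu> * (int_vec (h v) \<bullet> z)" unfolding y_def \<eta>_def by (simp add: inner_add_right)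
  then have "int_vec (h v) \<bullet> y = 0" using mu(3) by simp
  ultimately obtain \<alpha> \<beta> where ab: "0 \<le> \<alpha>" "0 \<le> \<beta>" "y = \<alpha> *\<^sub>R axis (dirn v) 1 + \<beta> *\<^sub>R int_vec (w v)" using h4 by blast
  have "w v \<in> W" "axis (dirn v) 1 \<in> W" unfolding W using wr cv(2,3) by auto
  then have yW: "y \<in> conic_hull W"
    unfolding ab(3) int_vec_axis[symmetric] using ab(1,2) by (intro conic_hull_add conic_hull_scale conic_hull_base finW)
  \<comment> \<open>The total vector is unchanged, so the other inequalities persist, and the
    remaining coefficients are only scaled by \<open>1 - \<mu>\<close>.\<close>
  have split: "q v *\<^sub>R int_vec v + z = (y + (1 - \<mu>) *\<^sub>R x) + (\<Sum>u\<in>T. ((1 - \<mu>) * q u) *\<^sub>R int_vec u)"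
  proof -
    have "(\<Sum>u\<in>T. ((1 - \<mu>) * q u) *\<^sub>R int_vec u) = (1 - \<mu>) *\<^sub>R ?S" by (simp add: scaleR_sum_right)
    then show ?thesis unfolding y_def z_def by (simp add: algebra_simps)
  qed
  show ?case unfolding tot split
  proof (rule insert.IH[OF TQ])
    show "y + (1 - \<mu>) *\<^sub>R x \<in> conic_hull W"
      using mu(2) by (intro conic_hull_add yW conic_hull_scale insert.prems(3)) simp
    show "0 \<le> (1 - \<mu>) * q u" if "u \<in> T" for u using mu(2) qT[OF that] by simp
    show "0 \<le> int_vec (h u) \<bullet> (y + (1 - \<mu>) *\<^sub>R x + (\<Sum>v\<in>T. ((1 - \<mu>) * q v) *\<^sub>R int_vec v))" if "u \<in> T" for u
      using insert.prems(5)[of u] that unfolding tot split by simp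
    show "corner_form u A (h u) (w u) \<and> w u \<notin> Q \<and> A $ dirn u = 0" if "u \<in> T" for u
      using insert.prems(2)[of u] that by simp
  qed
qed

text \<open>The surviving points are described both by inequalities and by generators, as
  \<open>polyhedral_sum_continues\<close> requires. Axes appear among the generators because
  eliminating a ray of \<open>Q\<close> uses the direction of its fibres.\<close>

lemma remaining:
  assumes c: "c \<epsilon> \<noteq> 0" and N: "N = {k \<in> pos_points. wface f k = \<epsilon>} - killed" and k1: "k1 \<in> N"
  shows "\<exists>A L W. A \<in> \<epsilon> \<and> finite L \<and> finite W \<and> (\<forall>(l, b)\<in>L. additive_form l \<and> (\<forall>w\<in>W. 0 \<le> l w)) \<and>
    N = {k. (\<forall>w\<in>\<epsilon>. wt k w = wt k A) \<and> (\<forall>(l, b)\<in>L. b \<le> l k)} \<and> int_vec ` N \<subseteq> conic_hull W \<and>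
    (\<forall>w\<in>W. (w \<in> rays_at f A - Q \<and> \<epsilon> \<subseteq> wface f w) \<or> (\<exists>i. w = axis i 1 \<and> (\<forall>x\<in>\<epsilon>. x $ i = 0)))"
proof -
  have k1': "k1 \<in> pos_points" "wface f k1 = \<epsilon>" "k1 \<notin> killed" using k1 unfolding N by auto
  obtain A where A: "A \<in> \<epsilon>" using wface_nonempty[OF f0, of k1] k1'(2) by auto
  have sub: "\<epsilon> \<subseteq> Poly_Mapping.keys f" unfolding k1'(2)[symmetric] wface_def by auto
  have AV: "A \<in> Poly_Mapping.keys f" using A sub by auto
  have gen: "\<exists>r. (\<forall>v. 0 \<le> r v) \<and> int_vec k = (\<Sum>v\<in>rays_at f A. r v *\<^sub>R int_vec v)" if "k \<in> N" for k
  proof -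
    have "int_vec k \<in> newton_cone f A" using that A unfolding N by (intro pos_point_in_cone) auto
    then show ?thesis by (rule newton_cone_generated[OF AV]) blast
  qed
  show ?thesis
  proof (cases "\<exists>v\<in>Q. \<epsilon> \<subseteq> wface f v")
    case False
    let ?W = "{v \<in> rays_at f A. \<epsilon> \<subseteq> wface f v}" and ?L = "face_forms f A \<epsilon>"
    have "N = {k \<in> pos_points. wface f k = \<epsilon>}" unfolding N using killed_rays False by blast
    then have NE: "N = {k. (\<forall>w\<in>\<epsilon>. wt k w = wt k A) \<and> (\<forall>(l, b)\<in>?L. b \<le> l k)}" using face_points_eq[OF A sub] by simp
    have hull: "int_vec k \<in> conic_hull ?W" if k: "k \<in> N" for k
    proof -
      obtain r where r: "\<And>v. 0 \<le> r v" "int_vec k = (\<Sum>v\<in>rays_at f A. r v *\<^sub>R int_vec v)" using gen[OF k] by blast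
      \<comment> \<open>The edge form of an exponent \<open>u\<close> of the face vanishes at
        \<open>k\<close> and is nonnegative on all rays, so only rays with \<open>u\<close> on their
        face can occur.\<close>
      have z: "r v = 0" if v: "v \<in> rays_at f A" "\<not> \<epsilon> \<subseteq> wface f v" for v
      proof -
        obtain u where u: "u \<in> \<epsilon>" "u \<notin> wface f v" using v(2) by auto
        then have uV: "u \<in> Poly_Mapping.keys f" using sub by auto
        let ?d = "int_vec (edge u A)"
        have nn: "0 \<le> ?d \<bullet> int_vec v'" if "v' \<in> rays_at f A" for v' by (rule newton_cone_inner[OF rays_at_D(4)[OF that] uV])
        have "wt k u = wt k A" using u(1) A k unfolding N by (auto simp: wface_def)
        then have "?d \<bullet> int_vec k = 0" unfolding inner_int_int lin_form_edge by simp
        then have "(\<Sum>v\<in>rays_at f A. r v * (?d \<bullet> int_vec v)) = 0" unfolding r(2) by (simp add: inner_sum_right)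
        then have "r v * (?d \<bullet> int_vec v) = 0"
          using v(1) nn r(1) by (subst (asm) sum_nonneg_eq_0_iff[OF finite_rays_at]) auto
        moreover have "wt v u \<noteq> wt v A" using u uV rays_at_D(2)[OF v(1)] by (auto simp: wface_def)
        then have "?d \<bullet> int_vec v \<noteq> 0" unfolding inner_int_int lin_form_edge by simp
        ultimately show ?thesis by simp
      qed
      have "int_vec k = (\<Sum>v\<in>?W. r v *\<^sub>R int_vec v)" unfolding r(2)
        using z by (intro sum.mono_neutral_right finite_rays_at) auto
      then show ?thesis unfolding conic_hull_def using r(1) by (intro CollectI exI[of _ r]) auto
    qed
    have nonneg: "0 \<le> l w" if "(l, b) \<in> ?L" "w \<in> ?W" for l b w
      using face_forms_nonneg[OF that(1)] rays_at_D(4)[of w f A] that(2) by auto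
    show ?thesis
      by (rule exI[of _ A], rule exI[of _ ?L], rule exI[of _ ?W], intro conjI A finite_face_forms NE)
        (use False nonneg hull in \<open>auto simp: finite_rays_at intro: face_forms_additive\<close>)
  next
    case True
    then obtain v0 where v0: "v0 \<in> Q" "\<epsilon> \<subseteq> wface f v0" by blast
    have \<epsilon>: "\<epsilon> = {A}" by (rule remaining_face[OF v0 c A k1'])
    note k1A = k1'[unfolded \<epsilon>] and cA = c[unfolded \<epsilon>]
    let ?T = "rays_at f A \<inter> Q"
    have "\<forall>v\<in>?T. \<exists>h w. corner_form v A h w"
      using corner_form_exists[OF _ _ cA k1A(1,2)] rays_at_D(2) by blast
    then have "\<exists>h. \<forall>v\<in>?T. \<exists>w. corner_form v A (h v) w" by (rule bchoice)
    then obtain h where "\<forall>v\<in>?T. \<exists>w. corner_form v A (h v) w" ..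
    then have "\<exists>w. \<forall>v\<in>?T. corner_form v A (h v) (w v)" by (rule bchoice)
    then obtain w where cf: "\<forall>v\<in>?T. corner_form v A (h v) (w v)" ..
    have cf': "corner_form v A (h v) (w v) \<and> w v \<notin> Q \<and> A $ dirn v = 0" if v: "v \<in> ?T" for v
    proof -
      have vv: "v \<in> Q" "A \<in> wface f v" using v rays_at_D(2) by auto
      have "A $ dirn v = 0" using b1_apex_coord[OF apex[OF vv(1)] vv(2)] coord_ne_1[OF cA, of "dirn v"] by auto
      then show ?thesis using cf v corner_neighbour_notin_Q[OF vv cA _ k1A] by blast
    qed
    let ?W = "(rays_at f A - Q) \<union> {axis i 1 |i. A $ i = 0}"
    let ?L = "face_forms f A \<epsilon> \<union> (\<lambda>v. (lin_form (h v), 0)) ` ?T"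
    have hpos: "0 \<le> lin_form (h v) u" if "v \<in> ?T" "u \<in> ?W" for v u
    proof -
      note F = cf[rule_format, OF that(1), unfolded corner_form_def]
      have "0 \<le> lin_form (h v) r" if "r \<in> rays_at f A" "r \<noteq> v" for r using F that by blast
      moreover have "0 \<le> lin_form (h v) (axis j 1)" if "A $ j = 0" for j unfolding lin_form_axis using F that by blast
      ultimately show ?thesis using that by auto
    qed
    \<comment> \<open>One inequality for each facet of \<open>Q\<close> at \<open>A\<close>
      describes exactly what the fibres leave.\<close>
    have Nh: "N = {k \<in> pos_points. wface f k = \<epsilon>} \<inter> {k. \<forall>v\<in>?T. 0 \<le> lin_form (h v) k}"
    proof (intro equalityI subsetI IntI CollectI ballI)
      fix k v assume k: "k \<in> N" and v: "v \<in> ?T"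
      note F = cf[rule_format, OF v, unfolded corner_form_def]
      have "k \<in> pos_points" "wface f k = {A}" "k \<notin> killed" using k unfolding N \<epsilon> by auto
      then show "0 \<le> lin_form (h v) k" using F by blast
    next
      fix k assume "k \<in> N"
      then show "k \<in> pos_points \<and> wface f k = \<epsilon>" unfolding N by simp
    next
      fix k assume k: "k \<in> {k \<in> pos_points. wface f k = \<epsilon>} \<inter> {k. \<forall>v\<in>?T. 0 \<le> lin_form (h v) k}"
      then have kp: "k \<in> pos_points" "wface f k = {A}" unfolding \<epsilon> by auto
      have "k \<notin> killed"
      proof
        assume "k \<in> killed"
        then obtain k0 t where f: "k0 \<in> base" "k = fibre (k0, t)" unfolding killed_def by auto
        note bd = baseD[OF f(1)]
        have "t \<noteq> 0"
        proof
          assume "t = 0"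
          then have "k0 = k" using f(2) by simp
          then have "apex (chosen k0) = A" using bd(4) kp(2) by simp
          then show False using bd(6) coord_ne_1[OF cA] by blast
        qed
        then have t: "0 < t" by simp
        have "A \<in> wface f k0" using lower_in_fibre[OF f(1) t, of A] kp(2) f(2) by simp
        then have "A \<in> wface f (chosen k0)" using bd(3) by auto
        then have T: "chosen k0 \<in> ?T" using bd(2) rays_atI by auto
        note F = cf[rule_format, OF T, unfolded corner_form_def]
        have "lin_form (h (chosen k0)) k < 0" using F f t kp(2) by blast
        moreover have "0 \<le> lin_form (h (chosen k0)) k" using k T by blast
        ultimately show False by simp
      qed
      then show "k \<in> N" unfolding N \<epsilon> using kp by simp
    qed
    have NE: "N = {k. (\<forall>w\<in>\<epsilon>. wt k w = wt k A) \<and> (\<forall>(l, b)\<in>?L. b \<le> l k)}"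
      unfolding Nh face_points_eq[OF A sub] by auto
    have finW: "finite ?W" by (simp add: finite_rays_at)
    have hull: "int_vec k \<in> conic_hull ?W" if k: "k \<in> N" for k
    proof -
      obtain r where r: "\<And>v. 0 \<le> r v" "int_vec k = (\<Sum>v\<in>rays_at f A. r v *\<^sub>R int_vec v)" using gen[OF k] by blast
      let ?x = "\<Sum>v\<in>rays_at f A - Q. r v *\<^sub>R int_vec v"
      have e: "int_vec k = ?x + (\<Sum>v\<in>?T. r v *\<^sub>R int_vec v)"
        using sum.Int_Diff[OF finite_rays_at, where g = "\<lambda>v. r v *\<^sub>R int_vec v" and B = Q] unfolding r(2)
        by (simp add: add.commute)
      have x: "?x \<in> conic_hull ?W"
        using r(1) by (intro conic_hull_sum conic_hull_scale conic_hull_base finW) (auto simp: finite_rays_at)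
      have hk: "0 \<le> int_vec (h v) \<bullet> int_vec k" if "v \<in> ?T" for v
        using k that unfolding Nh inner_int_int by simp
      show ?thesis unfolding e
      proof (rule eliminate_rays[OF _ _ refl cf' x])
        show "finite ?T" by (simp add: finite_rays_at)
        show "0 \<le> int_vec (h v) \<bullet> (?x + (\<Sum>v\<in>?T. r v *\<^sub>R int_vec v))" if "v \<in> ?T" for v
          using hk[OF that] unfolding e .
      qed (use r(1) in auto)
    qed
    have Wcase: "(u \<in> rays_at f A \<and> u \<notin> Q) \<or> (\<exists>i. u = axis i 1 \<and> A $ i = 0)" if "u \<in> ?W" for u
      using that by auto
    have Wc: "int_vec u \<in> newton_cone f A" if "u \<in> ?W" for u
      using Wcase[OF that]
    proof
      assume "u \<in> rays_at f A \<and> u \<notin> Q"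
      then show ?thesis using rays_at_D(4)[of u f A] by simp
    next
      assume "\<exists>i. u = axis i 1 \<and> A $ i = 0"
      then obtain i where i: "u = axis i 1" "A $ i = 0" by auto
      show ?thesis unfolding i(1) by (rule axis_in_newton_cone[where f = f, OF i(2)])
    qed
    have LW: "additive_form l \<and> (\<forall>w\<in>?W. 0 \<le> l w)" if lb: "(l, b) \<in> ?L" for l b
    proof (cases "(l, b) \<in> face_forms f A \<epsilon>")
      case True
      show ?thesis
      proof (intro conjI ballI)
        show "additive_form l" by (rule face_forms_additive[OF True])
        show "0 \<le> l w" if "w \<in> ?W" for w by (rule face_forms_nonneg[OF True Wc[OF that]])
      qed
    next
      case False
      then obtain v where v: "v \<in> ?T" "l = lin_form (h v)" using lb by auto
      show ?thesis
      proof (intro conjI ballI)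
        show "additive_form l" unfolding v(2) by (rule additive_lin_form)
        show "0 \<le> l w" if "w \<in> ?W" for w unfolding v(2) by (rule hpos[OF v(1) that])
      qed
    qed
    have LW': "\<forall>(l, b)\<in>?L. additive_form l \<and> (\<forall>w\<in>?W. 0 \<le> l w)" 
    proof (intro ballI, clarify)
      fix l b assume "(l, b) \<in> ?L"
      then show "additive_form l \<and> (\<forall>w\<in>?W. 0 \<le> l w)" by (rule LW)
    qed
    have finL: "finite ?L" by (simp add: finite_face_forms finite_rays_at)
    have Wt: "\<forall>w\<in>?W. (w \<in> rays_at f A - Q \<and> \<epsilon> \<subseteq> wface f w) \<or> (\<exists>i. w = axis i 1 \<and> (\<forall>x\<in>\<epsilon>. x $ i = 0))"
    proof
      fix u assume "u \<in> ?W"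
      from Wcase[OF this] show "(u \<in> rays_at f A - Q \<and> \<epsilon> \<subseteq> wface f u) \<or> (\<exists>i. u = axis i 1 \<and> (\<forall>x\<in>\<epsilon>. x $ i = 0))"
        using rays_at_D(2)[of u f A] unfolding \<epsilon> by auto
    qed
    have hull': "int_vec ` N \<subseteq> conic_hull ?W" using hull by (rule image_subsetI)
    show ?thesis
      by (rule exI[of _ A], rule exI[of _ ?L], rule exI[of _ ?W]) (intro conjI A finL finW LW' NE hull' Wt)
  qed
qed

end

subsection \<open>The coefficients of an edge and of its lower vertex\<close>

lemma face_value_insert_update:
  fixes f :: "('n::finite, 'p::prime_card padic_int) mpoly"
  assumes "finite E" "C \<notin> E" "C $ i = 1" "\<And>w. w \<in> E \<Longrightarrow> w $ i = 0"
  shows "face_value f (insert C E) (a(i := t)) = face_value f E a +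
    (padic_mod_p (Poly_Mapping.lookup f C) * (\<Prod>j\<in>UNIV - {i}. a j ^ (C $ j))) * t"
proof -
  have "(\<Prod>j\<in>UNIV - {i}. (a(i := t)) j ^ (C $ j)) = (\<Prod>j\<in>UNIV - {i}. a j ^ (C $ j))"
    by (intro prod.cong) auto
  then have C: "(\<Prod>j\<in>UNIV. (a(i := t)) j ^ (C $ j)) = t * (\<Prod>j\<in>UNIV - {i}. a j ^ (C $ j))"
    using prod.remove[of UNIV i "\<lambda>j. (a(i := t)) j ^ (C $ j)"] assms(3) by simp
  have "(\<Prod>j\<in>UNIV. (a(i := t)) j ^ (w $ j)) = (\<Prod>j\<in>UNIV. a j ^ (w $ j))" if "w \<in> E" for w
    using assms(4)[OF that] by (intro prod.cong) auto
  then have E: "face_value f E (a(i := t)) = face_value f E a"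
    unfolding face_value_def by (intro sum.cong) auto
  have "face_value f (insert C E) (a(i := t)) =
    padic_mod_p (Poly_Mapping.lookup f C) * (\<Prod>j\<in>UNIV. (a(i := t)) j ^ (C $ j)) + face_value f E (a(i := t))"
    unfolding face_value_def using assms(1,2) by simp
  then show ?thesis unfolding C E by (simp add: algebra_simps)
qed

text \<open>Perturbing a large multiple of \<open>k\<close> by \<open>- axis i 1\<close> favours the
  only exponent of the face at height 1, so \<open>{C}\<close> is itself the face of a positive
  weight. For a monomial, nondegeneracy means that its coefficient is nonzero modulo
  \<open>p\<close>.\<close>

lemma vertex_coefficient:
  fixes f :: "('n::finite, 'p::prime_card padic_int) mpoly"
  assumes nd: "\<And>k. k \<in> pos_points \<Longrightarrow> nondegenerate_face f (wface f k)"
    and k: "k \<in> pos_points" "wface f k = insert C E" "C \<notin> E" "C $ i = 1" and E: "\<And>w. w \<in> E \<Longrightarrow> w $ i = 0"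
  shows "padic_mod_p (Poly_Mapping.lookup f C) \<noteq> 0"
proof
  assume z: "padic_mod_p (Poly_Mapping.lookup f C) = 0"
  let ?V = "Poly_Mapping.keys f"
  \<comment> \<open>Exponents off the face of \<open>k\<close> gain at least \<open>M\<close>, which
    exceeds whatever the perturbation takes away; \<open>M >= 2\<close> keeps \<open>k'\<close>
    positive.\<close>
  define M where "M = (\<Sum>w\<in>?V. int (w $ i)) + 2"
  define k' :: "int ^ 'n" where "k' = (\<chi> j. M * k $ j - (if j = i then 1 else 0))"
  have M: "int (w $ i) + 2 \<le> M" if "w \<in> ?V" for w
    unfolding M_def using member_le_sum[of w ?V "\<lambda>w. int (w $ i)"] that by simp
  have M2: "2 \<le> M" unfolding M_def by (simp add: sum_nonneg)
  have kj: "1 \<le> k $ j" for j using k(1) unfolding pos_points_def by simp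
  have wt': "wt k' w = M * wt k w - int (w $ i)" for w
  proof -
    have "wt k' w = (\<Sum>j\<in>UNIV. M * (k $ j * int (w $ j)) - (if j = i then int (w $ i) else 0))"
      unfolding wt_def k'_def by (intro sum.cong) (auto simp: algebra_simps)
    then show ?thesis by (simp add: sum_subtractf wt_def sum_distrib_left)
  qed
  have CV: "C \<in> ?V" "wt k C = wmin f k" using k(2) unfolding wface_def by auto
  have lt: "wt k' C < wt k' w" if w: "w \<in> ?V" "w \<noteq> C" for w
  proof (cases "w \<in> wface f k")
    case True
    then have "w \<in> E" using k(2) w by auto
    then have "w $ i = 0" "wt k w = wmin f k" using E True by (auto simp: wface_def)
    then show ?thesis unfolding wt' using CV k(4) by simp
  next
    case False
    then have "wmin f k + 1 \<le> wt k w" using wmin_le[OF w(1), of k] w(1) by (simp add: wface_def)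
    then have "M * (wmin f k + 1) \<le> M * wt k w" using M2 by (intro mult_left_mono) auto
    then show ?thesis unfolding wt' using CV k(4) M[OF w(1)] by (simp add: algebra_simps)
  qed
  have "wt k' C \<le> wt k' w" if "w \<in> ?V" for w using lt[OF that] by (cases "w = C") auto
  then have m: "wmin f k' = wt k' C" unfolding wmin_def using CV(1) by (intro Min_eqI) auto
  have "w \<in> ?V \<and> wt k' w = wt k' C \<longleftrightarrow> w = C" for w using lt[of w] CV(1) by (cases "w = C") auto
  then have "wface f k' = {C}" unfolding wface_def m by simp
  moreover have "k' \<in> pos_points" unfolding pos_points_def
  proof (intro CollectI allI)
    fix j
    have "M * 1 \<le> M * k $ j" using M2 kj[of j] by (intro mult_left_mono) auto
    moreover have "M * k $ j - 1 \<le> k' $ j" unfolding k'_def by simp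
    ultimately show "1 \<le> k' $ j" using M2 by linarith
  qed
  ultimately have "nondegenerate_face f {C}" using nd[of k'] by simp
  moreover have "face_value f {C} (\<lambda>_. 1) = 0" "\<And>j. face_deriv f {C} j (\<lambda>_. 1) = 0"
    using z by (simp_all add: face_value_def face_deriv_def)
  ultimately show False unfolding nondegenerate_face_def by (metis zero_neq_one)
qed

context twisting_character
begin

text \<open>The factor \<open>p - 1\<close> counts the values over which the coordinate is
  resampled; the slope in that coordinate is nonzero because the coefficient at \<open>C\<close>
  is.\<close>

lemma face_sum_edge:
  fixes f :: "('n::finite, 'p padic_int) mpoly"
  assumes E: "finite E" "C \<notin> E" "C $ i = 1" "\<And>w. w \<in> E \<Longrightarrow> w $ i = 0"
    and C: "padic_mod_p (Poly_Mapping.lookup f C) \<noteq> 0"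
  shows "of_nat (CARD('p) - 1) * face_sum f (insert C E) = - face_sum f E"
proof -
  let ?R = "\<lambda>_ :: 'n. {t :: 'p mod_ring. t \<noteq> 0}"
  let ?F = "\<lambda>u. chi_mod (face_value f (insert C E) u)"
  have card: "card (?R i) = CARD('p) - 1"
  proof -
    have "?R i = UNIV - {0}" by auto
    then show ?thesis by (simp add: card_Diff_singleton)
  qed
  have inner: "(\<Sum>t\<in>?R i. ?F (u(i := t))) = - chi_mod (face_value f E u)" if u: "\<forall>j. u j \<in> ?R j" for u
  proof -
    have "padic_mod_p (Poly_Mapping.lookup f C) * (\<Prod>j\<in>UNIV - {i}. u j ^ (C $ j)) \<noteq> 0"
      using C u by (simp add: prod_zero_iff)
    moreover have "face_value f (insert C E) (u(i := t)) = face_value f E u +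
      (padic_mod_p (Poly_Mapping.lookup f C) * (\<Prod>j\<in>UNIV - {i}. u j ^ (C $ j))) * t" for t
      by (rule face_value_insert_update[OF E])
    ultimately show ?thesis by (simp add: sum_chi_mod_affine)
  qed
  have "(\<Sum>u | \<forall>j. u j \<in> ?R j. \<Sum>t\<in>?R i. ?F (u(i := t))) = of_nat (card (?R i)) * (\<Sum>u | \<forall>j. u j \<in> ?R j. ?F u)"
    by (rule sum_resample) simp
  moreover have "(\<Sum>u | \<forall>j. u j \<in> ?R j. \<Sum>t\<in>?R i. ?F (u(i := t))) = (\<Sum>u | \<forall>j. u j \<in> ?R j. - chi_mod (face_value f E u))"
    using inner by (intro sum.cong) auto
  ultimately have "of_nat (CARD('p) - 1) * (\<Sum>u | \<forall>j. u j \<noteq> 0. ?F u) = - (\<Sum>u | \<forall>j. u j \<noteq> 0. chi_mod (face_value f E u))"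
    unfolding card mem_Collect_eq sum_negf by simp
  then show ?thesis unfolding face_sum_def
    by (simp only: mult.left_commute[of "of_nat (CARD('p) - 1)"] mult_minus_right)
qed

lemma face_sum_empty [simp]: "face_sum f {} = 0"
  unfolding face_sum_def face_value_def by simp

lemma card_p_gt_1: "1 < CARD('p)"
  using prime_card[where ?'a = 'p] prime_gt_1_nat by blast

text \<open>The case of an empty lower part; a coefficient vanishing modulo \<open>p\<close> makes
  every term 0.\<close>

lemma face_sum_apex:
  fixes f :: "('n::finite, 'p padic_int) mpoly"
  assumes "C $ i = 1"
  shows "face_sum f {C} = 0"
proof (cases "padic_mod_p (Poly_Mapping.lookup f C) = 0")
  case True
  then show ?thesis unfolding face_sum_def face_value_def by simp
next
  case False
  then have "of_nat (CARD('p) - 1) * face_sum f {C} = 0" using face_sum_edge[of "{}" C i f] assms by simp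
  then show ?thesis using card_p_gt_1 by simp
qed

lemma norm_p_exp: "norm (p_exp w) = exp (- ln (real CARD('p)) * Re w)"
  unfolding p_exp_def by simp

lemma p_exp_neq_1: "0 < Re w \<Longrightarrow> p_exp w \<noteq> 1"
proof
  assume w: "0 < Re w" and "p_exp w = 1"
  then have "exp (- ln (real CARD('p)) * Re w) = 1" using norm_p_exp[of w] by simp
  moreover have "0 < ln (real CARD('p))" using card_p_gt_1 by simp
  ultimately show False using w by simp
qed

lemma powr_eq_1_iff: "of_nat CARD('p) powr w = 1 \<longleftrightarrow> p_exp w = 1"
proof -
  have "of_nat CARD('p) powr w = exp (w * of_real (ln (real CARD('p))))"
    using card_p_gt_1 by (simp add: powr_def Ln_of_nat)
  also have "\<dots> = inverse (p_exp w)" unfolding p_exp_def by (simp add: exp_minus mult.commute)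
  finally show ?thesis by simp
qed

end

subsection \<open>The meromorphic continuation\<close>

text \<open>The normalisation determines the value at a point from the values around it: it is the
  limit, or 0 at a pole.\<close>

lemma nicely_meromorphic_eqI:
  assumes "f nicely_meromorphic_on UNIV" "g nicely_meromorphic_on UNIV"
    and eq: "\<forall>\<^sub>F z in at w. f z = g z"
  shows "f w = g w"
proof -
  have f: "(is_pole f w \<and> f w = 0) \<or> f \<midarrow>w\<rightarrow> f w" and g: "(is_pole g w \<and> g w = 0) \<or> g \<midarrow>w\<rightarrow> g w"
    using assms(1,2) unfolding nicely_meromorphic_on_def by auto
  have p: "is_pole f w \<longleftrightarrow> is_pole g w" by (rule is_pole_cong[OF eq refl])
  have np: "\<not> (is_pole h w \<and> h \<midarrow>w\<rightarrow> c)" for h :: "complex \<Rightarrow> complex" and c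
    unfolding is_pole_def using not_tendsto_and_filterlim_at_infinity[of "at w" h c] by auto
  show ?thesis
  proof (cases "is_pole f w")
    case True
    then have "f w = 0" "g w = 0" using f g p np[of f "f w"] np[of g "g w"] by blast+
    then show ?thesis by simp
  next
    case False
    then have "f \<midarrow>w\<rightarrow> f w" "g \<midarrow>w\<rightarrow> g w" using f g p by auto
    moreover have "g \<midarrow>w\<rightarrow> f w" using \<open>f \<midarrow>w\<rightarrow> f w\<close> eq by (rule Lim_transform_eventually)
    ultimately show ?thesis using tendsto_unique[OF at_neq_bot] by blast
  qed
qed

lemma eventually_half_plane: "0 < Re w \<Longrightarrow> \<forall>\<^sub>F z in nhds w. 0 < Re z"
  using eventually_nhds_in_open[OF open_halfspace_Re_gt[of 0], of w] by simp

text \<open>By the identity theorem the difference vanishes identically once its singularities are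
  removed.\<close>

lemma nicely_meromorphic_half_plane_eq:
  assumes f: "f nicely_meromorphic_on UNIV" and g: "g nicely_meromorphic_on UNIV"
    and eq: "\<And>s. 0 < Re s \<Longrightarrow> f s = g s"
  shows "f = g"
proof
  fix w
  define h where "h = (\<lambda>z. f z - g z)"
  have hm: "h meromorphic_on UNIV" unfolding h_def
    using f g by (intro meromorphic_intros) (auto simp: nicely_meromorphic_on_def)
  have z: "remove_sings h z = 0" if "0 < Re z" for z
  proof (rule remove_sings_eqI, rule tendsto_eventually)
    have "\<forall>\<^sub>F y in at z. 0 < Re y" using eventually_half_plane[OF that] by (rule eventually_nhds_conv_at[THEN iffD1, THEN conjunct1])
    then show "\<forall>\<^sub>F y in at z. h y = 0" by eventually_elim (simp add: h_def eq)
  qed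
  have "\<forall>\<^sub>F y in at 1. 0 < Re y"
    using eventually_half_plane[of 1] eventually_nhds_conv_at[of "\<lambda>y. 0 < Re y" 1] by simp
  then have "\<forall>\<^sub>F y in at 1. remove_sings h y = 0" by eventually_elim (rule z)
  then have "frequently (\<lambda>y. remove_sings h y = 0) (at 1)" by (intro eventually_frequently) auto
  then have h0: "remove_sings h y = 0" for y
    by (rule frequently_eq_meromorphic_imp_constant[OF _ remove_sings_nicely_meromorphic[OF hm] open_UNIV connected_UNIV]) auto
  have "isolated_singularity_at h w" 
    by (rule meromorphic_on_isolated_singularity[OF meromorphic_on_subset[OF hm]]) simp
  then have "\<forall>\<^sub>F y in at w. remove_sings h y = h y" by (rule eventually_remove_sings_eq_at)
  then have "\<forall>\<^sub>F y in at w. h y = 0" by eventually_elim (simp add: h0)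
  then have "\<forall>\<^sub>F y in at w. f y = g y" by eventually_elim (simp add: h_def)
  then show "f w = g w" by (rule nicely_meromorphic_eqI[OF f g])
qed

text \<open>Regularity throughout the half plane ensures that removing the singularities of
  \<open>F\<close> does not alter its values there. The result is the function selected by
  \<open>THE\<close>, and near the given point it agrees with the analytic \<open>F\<close>.\<close>

lemma zeta0_no_pole:
  assumes half: "\<And>s. 0 < Re s \<Longrightarrow> continues_regularly s (zeta0_integral f chi)"
    and s0: "continues_regularly s\<^sub>0 (zeta0_integral f chi)"
  shows "\<not> is_pole (zeta0 f chi) s\<^sub>0"
proof -
  obtain F where F: "F meromorphic_on UNIV" "F analytic_on {s\<^sub>0}" "\<And>s. 0 < Re s \<Longrightarrow> F s = zeta0_integral f chi s"
    using s0 unfolding continues_regularly_def by auto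
  have an: "F analytic_on {s}" if s: "0 < Re s" for s
  proof -
    obtain G where G: "G analytic_on {s}" "\<And>z. 0 < Re z \<Longrightarrow> G z = zeta0_integral f chi z"
      using half[OF s] unfolding continues_regularly_def by auto
    have "\<forall>\<^sub>F z in nhds s. G z = F z" using eventually_half_plane[OF s] by eventually_elim (simp add: F(3) G(2))
    then show ?thesis using G(1) analytic_at_cong[of G F s s] by simp
  qed
  define Z where "Z = remove_sings F"
  have Zn: "Z nicely_meromorphic_on UNIV" unfolding Z_def by (rule remove_sings_nicely_meromorphic[OF F(1)])
  have Zs: "Z s = zeta0_integral f chi s" if "0 < Re s" for s
    unfolding Z_def using remove_sings_at_analytic[OF an[OF that]] F(3)[OF that] by simp
  have "zeta0 f chi = Z" unfolding zeta0_def
  proof (rule the_equality)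
    show "Z nicely_meromorphic_on UNIV \<and> (\<forall>s. Re s > 0 \<longrightarrow> Z s = zeta0_integral f chi s)" using Zn Zs by blast
  next
    fix Y assume "Y nicely_meromorphic_on UNIV \<and> (\<forall>s. Re s > 0 \<longrightarrow> Y s = zeta0_integral f chi s)"
    then show "Y = Z" using Zn Zs by (intro nicely_meromorphic_half_plane_eq) auto
  qed
  moreover have "isolated_singularity_at F s\<^sub>0" 
    by (rule meromorphic_on_isolated_singularity[OF meromorphic_on_subset[OF F(1)]]) simp
  then have "\<forall>\<^sub>F y in at s\<^sub>0. Z y = F y" unfolding Z_def by (rule eventually_remove_sings_eq_at)
  then have "is_pole Z s\<^sub>0 \<longleftrightarrow> is_pole F s\<^sub>0" by (rule is_pole_cong) simp
  ultimately show ?thesis using analytic_at_imp_no_pole[OF F(2)] by simp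
qed

subsection \<open>Summation over the cones\<close>

lemma infsum_fibres:
  fixes g :: "'a \<Rightarrow> complex"
  assumes g: "g summable_on X" and fin: "finite F"
  shows "infsum g {k \<in> X. E k \<in> F} = (\<Sum>\<epsilon>\<in>F. infsum g {k \<in> X. E k = \<epsilon>})"
  using fin
proof (induction F rule: finite_induct)
  case (insert \<epsilon> F)
  have "{k \<in> X. E k \<in> insert \<epsilon> F} = {k \<in> X. E k = \<epsilon>} \<union> {k \<in> X. E k \<in> F}" by auto
  moreover have "infsum g ({k \<in> X. E k = \<epsilon>} \<union> {k \<in> X. E k \<in> F}) = infsum g {k \<in> X. E k = \<epsilon>} + infsum g {k \<in> X. E k \<in> F}"
    using insert.hyps(2) by (intro infsum_Un_disjoint summable_on_subset_banach[OF g]) auto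
  ultimately show ?case using insert by simp
qed simp

lemma sum_up: "(\<Sum>j\<in>UNIV. up k i t $ j) = (\<Sum>j\<in>UNIV. k $ j) + t"
  by (simp add: sum.distrib)

lemma wt_add: "wt (k + k') w = wt k w + wt k' w"
  by (simp add: wt_def distrib_right sum.distrib)

lemma wt_axis: "wt (axis i 1) w = int (w $ i)"
proof -
  have "wt (axis i 1) w = (\<Sum>j\<in>UNIV. if j = i then int (w $ i) else 0)"
    unfolding wt_def axis_def by (intro sum.cong) auto
  then show ?thesis by simp
qed

lemma ray_sum_pos:
  assumes "is_ray f v"
  shows "0 < (\<Sum>i\<in>UNIV. v $ i)"
proof -
  have nn: "0 \<le> v $ i" for i using assms unfolding is_ray_def by blast
  have "v \<noteq> 0" using assms unfolding is_ray_def by blast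
  then obtain j where j: "v $ j \<noteq> 0" by (auto simp: vec_eq_iff)
  have "v $ j \<le> (\<Sum>i\<in>UNIV. v $ i)" using nn by (intro member_le_sum) auto
  then show ?thesis using j nn[of j] by linarith
qed

context twisting_character
begin

text \<open>The rays whose denominator 1 - p^(-(sigma v + m v * s)) vanishes at \<open>s\<close>;
  they are normals of facets contributing to \<open>s\<close>.\<close>

definition polar_rays :: "(3, 'p padic_int) mpoly \<Rightarrow> complex \<Rightarrow> (int ^ 3) set" where
  "polar_rays f s = {v. is_ray f v \<and> p_exp (of_int (\<Sum>i\<in>UNIV. v $ i) + of_int (wmin f v) * s) = 1}"

text \<open>On a coordinate axis with \<open>A $ i = 0\<close> the minimum is 0, and p^(-sigma v) is
  not 1 because sigma v is positive.\<close>

lemma polar_rays_off_axis: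
  assumes v: "v \<in> polar_rays f s" "A \<in> wface f v" "A $ i = 0"
  shows "\<exists>a. a \<noteq> i \<and> v $ a \<noteq> 0"
proof (rule ccontr)
  assume n: "\<not> ?thesis"
  have "wt v A = 0" unfolding wt_def
  proof (rule sum.neutral, rule ballI)
    fix j show "v $ j * int (A $ j) = 0" using n v(3) by (cases "j = i") auto
  qed
  then have "wmin f v = 0" using v(2) by (simp add: wface_def)
  then have "p_exp (of_int (\<Sum>i\<in>UNIV. v $ i)) = 1" using v(1) unfolding polar_rays_def by simp
  moreover have "0 < Re (of_int (\<Sum>i\<in>UNIV. v $ i))" using ray_sum_pos[of f v] v(1) unfolding polar_rays_def by (simp del: of_int_sum)
  ultimately show False using p_exp_neq_1 by blast
qed

text \<open>Two distinct common exponents exclude that the facets meet in at most one point, so the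
  hypothesis on pairs yields a common variable.\<close>

lemma b1_configuration_polar_rays:
  assumes f: "f \<noteq> 0" and nd: "\<And>k. k \<in> pos_points \<Longrightarrow> nondegenerate_face f (wface f k)"
    and B1: "\<And>v. v \<in> polar_rays f s \<Longrightarrow> \<exists>i. B1_facet f i (wt_face f v)"
    and pair: "\<And>v w. v \<in> polar_rays f s \<Longrightarrow> w \<in> polar_rays f s \<Longrightarrow>
      (\<exists>i. B1_facet f i (wt_face f v) \<and> B1_facet f i (wt_face f w)) \<or> (\<exists>x. wt_face f v \<inter> wt_face f w \<subseteq> {x})"
  shows "b1_configuration f (polar_rays f s) (face_sum f) (1 / of_nat (CARD('p) - 1))"
proof
  have p1: "of_nat (CARD('p) - 1) \<noteq> (0 :: complex)" using card_p_gt_1 by simp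
  have ray: "is_ray f v" if "v \<in> polar_rays f s" for v using that unfolding polar_rays_def by simp
  have apex: "\<exists>C. b1_apex f v i C" if "v \<in> polar_rays f s" "B1_facet f i (wt_face f v)" for v i
  proof (rule B1_facet_apex[OF f _ that(2)])
    show "0 \<le> v $ i" for i using ray[OF that(1)] unfolding is_ray_def by blast
  qed
  show "f \<noteq> 0" by (rule f)
  show "1 / of_nat (CARD('p) - 1) \<noteq> (0 :: complex)" using p1 by simp
  show "is_ray f v" if "v \<in> polar_rays f s" for v by (rule ray[OF that])
  show "\<exists>a. a \<noteq> i \<and> v $ a \<noteq> 0" if "v \<in> polar_rays f s" "A \<in> wface f v" "A $ i = 0" for v A i
    by (rule polar_rays_off_axis[OF that])
  show "\<exists>i C. b1_apex f v i C" if "v \<in> polar_rays f s" for v using B1[OF that] apex[OF that] by blast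
  show "\<exists>i C1 C2. b1_apex f v i C1 \<and> b1_apex f w i C2"
    if vw: "v \<in> polar_rays f s" "w \<in> polar_rays f s" and AC: "A \<in> wface f v" "A \<in> wface f w" "C \<in> wface f v" "C \<in> wface f w" "A \<noteq> C"
    for v w A C
  proof -
    have "\<not> (\<exists>x. wt_face f v \<inter> wt_face f w \<subseteq> {x})"
    proof
      assume "\<exists>x. wt_face f v \<inter> wt_face f w \<subseteq> {x}"
      then obtain x where x: "wt_face f v \<inter> wt_face f w \<subseteq> {x}" by blast
      have "real_vec A = x" "real_vec C = x" using x AC(1-4)[THEN real_vec_in_wt_face] by auto
      then have "real_vec A = real_vec C" by simp
      then show False using AC(5) by (simp add: vec_eq_iff)
    qed
    then obtain i where "B1_facet f i (wt_face f v)" "B1_facet f i (wt_face f w)" using pair[OF vw] by blast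
    then show ?thesis using apex[OF vw(1)] apex[OF vw(2)] by blast
  qed
  show "face_sum f {C} = 0" if "C $ i = 1" for C i using that by (rule face_sum_apex)
  show "face_sum f (wface f k) = - (1 / of_nat (CARD('p) - 1) * face_sum f E)"
    if k: "k \<in> pos_points" "wface f k = insert C E" "C \<notin> E" "C $ i = 1" "E \<noteq> {}" and E: "\<And>w. w \<in> E \<Longrightarrow> w $ i = 0" for k C E i
  proof -
    have fin: "finite E" using finite_wface[of f k] unfolding k(2) by simp
    have "padic_mod_p (Poly_Mapping.lookup f C) \<noteq> 0" by (rule vertex_coefficient[OF nd k(1-4) E])
    then have e: "of_nat (CARD('p) - 1) * face_sum f (insert C E) = - face_sum f E"
      by (intro face_sum_edge[OF fin k(3,4)] E)
    have "face_sum f (insert C E) = (of_nat (CARD('p) - 1) * face_sum f (insert C E)) / of_nat (CARD('p) - 1)"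
      using p1 by simp
    then show ?thesis unfolding k(2) e by simp
  qed
qed

text \<open>Relative to the lower part, the foot has coefficient -1/(p - 1) instead of 1, which is
  what the correction at \<open>t = 0\<close> encodes; the geometric series in 1/p sums to 1 + 1/(p
  - 1).\<close>

lemma fibre_series:
  "(\<lambda>t. a * (of_real ((1 / real CARD('p)) ^ t) - (if t = 0 then 1 + 1 / of_nat (CARD('p) - 1) else 0))) sums (0 :: complex)"
proof -
  define P where "P = (of_nat CARD('p) :: complex)"
  have P: "P \<noteq> 0" "P - 1 \<noteq> 0" "of_nat (CARD('p) - 1) = P - 1"
    using card_p_gt_1 unfolding P_def by (auto simp: of_nat_diff)
  have q: "complex_of_real ((1 / real CARD('p)) ^ t) = (1 / P) ^ t" for t unfolding P_def by simp
  have "norm (1 / P) < 1" unfolding P_def using card_p_gt_1 by (simp add: norm_divide)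
  then have "(\<lambda>t. (1 / P) ^ t) sums (1 / (1 - 1 / P))" by (rule geometric_sums)
  moreover have "(\<lambda>t. if t = 0 then 1 + 1 / (P - 1) else 0) sums (1 + 1 / (P - 1))"
    using sums_single[of 0 "\<lambda>_. 1 + 1 / (P - 1)"] by simp
  ultimately have "(\<lambda>t. a * ((1 / P) ^ t - (if t = 0 then 1 + 1 / (P - 1) else 0))) sums
    (a * (1 / (1 - 1 / P) - (1 + 1 / (P - 1))))"
    by (intro sums_mult sums_diff)
  moreover have "1 / (1 - 1 / P) - (1 + 1 / (P - 1)) = 0"
  proof -
    have "1 - 1 / P = (P - 1) / P" using P(1) by (simp add: field_simps)
    then have "1 / (1 - 1 / P) = P / (P - 1)" by simp
    moreover have "1 + 1 / (P - 1) = P / (P - 1)" using P(2) by (simp add: field_simps)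
    ultimately show ?thesis by simp
  qed
  ultimately show ?thesis unfolding q P(3) by simp
qed

definition shell_term :: "(3, 'p padic_int) mpoly \<Rightarrow> complex \<Rightarrow> int ^ 3 \<Rightarrow> complex" where
  "shell_term f s k = face_sum f (wface f k) * p_exp (of_int (\<Sum>i\<in>UNIV. k $ i) + of_int (wmin f k) * s)"

context
  fixes f :: "(3, 'p padic_int) mpoly" and Q :: "(int ^ 3) set"
  assumes conf: "b1_configuration f Q (face_sum f) (1 / of_nat (CARD('p) - 1))"
begin

interpretation B: b1_configuration f Q "face_sum f" "1 / of_nat (CARD('p) - 1)"
  by (rule conf)

text \<open>Along a fibre the minimum is constant and the coordinate sum grows by \<open>t\<close>,
  which contributes p^(-t).\<close>

lemma shell_term_fibre:
  assumes k: "k \<in> B.base"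
  shows "shell_term f s (B.fibre (k, t)) = (face_sum f (B.lower k) * p_exp (of_int (\<Sum>i\<in>UNIV. k $ i) + of_int (wmin f k) * s)) *
    (of_real ((1 / real CARD('p)) ^ t) - (if t = 0 then 1 + 1 / of_nat (CARD('p) - 1) else 0))"
proof (cases "t = 0")
  case True
  then show ?thesis using B.baseD(8)[OF k] by (simp add: shell_term_def)
next
  case False
  then have t: "0 < t" by simp
  note ff = B.fibre_face[OF k t]
  have "(\<Sum>i\<in>UNIV. B.fibre (k, t) $ i) = (\<Sum>i\<in>UNIV. k $ i) + int t" unfolding B.fibre_def by (simp only: prod.case sum_up)
  then have "p_exp (of_int (\<Sum>i\<in>UNIV. B.fibre (k, t) $ i) + of_int (wmin f k) * s) =
    p_exp ((of_int (\<Sum>i\<in>UNIV. k $ i) + of_int (wmin f k) * s) + of_nat t)"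
    by (simp del: of_int_sum add: algebra_simps)
  also have "\<dots> = p_exp (of_int (\<Sum>i\<in>UNIV. k $ i) + of_int (wmin f k) * s) * of_real ((1 / real CARD('p)) ^ t)"
    unfolding p_exp_add p_exp_of_nat ..
  finally show ?thesis using False unfolding shell_term_def ff(2,3) by (simp del: of_int_sum)
qed

lemma killed_pos: "B.killed \<subseteq> pos_points"
proof
  fix k assume "k \<in> B.killed"
  then obtain k0 t where k: "k0 \<in> B.base" "k = B.fibre (k0, t)" unfolding B.killed_def by auto
  show "k \<in> pos_points"
  proof (cases "t = 0")
    case True
    then show ?thesis using B.baseD(1)[OF k(1)] k(2) by simp
  next
    case False
    then show ?thesis using B.fibre_face(1)[OF k(1), of t] k(2) by simp
  qed
qed

text \<open>Absolute summability allows summing along each fibre first, and disjointness of the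
  fibres lets every removed point be counted once.\<close>

lemma killed_sum:
  assumes "shell_term f s summable_on pos_points"
  shows "infsum (shell_term f s) B.killed = 0"
proof -
  let ?g = "shell_term f s \<circ> B.fibre"
  have "shell_term f s summable_on B.killed" by (rule summable_on_subset_banach[OF assms killed_pos])
  then have g: "?g summable_on (B.base \<times> UNIV)" unfolding B.killed_def summable_on_reindex[OF B.inj_fibre] .
  have "infsum (\<lambda>t. ?g (k, t)) UNIV = 0" if k: "k \<in> B.base" for k
  proof -
    have eta: "(\<lambda>(x, y). ?g (x, y)) = ?g" by (auto simp: fun_eq_iff)
    have "(\<lambda>(x, y). ?g (x, y)) summable_on (B.base \<times> UNIV)" unfolding eta by (rule g)
    from summable_on_SigmaD1[OF this k] have "((\<lambda>t. ?g (k, t)) has_sum infsum (\<lambda>t. ?g (k, t)) UNIV) UNIV"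
      by (rule has_sum_infsum)
    then have "(\<lambda>t. ?g (k, t)) sums infsum (\<lambda>t. ?g (k, t)) UNIV" by (rule has_sum_imp_sums)
    moreover have "(\<lambda>t. ?g (k, t)) sums 0" unfolding o_def shell_term_fibre[OF k] by (rule fibre_series)
    ultimately show ?thesis by (rule sums_unique2)
  qed
  then have "infsum (\<lambda>k. infsum (\<lambda>t. ?g (k, t)) UNIV) B.base = 0" by (rule infsum_0)
  then show ?thesis unfolding B.killed_def infsum_reindex[OF B.inj_fibre] using infsum_Sigma_banach[OF g] by simp
qed

text \<open>On points with a fixed face the minimum is the linear form of one exponent
  \<open>A\<close>, so the term is a constant times \<open>weight\<close>. Rays contribute
  denominators that are nonzero by \<open>reg\<close>; coordinate directions contribute 1 -
  1/p.\<close>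

lemma remaining_continues:
  assumes summ: "\<And>s. 0 < Re s \<Longrightarrow> shell_term f s summable_on pos_points"
    and N: "N = {k \<in> pos_points. wface f k = \<epsilon>} - B.killed"
    and reg: "\<And>v. is_ray f v \<Longrightarrow> v \<notin> Q \<Longrightarrow> p_exp (of_int (\<Sum>i\<in>UNIV. v $ i) + of_int (wmin f v) * s\<^sub>0) \<noteq> 1"
  shows "continues_regularly s\<^sub>0 (\<lambda>s. infsum (shell_term f s) N)"
proof (cases "face_sum f \<epsilon> = 0 \<or> N = {}")
  case True
  have "infsum (shell_term f s) N = 0" for s
    using True by (intro infsum_0) (auto simp: N shell_term_def)
  then show ?thesis by (simp add: continues_regularly_entire)
next
  case False
  then obtain k1 where c: "face_sum f \<epsilon> \<noteq> 0" and k1: "k1 \<in> N" by auto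
  obtain A L W where A: "A \<in> \<epsilon>" and fin: "finite L" "finite W"
    and LW: "\<forall>(l, b)\<in>L. additive_form l \<and> (\<forall>w\<in>W. 0 \<le> l w)"
    and NE: "N = {k. (\<forall>w\<in>\<epsilon>. wt k w = wt k A) \<and> (\<forall>(l, b)\<in>L. b \<le> l k)}" and hull: "int_vec ` N \<subseteq> conic_hull W"
    and W: "\<forall>w\<in>W. (w \<in> rays_at f A - Q \<and> \<epsilon> \<subseteq> wface f w) \<or> (\<exists>i. w = axis i 1 \<and> (\<forall>x\<in>\<epsilon>. x $ i = 0))"
    using B.remaining[OF c N k1] by blast
  obtain L' where L': "set L' = L" using finite_list[OF fin(1)] by blast
  define \<mu> where "\<mu> = (\<lambda>k. wt k A)"
  define P0 where "P0 = {k :: int ^ 3. \<forall>w\<in>\<epsilon>. wt k w = wt k A}"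
  have NP: "{k \<in> P0. \<forall>(l, b)\<in>set L'. b \<le> l k} = N" unfolding NE P0_def L' by blast
  have shell: "shell_term f s k = face_sum f \<epsilon> * weight \<mu> s k" if "k \<in> N" for s k
  proof -
    have "wface f k = \<epsilon>" "wmin f k = wt k A" using that A unfolding N by (auto simp: wface_def)
    then show ?thesis unfolding shell_term_def weight_def \<mu>_def by simp
  qed
  obtain B where B: "finite B" "\<And>k r. (\<And>w. w \<in> W \<Longrightarrow> 0 \<le> r w) \<Longrightarrow>
     (\<And>i. real_of_int (k $ i) = (\<Sum>w\<in>W. r w * real_of_int (w $ i))) \<Longrightarrow> k \<in> nat_span W B"
    using nat_span_of_real_span[OF fin(2)] by blast
  have Wcases: "(is_ray f w \<and> w \<notin> Q \<and> wmin f w = \<mu> w \<and> 0 \<le> \<mu> w) \<or> ((\<Sum>i\<in>UNIV. w $ i) = 1 \<and> \<mu> w = 0)"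
    and Wwt: "\<And>x. x \<in> \<epsilon> \<Longrightarrow> wt w x = wt w A" if w: "w \<in> W" for w
  proof -
    consider "w \<in> rays_at f A - Q" "\<epsilon> \<subseteq> wface f w" | i where "w = axis i 1" "\<forall>x\<in>\<epsilon>. x $ i = 0" using W w by blast
    then have "((is_ray f w \<and> w \<notin> Q \<and> wmin f w = \<mu> w \<and> 0 \<le> \<mu> w) \<or> ((\<Sum>i\<in>UNIV. w $ i) = 1 \<and> \<mu> w = 0)) \<and> (\<forall>x\<in>\<epsilon>. wt w x = wt w A)"
    proof cases
      case 1
      have "is_ray f w" "A \<in> wface f w" using 1(1) rays_at_D(1,2)[of w f A] by auto
      moreover have "0 \<le> \<mu> w" unfolding \<mu>_def wt_def using rays_at_D(5)[of w f A] 1(1) by (intro sum_nonneg) auto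
      moreover have "wt w x = wt w A" if "x \<in> \<epsilon>" for x using 1(2) that A by (auto simp: wface_def subset_iff)
      ultimately show ?thesis using 1(1) unfolding \<mu>_def by (auto simp: wface_def)
    next
      case 2
      have "(\<Sum>j\<in>UNIV. w $ j) = (\<Sum>j\<in>UNIV. if j = i then 1 else 0)" unfolding 2(1) axis_def by (intro sum.cong) auto
      then have "(\<Sum>j\<in>UNIV. w $ j) = 1" by simp
      then show ?thesis using 2(2) A unfolding \<mu>_def by (simp add: 2(1) wt_axis)
    qed
    then show "(is_ray f w \<and> w \<notin> Q \<and> wmin f w = \<mu> w \<and> 0 \<le> \<mu> w) \<or> ((\<Sum>i\<in>UNIV. w $ i) = 1 \<and> \<mu> w = 0)"
      and "\<And>x. x \<in> \<epsilon> \<Longrightarrow> wt w x = wt w A" by blast+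
  qed
  have p1: "p_exp 1 \<noteq> 1" by (rule p_exp_neq_1) simp
  have "continues_regularly s\<^sub>0 (\<lambda>s. infsum (weight \<mu> s) {k \<in> P0. \<forall>(l, b)\<in>set L'. b \<le> l k})"
  proof (rule polyhedral_sum_continues[where W = W and B = B])
    show "additive_form \<mu>" unfolding additive_form_def \<mu>_def by (simp add: wt_add)
    show "additive_form l" if "(l, b) \<in> set L'" for l b using LW that unfolding L' by blast
    show "0 \<le> l w" if "(l, b) \<in> set L'" "w \<in> W" for l b w using LW that unfolding L' by blast
    show "k + w \<in> P0 \<longleftrightarrow> k \<in> P0" if "w \<in> W" for k w
      using Wwt[OF that] unfolding P0_def by (simp add: wt_add)
    show "finite W" "finite B" by (rule fin B)+
    show "{k \<in> P0. \<forall>(l, b)\<in>set L'. b \<le> l k} \<subseteq> nat_span W B" unfolding NP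
    proof
      fix k assume "k \<in> N"
      then have "int_vec k \<in> conic_hull W" using hull by blast
      then obtain r where r: "\<forall>w\<in>W. 0 \<le> r w" "int_vec k = (\<Sum>w\<in>W. r w *\<^sub>R int_vec w)" unfolding conic_hull_def by auto
      have "real_of_int (k $ i) = (\<Sum>w\<in>W. r w * real_of_int (w $ i))" for i
        using arg_cong[OF r(2), of "\<lambda>x. x $ i"] by (simp add: sum_component)
      then show "k \<in> nat_span W B" using r(1) by (intro B(2)[of r]) auto
    qed
    show "weight \<mu> s summable_on {k \<in> P0. \<forall>(l, b)\<in>set L'. b \<le> l k}" if s: "0 < Re s" for s unfolding NP
    proof -
      have "shell_term f s summable_on N" by (rule summable_on_subset_banach[OF summ[OF s]]) (auto simp: N)
      then have "(\<lambda>k. face_sum f \<epsilon> * weight \<mu> s k) summable_on N"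
        by (rule summable_on_cong[THEN iffD1, rotated]) (rule shell)
      then show "weight \<mu> s summable_on N" using summable_on_cmult_right'[OF c] by blast
    qed
    show "weight \<mu> s\<^sub>0 w \<noteq> 1" if "w \<in> W" for w
      using Wcases[OF that]
    proof
      assume a: "is_ray f w \<and> w \<notin> Q \<and> wmin f w = \<mu> w \<and> 0 \<le> \<mu> w"
      then show ?thesis using reg[of w] unfolding weight_def by (simp del: of_int_sum)
    next
      assume "(\<Sum>i\<in>UNIV. w $ i) = 1 \<and> \<mu> w = 0"
      then show ?thesis unfolding weight_def using p1 by (simp del: of_int_sum)
    qed
    show "weight \<mu> s w \<noteq> 1" if "w \<in> W" "0 < Re s" for w s
      using Wcases[OF that(1)]
    proof
      assume a: "is_ray f w \<and> w \<notin> Q \<and> wmin f w = \<mu> w \<and> 0 \<le> \<mu> w"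
      then have "0 < real_of_int (\<Sum>i\<in>UNIV. w $ i)" "0 \<le> real_of_int (\<mu> w) * Re s"
        using ray_sum_pos[of f w] that(2) by (simp_all del: of_int_sum)
      then show ?thesis unfolding weight_def by (intro p_exp_neq_1) (simp del: of_int_sum)
    next
      assume "(\<Sum>i\<in>UNIV. w $ i) = 1 \<and> \<mu> w = 0"
      then show ?thesis unfolding weight_def using p1 by (simp del: of_int_sum)
    qed
  qed
  then have "continues_regularly s\<^sub>0 (\<lambda>s. face_sum f \<epsilon> * infsum (weight \<mu> s) N)" unfolding NP by (rule continues_regularly_cmult)
  moreover have "infsum (shell_term f s) N = face_sum f \<epsilon> * infsum (weight \<mu> s) N" for s
    unfolding infsum_cmult_right'[symmetric] by (rule infsum_cong) (rule shell)
  ultimately show ?thesis by simp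
qed

text \<open>The support has finitely many subsets, so the surviving points split into finitely many
  families that can be continued separately.\<close>

lemma zeta0_integral_continues:
  assumes nd: "\<And>k. k \<in> pos_points \<Longrightarrow> nondegenerate_face f (wface f k)"
    and reg: "\<And>v. is_ray f v \<Longrightarrow> v \<notin> Q \<Longrightarrow> p_exp (of_int (\<Sum>i\<in>UNIV. v $ i) + of_int (wmin f v) * s\<^sub>0) \<noteq> 1"
  shows "continues_regularly s\<^sub>0 (zeta0_integral f chi)"
proof -
  let ?N = "\<lambda>\<epsilon>. {k \<in> pos_points. wface f k = \<epsilon>} - B.killed"
  have hs: "(shell_term f s has_sum zeta0_integral f chi s) pos_points" if "0 < Re s" for s
    using zeta0_integral_has_sum[OF B.f0 that nd] unfolding shell_term_def[abs_def] .
  have summ: "shell_term f s summable_on pos_points" if "0 < Re s" for s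
    using hs[OF that] by (rule has_sum_imp_summable)
  have eq: "(\<Sum>\<epsilon>\<in>Pow (Poly_Mapping.keys f). infsum (shell_term f s) (?N \<epsilon>)) = zeta0_integral f chi s" if s: "0 < Re s" for s
  proof -
    let ?X = "pos_points - B.killed"
    have X: "shell_term f s summable_on ?X" by (rule summable_on_subset_banach[OF summ[OF s]]) auto
    have "zeta0_integral f chi s = infsum (shell_term f s) pos_points" using infsumI[OF hs[OF s]] by simp
    also have "pos_points = B.killed \<union> ?X" using killed_pos by blast
    also have "infsum (shell_term f s) (B.killed \<union> ?X) = infsum (shell_term f s) B.killed + infsum (shell_term f s) ?X"
      by (intro infsum_Un_disjoint summable_on_subset_banach[OF summ[OF s]]) (use killed_pos in auto)
    also have "\<dots> = infsum (shell_term f s) ?X" using killed_sum[OF summ[OF s]] by simp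
    also have "?X = {k \<in> ?X. wface f k \<in> Pow (Poly_Mapping.keys f)}" by (auto simp: wface_def)
    also have "infsum (shell_term f s) \<dots> = (\<Sum>\<epsilon>\<in>Pow (Poly_Mapping.keys f). infsum (shell_term f s) {k \<in> ?X. wface f k = \<epsilon>})"
      by (rule infsum_fibres[OF X]) simp
    also have "\<dots> = (\<Sum>\<epsilon>\<in>Pow (Poly_Mapping.keys f). infsum (shell_term f s) (?N \<epsilon>))"
      by (intro sum.cong refl arg_cong[of _ _ "infsum (shell_term f s)"]) auto
    finally show ?thesis by simp
  qed
  show ?thesis
    by (rule continues_regularly_cong[OF continues_regularly_sum eq]) (rule remaining_continues[OF summ refl reg])
qed

end

end

theorem proposition9p6:
  fixes f :: "(3, 'p::prime_card padic_int) mpoly"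
    and chi :: "'p padic_int \<Rightarrow> complex"
    and s\<^sub>0 :: complex
  assumes "f \<noteq> 0" and "mpoly_eval f 0 = 0"
    and "nondegenerate_mod_p f"
    and "padic_character chi"
    and "\<exists>u. u dvd 1 \<and> chi u \<noteq> 1"
    and "\<forall>u. of_nat CARD('p) dvd u - 1 \<longrightarrow> chi u = 1"
    and "candidate_pole f s\<^sub>0"
    and "\<forall>\<tau>. contributes f \<tau> s\<^sub>0 \<longrightarrow> (\<exists>i. B1_facet f i \<tau>)"
    and "\<forall>\<tau> \<tau>'. contributes f \<tau> s\<^sub>0 \<and> contributes f \<tau>' s\<^sub>0 \<longrightarrow>
           (\<exists>i. B1_facet f i \<tau> \<and> B1_facet f i \<tau>') \<or> (\<exists>x. \<tau> \<inter> \<tau>' \<subseteq> {x})"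
  shows "\<not> is_pole (zeta0 f chi) s\<^sub>0"
proof -
  interpret twisting_character chi
    using assms(4,5,6) by unfold_locales auto
  have nd: "nondegenerate_face f (wface f k)" if "k \<in> pos_points" for k
  proof (rule nondegenerate_wface[OF assms(1,3)])
    show "0 < k $ i" for i using that unfolding pos_points_def by (simp add: int_one_le_iff_zero_less)
  qed
  \<comment> \<open>The hypotheses speak of facets, the argument of rays: a polar ray cuts out a
    contributing facet.\<close>
  have contr: "contributes f (wt_face f v) s\<^sub>0" if "v \<in> polar_rays f s\<^sub>0" for v
  proof -
    have r: "is_ray f v" and e: "p_exp (of_int (\<Sum>i\<in>UNIV. v $ i) + of_int (wmin f v) * s\<^sub>0) = 1"
      using that unfolding polar_rays_def by auto
    show ?thesis unfolding contributes_def is_ray_facet(2-4)[OF assms(1) r] powr_eq_1_iff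
      using is_ray_facet(1)[OF assms(1) r] e by simp
  qed
  have "b1_configuration f (polar_rays f s\<^sub>0) (face_sum f) (1 / of_nat (CARD('p) - 1))"
    using assms(8,9) contr by (intro b1_configuration_polar_rays[OF assms(1) nd]) blast+
  then have s0: "continues_regularly s\<^sub>0 (zeta0_integral f chi)"
    by (rule zeta0_integral_continues[OF _ nd]) (auto simp: polar_rays_def)
  \<comment> \<open>For Re s > 0 the number sigma v + m v * s has positive real part for every ray,
    so there are no polar rays and the continuation applies with nothing removed.\<close>
  have half: "continues_regularly s (zeta0_integral f chi)" if s: "0 < Re s" for s
  proof -
    have e: "p_exp (of_int (\<Sum>i\<in>UNIV. v $ i) + of_int (wmin f v) * s) \<noteq> 1" if v: "is_ray f v" for v
    proof (rule p_exp_neq_1)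
      obtain A where A: "A \<in> wface f v" using wface_nonempty[OF assms(1)] by blast
      then have "v \<in> rays_at f A" using v unfolding rays_at_def by simp
      then have "0 \<le> wt v A" unfolding wt_def using rays_at_D(5)[of v f A] by (intro sum_nonneg) auto
      then have "0 \<le> real_of_int (wmin f v) * Re s" using A s by (simp add: wface_def)
      moreover have "0 < real_of_int (\<Sum>i\<in>UNIV. v $ i)" using ray_sum_pos[OF v] by (simp del: of_int_sum)
      ultimately show "0 < Re (of_int (\<Sum>i\<in>UNIV. v $ i) + of_int (wmin f v) * s)" by (simp del: of_int_sum)
    qed
    then have "polar_rays f s = {}" unfolding polar_rays_def by auto
    then have "b1_configuration f (polar_rays f s) (face_sum f) (1 / of_nat (CARD('p) - 1))"
      by (intro b1_configuration_polar_rays[OF assms(1) nd]) auto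
    then show ?thesis by (rule zeta0_integral_continues[OF _ nd]) (assumption | erule e)+
  qed
  show ?thesis by (rule zeta0_no_pole[OF half s0])
qed

end
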